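(* Let $a,b\ge2$ be integers with $a\not\sim b$, and let $f,g:\mathbb{R}/\mathbb{Z}\to\mathbb{R}/\mathbb{Z}$ be maps which are (separately) $C^2$-conjugate to $T_a$ and $T_b$ respectively. Then there is no Borel probability measure on $\mathbb{R}/\mathbb{Z}$ of positive Hausdorff dimension which is ergodic for both $f$ and $g$, except possibly one which is equivalent to Lebesgue measure; and such an exceptional measure exists precisely when the conjugating maps differ by a rotation, i.e. when there are $C^2$-diffeomorphisms $\varphi,\psi$ of $\mathbb{R}/\mathbb{Z}$ with $\varphi f\varphi^{-1}=T_a$ and $\psi g\psi^{-1}=T_b$ such that $\psi\varphi^{-1}$ is a rotation of $\mathbb{R}/\mathbb{Z}$.
   Context: $T_m(x)=mx\bmod1$ on $\mathbb{R}/\mathbb{Z}$. $a\sim b$ means $a=c^k$, $b=c^m$ for some $c,k,m\in\mathbb{N}=\{1,2,\dots\}$; otherwise $a\not\sim b$. $f$ is $C^2$-conjugate to $T_a$ if $\varphi f\varphi^{-1}=T_a$ for some $C^2$-diffeomorphism $\varphi$ of $\mathbb{R}/\mathbb{Z}$. A measure is ergodic for $f$ if it is $f$-invariant and ergodic. The (lower) Hausdorff dimension of a measure $\tau$ is $\inf\{\dim A:\tau(A)>0\}$, with $\dim A$ the Hausdorff dimension of the Borel set $A$. *)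

theory Defs
  imports "HOL-Probability.Probability"
begin

section \<open>The circle group \<open>\<real>/\<int>\<close>\<close>

quotient_type circle = real / "\<lambda>x y. x - y \<in> \<int>"
  morphisms rep_circle to_circle
proof (rule equivpI)
  show "reflp (\<lambda>x y::real. x - y \<in> \<int>)"
    by (simp add: reflp_def)
  show "symp (\<lambda>x y::real. x - y \<in> \<int>)"
  proof (rule sympI)
    fix x y :: real
    assume "x - y \<in> \<int>"
    then have "- (x - y) \<in> \<int>"
      by (rule Ints_minus)
    then show "y - x \<in> \<int>"
      by simp
  qed
  show "transp (\<lambda>x y::real. x - y \<in> \<int>)"
  proof (rule transpI)
    fix x y z :: real
    assume "x - y \<in> \<int>" "y - z \<in> \<int>"
    then have "(x - y) + (y - z) \<in> \<int>"
      by (rule Ints_add)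
    then show "x - z \<in> \<int>"
      by simp
  qed
qed

instantiation circle :: ab_group_add
begin

lift_definition zero_circle :: circle is "0 :: real" .

lift_definition plus_circle :: "circle \<Rightarrow> circle \<Rightarrow> circle" is "(+) :: real \<Rightarrow> real \<Rightarrow> real"
proof -
  fix x y u v :: real
  assume "x - y \<in> \<int>" "u - v \<in> \<int>"
  then have "(x - y) + (u - v) \<in> \<int>"
    by (rule Ints_add)
  then show "(x + u) - (y + v) \<in> \<int>"
    by (simp add: algebra_simps)
qed

lift_definition uminus_circle :: "circle \<Rightarrow> circle" is "uminus :: real \<Rightarrow> real"
proof -
  fix x y :: real
  assume "x - y \<in> \<int>"
  then have "- (x - y) \<in> \<int>"
    by (rule Ints_minus)
  then show "- x - - y \<in> \<int>"
    by simp
qed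

lift_definition minus_circle :: "circle \<Rightarrow> circle \<Rightarrow> circle" is "(-) :: real \<Rightarrow> real \<Rightarrow> real"
proof -
  fix x y u v :: real
  assume "x - y \<in> \<int>" "u - v \<in> \<int>"
  then have "(x - y) - (u - v) \<in> \<int>"
    by (rule Ints_diff)
  then show "(x - u) - (y - v) \<in> \<int>"
    by (simp add: algebra_simps)
qed

instance
  by standard (transfer; simp)+

end

text \<open>The distance on \<open>\<real>/\<int>\<close> induced by \<open>\<real>\<close>: the distance of \<open>x - y\<close> to the nearest integer.\<close>

definition int_dist :: "real \<Rightarrow> real" where
  "int_dist x = \<bar>x - of_int (round x)\<bar>"

lemma int_dist_le: "k \<in> \<int> \<Longrightarrow> int_dist x \<le> \<bar>x - k\<bar>"
  unfolding int_dist_def by (elim Ints_cases) (simp add: round_diff_minimal)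

lemma int_dist_attained: "\<exists>k\<in>\<int>. int_dist x = \<bar>x - k\<bar>"
  unfolding int_dist_def by (rule bexI[of _ "of_int (round x)"]) auto

lemma int_dist_cong:
  assumes "x - y \<in> \<int>"
  shows "int_dist x = int_dist y"
proof -
  have *: "int_dist u \<le> int_dist v" if uv: "u - v \<in> \<int>" for u v
  proof -
    obtain k where k: "k \<in> \<int>" "int_dist v = \<bar>v - k\<bar>"
      using int_dist_attained by blast
    have "int_dist u \<le> \<bar>u - ((u - v) + k)\<bar>"
      by (rule int_dist_le) (use uv k in auto)
    then show ?thesis
      using k by simp
  qed
  have "y - x \<in> \<int>"
    using Ints_minus[OF assms] by simp
  with assms show ?thesis
    by (intro antisym *)
qed

lemma int_dist_triangle: "int_dist (x + y) \<le> int_dist x + int_dist y"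
proof -
  obtain k where k: "k \<in> \<int>" "int_dist x = \<bar>x - k\<bar>"
    using int_dist_attained by blast
  obtain l where l: "l \<in> \<int>" "int_dist y = \<bar>y - l\<bar>"
    using int_dist_attained by blast
  have "int_dist (x + y) \<le> \<bar>x + y - (k + l)\<bar>"
    by (rule int_dist_le) (use k l in auto)
  then show ?thesis
    using k l by linarith
qed

lemma int_dist_minus: "int_dist (- x) = int_dist x"
proof -
  have *: "int_dist (- u) \<le> int_dist u" for u
  proof -
    obtain k where k: "k \<in> \<int>" "int_dist u = \<bar>u - k\<bar>"
      using int_dist_attained by blast
    have "int_dist (- u) \<le> \<bar>- u - (- k)\<bar>"
      by (rule int_dist_le) (use k in auto)
    then show ?thesis
      using k by linarith
  qed
  show ?thesis
    using *[of x] *[of "- x"] by simp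
qed

lemma int_dist_eq_0_iff: "int_dist x = 0 \<longleftrightarrow> x \<in> \<int>"
proof
  assume "int_dist x = 0"
  then have "x = of_int (round x)"
    by (simp add: int_dist_def)
  then show "x \<in> \<int>"
    by (rule ssubst) (rule Ints_of_int)
next
  assume "x \<in> \<int>"
  then show "int_dist x = 0"
    by (elim Ints_cases) (simp add: int_dist_def)
qed

instantiation circle :: metric_space
begin

lift_definition dist_circle :: "circle \<Rightarrow> circle \<Rightarrow> real" is "\<lambda>x y. int_dist (x - y)"
proof -
  fix x y u v :: real
  assume "x - y \<in> \<int>" "u - v \<in> \<int>"
  then have "(x - y) - (u - v) \<in> \<int>"
    by (rule Ints_diff)
  then show "int_dist (x - u) = int_dist (y - v)"
    by (intro int_dist_cong) (simp add: algebra_simps)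
qed

definition uniformity_circle :: "(circle \<times> circle) filter" where
  "uniformity_circle = (INF e\<in>{0 <..}. principal {(x, y). dist x y < e})"

definition open_circle :: "circle set \<Rightarrow> bool" where
  "open_circle U \<longleftrightarrow> (\<forall>x\<in>U. eventually (\<lambda>(x', y). x' = x \<longrightarrow> y \<in> U) uniformity)"

instance
proof
  show "dist x y = 0 \<longleftrightarrow> x = y" for x y :: circle
    by transfer (rule int_dist_eq_0_iff)
  show "dist x y \<le> dist x z + dist y z" for x y z :: circle
  proof transfer
    fix x y z :: real
    show "int_dist (x - y) \<le> int_dist (x - z) + int_dist (y - z)"
      using int_dist_triangle[of "x - z" "z - y"] int_dist_minus[of "y - z"] by simp
  qed
qed (simp_all add: uniformity_circle_def open_circle_def)

end

lemma dist_to_circle_le: "dist (to_circle x) (to_circle y) \<le> \<bar>x - y\<bar>"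
  using int_dist_le[of 0 "x - y"] by (simp add: dist_circle.abs_eq)

lemma continuous_on_to_circle: "continuous_on A to_circle"
  unfolding continuous_on_iff dist_real_def
  by (meson dist_to_circle_le order_le_less_trans)

lemma borel_measurable_to_circle [measurable]: "to_circle \<in> borel_measurable borel"
  by (rule borel_measurable_continuous_onI) (rule continuous_on_to_circle)

lift_definition times_map :: "nat \<Rightarrow> circle \<Rightarrow> circle" is "\<lambda>m x. real m * x"
proof -
  fix m :: nat and x y :: real
  assume "x - y \<in> \<int>"
  then have "real m * (x - y) \<in> \<int>"
    by (intro Ints_mult) auto
  then show "real m * x - real m * y \<in> \<int>"
    by (simp add: right_diff_distrib)
qed

definition lebesgue_circle :: "circle measure" where
  "lebesgue_circle = distr (restrict_space lborel {0..<1}) borel to_circle"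

section \<open>Multiplicative dependence\<close>

definition mult_dep :: "nat \<Rightarrow> nat \<Rightarrow> bool" where
  "mult_dep a b \<longleftrightarrow> (\<exists>c k m. c \<ge> 1 \<and> k \<ge> 1 \<and> m \<ge> 1 \<and> a = c ^ k \<and> b = c ^ m)"

section \<open>Conjugation by \<open>C\<^sup>2\<close>-diffeomorphisms of the circle\<close>

definition C2_real :: "(real \<Rightarrow> real) \<Rightarrow> bool" where
  "C2_real F \<longleftrightarrow> (\<exists>F' F''. (\<forall>x. (F has_real_derivative F' x) (at x)) \<and>
     (\<forall>x. (F' has_real_derivative F'' x) (at x)) \<and> continuous_on UNIV F'')"

text \<open>Since \<open>\<real> \<rightarrow> \<real>/\<int>\<close> is a covering and a local diffeomorphism, a self-map of the circle is
  \<open>C\<^sup>2\<close> iff it has a \<open>C\<^sup>2\<close> lift to \<open>\<real>\<close>. The degree is arbitrary; in particular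
  diffeomorphisms may reverse the orientation.\<close>

definition C2_circle :: "(circle \<Rightarrow> circle) \<Rightarrow> bool" where
  "C2_circle \<phi> \<longleftrightarrow> (\<exists>F. C2_real F \<and> (\<forall>x. \<phi> (to_circle x) = to_circle (F x)))"

definition C2_diffeo :: "(circle \<Rightarrow> circle) \<Rightarrow> bool" where
  "C2_diffeo \<phi> \<longleftrightarrow> bij \<phi> \<and> C2_circle \<phi> \<and> C2_circle (inv \<phi>)"

definition C2_conjugate :: "(circle \<Rightarrow> circle) \<Rightarrow> (circle \<Rightarrow> circle) \<Rightarrow> bool" where
  "C2_conjugate f h \<longleftrightarrow> (\<exists>\<phi>. C2_diffeo \<phi> \<and> \<phi> \<circ> f \<circ> inv \<phi> = h)"

section \<open>Hausdorff dimension\<close>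

text \<open>Only exponents \<open>s > 0\<close> are used below, so that \<open>0 powr s = 0\<close> is the right value for
  empty covering sets. Boundedness is required because \<^const>\<open>diameter\<close> is unspecified
  for unbounded sets.\<close>

definition hausdorff_premeasure :: "real \<Rightarrow> real \<Rightarrow> 'a::metric_space set \<Rightarrow> ennreal" where
  "hausdorff_premeasure \<delta> s A =
     (INF U \<in> {U :: nat \<Rightarrow> 'a set. A \<subseteq> (\<Union>i. U i) \<and> (\<forall>i. bounded (U i) \<and> diameter (U i) \<le> \<delta>)}.
        \<Sum>i. ennreal (diameter (U i) powr s))"

definition hausdorff_measure :: "real \<Rightarrow> 'a::metric_space set \<Rightarrow> ennreal" where
  "hausdorff_measure s A = (SUP \<delta> \<in> {0<..}. hausdorff_premeasure \<delta> s A)"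

definition hausdorff_dim :: "'a::metric_space set \<Rightarrow> ennreal" where
  "hausdorff_dim A = (INF s \<in> {s. s > 0 \<and> hausdorff_measure s A = 0}. ennreal s)"

definition measure_dim :: "'a::metric_space measure \<Rightarrow> ennreal" where
  "measure_dim M = (INF A \<in> {A \<in> sets M. emeasure M A > 0}. hausdorff_dim A)"

section \<open>Ergodic measures\<close>

definition ergodic :: "'a measure \<Rightarrow> ('a \<Rightarrow> 'a) \<Rightarrow> bool" where
  "ergodic M f \<longleftrightarrow> f \<in> measurable M M \<and> distr M M f = M \<and>
     (\<forall>A\<in>sets M. f -` A \<inter> space M = A \<longrightarrow> emeasure M A = 0 \<or> emeasure M (space M - A) = 0)"

definition equivalent_measures :: "'a measure \<Rightarrow> 'a measure \<Rightarrow> bool" where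
  "equivalent_measures M N \<longleftrightarrow> absolutely_continuous M N \<and> absolutely_continuous N M"

definition joint_ergodic_measures :: "(circle \<Rightarrow> circle) \<Rightarrow> (circle \<Rightarrow> circle) \<Rightarrow> circle measure set" where
  "joint_ergodic_measures f g =
     {\<mu>. sets \<mu> = sets borel \<and> prob_space \<mu> \<and> measure_dim \<mu> > 0 \<and> ergodic \<mu> f \<and> ergodic \<mu> g}"

end

theory Submission
  imports Defs
begin

text \<open>Let \<open>\<nu> = \<psi>\<mu>\<close>, an ergodic measure for multiplication by \<open>b\<close>, which is also preserved by the
  smooth map \<open>F = \<xi> T\<^sub>a \<xi>\<^sup>-\<^sup>1\<close> with \<open>\<xi> = \<psi> \<phi>\<^sup>-\<^sup>1\<close>. For a real frequency \<open>s\<close> let \<open>\<Phi>(s)\<close> be the limit over \<open>m\<close>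
  of the squared \<open>L\<^sup>2\<close> norm of the projection of \<open>e(s b\<^sup>m x)\<close> to the \<open>b\<close>-adic cells of level \<open>m\<close>. The
  function \<open>\<Phi>\<close> is Lipschitz, \<open>\<Phi>(bs) \<le> \<Phi>(s)\<close>, and \<open>\<Phi>(k b\<^sup>p)\<close> bounds the squared \<open>k\<close>-th Fourier coefficient
  of \<open>\<nu>\<close>. Linearising \<open>F\<close> at a point \<open>y\<close> of the support shows that the closed set of those \<open>s\<close> for which
  \<open>\<Phi>(s b\<^sup>p) \<ge> \<epsilon>\<close> for all \<open>p\<close> is mapped into itself by multiplication with \<open>\<bar>F'(y)\<bar>\<close>. Positive dimension
  forces positive entropy, which makes \<open>inf \<Phi> = 0\<close>. Hence, if \<open>\<nu>\<close> has a nonzero Fourier coefficient, this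
  set is proper and nonempty, and on the logarithmic scale its translations into itself are discrete:
  \<open>J ln \<bar>F'(y)\<bar>\<close> is almost everywhere an integer multiple of \<open>ln b\<close> for some \<open>J \<ge> 1\<close>.

  For a lift \<open>X\<close> of \<open>\<xi>\<close> and \<open>H = ln \<bar>X'\<bar>\<close> this says that \<open>J (ln a + H(at) - H(t)) / ln b\<close> is integral.
  Differentiating gives \<open>a H'(at) = H'(t)\<close> almost everywhere, so invariance forces \<open>\<integral>\<bar>H'\<bar> = 0\<close>, and by
  Sard's lemma the law of \<open>J H / ln b\<close> modulo 1 is singular. But this law is invariant under the rotation by
  \<open>J ln a / ln b\<close>, which is irrational, so it is Lebesgue measure. This contradiction shows that \<open>\<psi>\<mu>\<close>, and
  by symmetry \<open>\<phi>\<mu>\<close>, is Lebesgue measure. Then \<open>\<psi> \<phi>\<^sup>-\<^sup>1\<close> preserves Lebesgue measure, so it is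
  \<open>x \<mapsto> \<plusminus>x + \<theta>\<close>, and a reflection is absorbed into \<open>\<psi>\<close>.\<close>

text \<open>The obstacle is that \<open>F\<close> need not commute with multiplication by b.
  Linearising \<open>F\<close> on a small cell leaves a phase that varies from cell to cell, so
  Fourier coefficients cannot be compared through \<open>F\<close>. The energy \<open>Phi\<close> is
  blind to this phase, since only the modulus of each cell average enters. A second difficulty is
  that the linearisation is good only on a small set \<open>U\<close>, whose share of the energy at
  one level is uncontrolled. Averaging over levels cures this: up to small L1 errors the cell
  averages are values of one stationary sequence along the orbit (\<open>asymp_invariant\<close>),
  and the mean ergodic theorem gives \<open>U\<close> exactly its share of the energy, directly and
  also seen through \<open>F\<close>, because \<open>F\<close> preserves the measure. In the
  comparison the energy at s b^d then stands once on the left and with weight 1/2 on the right, by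
  xy \<le> (x^2 + y^2)/2, and is absorbed without loss of a constant; therefore one threshold
  \<epsilon> serves for the whole translation argument. Entropy enters through collision
  probabilities of digit blocks (\<open>Qlim\<close>), which Parseval's identity on Z/b^p relates to
  averages of \<open>Phi\<close> over integer frequencies.\<close>

section \<open>Conditional expectation on finite partitions\<close>

text \<open>The conditional expectation of \<open>u\<close> given the partition into fibres of
  \<open>\<kappa>\<close>, written as an explicit average so that no sub-sigma-algebra has to be
  introduced. On a null cell division by zero gives the value 0.\<close>

definition cell_exp :: "'a measure \<Rightarrow> ('a \<Rightarrow> int) \<Rightarrow> ('a \<Rightarrow> complex) \<Rightarrow> 'a \<Rightarrow> complex" where
  "cell_exp M \<kappa> u x =
     (\<integral>y. indicator (\<kappa> -` {\<kappa> x}) y *\<^sub>R u y \<partial>M) / of_real (measure M (\<kappa> -` {\<kappa> x} \<inter> space M))"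

lemma borel_measurable_cnj [measurable (raw)]:
  "f \<in> borel_measurable M \<Longrightarrow> (\<lambda>x. cnj (f x)) \<in> borel_measurable M"
  by (rule measurable_compose[OF _ borel_measurable_continuous_onI])
     (auto intro: continuous_on_cnj continuous_on_id)

context prob_space
begin

abbreviation partition_map :: "('a \<Rightarrow> int) \<Rightarrow> bool" where
  "partition_map \<kappa> \<equiv> \<kappa> \<in> measurable M (count_space UNIV) \<and> finite (\<kappa> ` space M)"

lemma integrable_bounded:
  fixes f :: "'a \<Rightarrow> 'b::{banach, second_countable_topology}"
  assumes "f \<in> borel_measurable M" "\<And>x. x \<in> space M \<Longrightarrow> norm (f x) \<le> B"
  shows "integrable M f"
  by (rule integrable_const_bound[where B = B]) (use assms in auto)

lemma integral_norm_bounded: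
  fixes f :: "'a \<Rightarrow> 'b::{banach, second_countable_topology}"
  assumes "f \<in> borel_measurable M" "\<And>x. x \<in> space M \<Longrightarrow> norm (f x) \<le> B"
  shows "norm (integral\<^sup>L M f) \<le> B"
proof -
  have "norm (integral\<^sup>L M f) \<le> (\<integral>x. norm (f x) \<partial>M)"
    by (rule integral_norm_bound)
  also have "\<dots> \<le> (\<integral>x. B \<partial>M)"
    by (rule integral_mono) (use assms in \<open>auto intro: integrable_bounded integrable_norm\<close>)
  finally show ?thesis by (simp add: prob_space)
qed

lemma partition_cell_sets:
  "partition_map \<kappa> \<Longrightarrow> \<kappa> -` A \<inter> space M \<in> sets M"
  by (auto intro: measurable_sets)

lemma measurable_partition_comp [measurable (raw)]:
  "\<kappa> \<in> measurable M (count_space UNIV) \<Longrightarrow> (\<lambda>x. g (\<kappa> x :: int)) \<in> borel_measurable M"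
  by (rule measurable_compose[of \<kappa> M "count_space UNIV" g borel]) auto

lemma integral_partition:
  fixes u :: "'a \<Rightarrow> 'b::{banach, second_countable_topology}"
  assumes "partition_map \<kappa>" "integrable M u"
  shows "(\<integral>x. u x \<partial>M) = (\<Sum>c\<in>\<kappa> ` space M. \<integral>x. indicator (\<kappa> -` {c}) x *\<^sub>R u x \<partial>M)"
proof -
  \<comment> \<open>The fibre of \<open>\<kappa>\<close> is taken in the whole type and may fail to
    be measurable; the indicator is therefore first restricted to \<open>space M\<close>.\<close>
  have int: "integrable M (\<lambda>x. indicator (\<kappa> -` {c}) x *\<^sub>R u x)" for c
  proof -
    have "integrable M (\<lambda>x. indicator (\<kappa> -` {c} \<inter> space M) x *\<^sub>R u x)"
      using partition_cell_sets[OF assms(1)] assms(2)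
      by (intro integrable_mult_indicator) auto
    moreover have "integrable M (\<lambda>x. indicator (\<kappa> -` {c} \<inter> space M) x *\<^sub>R u x)
        \<longleftrightarrow> integrable M (\<lambda>x. indicator (\<kappa> -` {c}) x *\<^sub>R u x)"
      by (rule Bochner_Integration.integrable_cong) (auto simp: indicator_def)
    ultimately show ?thesis by simp
  qed
  have "(\<integral>x. u x \<partial>M) = (\<integral>x. (\<Sum>c\<in>\<kappa> ` space M. indicator (\<kappa> -` {c}) x *\<^sub>R u x) \<partial>M)"
  proof (rule Bochner_Integration.integral_cong[OF refl])
    fix x assume x: "x \<in> space M"
    have "(\<Sum>c\<in>\<kappa> ` space M. indicator (\<kappa> -` {c}) x *\<^sub>R u x) = (\<Sum>c\<in>{\<kappa> x}. u x)"
      by (rule sum.mono_neutral_cong_right) (use assms x in \<open>auto simp: indicator_def\<close>)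
    then show "u x = (\<Sum>c\<in>\<kappa> ` space M. indicator (\<kappa> -` {c}) x *\<^sub>R u x)" by simp
  qed
  also have "\<dots> = (\<Sum>c\<in>\<kappa> ` space M. \<integral>x. indicator (\<kappa> -` {c}) x *\<^sub>R u x \<partial>M)"
    by (rule Bochner_Integration.integral_sum) (rule int)
  finally show ?thesis .
qed

lemma cell_exp_measurable [measurable (raw)]:
  "\<kappa> \<in> measurable M (count_space UNIV) \<Longrightarrow> cell_exp M \<kappa> u \<in> borel_measurable M"
  unfolding cell_exp_def by (rule measurable_partition_comp)

lemma norm_cell_integral_le:
  assumes "partition_map \<kappa>" and "u \<in> borel_measurable M"
    and "\<And>x. x \<in> space M \<Longrightarrow> cmod (u x) \<le> B"
  shows "cmod (\<integral>x. indicator (\<kappa> -` {c}) x *\<^sub>R u x \<partial>M) \<le> B * measure M (\<kappa> -` {c} \<inter> space M)"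
proof -
  have B: "B \<ge> 0"
    using assms(3) not_empty by (meson norm_ge_zero order_trans ex_in_conv)
  have s: "\<kappa> -` {c} \<inter> space M \<in> sets M"
    by (rule partition_cell_sets[OF assms(1)])
  have "(\<integral>x. indicator (\<kappa> -` {c}) x *\<^sub>R u x \<partial>M) = (\<integral>x. indicator (\<kappa> -` {c} \<inter> space M) x *\<^sub>R u x \<partial>M)"
    by (rule Bochner_Integration.integral_cong) (auto simp: indicator_def)
  also have "cmod \<dots> \<le> (\<integral>x. cmod (indicator (\<kappa> -` {c} \<inter> space M) x *\<^sub>R u x) \<partial>M)"
    by (rule integral_norm_bound)
  also have "\<dots> \<le> (\<integral>x. indicator (\<kappa> -` {c} \<inter> space M) x *\<^sub>R B \<partial>M)"
  proof (rule integral_mono)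
    show "integrable M (\<lambda>x. cmod (indicator (\<kappa> -` {c} \<inter> space M) x *\<^sub>R u x))"
      using assms s by (intro integrable_norm integrable_mult_indicator integrable_bounded[where B=B]) auto
    show "integrable M (\<lambda>x. indicator (\<kappa> -` {c} \<inter> space M) x *\<^sub>R B)"
      using s by (intro integrable_mult_indicator) auto
  qed (use assms(3) B in \<open>simp add: indicator_def\<close>)
  also have "\<dots> = B * measure M (\<kappa> -` {c} \<inter> space M)"
    using s by (simp add: mult.commute)
  finally show ?thesis .
qed

text \<open>On a cell of mass zero both sides vanish, the integral because
  \<open>norm_cell_integral_le\<close> bounds it by a multiple of the mass.\<close>

lemma cell_exp_mass:
  assumes "partition_map \<kappa>" and "u \<in> borel_measurable M"
    and "\<And>x. x \<in> space M \<Longrightarrow> cmod (u x) \<le> B"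
  shows "of_real (measure M (\<kappa> -` {\<kappa> x} \<inter> space M)) * cell_exp M \<kappa> u x
     = (\<integral>y. indicator (\<kappa> -` {\<kappa> x}) y *\<^sub>R u y \<partial>M)"
  using norm_cell_integral_le[OF assms, of "\<kappa> x"] by (auto simp: cell_exp_def)

lemma cell_exp_bound:
  assumes "partition_map \<kappa>" and "u \<in> borel_measurable M"
    and "\<And>x. x \<in> space M \<Longrightarrow> cmod (u x) \<le> B" and "B \<ge> 0"
  shows "cmod (cell_exp M \<kappa> u x) \<le> B"
  using norm_cell_integral_le[OF assms(1-3), of "\<kappa> x"] \<open>B \<ge> 0\<close>
  by (cases "measure M (\<kappa> -` {\<kappa> x} \<inter> space M) = 0")
     (auto simp: cell_exp_def norm_divide divide_simps zero_less_measure_iff mult.commute)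

lemma cell_exp_const_on_cell: "\<kappa> x = \<kappa> y \<Longrightarrow> cell_exp M \<kappa> u x = cell_exp M \<kappa> u y"
  by (simp add: cell_exp_def)

lemma integral_partition_mult:
  fixes u :: "'a \<Rightarrow> complex"
  assumes "partition_map \<kappa>" "u \<in> borel_measurable M" "\<And>x. x \<in> space M \<Longrightarrow> cmod (u x) \<le> B"
  shows "(\<integral>x. g (\<kappa> x) * u x \<partial>M)
    = (\<Sum>c\<in>\<kappa> ` space M. g c * (\<integral>x. indicator (\<kappa> -` {c}) x *\<^sub>R u x \<partial>M))"
proof -
  obtain G where G: "\<And>x. x \<in> space M \<Longrightarrow> cmod (g (\<kappa> x)) \<le> G"
  proof -
    have "finite ((\<lambda>c. cmod (g c)) ` \<kappa> ` space M)" using assms(1) by simp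
    then have "\<And>x. x \<in> space M \<Longrightarrow> cmod (g (\<kappa> x)) \<le> Max ((\<lambda>c. cmod (g c)) ` \<kappa> ` space M)"
      by (intro Max_ge) auto
    with that show ?thesis by blast
  qed
  have [measurable]: "\<kappa> \<in> measurable M (count_space UNIV)" "u \<in> borel_measurable M"
    using assms by auto
  have 1: "(\<lambda>x. g (\<kappa> x) * u x) \<in> borel_measurable M"
    by measurable
  have "cmod (g (\<kappa> x) * u x) \<le> G * B" if "x \<in> space M" for x
    unfolding norm_mult
    using G[OF that] assms(3)[OF that] by (rule mult_mono) (auto intro: order_trans[OF norm_ge_zero G[OF that]])
  then have "integrable M (\<lambda>x. g (\<kappa> x) * u x)"
    by (rule integrable_bounded[OF 1])
  then have "(\<integral>x. g (\<kappa> x) * u x \<partial>M)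
    = (\<Sum>c\<in>\<kappa> ` space M. \<integral>x. indicator (\<kappa> -` {c}) x *\<^sub>R (g (\<kappa> x) * u x) \<partial>M)"
    by (rule integral_partition[OF assms(1)])
  also have "\<dots> = (\<Sum>c\<in>\<kappa> ` space M. \<integral>x. g c * (indicator (\<kappa> -` {c}) x *\<^sub>R u x) \<partial>M)"
    by (intro sum.cong Bochner_Integration.integral_cong refl) (auto simp: indicator_def)
  finally show ?thesis by (simp only: integral_mult_right_zero)
qed

text \<open>The characteristic property of the orthogonal projection onto functions of
  \<open>\<kappa>\<close>: both sides are the same finite sum over cells, weighted by the value of
  \<open>g\<close> on each.\<close>

lemma cell_exp_projection:
  fixes u :: "'a \<Rightarrow> complex"
  assumes "partition_map \<kappa>" "u \<in> borel_measurable M" "\<And>x. x \<in> space M \<Longrightarrow> cmod (u x) \<le> B"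
  shows "(\<integral>x. g (\<kappa> x) * cell_exp M \<kappa> u x \<partial>M) = (\<integral>x. g (\<kappa> x) * u x \<partial>M)"
proof -
  define I where "I c = (\<integral>x. indicator (\<kappa> -` {c}) x *\<^sub>R u x \<partial>M)" for c
  define p where "p c = measure M (\<kappa> -` {c} \<inter> space M)" for c
  have B: "B \<ge> 0"
    using assms(3) not_empty by (meson norm_ge_zero order_trans ex_in_conv)
  have "(\<integral>x. g (\<kappa> x) * cell_exp M \<kappa> u x \<partial>M)
    = (\<integral>x. g (\<kappa> x) * (I (\<kappa> x) / of_real (p (\<kappa> x))) * (\<lambda>_. 1) x \<partial>M)"
    by (simp add: cell_exp_def I_def p_def)
  also have "\<dots> = (\<Sum>c\<in>\<kappa> ` space M. g c * (I c / of_real (p c)) * (\<integral>x. indicator (\<kappa> -` {c}) x *\<^sub>R 1 \<partial>M))"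
    by (rule integral_partition_mult[OF assms(1), where B = 1]) auto
  also have "\<dots> = (\<Sum>c\<in>\<kappa> ` space M. g c * I c)"
  proof (rule sum.cong[OF refl])
    fix c
    have s: "\<kappa> -` {c} \<inter> space M \<in> sets M"
      by (rule partition_cell_sets[OF assms(1)])
    have "(\<integral>x. indicator (\<kappa> -` {c}) x *\<^sub>R (1::complex) \<partial>M)
        = (\<integral>x. indicator (\<kappa> -` {c} \<inter> space M) x *\<^sub>R (1::complex) \<partial>M)"
      by (rule Bochner_Integration.integral_cong) (auto simp: indicator_def)
    also have "\<dots> = of_real (p c)"
      using s by (subst integral_scaleR_left) (auto simp: p_def of_real_def integrable_indicator_iff less_top[symmetric])
    finally have *: "(\<integral>x. indicator (\<kappa> -` {c}) x *\<^sub>R (1::complex) \<partial>M) = of_real (p c)" .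
    \<comment> \<open>On a null cell the quotient has the default value 0, so the cell integral has
      to be 0 as well.\<close>
    have "p c = 0 \<Longrightarrow> I c = 0"
      using norm_cell_integral_le[OF assms, of c] by (simp add: I_def p_def)
    then show "g c * (I c / of_real (p c)) * (\<integral>x. indicator (\<kappa> -` {c}) x *\<^sub>R 1 \<partial>M) = g c * I c"
      unfolding * by auto
  qed
  also have "\<dots> = (\<integral>x. g (\<kappa> x) * u x \<partial>M)"
    unfolding I_def by (rule integral_partition_mult[OF assms, symmetric])
  finally show ?thesis .
qed

lemma integral_cell_exp:
  assumes "partition_map \<kappa>" "u \<in> borel_measurable M" "\<And>x. x \<in> space M \<Longrightarrow> cmod (u x) \<le> B"
  shows "(\<integral>x. cell_exp M \<kappa> u x \<partial>M) = (\<integral>x. u x \<partial>M)"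
  using cell_exp_projection[OF assms, of "\<lambda>_. 1"] by simp

text \<open>Pythagoras for nested projections. The function \<open>\<theta>\<close> says that
  \<open>\<kappa>'\<close> is coarser than \<open>\<kappa>\<close>; the cross term equals the
  squared norm of the coarser projection because that projection is itself a function of
  \<open>\<kappa>\<close>.\<close>

lemma cell_exp_orthogonal:
  assumes \<kappa>: "partition_map \<kappa>" and \<kappa>': "partition_map \<kappa>'"
    and refine: "\<And>x. x \<in> space M \<Longrightarrow> \<kappa>' x = \<theta> (\<kappa> x)"
    and u: "u \<in> borel_measurable M" "\<And>x. x \<in> space M \<Longrightarrow> cmod (u x) \<le> B"
  shows "(\<integral>x. (cmod (cell_exp M \<kappa> u x - cell_exp M \<kappa>' u x))\<^sup>2 \<partial>M)
    = (\<integral>x. (cmod (cell_exp M \<kappa> u x))\<^sup>2 \<partial>M) - (\<integral>x. (cmod (cell_exp M \<kappa>' u x))\<^sup>2 \<partial>M)"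
proof -
  let ?A = "cell_exp M \<kappa> u" and ?B = "cell_exp M \<kappa>' u"
  have B: "B \<ge> 0"
    using u(2) not_empty by (meson norm_ge_zero order_trans ex_in_conv)
  define gB where "gB c = (\<integral>y. indicator (\<kappa>' -` {c}) y *\<^sub>R u y \<partial>M) / of_real (measure M (\<kappa>' -` {c} \<inter> space M))" for c
  have gB: "?B x = gB (\<kappa>' x)" for x by (simp add: gB_def cell_exp_def)
  have bA: "cmod (?A x) \<le> B" and bB: "cmod (?B x) \<le> B" for x
    using cell_exp_bound[OF \<kappa> u B] cell_exp_bound[OF \<kappa>' u B] by auto
  have m[measurable]: "?A \<in> borel_measurable M" "?B \<in> borel_measurable M"
    using \<kappa> \<kappa>' by (auto intro: cell_exp_measurable)
  have bb: "cmod (w * cnj z) \<le> B * B" if "cmod w \<le> B" "cmod z \<le> B" for w z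
    using that B by (auto simp: norm_mult intro!: mult_mono)
  have iAB: "integrable M (\<lambda>x. ?A x * cnj (?B x))" and iBB: "integrable M (\<lambda>x. ?B x * cnj (?B x))"
    and iAA: "integrable M (\<lambda>x. ?A x * cnj (?A x))"
    by (auto intro!: integrable_bounded[where B = "B * B"] bb bA bB)
  have "(\<integral>x. cnj (gB (\<theta> (\<kappa> x))) * ?A x \<partial>M) = (\<integral>x. cnj (gB (\<theta> (\<kappa> x))) * u x \<partial>M)"
    by (rule cell_exp_projection[OF \<kappa> u])
  also have "\<dots> = (\<integral>x. cnj (gB (\<kappa>' x)) * u x \<partial>M)"
    by (rule Bochner_Integration.integral_cong) (auto simp: refine)
  also have "\<dots> = (\<integral>x. cnj (gB (\<kappa>' x)) * ?B x \<partial>M)"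
    by (rule cell_exp_projection[OF \<kappa>' u, symmetric])
  also have "(\<integral>x. cnj (gB (\<theta> (\<kappa> x))) * ?A x \<partial>M) = (\<integral>x. ?A x * cnj (?B x) \<partial>M)"
    by (rule Bochner_Integration.integral_cong) (auto simp: refine gB)
  also have "(\<integral>x. cnj (gB (\<kappa>' x)) * ?B x \<partial>M) = (\<integral>x. ?B x * cnj (?B x) \<partial>M)"
    by (rule Bochner_Integration.integral_cong) (auto simp: gB)
  finally have key: "(\<integral>x. ?A x * cnj (?B x) \<partial>M) = (\<integral>x. ?B x * cnj (?B x) \<partial>M)" .
  have key': "(\<integral>x. Re (?A x * cnj (?B x)) \<partial>M) = (\<integral>x. (cmod (?B x))\<^sup>2 \<partial>M)"
  proof -
    have "(\<integral>x. Re (?A x * cnj (?B x)) \<partial>M) = Re (\<integral>x. ?A x * cnj (?B x) \<partial>M)"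
      by (rule integral_Re[OF iAB])
    also have "\<dots> = (\<integral>x. Re (?B x * cnj (?B x)) \<partial>M)"
      unfolding key by (rule integral_Re[OF iBB, symmetric])
    also have "\<dots> = (\<integral>x. (cmod (?B x))\<^sup>2 \<partial>M)"
      by (rule Bochner_Integration.integral_cong) (simp_all only: cmod_power2, simp_all add: power2_eq_square)
    finally show ?thesis .
  qed
  have i2: "integrable M (\<lambda>x. (cmod (?A x))\<^sup>2)" "integrable M (\<lambda>x. (cmod (?B x))\<^sup>2)"
    using bA bB by (auto intro!: integrable_bounded[where B = "B\<^sup>2"] power_mono)
  have "(\<integral>x. (cmod (?A x - ?B x))\<^sup>2 \<partial>M)
    = (\<integral>x. (cmod (?A x))\<^sup>2 - 2 * Re (?A x * cnj (?B x)) + (cmod (?B x))\<^sup>2 \<partial>M)"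
    by (rule Bochner_Integration.integral_cong[OF refl]) (simp only: cmod_power2, simp add: power2_eq_square algebra_simps)
  also have "\<dots> = (\<integral>x. (cmod (?A x))\<^sup>2 \<partial>M) - 2 * (\<integral>x. Re (?A x * cnj (?B x)) \<partial>M) + (\<integral>x. (cmod (?B x))\<^sup>2 \<partial>M)"
  proof -
    have "integrable M (\<lambda>x. Re (?A x * cnj (?B x)))"
      by (rule integrable_Re[OF iAB])
    then show ?thesis
      using i2 by (simp del: times_complex.simps)
  qed
  finally show ?thesis using key' by simp
qed

corollary cell_exp_L2_mono:
  assumes "partition_map \<kappa>" "partition_map \<kappa>'"
    and "\<And>x. x \<in> space M \<Longrightarrow> \<kappa>' x = \<theta> (\<kappa> x)"
    and "u \<in> borel_measurable M" "\<And>x. x \<in> space M \<Longrightarrow> cmod (u x) \<le> B"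
  shows "(\<integral>x. (cmod (cell_exp M \<kappa>' u x))\<^sup>2 \<partial>M) \<le> (\<integral>x. (cmod (cell_exp M \<kappa> u x))\<^sup>2 \<partial>M)"
  using cell_exp_orthogonal[OF assms]
    Bochner_Integration.integral_nonneg[of M "\<lambda>x. (cmod (cell_exp M \<kappa> u x - cell_exp M \<kappa>' u x))\<^sup>2"]
  by simp

text \<open>Nonnegativity of the variance of the absolute value.\<close>

lemma L1_le_L2:
  fixes f :: "'a \<Rightarrow> real"
  assumes [measurable]: "f \<in> borel_measurable M" and "\<And>x. x \<in> space M \<Longrightarrow> \<bar>f x\<bar> \<le> B"
  shows "(\<integral>x. \<bar>f x\<bar> \<partial>M)\<^sup>2 \<le> (\<integral>x. (f x)\<^sup>2 \<partial>M)"
proof -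
  have "integrable M (\<lambda>x. \<bar>f x\<bar>)"
    by (rule integrable_bounded[where B = B]) (use assms(2) in auto)
  moreover have "norm ((\<bar>f x\<bar>)\<^sup>2) \<le> B\<^sup>2" if "x \<in> space M" for x
    using power_mono[OF assms(2)[OF that], of 2] by simp
  then have "integrable M (\<lambda>x. (\<bar>f x\<bar>)\<^sup>2)"
    by (intro integrable_bounded[where B = "B\<^sup>2"]) auto
  ultimately have "variance (\<lambda>x. \<bar>f x\<bar>) = (\<integral>x. (\<bar>f x\<bar>)\<^sup>2 \<partial>M) - (\<integral>x. \<bar>f x\<bar> \<partial>M)\<^sup>2"
    by (rule variance_eq)
  then show ?thesis
    using variance_positive[of "\<lambda>x. \<bar>f x\<bar>"] by simp
qed

end

subsection \<open>The mean ergodic theorem\<close>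

definition birkhoff :: "('a \<Rightarrow> 'a) \<Rightarrow> ('a \<Rightarrow> real) \<Rightarrow> nat \<Rightarrow> 'a \<Rightarrow> real" where
  "birkhoff T w n x = (\<Sum>j<n. w ((T ^^ j) x)) / real n"

context prob_space
begin

lemma integral_measure_preserving:
  fixes f :: "'a \<Rightarrow> 'b::{banach, second_countable_topology}"
  assumes "T \<in> measurable M M" "distr M M T = M" "f \<in> borel_measurable M"
  shows "(\<integral>x. f (T x) \<partial>M) = (\<integral>x. f x \<partial>M)"
  using integral_distr[OF assms(1,3)] assms(2) by simp

lemma measurable_funpow: "T \<in> measurable M M \<Longrightarrow> T ^^ n \<in> measurable M M"
  by (induction n) (auto intro: measurable_comp)

lemma distr_funpow:
  assumes "T \<in> measurable M M" "distr M M T = M"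
  shows "distr M M (T ^^ n) = M"
proof (induction n)
  case 0
  then show ?case by (simp add: id_def distr_id)
next
  case (Suc n)
  have "distr (distr M M (T ^^ n)) M T = distr M M (T \<circ> T ^^ n)"
    using assms(1) measurable_funpow[OF assms(1)] by (intro distr_distr) auto
  then show ?case using Suc assms(2) by (simp add: comp_def)
qed

lemma birkhoff_bound:
  assumes "T \<in> measurable M M" "\<And>x. x \<in> space M \<Longrightarrow> \<bar>w x\<bar> \<le> B" "B \<ge> 0" "x \<in> space M"
  shows "\<bar>birkhoff T w n x\<bar> \<le> B"
proof (cases "n = 0")
  case False
  have "(T ^^ j) x \<in> space M" for j
    using measurable_space[OF measurable_funpow[OF assms(1)] assms(4)] .
  then have "\<bar>\<Sum>j<n. w ((T ^^ j) x)\<bar> \<le> (\<Sum>j<n. B)"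
    by (intro sum_abs[THEN order_trans] sum_mono assms(2))
  then show ?thesis using False by (simp add: birkhoff_def divide_simps mult.commute)
qed (use assms in \<open>simp add: birkhoff_def\<close>)

lemma birkhoff_measurable [measurable (raw)]:
  assumes "T \<in> measurable M M" "w \<in> borel_measurable M"
  shows "birkhoff T w n \<in> borel_measurable M"
  unfolding birkhoff_def[abs_def]
  using measurable_compose[OF measurable_funpow[OF assms(1)] assms(2)] by measurable

lemma birkhoff_shift:
  "birkhoff T w n (T x) - birkhoff T w n x = (w ((T ^^ n) x) - w x) / real n"
proof -
  have "(\<Sum>j<n. w ((T ^^ j) (T x))) - (\<Sum>j<n. w ((T ^^ j) x)) = w ((T ^^ n) x) - w x"
    using sum_lessThan_telescope[of "\<lambda>j. w ((T ^^ j) x)" n]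
    by (simp add: sum_subtractf funpow_swap1)
  then show ?thesis by (simp add: birkhoff_def flip: diff_divide_distrib)
qed

lemma birkhoff_shift_pow:
  assumes "T \<in> measurable M M" "\<And>x. x \<in> space M \<Longrightarrow> \<bar>w x\<bar> \<le> B" "x \<in> space M"
  shows "\<bar>birkhoff T w n ((T ^^ k) x) - birkhoff T w n x\<bar> \<le> 2 * B * real k / real n"
proof (induction k)
  case (Suc k)
  have sp: "(T ^^ j) x \<in> space M" for j
    using measurable_space[OF measurable_funpow[OF assms(1)] assms(3)] .
  have "\<bar>birkhoff T w n (T ((T ^^ k) x)) - birkhoff T w n ((T ^^ k) x)\<bar> \<le> 2 * B / real n"
  proof -
    have "\<bar>w ((T ^^ n) ((T ^^ k) x)) - w ((T ^^ k) x)\<bar> \<le> 2 * B"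
      using assms(2)[OF sp[of "n + k"]] assms(2)[OF sp[of k]] by (simp add: funpow_add)
    then show ?thesis
      by (simp add: birkhoff_shift abs_divide divide_right_mono)
  qed
  with Suc show ?case by (simp add: algebra_simps add_divide_distrib)
qed simp

lemma funpow_in_space: "T \<in> measurable M M \<Longrightarrow> x \<in> space M \<Longrightarrow> (T ^^ j) x \<in> space M"
  using measurable_space[OF measurable_funpow] .

lemma integral_funpow:
  fixes f :: "'a \<Rightarrow> 'b::{banach, second_countable_topology}"
  assumes "T \<in> measurable M M" "distr M M T = M" "f \<in> borel_measurable M"
  shows "(\<integral>x. f ((T ^^ n) x) \<partial>M) = (\<integral>x. f x \<partial>M)"
  by (rule integral_measure_preserving[OF measurable_funpow[OF assms(1)] distr_funpow[OF assms(1,2)] assms(3)])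

lemma integral_birkhoff:
  assumes T: "T \<in> measurable M M" "distr M M T = M"
    and w: "w \<in> borel_measurable M" "\<And>x. x \<in> space M \<Longrightarrow> \<bar>w x\<bar> \<le> B" and n: "n > 0"
  shows "(\<integral>x. birkhoff T w n x \<partial>M) = (\<integral>x. w x \<partial>M)"
proof -
  have "integrable M (\<lambda>x. w ((T ^^ j) x))" for j
    using w(2) funpow_in_space[OF T(1)]
    by (intro integrable_bounded[where B = B] measurable_compose[OF measurable_funpow[OF T(1)] w(1)]) auto
  then have "(\<integral>x. birkhoff T w n x \<partial>M) = (\<Sum>j<n. \<integral>x. w ((T ^^ j) x) \<partial>M) / real n"
    by (simp add: birkhoff_def)
  also have "\<dots> = (\<integral>x. w x \<partial>M)"
    using n by (simp add: integral_funpow[OF T w(1)])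
  finally show ?thesis .
qed

text \<open>Cauchy-Schwarz and the triangle inequality compare, pointwise, with the Birkhoff
  averages of the square and of the absolute value; these have the integral of the original function
  by invariance.\<close>

lemma birkhoff_contraction:
  assumes T: "T \<in> measurable M M" "distr M M T = M"
    and g: "g \<in> borel_measurable M" "\<And>x. x \<in> space M \<Longrightarrow> \<bar>g x\<bar> \<le> B"
  shows "(\<integral>x. (birkhoff T g n x)\<^sup>2 \<partial>M) \<le> (\<integral>x. (g x)\<^sup>2 \<partial>M)"
    and "(\<integral>x. \<bar>birkhoff T g n x\<bar> \<partial>M) \<le> (\<integral>x. \<bar>g x\<bar> \<partial>M)"
proof -
  have B: "B \<ge> 0" using g(2) not_empty by (meson abs_ge_zero order_trans ex_in_conv)
  have sq: "\<bar>(g x)\<^sup>2\<bar> \<le> B\<^sup>2" if "x \<in> space M" for x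
    using power_mono[OF g(2)[OF that], of 2] by simp
  have m[measurable]: "(\<lambda>x. birkhoff T g n x) \<in> borel_measurable M" using T(1) g(1) by measurable
  have [measurable]: "g \<in> borel_measurable M" by (rule g)
  have b: "\<bar>birkhoff T g n x\<bar> \<le> B" if "x \<in> space M" for x
    by (rule birkhoff_bound[OF T(1) g(2) B that])
  have sqb: "\<bar>(birkhoff T g n x)\<^sup>2\<bar> \<le> B\<^sup>2" if "x \<in> space M" for x
    using power_mono[OF b[OF that], of 2] by simp
  have "(\<integral>x. (birkhoff T g n x)\<^sup>2 \<partial>M) \<le> (\<integral>x. birkhoff T (\<lambda>x. (g x)\<^sup>2) n x \<partial>M)"
  proof (rule integral_mono)
    show "integrable M (\<lambda>x. (birkhoff T g n x)\<^sup>2)"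
      by (rule integrable_bounded[where B = "B\<^sup>2"]) (use sqb in auto)
    show "integrable M (birkhoff T (\<lambda>x. (g x)\<^sup>2) n)"
      by (rule integrable_bounded[where B = "B\<^sup>2"], rule birkhoff_measurable[OF T(1)])
         (use birkhoff_bound[OF T(1) sq] in auto)
    fix x
    have "(\<Sum>j<n. g ((T ^^ j) x))\<^sup>2 \<le> (\<Sum>j<n. (g ((T ^^ j) x))\<^sup>2) * real n"
      using sum_squared_le_sum_of_squares[of "\<lambda>j. g ((T ^^ j) x)" "{..<n}"] by simp
    then show "(birkhoff T g n x)\<^sup>2 \<le> birkhoff T (\<lambda>x. (g x)\<^sup>2) n x"
      by (cases "n = 0") (simp_all add: birkhoff_def power_divide divide_simps power2_eq_square[of "real n"] mult.commute)
  qed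
  also have "\<dots> \<le> (\<integral>x. (g x)\<^sup>2 \<partial>M)"
    by (cases "n = 0") (auto simp: birkhoff_def[of T _ 0] intro!: integral_birkhoff[OF T _ sq, THEN eq_refl])
  finally show "(\<integral>x. (birkhoff T g n x)\<^sup>2 \<partial>M) \<le> (\<integral>x. (g x)\<^sup>2 \<partial>M)" .
  have "(\<integral>x. \<bar>birkhoff T g n x\<bar> \<partial>M) \<le> (\<integral>x. birkhoff T (\<lambda>x. \<bar>g x\<bar>) n x \<partial>M)"
  proof (rule integral_mono)
    show "integrable M (\<lambda>x. \<bar>birkhoff T g n x\<bar>)"
      by (rule integrable_bounded[where B = B]) (use b in auto)
    show "integrable M (birkhoff T (\<lambda>x. \<bar>g x\<bar>) n)"
      by (rule integrable_bounded[where B = B], rule birkhoff_measurable[OF T(1)])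
         (use birkhoff_bound[OF T(1), of "\<lambda>x. \<bar>g x\<bar>" B] g(2) B in auto)
    show "\<bar>birkhoff T g n x\<bar> \<le> birkhoff T (\<lambda>x. \<bar>g x\<bar>) n x" for x
      by (simp add: birkhoff_def abs_divide divide_right_mono)
  qed
  also have "\<dots> \<le> (\<integral>x. \<bar>g x\<bar> \<partial>M)"
    using g(2) by (cases "n = 0") (auto simp: birkhoff_def[of T _ 0] intro!: integral_birkhoff[OF T, of "\<lambda>x. \<bar>g x\<bar>" B, THEN eq_refl])
  finally show "(\<integral>x. \<bar>birkhoff T g n x\<bar> \<partial>M) \<le> (\<integral>x. \<bar>g x\<bar> \<partial>M)" .
qed

lemma birkhoff_commute: "birkhoff T (birkhoff T w n) k x = birkhoff T (birkhoff T w k) n x"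
proof -
  have "(\<Sum>j<k. \<Sum>i<n. w ((T ^^ i) ((T ^^ j) x))) = (\<Sum>i<n. \<Sum>j<k. w ((T ^^ j) ((T ^^ i) x)))"
    by (subst sum.swap) (simp add: add.commute flip: funpow_add[THEN fun_cong, unfolded comp_def])
  then show ?thesis
    by (simp add: birkhoff_def mult.commute flip: sum_divide_distrib)
qed

text \<open>The two averagings commute, so the iterated average is the mean of n shifts of the
  k-average, and a shift by fewer than n steps moves the latter by at most 2Bn/k.\<close>

lemma birkhoff_birkhoff_close:
  assumes T: "T \<in> measurable M M" and w: "\<And>x. x \<in> space M \<Longrightarrow> \<bar>w x\<bar> \<le> B"
    and x: "x \<in> space M" and n: "n > 0"
  shows "\<bar>birkhoff T (birkhoff T w n) k x - birkhoff T w k x\<bar> \<le> 2 * B * real n / real k"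
proof -
  have B: "B \<ge> 0" using w[OF x] by simp
  have "birkhoff T (birkhoff T w n) k x - birkhoff T w k x
     = (\<Sum>j<n. birkhoff T w k ((T ^^ j) x) - birkhoff T w k x) / real n"
    unfolding birkhoff_commute[of T w n k x] using n
    by (simp add: birkhoff_def[of T "birkhoff T w k"] sum_subtractf diff_divide_distrib)
  also have "\<bar>\<dots>\<bar> \<le> (\<Sum>j<n. 2 * B * real n / real k) / real n"
    unfolding abs_divide
  proof (rule divide_mono)
    show "\<bar>\<Sum>j<n. birkhoff T w k ((T ^^ j) x) - birkhoff T w k x\<bar> \<le> (\<Sum>j<n. 2 * B * real n / real k)"
    proof (rule order_trans[OF sum_abs sum_mono])
      fix j assume "j \<in> {..<n}"
      then have "2 * B * real j / real k \<le> 2 * B * real n / real k"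
        using B by (intro divide_right_mono mult_left_mono) auto
      then show "\<bar>birkhoff T w k ((T ^^ j) x) - birkhoff T w k x\<bar> \<le> 2 * B * real n / real k"
        using birkhoff_shift_pow[where w = w, OF T w x, where n = k and k = j] by linarith
    qed
  qed (use n B in \<open>auto intro!: sum_nonneg mult_nonneg_nonneg divide_nonneg_nonneg\<close>)
  finally show ?thesis using n by simp
qed

text \<open>Invariance at every point makes the level sets exactly invariant, the only kind of set
  that \<open>ergodic\<close> speaks about. If the set above (or below) the mean had full measure,
  the mean would exceed (or fall short of) itself.\<close>

lemma ergodic_invariant_const:
  fixes G :: "'a \<Rightarrow> real"
  assumes "ergodic M T" and G[measurable]: "G \<in> borel_measurable M" and int: "integrable M G"
    and inv: "\<And>x. x \<in> space M \<Longrightarrow> G (T x) = G x"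
  shows "AE x in M. G x = (\<integral>x. G x \<partial>M)"
proof -
  define c where "c = (\<integral>x. G x \<partial>M)"
  have T: "T \<in> measurable M M" using assms(1) by (simp add: ergodic_def)
  have zo: "prob A = 0 \<or> prob A = 1" if "A \<in> sets M" "T -` A \<inter> space M = A" for A
  proof -
    have "emeasure M A = 0 \<or> emeasure M (space M - A) = 0"
      using assms(1) that by (auto simp: ergodic_def)
    then show ?thesis
      using prob_compl[OF that(1)] by (auto simp: measure_def)
  qed
  have "AE x in M. G x \<le> c"
  proof -
    let ?A = "{x \<in> space M. G x > c}"
    have "T -` ?A \<inter> space M = ?A"
      using inv measurable_space[OF T] by auto
    then have "prob ?A = 0 \<or> prob ?A = 1" by (intro zo) auto
    moreover have "prob ?A \<noteq> 1"
    proof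
      assume "prob ?A = 1"
      then have *: "AE x in M. G x > c"
        using AE_prob_1 by fastforce
      have "(\<integral>x. c \<partial>M) < (\<integral>x. G x \<partial>M)"
        by (rule integral_less_AE_space) (use int * in \<open>auto simp: emeasure_space_1\<close>)
      then show False by (simp add: c_def prob_space)
    qed
    ultimately have "prob ?A = 0" by simp
    then show ?thesis
      by (subst (asm) prob_eq_0) (auto elim: eventually_mono)
  qed
  moreover have "AE x in M. G x \<ge> c"
  proof -
    let ?A = "{x \<in> space M. G x < c}"
    have "T -` ?A \<inter> space M = ?A"
      using inv measurable_space[OF T] by auto
    then have "prob ?A = 0 \<or> prob ?A = 1" by (intro zo) auto
    moreover have "prob ?A \<noteq> 1"
    proof
      assume "prob ?A = 1"
      then have *: "AE x in M. G x < c"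
        using AE_prob_1 by fastforce
      have "(\<integral>x. G x \<partial>M) < (\<integral>x. c \<partial>M)"
        by (rule integral_less_AE_space) (use int * in \<open>auto simp: emeasure_space_1\<close>)
      then show False by (simp add: c_def prob_space)
    qed
    ultimately have "prob ?A = 0" by simp
    then show ?thesis
      by (subst (asm) prob_eq_0) (auto elim: eventually_mono)
  qed
  ultimately show ?thesis unfolding c_def by (auto elim: eventually_elim2)
qed

text \<open>A minimal-norm argument. By \<open>contr\<close> the midpoint of two averages has second
  moment at least the infimum, so the parallelogram law makes averages of nearly minimal norm close
  to each other. A fast subsequence converges almost everywhere to an invariant, hence constant,
  limit, and \<open>final\<close> passes the smallness from one average to all late ones.\<close>

theorem mean_ergodic:
  assumes erg: "ergodic M T" and w[measurable]: "w \<in> borel_measurable M"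
    and wB: "\<And>x. x \<in> space M \<Longrightarrow> \<bar>w x\<bar> \<le> B"
  shows "(\<lambda>n. \<integral>x. \<bar>birkhoff T w n x - (\<integral>x. w x \<partial>M)\<bar> \<partial>M) \<longlonglongrightarrow> 0"
proof -
  have T: "T \<in> measurable M M" "distr M M T = M"
    using erg by (auto simp: ergodic_def)
  have B: "B \<ge> 0" using wB not_empty by (meson abs_ge_zero order_trans ex_in_conv)
  define A where "A = birkhoff T w"
  have Am[measurable]: "A n \<in> borel_measurable M" for n
    unfolding A_def using T by measurable
  have Ab: "\<bar>A n x\<bar> \<le> B" if "x \<in> space M" for n x
    unfolding A_def by (rule birkhoff_bound[OF T(1) wB B that])
  define a where "a n = (\<integral>x. (A n x)\<^sup>2 \<partial>M)" for n
  have isq: "integrable M (\<lambda>x. (f x)\<^sup>2)" if "f \<in> borel_measurable M" "\<And>x. x \<in> space M \<Longrightarrow> \<bar>f x\<bar> \<le> C" for f :: "'a \<Rightarrow> real" and C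
  proof (rule integrable_bounded[where B = "C\<^sup>2"])
    show "norm ((f x)\<^sup>2) \<le> C\<^sup>2" if "x \<in> space M" for x
      using power_mono[of "\<bar>f x\<bar>" C 2] that \<open>\<And>x. x \<in> space M \<Longrightarrow> \<bar>f x\<bar> \<le> C\<close> by simp
  qed (use that(1) in measurable)
  \<comment> \<open>The index 0 is left out because the empty average is 0.\<close>
  define inf_a where "inf_a = (INF n\<in>{1..}. a n)"
  have bdd: "bdd_below (a ` {1..})"
    by (rule bdd_belowI[of _ 0]) (auto simp: a_def)
  have a_ge: "inf_a \<le> a n" if "n \<ge> 1" for n
    unfolding inf_a_def using that by (intro cINF_lower[OF bdd]) auto
  \<comment> \<open>Averages of averages do not change the limit, and averaging is a contraction.\<close>
  have contr: "a k \<le> (\<integral>x. ((A m x + A n x) / 2)\<^sup>2 \<partial>M) + 4 * B\<^sup>2 * real (max m n) / real k"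
    if mn: "m \<ge> 1" "n \<ge> 1" for m n k
  proof -
    let ?g = "\<lambda>x. (A m x + A n x) / 2"
    have gm: "?g \<in> borel_measurable M" by measurable
    have gb: "\<bar>?g x\<bar> \<le> B" if "x \<in> space M" for x
      using Ab[OF that, of m] Ab[OF that, of n] by (simp add: abs_le_iff)
    let ?h = "birkhoff T ?g k"
    have hm[measurable]: "?h \<in> borel_measurable M" by (rule birkhoff_measurable[OF T(1) gm])
    have hb: "\<bar>?h x\<bar> \<le> B" if "x \<in> space M" for x
      by (rule birkhoff_bound[OF T(1) gb B that])
    have close: "\<bar>?h x - A k x\<bar> \<le> 2 * B * real (max m n) / real k" if x: "x \<in> space M" for x
    proof -
      have "?h x = (birkhoff T (A m) k x + birkhoff T (A n) k x) / 2"
        by (simp add: birkhoff_def sum.distrib add_divide_distrib flip: sum_divide_distrib)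
      moreover have "2 * B * real m / real k \<le> 2 * B * real (max m n) / real k"
        "2 * B * real n / real k \<le> 2 * B * real (max m n) / real k"
        using B by (auto intro!: divide_right_mono mult_left_mono)
      ultimately show ?thesis
        using birkhoff_birkhoff_close[where w = w, OF T(1) wB x, where n = m and k = k]
          birkhoff_birkhoff_close[where w = w, OF T(1) wB x, where n = n and k = k] mn
        unfolding A_def by auto
    qed
    have "a k \<le> (\<integral>x. (?h x)\<^sup>2 + 4 * B\<^sup>2 * real (max m n) / real k \<partial>M)"
      unfolding a_def
    proof (rule integral_mono)
      show "integrable M (\<lambda>x. (A k x)\<^sup>2)" using Ab by (intro isq) auto
      show "integrable M (\<lambda>x. (?h x)\<^sup>2 + 4 * B\<^sup>2 * real (max m n) / real k)"
        using hb by (intro Bochner_Integration.integrable_add isq integrable_const) auto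
      fix x assume x: "x \<in> space M"
      have "(A k x)\<^sup>2 - (?h x)\<^sup>2 \<le> \<bar>A k x + ?h x\<bar> * \<bar>?h x - A k x\<bar>"
        by (simp add: power2_eq_square algebra_simps flip: abs_mult)
      also have "\<dots> \<le> (2 * B) * (2 * B * real (max m n) / real k)"
        using Ab[OF x, of k] hb[OF x] by (intro mult_mono close[OF x]) auto
      finally show "(A k x)\<^sup>2 \<le> (?h x)\<^sup>2 + 4 * B\<^sup>2 * real (max m n) / real k"
        by (simp add: power2_eq_square)
    qed
    also have "\<dots> = (\<integral>x. (?h x)\<^sup>2 \<partial>M) + 4 * B\<^sup>2 * real (max m n) / real k"
      using hb by (subst Bochner_Integration.integral_add) (auto intro!: isq simp: prob_space)
    also have "(\<integral>x. (?h x)\<^sup>2 \<partial>M) \<le> (\<integral>x. (?g x)\<^sup>2 \<partial>M)"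
      by (rule birkhoff_contraction(1)[OF T gm gb])
    finally show ?thesis by simp
  qed
  have lim0: "(\<lambda>k. C / real k) \<longlonglongrightarrow> 0" for C
    by (rule lim_const_over_n)
  have mid: "inf_a \<le> (\<integral>x. ((A m x + A n x) / 2)\<^sup>2 \<partial>M)" if mn: "m \<ge> 1" "n \<ge> 1" for m n
  proof (rule LIMSEQ_le_const)
    show "(\<lambda>k. (\<integral>x. ((A m x + A n x) / 2)\<^sup>2 \<partial>M) + 4 * B\<^sup>2 * real (max m n) / real k)
        \<longlonglongrightarrow> (\<integral>x. ((A m x + A n x) / 2)\<^sup>2 \<partial>M)"
      using tendsto_add[OF tendsto_const lim0] by simp
    show "\<exists>N. \<forall>k\<ge>N. inf_a \<le> (\<integral>x. ((A m x + A n x) / 2)\<^sup>2 \<partial>M) + 4 * B\<^sup>2 * real (max m n) / real k"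
      using contr[OF mn] a_ge by (meson order_trans)
  qed
  have cauchy: "(\<integral>x. \<bar>A m x - A n x\<bar> \<partial>M)\<^sup>2 \<le> 2 * (a m - inf_a) + 2 * (a n - inf_a)"
    if mn: "m \<ge> 1" "n \<ge> 1" for m n
  proof -
    have "(\<integral>x. \<bar>A m x - A n x\<bar> \<partial>M)\<^sup>2 \<le> (\<integral>x. (A m x - A n x)\<^sup>2 \<partial>M)"
    proof (rule L1_le_L2)
      show "\<bar>A m x - A n x\<bar> \<le> 2 * B" if "x \<in> space M" for x
        using Ab[OF that, of m] Ab[OF that, of n] by linarith
    qed measurable
    also have "\<dots> = (\<integral>x. 2 * (A m x)\<^sup>2 + 2 * (A n x)\<^sup>2 - 4 * ((A m x + A n x) / 2)\<^sup>2 \<partial>M)"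
      by (rule Bochner_Integration.integral_cong) (auto simp: power2_eq_square field_simps)
    also have "\<dots> = 2 * a m + 2 * a n - 4 * (\<integral>x. ((A m x + A n x) / 2)\<^sup>2 \<partial>M)"
    proof -
      have "integrable M (\<lambda>x. (A m x)\<^sup>2)" "integrable M (\<lambda>x. (A n x)\<^sup>2)"
        using Ab by (auto intro!: isq)
      moreover have "\<bar>(A m x + A n x) / 2\<bar> \<le> B" if "x \<in> space M" for x
        using Ab[OF that, of m] Ab[OF that, of n] by (simp add: abs_le_iff)
      then have "integrable M (\<lambda>x. ((A m x + A n x) / 2)\<^sup>2)"
        by (rule isq[rotated]) auto
      ultimately show ?thesis unfolding a_def by simp
    qed
    finally have *: "(\<integral>x. \<bar>A m x - A n x\<bar> \<partial>M)\<^sup>2 \<le> 2 * a m + 2 * a n - 4 * I"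
      if "I = (\<integral>x. ((A m x + A n x) / 2)\<^sup>2 \<partial>M)" for I using that by simp
    show ?thesis using *[OF refl] mid[OF mn] by argo
  qed
  \<comment> \<open>With e = (1/4)^i, consecutive terms exceed the infimum by less than e/4 and
    e/16, so \<open>cauchy\<close> bounds the squared distance by 2(e/4 + e/16) < e, and the
    distances are at most the summable (1/2)^i. The condition n \<ge> i + 1 sends the subsequence to
    infinity.\<close>
  have "\<exists>n\<ge>i + 1. a n < inf_a + (1/4) ^ i / 4" for i
  proof -
    define e :: real where "e = (1/4) ^ i / 4"
    have e: "e > 0" by (simp add: e_def)
    have "inf_a < inf_a + e/2" using e by simp
    then obtain n where n: "n \<ge> 1" "a n < inf_a + e/2"
      unfolding inf_a_def by (subst (asm) cINF_less_iff[OF _ bdd]) auto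
    have "\<forall>\<^sub>F k in sequentially. 4 * B\<^sup>2 * real n / real k < e/2"
      using e by (intro order_tendstoD[OF lim0]) auto
    then have "\<forall>\<^sub>F k in sequentially. k \<ge> i + 1 \<and> a k < inf_a + e"
      using eventually_ge_at_top[of "i + 1"]
    proof eventually_elim
      case (elim k)
      have "a k \<le> a n + 4 * B\<^sup>2 * real n / real k"
        using contr[OF n(1) n(1), of k] by (simp add: a_def)
      then show ?case using elim n by linarith
    qed
    then show ?thesis
      unfolding e_def[symmetric] by (auto simp: eventually_sequentially)
  qed
  then obtain N where N: "\<And>i. N i \<ge> i + 1" "\<And>i. a (N i) < inf_a + (1/4) ^ i / 4"
    by metis
  have N1: "N i \<ge> 1" for i using N(1)[of i] by linarith
  have Ni: "i \<le> N i" for i using N(1)[of i] by linarith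
  have Nlim: "filterlim N at_top sequentially"
    by (rule filterlim_at_top_mono[OF filterlim_ident]) (simp add: Ni)
  define D where "D i x = \<bar>A (N (Suc i)) x - A (N i) x\<bar>" for i x
  have Dm[measurable]: "D i \<in> borel_measurable M" for i unfolding D_def[abs_def] by measurable
  have D_int: "(\<integral>x. D i x \<partial>M) \<le> (1/2) ^ i" for i
  proof -
    define e :: real where "e = (1/4) ^ i"
    have pos: "0 < e" by (simp add: e_def)
    have "(\<integral>x. D i x \<partial>M)\<^sup>2 \<le> 2 * (a (N (Suc i)) - inf_a) + 2 * (a (N i) - inf_a)"
      unfolding D_def by (rule cauchy[OF N1 N1])
    moreover have "a (N (Suc i)) < inf_a + e / 16"
      using N(2)[of "Suc i"] by (simp add: e_def)
    moreover have "a (N i) < inf_a + e / 4"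
      using N(2)[of i] by (simp add: e_def)
    ultimately have "(\<integral>x. D i x \<partial>M)\<^sup>2 \<le> e"
      using pos by argo
    also have "e = ((1/2::real) ^ i)\<^sup>2"
      by (simp add: e_def power2_eq_square flip: power_mult_distrib)
    finally have "(\<integral>x. D i x \<partial>M)\<^sup>2 \<le> ((1/2) ^ i)\<^sup>2" .
    then show ?thesis by (rule power2_le_imp_le) simp
  qed
  have D_integrable: "integrable M (D i)" for i
  proof (rule integrable_bounded[where B = "2 * B"])
    show "norm (D i x) \<le> 2 * B" if "x \<in> space M" for x
      using Ab[OF that, of "N i"] Ab[OF that, of "N (Suc i)"] unfolding D_def by simp
  qed simp
  have "(\<integral>\<^sup>+x. (\<Sum>i. ennreal (D i x)) \<partial>M) = (\<Sum>i. \<integral>\<^sup>+x. ennreal (D i x) \<partial>M)"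
    by (rule nn_integral_suminf) measurable
  also have "\<dots> \<le> (\<Sum>i. ennreal ((1/2) ^ i))"
  proof (intro suminf_le)
    have "AE x in M. 0 \<le> D i x" for i by (simp add: D_def)
    then show "(\<integral>\<^sup>+x. ennreal (D i x) \<partial>M) \<le> ennreal ((1/2) ^ i)" for i
      by (subst nn_integral_eq_integral[OF D_integrable]) (auto intro: ennreal_leI D_int)
  qed auto
  also have "\<dots> < \<infinity>"
    by (subst suminf_ennreal2) (auto intro: summable_geometric)
  finally have "AE x in M. (\<Sum>i. ennreal (D i x)) \<noteq> \<infinity>"
    by (intro nn_integral_PInf_AE) auto
  then have conv: "AE x in M. convergent (\<lambda>i. A (N i) x)"
  proof eventually_elim
    case (elim x)
    then have "summable (\<lambda>i. D i x)"
      by (intro summable_suminf_not_top) (auto simp: D_def)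
    then have "summable (\<lambda>i. A (N (Suc i)) x - A (N i) x)"
      unfolding D_def by (rule summable_rabs_cancel)
    then have "convergent (\<lambda>n. \<Sum>i<n. A (N (Suc i)) x - A (N i) x)"
      by (simp add: summable_iff_convergent)
    then have "convergent (\<lambda>n. A (N n) x - A (N 0) x)"
      by (simp only: sum_lessThan_telescope[of "\<lambda>n. A (N n) x"])
    then show ?case using convergent_add_const_iff[of "- A (N 0) x" "\<lambda>n. A (N n) x"] by simp
  qed
  \<comment> \<open>\<open>lim\<close> is total, so \<open>G\<close> is defined at every point and
    can be invariant everywhere, as \<open>ergodic_invariant_const\<close> demands, and not only
    almost everywhere.\<close>
  define G where "G x = lim (\<lambda>i. A (N i) x)" for x
  have Gm[measurable]: "G \<in> borel_measurable M"
    unfolding G_def[abs_def] by (rule borel_measurable_lim_metric) simp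
  have tendG: "AE x in M. (\<lambda>i. A (N i) x) \<longlonglongrightarrow> G x"
    using conv by eventually_elim (simp add: G_def convergent_LIMSEQ_iff)
  have "AE x in M. norm (G x) \<le> B"
    using tendG AE_space
  proof eventually_elim
    case (elim x)
    then show ?case using Ab[OF elim(2)]
      by (intro LIMSEQ_le_const2[OF tendsto_norm[OF elim(1)]]) auto
  qed
  then have Gint: "integrable M G"
    by (intro integrable_const_bound) auto
  have Ginv: "G (T x) = G x" if x: "x \<in> space M" for x
  proof -
    have "(\<lambda>i. A (N i) (T x) - A (N i) x) \<longlonglongrightarrow> 0"
    proof (rule Lim_null_comparison)
      have "norm (A n (T x) - A n x) \<le> 2 * B / real n" for n
        using birkhoff_shift_pow[where w = w, OF T(1) wB x, where n = n and k = 1] by (simp add: A_def)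
      then show "\<forall>\<^sub>F i in sequentially. norm (A (N i) (T x) - A (N i) x) \<le> 2 * B / real (N i)"
        by simp
      show "(\<lambda>i. 2 * B / real (N i)) \<longlonglongrightarrow> 0"
        by (rule filterlim_compose[OF lim0 Nlim])
    qed
    note d = this
    \<comment> \<open>Both sequences have the same limits, if any, so the choice hidden in
      \<open>lim\<close> picks the same value even where there is no convergence.\<close>
    have "(\<lambda>i. A (N i) (T x)) \<longlonglongrightarrow> L \<longleftrightarrow> (\<lambda>i. A (N i) x) \<longlonglongrightarrow> L" for L
      using tendsto_diff[OF _ d, of "\<lambda>i. A (N i) (T x)" L]
        tendsto_add[OF d, of "\<lambda>i. A (N i) x" L] by auto
    then show ?thesis by (simp add: G_def lim_def)
  qed
  define c where "c = (\<integral>x. w x \<partial>M)"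
  have Gc: "(\<integral>x. G x \<partial>M) = c"
  proof (rule LIMSEQ_unique)
    show "(\<lambda>i. \<integral>x. A (N i) x \<partial>M) \<longlonglongrightarrow> (\<integral>x. G x \<partial>M)"
      using Ab tendG by (intro integral_dominated_convergence[where w = "\<lambda>_. B"]) auto
    show "(\<lambda>i. \<integral>x. A (N i) x \<partial>M) \<longlonglongrightarrow> c"
      using integral_birkhoff[OF T w wB] N1 by (simp add: A_def c_def Suc_le_eq)
  qed
  have "AE x in M. G x = c"
    unfolding Gc[symmetric] by (rule ergodic_invariant_const[OF erg Gm Gint]) (rule Ginv)
  with tendG have "AE x in M. (\<lambda>i. A (N i) x) \<longlonglongrightarrow> c"
    by eventually_elim simp
  then have "(\<lambda>i. \<integral>x. \<bar>A (N i) x - c\<bar> \<partial>M) \<longlonglongrightarrow> (\<integral>x. 0 \<partial>M)"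
  proof (intro integral_dominated_convergence[where w = "\<lambda>_. B + \<bar>c\<bar>"])
    show "AE x in M. (\<lambda>i. \<bar>A (N i) x - c\<bar>) \<longlonglongrightarrow> 0"
      using \<open>AE x in M. (\<lambda>i. A (N i) x) \<longlonglongrightarrow> c\<close>
      by eventually_elim (simp add: LIM_zero tendsto_rabs_zero)
    show "AE x in M. norm \<bar>A (N i) x - c\<bar> \<le> B + \<bar>c\<bar>" for i
      using AE_space
    proof eventually_elim
      case (elim x)
      then show ?case using Ab[OF elim, of "N i"] abs_triangle_ineq4[of "A (N i) x" c] by simp
    qed
  qed auto
  then have sub: "(\<lambda>i. \<integral>x. \<bar>A (N i) x - c\<bar> \<partial>M) \<longlonglongrightarrow> 0" by simp
  have final: "(\<integral>x. \<bar>A k x - c\<bar> \<partial>M) \<le> (\<integral>x. \<bar>A n x - c\<bar> \<partial>M) + 2 * B * real n / real k"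
    if "n \<ge> 1" "k \<ge> 1" for n k
  proof -
    have gb: "\<bar>A n x - c\<bar> \<le> B + \<bar>c\<bar>" if "x \<in> space M" for n x
      using Ab[OF that, of n] by linarith
    have m: "(\<lambda>x. A n x - c) \<in> borel_measurable M" by measurable
    have ib: "integrable M (\<lambda>x. \<bar>birkhoff T (\<lambda>x. A n x - c) k x\<bar>)"
      using birkhoff_bound[where w = "\<lambda>x. A n x - c" and n = k, OF T(1) gb] B birkhoff_measurable[OF T(1) m, of k]
      by (intro integrable_bounded[where B = "B + \<bar>c\<bar>"]) auto
    have "(\<integral>x. \<bar>A k x - c\<bar> \<partial>M) \<le> (\<integral>x. \<bar>birkhoff T (\<lambda>x. A n x - c) k x\<bar> + 2 * B * real n / real k \<partial>M)"
    proof (rule integral_mono)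
      show "integrable M (\<lambda>x. \<bar>A k x - c\<bar>)"
        using gb by (intro integrable_bounded[where B = "B + \<bar>c\<bar>"]) auto
      fix x assume x: "x \<in> space M"
      have "birkhoff T (\<lambda>x. A n x - c) k x = birkhoff T (A n) k x - c"
        using that by (simp add: birkhoff_def sum_subtractf diff_divide_distrib)
      then show "\<bar>A k x - c\<bar> \<le> \<bar>birkhoff T (\<lambda>x. A n x - c) k x\<bar> + 2 * B * real n / real k"
        using birkhoff_birkhoff_close[where w = w, OF T(1) wB x, where n = n and k = k] that unfolding A_def by simp
    qed (use ib in auto)
    also have "\<dots> = (\<integral>x. \<bar>birkhoff T (\<lambda>x. A n x - c) k x\<bar> \<partial>M) + 2 * B * real n / real k"
      using ib by (simp add: prob_space)
    also have "(\<integral>x. \<bar>birkhoff T (\<lambda>x. A n x - c) k x\<bar> \<partial>M) \<le> (\<integral>x. \<bar>A n x - c\<bar> \<partial>M)"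
      by (rule birkhoff_contraction(2)[OF T m gb])
    finally show ?thesis by simp
  qed
  show ?thesis
    unfolding A_def[symmetric] c_def[symmetric]
  proof (rule LIMSEQ_I)
    fix e :: real assume e: "e > 0"
    then have "\<forall>\<^sub>F i in sequentially. (\<integral>x. \<bar>A (N i) x - c\<bar> \<partial>M) < e/2"
      by (intro order_tendstoD[OF sub]) auto
    then obtain i where i: "(\<integral>x. \<bar>A (N i) x - c\<bar> \<partial>M) < e/2"
      by (auto simp: eventually_sequentially)
    have "\<forall>\<^sub>F k in sequentially. 2 * B * real (N i) / real k < e/2"
      using e by (intro order_tendstoD[OF lim0]) auto
    then have "\<forall>\<^sub>F k in sequentially. norm ((\<integral>x. \<bar>A k x - c\<bar> \<partial>M) - 0) < e"
      using eventually_ge_at_top[of 1]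
    proof eventually_elim
      case (elim k)
      then show ?case using final[OF N1[of i] elim(2)] i by simp
    qed
    then show "\<exists>no. \<forall>n\<ge>no. norm ((\<integral>x. \<bar>A n x - c\<bar> \<partial>M) - 0) < e"
      by (simp add: eventually_sequentially)
  qed
qed

end

section \<open>Base b expansions on [0,1)\<close>

text \<open>The measure lives on the fundamental domain [0,1) rather than on the circle, so that the
  b-adic intervals become level sets of a floor function.\<close>

locale base_b = prob_space N for N :: "real measure" +
  fixes b :: nat
  assumes sets_N: "sets N = sets (restrict_space borel {0..<1})"
    and b: "b \<ge> 2"
    and erg: "ergodic N (\<lambda>x. frac (real b * x))"
begin

definition T :: "real \<Rightarrow> real" where "T x = frac (real b * x)"

text \<open>The integer whose base b digits are the first \<open>m\<close> digits of x; its fibres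
  in [0,1) are the b-adic intervals of length b^(-m).\<close>

definition cell :: "nat \<Rightarrow> real \<Rightarrow> int" where "cell m x = \<lfloor>real b ^ m * x\<rfloor>"

lemma space_N: "space N = {0..<1}"
  using sets_eq_imp_space_eq[OF sets_N] by (simp add: space_restrict_space)

lemma ergT: "ergodic N T"
  using erg by (simp add: T_def[abs_def])

lemma T_measurable: "T \<in> measurable N N" and T_distr: "distr N N T = N"
  using ergT by (auto simp: ergodic_def)

lemmas Tn_measurable = measurable_funpow[OF T_measurable]
lemmas Tn_distr = distr_funpow[OF T_measurable T_distr]

lemma borel_measurable_N: "f \<in> borel_measurable borel \<Longrightarrow> f \<in> borel_measurable N"
  by (subst measurable_cong_sets[OF sets_N refl]) (rule measurable_restrict_space1)

lemma frac_mult_frac: "frac (real n * frac y) = frac (real n * y)"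
proof -
  have "real n * frac y = real n * y - of_int (int n * \<lfloor>y\<rfloor>)"
    by (simp add: frac_def right_diff_distrib)
  moreover have "\<lfloor>real n * y - of_int (int n * \<lfloor>y\<rfloor>)\<rfloor> = \<lfloor>real n * y\<rfloor> - int n * \<lfloor>y\<rfloor>"
    by (rule floor_diff_of_int)
  ultimately show ?thesis
    by (simp only: frac_def)
qed

lemma Tn_eq: "x \<in> {0..<1} \<Longrightarrow> (T ^^ n) x = frac (real b ^ n * x)"
proof (induction n)
  case 0
  then show ?case by (simp add: frac_eq)
next
  case (Suc n)
  then show ?case using frac_mult_frac[of b "real b ^ n * x"] by (simp add: T_def mult.assoc)
qed

lemma bpos: "real b > 0" "real b ^ m > 0" "(int b) ^ m > 0"
  using b by auto

lemma Tn_eq_cell: "x \<in> {0..<1} \<Longrightarrow> (T ^^ n) x = real b ^ n * x - of_int (cell n x)"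
  by (simp add: Tn_eq frac_def cell_def)

text \<open>Integer division by b^j deletes the last j of m + j digits.\<close>

lemma cell_add_div: "cell m x = cell (m + j) x div int b ^ j"
proof -
  have "\<lfloor>(real b ^ (m + j) * x) / of_int (int b ^ j)\<rfloor> = \<lfloor>real b ^ (m + j) * x\<rfloor> div (int b ^ j)"
    by (rule floor_divide_real_eq_div) auto
  then show ?thesis using bpos by (simp add: cell_def power_add mult.assoc)
qed

text \<open>The shift forgets the first j of m + j digits, which is reduction modulo b^m.\<close>

lemma cell_shift:
  assumes "x \<in> {0..<1}"
  shows "cell m ((T ^^ j) x) = cell (m + j) x mod int b ^ m"
proof -
  have "real b ^ m * (T ^^ j) x = real b ^ (m + j) * x - of_int (int b ^ m * cell j x)"
    unfolding Tn_eq_cell[OF assms] by (simp add: power_add algebra_simps)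
  then have "cell m ((T ^^ j) x) = cell (m + j) x - int b ^ m * cell j x"
    by (simp only: cell_def[of m] floor_diff_of_int) (simp add: cell_def)
  also have "cell j x = cell (m + j) x div int b ^ m"
    using cell_add_div[of j x m] by (simp add: add.commute)
  finally show ?thesis by (simp add: minus_mult_div_eq_mod)
qed

lemma cell_range: "x \<in> {0..<1} \<Longrightarrow> cell m x \<in> {0..<int b ^ m}"
  using bpos(2)[of m] by (auto simp: cell_def floor_less_iff)

lemma cell_measurable: "cell m \<in> measurable N (count_space UNIV)"
  unfolding cell_def[abs_def]
  by (rule measurable_compose[OF borel_measurable_N measurable_real_floor]) measurable

lemma cell_partition: "partition_map (cell m)"
proof
  show "finite (cell m ` space N)"
    by (rule finite_subset[of _ "{0..<int b ^ m}"]) (use cell_range in \<open>auto simp: space_N\<close>)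
qed (rule cell_measurable)

lemma cell_comp_partition: "partition_map (\<lambda>x. cell m ((T ^^ j) x))"
proof
  show "(\<lambda>x. cell m ((T ^^ j) x)) \<in> measurable N (count_space UNIV)"
    by (rule measurable_compose[OF Tn_measurable cell_measurable])
  show "finite ((\<lambda>x. cell m ((T ^^ j) x)) ` space N)"
    by (rule finite_subset[of _ "{0..<int b ^ m}"])
       (use cell_range funpow_in_space[OF T_measurable] in \<open>fastforce simp: space_N\<close>)+
qed

subsection \<open>Asymptotically invariant sequences\<close>

text \<open>Seen from time m, the first m digits are the past of the point
  \<open>(T ^^ m) x\<close>. So \<open>V u m\<close> predicts the present value of \<open>u\<close>
  from m past digits: it is the martingale of conditional expectations in the natural extension,
  realised on the original space with a moving origin of time.\<close>

definition V :: "(real \<Rightarrow> complex) \<Rightarrow> nat \<Rightarrow> real \<Rightarrow> complex" where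
  "V u m = cell_exp N (cell m) (\<lambda>x. u ((T ^^ m) x))"

definition E2 :: "(real \<Rightarrow> complex) \<Rightarrow> nat \<Rightarrow> real" where
  "E2 u m = (\<integral>x. (cmod (V u m x))\<^sup>2 \<partial>N)"

definition test_fun :: "(real \<Rightarrow> complex) \<Rightarrow> bool" where
  "test_fun u \<longleftrightarrow> u \<in> borel_measurable N \<and> (\<forall>x\<in>space N. cmod (u x) \<le> 1)"

lemma test_fun_shift:
  assumes "test_fun u"
  shows "(\<lambda>x. u ((T ^^ m) x)) \<in> borel_measurable N" "x \<in> space N \<Longrightarrow> cmod (u ((T ^^ m) x)) \<le> 1"
  using assms funpow_in_space[OF T_measurable, of x m] measurable_compose[OF Tn_measurable, of u borel m]
  by (auto simp: test_fun_def)

lemma V_measurable [measurable]: "V u m \<in> borel_measurable N"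
  unfolding V_def by (rule cell_exp_measurable[OF cell_measurable])

lemma V_bound: "test_fun u \<Longrightarrow> cmod (V u m x) \<le> 1"
  unfolding V_def by (rule cell_exp_bound[OF cell_partition test_fun_shift]) auto

lemma V_const_on_cell: "cell m x = cell m y \<Longrightarrow> V u m x = V u m y"
  unfolding V_def by (rule cell_exp_const_on_cell)

lemma V_sq_integrable: "test_fun u \<Longrightarrow> integrable N (\<lambda>x. (cmod (V u m x))\<^sup>2)"
  by (rule integrable_bounded[where B = 1]) (auto intro: V_bound power_le_one)

text \<open>Invariance of \<open>N\<close> under \<open>T ^^ j\<close> transports the cell averages.
  Level m after j shifts conditions on the digits j + 1 to j + m only, a coarser partition than the
  one behind level m + j.\<close>

lemma V_comp:
  assumes "test_fun u" "x \<in> space N"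
  shows "V u m ((T ^^ j) x) = cell_exp N (\<lambda>x. cell m ((T ^^ j) x)) (\<lambda>x. u ((T ^^ (m + j)) x)) x"
proof -
  have m: "cell m -` A \<inter> space N \<in> sets N" for A
    by (rule measurable_sets[OF cell_measurable]) simp
  let ?c = "cell m ((T ^^ j) x)"
  have "(\<integral>y. indicator (cell m -` {?c}) y *\<^sub>R u ((T ^^ m) y) \<partial>N)
      = (\<integral>y. indicator (cell m -` {?c}) ((T ^^ j) y) *\<^sub>R u ((T ^^ m) ((T ^^ j) y)) \<partial>N)"
  proof (rule integral_funpow[OF T_measurable T_distr, symmetric])
    have "(\<lambda>y. indicator (cell m -` {?c} \<inter> space N) y *\<^sub>R u ((T ^^ m) y)) \<in> borel_measurable N"
      using m test_fun_shift(1)[OF assms(1)] by measurable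
    then show "(\<lambda>y. indicator (cell m -` {?c}) y *\<^sub>R u ((T ^^ m) y)) \<in> borel_measurable N"
      by (rule measurable_cong[THEN iffD1, rotated]) (auto simp: indicator_def)
  qed
  also have "\<dots> = (\<integral>y. indicator ((\<lambda>y. cell m ((T ^^ j) y)) -` {?c}) y *\<^sub>R u ((T ^^ (m + j)) y) \<partial>N)"
    by (simp add: funpow_add indicator_def)
  finally have 1: "(\<integral>y. indicator (cell m -` {?c}) y *\<^sub>R u ((T ^^ m) y) \<partial>N)
    = (\<integral>y. indicator ((\<lambda>y. cell m ((T ^^ j) y)) -` {?c}) y *\<^sub>R u ((T ^^ (m + j)) y) \<partial>N)" .
  have "measure N (cell m -` {?c} \<inter> space N) = measure (distr N N (T ^^ j)) (cell m -` {?c} \<inter> space N)"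
    by (simp add: Tn_distr)
  also have "\<dots> = measure N ((\<lambda>y. cell m ((T ^^ j) y)) -` {?c} \<inter> space N)"
    by (subst measure_distr[OF Tn_measurable m])
       (use funpow_in_space[OF T_measurable] in \<open>auto intro!: arg_cong[where f = "measure N"]\<close>)
  finally show ?thesis using 1 by (simp add: V_def cell_exp_def)
qed

text \<open>Orthogonality of martingale increments. It yields the monotonicity of \<open>E2\<close>
  and, as \<open>E2\<close> is bounded, a smallness that is uniform in j.\<close>

lemma V_increment:
  assumes "test_fun u"
  shows "(\<integral>x. (cmod (V u (m + j) x - V u m ((T ^^ j) x)))\<^sup>2 \<partial>N) = E2 u (m + j) - E2 u m"
proof -
  let ?A = "cell_exp N (cell (m + j)) (\<lambda>x. u ((T ^^ (m + j)) x))"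
  let ?B = "cell_exp N (\<lambda>x. cell m ((T ^^ j) x)) (\<lambda>x. u ((T ^^ (m + j)) x))"
  have "(\<integral>x. (cmod (V u (m + j) x - V u m ((T ^^ j) x)))\<^sup>2 \<partial>N) = (\<integral>x. (cmod (?A x - ?B x))\<^sup>2 \<partial>N)"
    by (rule Bochner_Integration.integral_cong[OF refl]) (simp only: V_comp[OF assms], simp add: V_def)
  also have "\<dots> = (\<integral>x. (cmod (?A x))\<^sup>2 \<partial>N) - (\<integral>x. (cmod (?B x))\<^sup>2 \<partial>N)"
    by (rule cell_exp_orthogonal[OF cell_partition cell_comp_partition, where \<theta> = "\<lambda>c. c mod int b ^ m" and B = 1])
       (use cell_shift test_fun_shift[OF assms] in \<open>auto simp: space_N\<close>)
  also have "(\<integral>x. (cmod (?A x))\<^sup>2 \<partial>N) = E2 u (m + j)"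
    by (simp add: E2_def V_def)
  also have "(\<integral>x. (cmod (?B x))\<^sup>2 \<partial>N) = (\<integral>x. (cmod (V u m ((T ^^ j) x)))\<^sup>2 \<partial>N)"
    by (rule Bochner_Integration.integral_cong[OF refl]) (simp only: V_comp[OF assms])
  also have "\<dots> = E2 u m"
    unfolding E2_def by (rule integral_funpow[OF T_measurable T_distr]) measurable
  finally show ?thesis .
qed

lemma E2_incseq:
  assumes "test_fun u"
  shows "incseq (E2 u)"
proof (rule incseq_SucI)
  fix m
  have "0 \<le> (\<integral>x. (cmod (V u (m + 1) x - V u m ((T ^^ 1) x)))\<^sup>2 \<partial>N)"
    by simp
  then show "E2 u m \<le> E2 u (Suc m)"
    unfolding V_increment[OF assms] by simp
qed

lemma E2_le_1: "test_fun u \<Longrightarrow> E2 u m \<le> 1" and E2_nonneg: "E2 u m \<ge> 0"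
proof -
  assume u: "test_fun u"
  have "norm (\<integral>x. (cmod (V u m x))\<^sup>2 \<partial>N) \<le> 1"
    by (rule integral_norm_bounded) (auto intro: V_bound[OF u] power_le_one)
  then show "E2 u m \<le> 1" by (simp add: E2_def)
qed (simp add: E2_def)

definition E2lim :: "(real \<Rightarrow> complex) \<Rightarrow> real" where
  "E2lim u = (SUP m. E2 u m)"

lemma E2_tendsto: "test_fun u \<Longrightarrow> E2 u \<longlonglongrightarrow> E2lim u"
  unfolding E2lim_def
  by (rule LIMSEQ_incseq_SUP) (auto intro!: bdd_aboveI[of _ 1] E2_le_1 E2_incseq)

lemma E2_le_lim: "test_fun u \<Longrightarrow> E2 u m \<le> E2lim u"
  using incseq_le[OF E2_incseq E2_tendsto] .

text \<open>A substitute for convergence in the natural extension: a late term, shifted along the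
  orbit, is close in L1 to every later term. The bound 1 is built in so that the class is closed
  under products.\<close>

definition asymp_invariant :: "(nat \<Rightarrow> real \<Rightarrow> 'c::{banach, second_countable_topology}) \<Rightarrow> bool" where
  "asymp_invariant w \<longleftrightarrow> (\<forall>m. w m \<in> borel_measurable N) \<and> (\<forall>m. \<forall>x\<in>space N. norm (w m x) \<le> 1) \<and>
     (\<forall>e>0. \<exists>m0. \<forall>m\<ge>m0. \<forall>j. (\<integral>x. norm (w (m + j) x - w m ((T ^^ j) x)) \<partial>N) \<le> e)"

lemma asymp_invariant_shift:
  assumes "asymp_invariant w"
  shows "asymp_invariant (\<lambda>m. w (m + d))"
  unfolding asymp_invariant_def
proof (intro conjI allI impI)
  fix e :: real assume "e > 0"
  then obtain m0 where m0: "\<And>m j. m \<ge> m0 \<Longrightarrow> (\<integral>x. norm (w (m + j) x - w m ((T ^^ j) x)) \<partial>N) \<le> e"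
    using assms unfolding asymp_invariant_def by meson
  show "\<exists>m0. \<forall>m\<ge>m0. \<forall>j. (\<integral>x. norm (w (m + j + d) x - w (m + d) ((T ^^ j) x)) \<partial>N) \<le> e"
    using m0[of "m + d" j for m j] by (intro exI[of _ m0]) (auto simp: add_ac)
qed (use assms in \<open>auto simp: asymp_invariant_def\<close>)

lemma asymp_invariant_V:
  assumes u: "test_fun u"
  shows "asymp_invariant (V u)"
  unfolding asymp_invariant_def
proof (intro conjI allI impI)
  fix e :: real assume e: "e > 0"
  then have "\<forall>\<^sub>F m in sequentially. E2lim u - e\<^sup>2 < E2 u m"
    by (intro order_tendstoD[OF E2_tendsto[OF u]]) auto
  then obtain m0 where m0: "\<And>m. m \<ge> m0 \<Longrightarrow> E2lim u - e\<^sup>2 < E2 u m"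
    by (auto simp: eventually_sequentially)
  show "\<exists>m0. \<forall>m\<ge>m0. \<forall>j. (\<integral>x. norm (V u (m + j) x - V u m ((T ^^ j) x)) \<partial>N) \<le> e"
  proof (intro exI[of _ m0] allI impI)
    fix m j assume m: "m0 \<le> m"
    let ?d = "\<lambda>x. V u (m + j) x - V u m ((T ^^ j) x)"
    have [measurable]: "(\<lambda>x. V u m ((T ^^ j) x)) \<in> borel_measurable N"
      by (rule measurable_compose[OF Tn_measurable V_measurable])
    have bd: "cmod (?d x) \<le> 2" for x
      using norm_triangle_ineq4[of "V u (m + j) x" "V u m ((T ^^ j) x)"] V_bound[OF u, of "m + j" x] V_bound[OF u, of m "(T ^^ j) x"]
      by linarith
    have "(\<integral>x. norm (?d x) \<partial>N)\<^sup>2 \<le> (\<integral>x. (norm (?d x))\<^sup>2 \<partial>N)"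
      using L1_le_L2[of "\<lambda>x. norm (?d x)" 2] bd by simp
    also have "\<dots> \<le> e\<^sup>2"
      unfolding V_increment[OF u] using m0[OF m] E2_le_lim[OF u, of "m + j"] by linarith
    finally show "(\<integral>x. norm (?d x) \<partial>N) \<le> e"
      by (rule power2_le_imp_le) (use e in simp)
  qed
qed (use V_bound[OF u] in auto)

lemma asymp_invariant_mult:
  fixes w v :: "nat \<Rightarrow> real \<Rightarrow> 'c::{real_normed_algebra, banach, second_countable_topology}"
  assumes w: "asymp_invariant w" and v: "asymp_invariant v"
  shows "asymp_invariant (\<lambda>m x. w m x * v m x)"
  unfolding asymp_invariant_def
proof (intro conjI allI impI)
  have [measurable]: "w m \<in> borel_measurable N" "v m \<in> borel_measurable N" for m
    using w v by (auto simp: asymp_invariant_def)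
  have bw: "norm (w m x) \<le> 1" "norm (v m x) \<le> 1" if "x \<in> space N" for m x
    using w v that by (auto simp: asymp_invariant_def)
  show "(\<lambda>x. w m x * v m x) \<in> borel_measurable N" for m by measurable
  show "\<forall>x\<in>space N. norm (w m x * v m x) \<le> 1" for m
    using bw by (auto intro!: order_trans[OF norm_mult_ineq] mult_le_one)
  fix e :: real assume e: "e > 0"
  then have "e/2 > 0" by simp
  then obtain m1 m2 where m1: "\<And>m j. m \<ge> m1 \<Longrightarrow> (\<integral>x. norm (w (m + j) x - w m ((T ^^ j) x)) \<partial>N) \<le> e/2"
    and m2: "\<And>m j. m \<ge> m2 \<Longrightarrow> (\<integral>x. norm (v (m + j) x - v m ((T ^^ j) x)) \<partial>N) \<le> e/2"
    using w v unfolding asymp_invariant_def by meson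
  show "\<exists>m0. \<forall>m\<ge>m0. \<forall>j. (\<integral>x. norm (w (m + j) x * v (m + j) x - w m ((T ^^ j) x) * v m ((T ^^ j) x)) \<partial>N) \<le> e"
  proof (intro exI[of _ "max m1 m2"] allI impI)
    fix m j assume m: "max m1 m2 \<le> m"
    let ?w' = "\<lambda>x. w m ((T ^^ j) x)" and ?v' = "\<lambda>x. v m ((T ^^ j) x)"
    have [measurable]: "?w' \<in> borel_measurable N" "?v' \<in> borel_measurable N"
      by (rule measurable_compose[OF Tn_measurable]; simp)+
    have b': "norm (?w' x) \<le> 1" "norm (?v' x) \<le> 1" if "x \<in> space N" for x
      using bw[OF funpow_in_space[OF T_measurable that]] by auto
    have b2: "norm (w (m + j) x - ?w' x) \<le> 2" "norm (v (m + j) x - ?v' x) \<le> 2" if "x \<in> space N" for x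
      using norm_triangle_ineq4[of "w (m + j) x" "?w' x"] norm_triangle_ineq4[of "v (m + j) x" "?v' x"]
        bw[OF that, of "m + j"] b'[OF that] by linarith+
    have int: "integrable N (\<lambda>x. norm (w (m + j) x - ?w' x))" "integrable N (\<lambda>x. norm (v (m + j) x - ?v' x))"
      by (rule integrable_bounded[where B = 2]; use b2 in simp)+
    have "norm (w (m + j) x * v (m + j) x - ?w' x * ?v' x)
        \<le> norm (w (m + j) x - ?w' x) + norm (v (m + j) x - ?v' x)" if x: "x \<in> space N" for x
    proof -
      have "w (m + j) x * v (m + j) x - ?w' x * ?v' x
          = (w (m + j) x - ?w' x) * v (m + j) x + ?w' x * (v (m + j) x - ?v' x)"
        by (simp add: algebra_simps)
      also have "norm \<dots> \<le> norm (w (m + j) x - ?w' x) * norm (v (m + j) x) + norm (?w' x) * norm (v (m + j) x - ?v' x)"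
        by (intro order_trans[OF norm_triangle_ineq] add_mono norm_mult_ineq)
      also have "\<dots> \<le> norm (w (m + j) x - ?w' x) * 1 + 1 * norm (v (m + j) x - ?v' x)"
        using bw[OF x, of "m + j"] b'[OF x] by (intro add_mono mult_left_mono mult_right_mono) auto
      finally show ?thesis by simp
    qed
    then have "(\<integral>x. norm (w (m + j) x * v (m + j) x - ?w' x * ?v' x) \<partial>N)
        \<le> (\<integral>x. norm (w (m + j) x - ?w' x) + norm (v (m + j) x - ?v' x) \<partial>N)"
      using int by (intro integral_mono') auto
    also have "\<dots> \<le> e/2 + e/2"
      using int m1[of m j] m2[of m j] m by (subst Bochner_Integration.integral_add) auto
    finally show "(\<integral>x. norm (w (m + j) x * v (m + j) x - ?w' x * ?v' x) \<partial>N) \<le> e" by simp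
  qed
qed

text \<open>Serves for complex conjugation, real part and modulus, the operations that turn
  \<open>V\<close> into energies.\<close>

lemma asymp_invariant_lipschitz:
  fixes w :: "nat \<Rightarrow> real \<Rightarrow> 'c::{banach, second_countable_topology}"
    and h :: "'c \<Rightarrow> 'd::{banach, second_countable_topology}"
  assumes w: "asymp_invariant w" and h: "\<And>y z. norm (h y - h z) \<le> norm (y - z)" and h0: "\<And>y. norm (h y) \<le> norm y"
    and hm: "continuous_on UNIV h"
  shows "asymp_invariant (\<lambda>m x. h (w m x))"
  unfolding asymp_invariant_def
proof (intro conjI allI impI)
  have [measurable]: "w m \<in> borel_measurable N" for m
    using w by (auto simp: asymp_invariant_def)
  have [measurable]: "h \<in> borel_measurable borel" by (rule borel_measurable_continuous_onI[OF hm])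
  have bw: "norm (w m x) \<le> 1" if "x \<in> space N" for m x
    using w that by (auto simp: asymp_invariant_def)
  show "(\<lambda>x. h (w m x)) \<in> borel_measurable N" for m by measurable
  show "\<forall>x\<in>space N. norm (h (w m x)) \<le> 1" for m
    using bw h0 order_trans by blast
  fix e :: real assume e: "e > 0"
  then obtain m1 where m1: "\<And>m j. m \<ge> m1 \<Longrightarrow> (\<integral>x. norm (w (m + j) x - w m ((T ^^ j) x)) \<partial>N) \<le> e"
    using w unfolding asymp_invariant_def by meson
  show "\<exists>m0. \<forall>m\<ge>m0. \<forall>j. (\<integral>x. norm (h (w (m + j) x) - h (w m ((T ^^ j) x))) \<partial>N) \<le> e"
  proof (intro exI[of _ m1] allI impI)
    fix m j assume m: "m1 \<le> m"
    have [measurable]: "(\<lambda>x. w m ((T ^^ j) x)) \<in> borel_measurable N"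
      by (rule measurable_compose[OF Tn_measurable]; simp)
    have "norm (w (m + j) x - w m ((T ^^ j) x)) \<le> 2" if "x \<in> space N" for x
      using norm_triangle_ineq4[of "w (m + j) x" "w m ((T ^^ j) x)"]
        bw[OF that, of "m + j"] bw[OF funpow_in_space[OF T_measurable that], of m j] by linarith
    then have "integrable N (\<lambda>x. norm (w (m + j) x - w m ((T ^^ j) x)))"
      by (intro integrable_bounded[where B = 2]) auto
    then have "(\<integral>x. norm (h (w (m + j) x) - h (w m ((T ^^ j) x))) \<partial>N)
        \<le> (\<integral>x. norm (w (m + j) x - w m ((T ^^ j) x)) \<partial>N)"
      using h by (intro integral_mono') auto
    also have "\<dots> \<le> e" by (rule m1[OF m])
    finally show "(\<integral>x. norm (h (w (m + j) x) - h (w m ((T ^^ j) x))) \<partial>N) \<le> e" .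
  qed
qed

lemma asymp_invariant_funpow:
  assumes "u \<in> borel_measurable N" "\<And>x. x \<in> space N \<Longrightarrow> norm (u x) \<le> 1"
  shows "asymp_invariant (\<lambda>m x. u ((T ^^ m) x))"
  unfolding asymp_invariant_def
  using assms measurable_compose[OF Tn_measurable assms(1)] funpow_in_space[OF T_measurable]
  by (auto simp: funpow_add intro!: exI[of _ 0])

text \<open>Freeze \<open>w\<close> at a large level m. Later terms can be replaced by
  \<open>w m\<close> along the orbit, and the mean ergodic theorem makes the average of these nearly
  constant in L1. As \<open>F\<close> preserves \<open>N\<close>, both L1 errors keep their size
  after composition with \<open>F\<close>, and the indicator of \<open>U\<close> can only decrease
  them.\<close>

theorem asymp_invariant_average:
  fixes w :: "nat \<Rightarrow> real \<Rightarrow> real"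
  assumes w: "asymp_invariant w" and lim: "(\<lambda>m. \<integral>x. w m x \<partial>N) \<longlonglongrightarrow> c"
    and F: "F \<in> measurable N N" "distr N N F = N" and U: "U \<in> sets N"
  shows "(\<lambda>n. (\<Sum>m<n. \<integral>x. indicator U x * w m (F x) \<partial>N) / real n) \<longlonglongrightarrow> c * measure N U"
proof (rule LIMSEQ_I)
  fix e :: real assume e: "e > 0"
  have [measurable]: "w m \<in> borel_measurable N" for m
    using w by (auto simp: asymp_invariant_def)
  have bw: "\<bar>w m x\<bar> \<le> 1" if "x \<in> space N" for m x
    using w that by (auto simp: asymp_invariant_def)
  define z where "z m = (\<integral>x. indicator U x * w m (F x) \<partial>N)" for m
  define C where "C = c * measure N U"
  have Ub: "0 \<le> measure N U" "measure N U \<le> 1" by auto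
  from e have "e/8 > 0" by simp
  then obtain m1 where m1: "\<And>m j. m \<ge> m1 \<Longrightarrow> (\<integral>x. \<bar>w (m + j) x - w m ((T ^^ j) x)\<bar> \<partial>N) \<le> e/8"
    using w unfolding asymp_invariant_def real_norm_def by meson
  have "\<forall>\<^sub>F m in sequentially. \<bar>(\<integral>x. w m x \<partial>N) - c\<bar> < e/8"
    using tendstoD[OF lim \<open>e/8 > 0\<close>] by (simp add: dist_real_def)
  then obtain m2 where m2: "\<And>m. m \<ge> m2 \<Longrightarrow> \<bar>(\<integral>x. w m x \<partial>N) - c\<bar> < e/8"
    by (auto simp: eventually_sequentially)
  define m where "m = max m1 m2"
  have Fs: "F x \<in> space N" if "x \<in> space N" for x
    using measurable_space[OF F(1) that] .
  have intF: "(\<integral>x. \<bar>h (F x)\<bar> \<partial>N) = (\<integral>x. \<bar>h x\<bar> \<partial>N)" if [measurable]: "h \<in> borel_measurable N" for h :: "real \<Rightarrow> real"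
    using integral_measure_preserving[OF F, of "\<lambda>x. \<bar>h x\<bar>"] by simp
  have UF: "\<bar>(\<integral>x. indicator U x * h (F x) \<partial>N)\<bar> \<le> (\<integral>x. \<bar>h x\<bar> \<partial>N)"
    if [measurable]: "h \<in> borel_measurable N" and hb: "\<And>x. x \<in> space N \<Longrightarrow> \<bar>h x\<bar> \<le> K" for h :: "real \<Rightarrow> real" and K
  proof -
    have [measurable]: "(\<lambda>x. h (F x)) \<in> borel_measurable N"
      by (rule measurable_compose[OF F(1)]) simp
    have "\<bar>(\<integral>x. indicator U x * h (F x) \<partial>N)\<bar> \<le> (\<integral>x. \<bar>indicator U x * h (F x)\<bar> \<partial>N)"
      by (rule integral_abs_bound)
    also have "\<dots> \<le> (\<integral>x. \<bar>h (F x)\<bar> \<partial>N)"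
      using hb Fs by (intro integral_mono' integrable_bounded[where B = K]) (auto simp: abs_mult indicator_def)
    finally show ?thesis using intF by simp
  qed
  have intz: "integrable N (\<lambda>x. indicator U x * h (F x))"
    if [measurable]: "h \<in> borel_measurable N" and hb: "\<And>x. x \<in> space N \<Longrightarrow> \<bar>h x\<bar> \<le> K" for h :: "real \<Rightarrow> real" and K
  proof -
    have [measurable]: "(\<lambda>x. h (F x)) \<in> borel_measurable N"
      by (rule measurable_compose[OF F(1)]) simp
    have "\<bar>h (F x)\<bar> \<le> K \<and> 0 \<le> K" if "x \<in> space N" for x
      using hb[OF Fs[OF that]] by linarith
    then show ?thesis
      using U by (intro integrable_bounded[where B = K]) (auto simp: abs_mult indicator_def)
  qed
  have me: "(\<lambda>n. \<integral>x. \<bar>birkhoff T (w m) n x - (\<integral>x. w m x \<partial>N)\<bar> \<partial>N) \<longlonglongrightarrow> 0"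
    by (rule mean_ergodic[OF ergT]) (use bw in auto)
  have "\<forall>\<^sub>F n in sequentially. (\<integral>x. \<bar>birkhoff T (w m) n x - (\<integral>x. w m x \<partial>N)\<bar> \<partial>N) < e/8"
    using e by (intro order_tendstoD[OF me]) auto
  then obtain n1 where n1: "\<And>n. n \<ge> n1 \<Longrightarrow> (\<integral>x. \<bar>birkhoff T (w m) n x - (\<integral>x. w m x \<partial>N)\<bar> \<partial>N) < e/8"
    by (auto simp: eventually_sequentially)
  \<comment> \<open>Three errors of e/8 per term: replacing \<open>w (m + j)\<close> by the shifted
    \<open>w m\<close>, the ergodic average, and the mean of \<open>w m\<close> against its limit
    \<open>c\<close>.\<close>
  have main: "\<bar>(\<Sum>j<n. z (m + j)) - real n * C\<bar> \<le> real n * (3 * e/8)" if n: "n \<ge> max n1 1" for n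
  proof -
    have [measurable]: "(\<lambda>x. w m ((T ^^ j) x)) \<in> borel_measurable N" for j
      by (rule measurable_compose[OF Tn_measurable]) simp
    have bT: "\<bar>w m ((T ^^ j) x)\<bar> \<le> 1" if "x \<in> space N" for j x
      using bw[OF funpow_in_space[OF T_measurable that]] .
    define y where "y j = (\<integral>x. indicator U x * w m ((T ^^ j) (F x)) \<partial>N)" for j
    have "\<bar>z (m + j) - y j\<bar> \<le> e/8" for j
    proof -
      have "z (m + j) - y j = (\<integral>x. indicator U x * (w (m + j) (F x) - w m ((T ^^ j) (F x))) \<partial>N)"
        unfolding z_def y_def right_diff_distrib
        using intz[of "w (m + j)" 1] intz[of "\<lambda>x. w m ((T ^^ j) x)" 1] bw bT
        by (subst Bochner_Integration.integral_diff) auto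
      also have "\<bar>\<dots>\<bar> \<le> (\<integral>x. \<bar>w (m + j) x - w m ((T ^^ j) x)\<bar> \<partial>N)"
      proof (rule UF[of _ 2])
        show "\<bar>w (m + j) x - w m ((T ^^ j) x)\<bar> \<le> 2" if "x \<in> space N" for x
          using bw[OF that, of "m + j"] bT[OF that, of j] by linarith
      qed measurable
      finally show ?thesis using m1[of m j] unfolding m_def by simp
    qed
    note zy = this
    have "\<bar>(\<Sum>j<n. z (m + j)) - (\<Sum>j<n. y j)\<bar> \<le> (\<Sum>j<n. \<bar>z (m + j) - y j\<bar>)"
      unfolding sum_subtractf[symmetric] by (rule sum_abs)
    also have "\<dots> \<le> (\<Sum>j<n. e/8)"
      by (rule sum_mono) (rule zy)
    finally have A1: "\<bar>(\<Sum>j<n. z (m + j)) - (\<Sum>j<n. y j)\<bar> \<le> real n * (e/8)" by simp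
    have "(\<Sum>j<n. y j) - real n * ((\<integral>x. w m x \<partial>N) * measure N U)
        = real n * (\<integral>x. indicator U x * (birkhoff T (w m) n (F x) - (\<integral>x. w m x \<partial>N)) \<partial>N)"
    proof -
      have "(\<Sum>j<n. y j) = (\<integral>x. (\<Sum>j<n. indicator U x * w m ((T ^^ j) (F x))) \<partial>N)"
        unfolding y_def using intz[of "\<lambda>x. w m ((T ^^ j) x)" 1 for j] bT
        by (subst Bochner_Integration.integral_sum) auto
      also have "\<dots> = (\<integral>x. real n * (indicator U x * birkhoff T (w m) n (F x)) \<partial>N)"
        using n by (intro Bochner_Integration.integral_cong) (simp_all add: birkhoff_def sum_distrib_left[symmetric])
      also have "\<dots> = real n * (\<integral>x. indicator U x * birkhoff T (w m) n (F x) \<partial>N)"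
        by simp
      finally have 1: "(\<Sum>j<n. y j) = real n * (\<integral>x. indicator U x * birkhoff T (w m) n (F x) \<partial>N)" .
      have i1: "integrable N (\<lambda>x. indicator U x * birkhoff T (w m) n (F x))"
        by (rule intz[of _ 1]) (auto intro!: birkhoff_measurable[OF T_measurable] birkhoff_bound[OF T_measurable bw])
      have i2: "integrable N (\<lambda>x. indicator U x * (\<integral>x. w m x \<partial>N))"
        using U by (intro integrable_mult_left) (simp add: less_top[symmetric])
      show ?thesis unfolding 1 right_diff_distrib
        using i1 i2 U by (subst Bochner_Integration.integral_diff) (auto simp: right_diff_distrib)
    qed
    moreover have "\<bar>\<integral>x. indicator U x * (birkhoff T (w m) n (F x) - (\<integral>x. w m x \<partial>N)) \<partial>N\<bar>
        \<le> (\<integral>x. \<bar>birkhoff T (w m) n x - (\<integral>x. w m x \<partial>N)\<bar> \<partial>N)"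
    proof (rule UF[of _ "1 + \<bar>\<integral>x. w m x \<partial>N\<bar>"])
      show "(\<lambda>x. birkhoff T (w m) n x - (\<integral>x. w m x \<partial>N)) \<in> borel_measurable N"
        by (intro borel_measurable_diff birkhoff_measurable[OF T_measurable]) auto
      show "\<bar>birkhoff T (w m) n x - (\<integral>x. w m x \<partial>N)\<bar> \<le> 1 + \<bar>\<integral>x. w m x \<partial>N\<bar>" if "x \<in> space N" for x
        using birkhoff_bound[where w = "w m" and n = n, OF T_measurable bw _ that] by linarith
    qed
    ultimately have A2: "\<bar>(\<Sum>j<n. y j) - real n * ((\<integral>x. w m x \<partial>N) * measure N U)\<bar> \<le> real n * (e/8)"
      using n1[of n] n by (auto simp: abs_mult intro!: mult_left_mono)
    have "\<bar>(\<integral>x. w m x \<partial>N) * measure N U - C\<bar> \<le> (e/8) * 1"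
      unfolding C_def left_diff_distrib[symmetric] abs_mult
      by (rule mult_mono) (use m2[of m] Ub e in \<open>auto simp: m_def\<close>)
    then have A3: "\<bar>real n * ((\<integral>x. w m x \<partial>N) * measure N U) - real n * C\<bar> \<le> real n * (e/8)"
      unfolding right_diff_distrib[symmetric] abs_mult by (intro mult_mono) auto
    have "real n * (3 * e/8) = real n * (e/8) + real n * (e/8) + real n * (e/8)" by simp
    then show ?thesis using A1 A2 A3 by linarith
  qed
  \<comment> \<open>The ceiling makes the deviation of the first m terms, which is at most m(1 +
    |C|), no larger than n e/8.\<close>
  define n0 where "n0 = max n1 1 + m + nat \<lceil>8 * real m * (1 + \<bar>C\<bar>) / e\<rceil>"
  show "\<exists>no. \<forall>n\<ge>no. norm ((\<Sum>m<n. \<integral>x. indicator U x * w m (F x) \<partial>N) / real n - c * measure N U) < e"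
    unfolding z_def[symmetric] C_def[symmetric]
  proof (intro exI[of _ n0] allI impI)
    fix n assume n: "n0 \<le> n"
    then have nm: "n \<ge> m" "n - m \<ge> max n1 1" "n \<ge> 1" by (auto simp: n0_def)
    have zb: "\<bar>z i\<bar> \<le> 1" for i
    proof -
      have "norm (z i) \<le> 1"
        unfolding z_def
      proof (rule integral_norm_bounded)
        show "(\<lambda>x. indicator U x * w i (F x)) \<in> borel_measurable N"
          by (rule borel_measurable_integrable[OF intz[of _ 1]]) (use bw in auto)
        show "norm (indicator U x * w i (F x)) \<le> 1" if "x \<in> space N" for x
          using bw[OF Fs[OF that], of i] by (simp add: indicator_def)
      qed
      then show ?thesis by simp
    qed
    have "(\<Sum>i<n. z i) = (\<Sum>i<m. z i) + (\<Sum>j<n - m. z (m + j))"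
      using sum.atLeastLessThan_concat[of 0 m n z] nm(1) sum.shift_bounds_nat_ivl[of z 0 m "n - m"]
      by (simp add: atLeast0LessThan add.commute)
    then have "(\<Sum>i<n. z i) - real n * C = ((\<Sum>i<m. z i) - real m * C) + ((\<Sum>j<n - m. z (m + j)) - real (n - m) * C)"
      using nm(1) by (simp add: of_nat_diff algebra_simps)
    moreover have "\<bar>(\<Sum>i<m. z i) - real m * C\<bar> \<le> real m * (1 + \<bar>C\<bar>)"
    proof -
      have "\<bar>\<Sum>i<m. z i\<bar> \<le> real m"
        using order_trans[OF sum_abs sum_mono[of "{..<m}" "\<lambda>i. \<bar>z i\<bar>" "\<lambda>_. 1"]] zb by simp
      then have "\<bar>(\<Sum>i<m. z i) - real m * C\<bar> \<le> real m + \<bar>real m * C\<bar>" by linarith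
      then show ?thesis by (simp add: abs_mult algebra_simps)
    qed
    moreover have "real m * (1 + \<bar>C\<bar>) \<le> real n * (e/8)"
    proof -
      have "8 * real m * (1 + \<bar>C\<bar>) / e \<le> real n"
        using n unfolding n0_def by linarith
      then show ?thesis using e by (simp add: divide_simps mult.commute mult.left_commute split: if_splits)
    qed
    moreover have "real (n - m) * (3 * e/8) \<le> real n * (3 * e/8)"
      using e by (intro mult_right_mono) auto
    ultimately have "\<bar>(\<Sum>i<n. z i) - real n * C\<bar> \<le> real n * (e/8) + real n * (3 * e / 8)"
      using main[OF nm(2)] by linarith
    also have "\<dots> = real n * (e/2)" by simp
    finally have "\<bar>((\<Sum>i<n. z i) - real n * C) / real n\<bar> \<le> e/2"
      using nm(3) by (simp add: abs_divide divide_simps mult.commute)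
    then show "norm ((\<Sum>m<n. z m) / real n - C) < e"
      using nm(3) e by (simp add: diff_divide_distrib)
  qed
qed

end

subsection \<open>The limit energy of a character\<close>

definition ee :: "real \<Rightarrow> complex" where "ee t = cis (2 * pi * t)"

lemma norm_ee [simp]: "cmod (ee t) = 1" by (simp add: ee_def)

lemma ee_add: "ee (s + t) = ee s * ee t" by (simp add: ee_def cis_mult distrib_left)

lemma ee_minus: "ee (- t) = cnj (ee t)" by (simp add: ee_def cis_cnj)

lemma ee_0 [simp]: "ee 0 = 1" by (simp add: ee_def)

lemma ee_int: "t \<in> \<int> \<Longrightarrow> ee t = 1"
  unfolding ee_def by (rule cis_multiple_2pi)

lemma ee_measurable [measurable]: "ee \<in> borel_measurable borel"
  unfolding ee_def[abs_def] cis_conv_exp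
  by (intro borel_measurable_continuous_onI continuous_intros)

lemma ee_lipschitz: "cmod (ee s - ee t) \<le> 2 * pi * \<bar>s - t\<bar>"
proof -
  have "cmod (ee s - ee t) = cmod (ee t * (ee (s - t) - 1))"
    using ee_add[of t "s - t"] by (simp add: right_diff_distrib)
  also have "\<dots> = cmod (exp (\<i> * of_real (2 * pi * (s - t))) - 1)"
    by (simp add: norm_mult ee_def cis_conv_exp)
  also have "\<dots> \<le> \<bar>2 * pi * (s - t)\<bar>"
    using iexp_approx1[of "2 * pi * (s - t)" 0] by simp
  finally show ?thesis by (simp add: abs_mult)
qed

lemma (in prob_space) cell_exp_mult_cell:
  "cell_exp M \<kappa> (\<lambda>y. g (\<kappa> y) * u y) x = g (\<kappa> x) * cell_exp M \<kappa> u x"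
proof -
  have "(\<integral>y. indicator (\<kappa> -` {\<kappa> x}) y *\<^sub>R (g (\<kappa> y) * u y) \<partial>M)
      = (\<integral>y. g (\<kappa> x) * (indicator (\<kappa> -` {\<kappa> x}) y *\<^sub>R u y) \<partial>M)"
    by (rule Bochner_Integration.integral_cong) (auto simp: indicator_def)
  then show ?thesis by (simp only: cell_exp_def integral_mult_right_zero times_divide_eq_right)
qed

lemma (in prob_space) cell_exp_cong:
  "(\<And>y. y \<in> space M \<Longrightarrow> u y = v y) \<Longrightarrow> cell_exp M \<kappa> u x = cell_exp M \<kappa> v x"
  unfolding cell_exp_def by (intro arg_cong2[where f = "(/)"] Bochner_Integration.integral_cong refl) auto

lemma (in prob_space) cell_exp_diff:
  assumes "partition_map \<kappa>" and u: "u \<in> borel_measurable M" "\<And>x. x \<in> space M \<Longrightarrow> cmod (u x) \<le> B"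
    and v: "v \<in> borel_measurable M" "\<And>x. x \<in> space M \<Longrightarrow> cmod (v x) \<le> B"
  shows "cell_exp M \<kappa> (\<lambda>y. u y - v y) x = cell_exp M \<kappa> u x - cell_exp M \<kappa> v x"
proof -
  have *: "integrable M (\<lambda>y. indicator (\<kappa> -` {\<kappa> x}) y *\<^sub>R f y)"
    if "f \<in> borel_measurable M" "\<And>x. x \<in> space M \<Longrightarrow> cmod (f x) \<le> B" for f :: "'a \<Rightarrow> complex"
  proof -
    have "integrable M (\<lambda>y. indicator (\<kappa> -` {\<kappa> x} \<inter> space M) y *\<^sub>R f y)"
      using partition_cell_sets[OF assms(1)] that
      by (intro integrable_mult_indicator integrable_bounded[where B = B]) auto
    moreover have "integrable M (\<lambda>y. indicator (\<kappa> -` {\<kappa> x} \<inter> space M) y *\<^sub>R f y)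
        \<longleftrightarrow> integrable M (\<lambda>y. indicator (\<kappa> -` {\<kappa> x}) y *\<^sub>R f y)"
      by (rule Bochner_Integration.integrable_cong) (auto simp: indicator_def)
    ultimately show ?thesis by simp
  qed
  show ?thesis
    unfolding cell_exp_def scaleR_diff_right
    using *[OF u] *[OF v] by (simp add: diff_divide_distrib)
qed

context base_b
begin

abbreviation char_fun :: "real \<Rightarrow> real \<Rightarrow> complex" where
  "char_fun s \<equiv> (\<lambda>x. ee (s * x))"

definition Phi :: "real \<Rightarrow> real" where
  "Phi s = E2lim (char_fun s)"

lemma char_measurable: "char_fun s \<in> borel_measurable N"
  by (rule borel_measurable_N) measurable

lemma test_fun_char: "test_fun (char_fun s)"
  unfolding test_fun_def by (simp add: char_measurable)

lemma char_shift_measurable: "(\<lambda>x. ee (s * (T ^^ m) x)) \<in> borel_measurable N"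
  by (rule test_fun_shift(1)[OF test_fun_char])

text \<open>On a cell \<open>(T ^^ m) x\<close> and \<open>real b ^ m * x\<close> differ by a
  constant integer c, so the two characters differ by the fixed phase \<open>ee (- s * c)\<close>.
  For real s this phase need not be 1, which is why moduli are compared.\<close>

lemma V_char_phase:
  assumes "x \<in> space N"
  shows "cmod (V (char_fun s) m x) = cmod (cell_exp N (cell m) (\<lambda>x. ee (s * real b ^ m * x)) x)"
proof -
  have "V (char_fun s) m x = cell_exp N (cell m) (\<lambda>y. ee (- s * of_int (cell m y)) * ee (s * real b ^ m * y)) x"
    unfolding V_def
    by (rule cell_exp_cong) (auto simp: Tn_eq_cell space_N right_diff_distrib mult.assoc simp flip: ee_add)
  also have "\<dots> = ee (- s * of_int (cell m x)) * cell_exp N (cell m) (\<lambda>y. ee (s * real b ^ m * y)) x"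
    by (rule cell_exp_mult_cell)
  finally show ?thesis by (simp add: norm_mult)
qed

text \<open>Frequency bs at level m and frequency s at level m + 1 both mean the character of s
  b^(m+1) x, averaged over coarser and over finer cells respectively.\<close>

lemma Phi_base_mult_le: "Phi (real b * s) \<le> Phi s"
proof -
  have "E2 (char_fun (real b * s)) m \<le> Phi s" for m
  proof -
    let ?u = "\<lambda>x. ee (s * real b ^ (m + 1) * x)"
    have eq: "real b * s * real b ^ m = s * real b ^ (m + 1)" by simp
    have "E2 (char_fun (real b * s)) m = (\<integral>x. (cmod (cell_exp N (cell m) ?u x))\<^sup>2 \<partial>N)"
      unfolding E2_def
      by (rule Bochner_Integration.integral_cong[OF refl]) (simp only: V_char_phase eq)
    also have "\<dots> \<le> (\<integral>x. (cmod (cell_exp N (cell (m + 1)) ?u x))\<^sup>2 \<partial>N)"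
    proof (rule cell_exp_L2_mono[OF cell_partition cell_partition, where \<theta> = "\<lambda>c. c div int b ^ 1" and B = 1])
      show "?u \<in> borel_measurable N" by (rule borel_measurable_N) measurable
    qed (rule cell_add_div, simp)
    also have "\<dots> = E2 (char_fun s) (m + 1)"
      unfolding E2_def
      by (rule Bochner_Integration.integral_cong[OF refl]) (simp only: V_char_phase)
    also have "\<dots> \<le> Phi s"
      unfolding Phi_def by (rule E2_le_lim[OF test_fun_char])
    finally show ?thesis .
  qed
  then show ?thesis
    unfolding Phi_def[of "real b * s"]
    by (intro LIMSEQ_le_const2[OF E2_tendsto[OF test_fun_char]]) (auto intro!: exI[of _ 0])
qed

lemma Phi_nonneg: "Phi s \<ge> 0"
  using E2_nonneg[of "char_fun s" 0] E2_le_lim[OF test_fun_char, of s 0] by (simp add: Phi_def)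

lemma sq_diff_le: "\<bar>p\<^sup>2 - q\<^sup>2\<bar> \<le> 2 * \<bar>p - q\<bar>" if "0 \<le> p" "p \<le> 1" "0 \<le> q" "q \<le> (1::real)"
proof -
  have "\<bar>p\<^sup>2 - q\<^sup>2\<bar> = (p + q) * \<bar>p - q\<bar>"
    using that by (simp add: square_diff_square_factored power2_eq_square abs_mult)
  also have "\<dots> \<le> 2 * \<bar>p - q\<bar>" using that by (intro mult_right_mono) auto
  finally show ?thesis .
qed

text \<open>The points \<open>(T ^^ m) x\<close> stay in [0,1), so the characters of frequencies s
  and t differ by at most 2 pi |s - t| at every level; squaring moduli bounded by 1 doubles the
  constant.\<close>

lemma Phi_lipschitz: "\<bar>Phi s - Phi t\<bar> \<le> 4 * pi * \<bar>s - t\<bar>"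
proof -
  have "\<bar>E2 (char_fun s) m - E2 (char_fun t) m\<bar> \<le> 4 * pi * \<bar>s - t\<bar>" for m
  proof -
    have Vd: "cmod (V (char_fun s) m x - V (char_fun t) m x) \<le> 2 * pi * \<bar>s - t\<bar>" for x
    proof -
      have "V (char_fun s) m x - V (char_fun t) m x
        = cell_exp N (cell m) (\<lambda>x. ee (s * (T ^^ m) x) - ee (t * (T ^^ m) x)) x"
        unfolding V_def
        by (rule cell_exp_diff[OF cell_partition, symmetric, where B = 1])
           (simp_all add: char_shift_measurable)
      also have "cmod \<dots> \<le> 2 * pi * \<bar>s - t\<bar>"
      proof (rule cell_exp_bound[OF cell_partition])
        show "(\<lambda>x. ee (s * (T ^^ m) x) - ee (t * (T ^^ m) x)) \<in> borel_measurable N"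
          by (intro borel_measurable_diff char_shift_measurable)
        fix x assume "x \<in> space N"
        then have "(T ^^ m) x \<in> {0..<1}"
          using funpow_in_space[OF T_measurable, of x m] by (simp add: space_N)
        then have "\<bar>s * (T ^^ m) x - t * (T ^^ m) x\<bar> \<le> \<bar>s - t\<bar> * 1"
          unfolding left_diff_distrib[symmetric] abs_mult by (intro mult_left_mono) auto
        then have "2 * pi * \<bar>s * (T ^^ m) x - t * (T ^^ m) x\<bar> \<le> 2 * pi * \<bar>s - t\<bar>"
          by (intro mult_left_mono) auto
        then show "cmod (ee (s * (T ^^ m) x) - ee (t * (T ^^ m) x)) \<le> 2 * pi * \<bar>s - t\<bar>"
          by (rule order_trans[OF ee_lipschitz])
      qed simp
      finally show ?thesis .
    qed
    have "norm (\<integral>x. (cmod (V (char_fun s) m x))\<^sup>2 - (cmod (V (char_fun t) m x))\<^sup>2 \<partial>N) \<le> 4 * pi * \<bar>s - t\<bar>"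
    proof (rule integral_norm_bounded)
      fix x
      have "norm ((cmod (V (char_fun s) m x))\<^sup>2 - (cmod (V (char_fun t) m x))\<^sup>2)
          \<le> 2 * \<bar>cmod (V (char_fun s) m x) - cmod (V (char_fun t) m x)\<bar>"
        unfolding real_norm_def by (rule sq_diff_le) (auto intro: V_bound test_fun_char)
      also have "\<dots> \<le> 2 * cmod (V (char_fun s) m x - V (char_fun t) m x)"
        by (intro mult_left_mono norm_triangle_ineq3) simp
      also have "\<dots> \<le> 2 * (2 * pi * \<bar>s - t\<bar>)"
        by (intro mult_left_mono Vd) simp
      finally show "norm ((cmod (V (char_fun s) m x))\<^sup>2 - (cmod (V (char_fun t) m x))\<^sup>2) \<le> 4 * pi * \<bar>s - t\<bar>"
        by simp
    qed measurable
    moreover have "E2 (char_fun s) m - E2 (char_fun t) m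
        = (\<integral>x. (cmod (V (char_fun s) m x))\<^sup>2 - (cmod (V (char_fun t) m x))\<^sup>2 \<partial>N)"
      unfolding E2_def by (rule Bochner_Integration.integral_diff[symmetric]; rule V_sq_integrable[OF test_fun_char])
    ultimately show ?thesis by simp
  qed
  note bd = this
  have lim: "(\<lambda>m. \<bar>E2 (char_fun s) m - E2 (char_fun t) m\<bar>) \<longlonglongrightarrow> \<bar>Phi s - Phi t\<bar>"
    unfolding Phi_def by (rule tendsto_rabs[OF tendsto_diff[OF E2_tendsto[OF test_fun_char] E2_tendsto[OF test_fun_char]]])
  show ?thesis by (rule LIMSEQ_le_const2[OF lim]) (use bd in blast)
qed

text \<open>Invariance replaces the character of kx by that of k b^p x, the phase on cells vanishing
  as k is an integer. The energy at level 0 already dominates the squared mean, and energies grow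
  with the level.\<close>

lemma fourier_le_Phi:
  assumes k: "k \<in> \<int>"
  shows "(cmod (\<integral>x. ee (k * x) \<partial>N))\<^sup>2 \<le> Phi (k * real b ^ p)"
proof -
  let ?u = "char_fun (k * real b ^ p)"
  have "(\<integral>x. ee (k * x) \<partial>N) = (\<integral>x. ee (k * (T ^^ p) x) \<partial>N)"
    by (rule integral_funpow[OF T_measurable T_distr, symmetric]) (rule char_measurable)
  also have "\<dots> = (\<integral>x. ?u x \<partial>N)"
  proof (rule Bochner_Integration.integral_cong[OF refl])
    fix x assume "x \<in> space N"
    then have "ee (k * (T ^^ p) x) = ?u x * ee (- (k * of_int (cell p x)))"
      by (simp add: Tn_eq_cell space_N right_diff_distrib mult.assoc flip: ee_add)
    also have "ee (- (k * of_int (cell p x))) = 1"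
      using k by (intro ee_int) auto
    finally show "ee (k * (T ^^ p) x) = ?u x" by simp
  qed
  also have "\<dots> = (\<integral>x. V ?u 0 x \<partial>N)"
    unfolding V_def
    by (subst integral_cell_exp[OF cell_partition, where B = 1]) (simp_all add: char_measurable)
  finally have "cmod (\<integral>x. ee (k * x) \<partial>N) \<le> (\<integral>x. cmod (V ?u 0 x) \<partial>N)"
    by simp
  then have "(cmod (\<integral>x. ee (k * x) \<partial>N))\<^sup>2 \<le> (\<integral>x. \<bar>cmod (V ?u 0 x)\<bar> \<partial>N)\<^sup>2"
    by (intro power_mono) auto
  also have "\<dots> \<le> E2 ?u 0"
    unfolding E2_def by (rule L1_le_L2[where B = 1]) (auto intro: V_bound[OF test_fun_char])
  also have "\<dots> \<le> Phi (k * real b ^ p)"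
    unfolding Phi_def by (rule E2_le_lim[OF test_fun_char])
  finally show ?thesis .
qed

text \<open>The projection identity lets the energy be read off from a product containing
  \<open>u\<close> itself, to which the linearisation can be applied before any averaging.\<close>

lemma integral_V_cross:
  assumes u: "test_fun u"
  shows "(\<integral>x. Re (u ((T ^^ m) x) * cnj (V u m x)) \<partial>N) = E2 u m"
proof -
  have s1[measurable]: "(\<lambda>x. u ((T ^^ m) x)) \<in> borel_measurable N" by (rule test_fun_shift[OF u])
  have s2: "cmod (u ((T ^^ m) x)) \<le> 1" if "x \<in> space N" for x
    by (rule test_fun_shift(2)[OF u that])
  define g where "g c = cnj ((\<integral>y. indicator (cell m -` {c}) y *\<^sub>R u ((T ^^ m) y) \<partial>N) / of_real (measure N (cell m -` {c} \<inter> space N)))" for c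
  have g: "g (cell m x) = cnj (V u m x)" for x by (simp add: g_def V_def cell_exp_def)
  have "integrable N (\<lambda>x. u ((T ^^ m) x) * cnj (V u m x))" "integrable N (\<lambda>x. V u m x * cnj (V u m x))"
    using V_bound[OF u] s2 by (auto intro!: integrable_bounded[where B = 1] mult_le_one simp: norm_mult)
  note i = this
  have "(\<integral>x. Re (u ((T ^^ m) x) * cnj (V u m x)) \<partial>N) = Re (\<integral>x. u ((T ^^ m) x) * cnj (V u m x) \<partial>N)"
    by (rule integral_Re[OF i(1)])
  also have "(\<integral>x. u ((T ^^ m) x) * cnj (V u m x) \<partial>N) = (\<integral>x. g (cell m x) * u ((T ^^ m) x) \<partial>N)"
    by (simp add: g mult.commute)
  also have "\<dots> = (\<integral>x. g (cell m x) * V u m x \<partial>N)"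
    unfolding V_def by (rule cell_exp_projection[OF cell_partition s1, symmetric, where B = 1]) (rule s2)
  also have "\<dots> = (\<integral>x. V u m x * cnj (V u m x) \<partial>N)"
    by (simp add: g mult.commute)
  also have "Re \<dots> = (\<integral>x. Re (V u m x * cnj (V u m x)) \<partial>N)"
    by (rule integral_Re[OF i(2), symmetric])
  also have "\<dots> = E2 u m"
    unfolding E2_def
    by (rule Bochner_Integration.integral_cong) (simp_all only: cmod_power2, simp_all add: power2_eq_square)
  finally show ?thesis .
qed

end

subsection \<open>Comparison along a smooth invariant map\<close>

context base_b
begin

text \<open>A neighbourhood of 0 on the circle, the place where the floor jumps. If the l-th shift
  of an image point avoids it, changing b^l times the lift by less than \<open>r\<close> leaves the
  floor unchanged.\<close>

definition wrap_zone :: "real \<Rightarrow> real set" where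
  "wrap_zone r = {x \<in> {0..<1}. x < r \<or> x > 1 - r}"

lemma wrap_zone_sets: "wrap_zone r \<in> sets N"
proof -
  have "wrap_zone r = {x. x < r \<or> x > 1 - r} \<inter> {0..<1}" by (auto simp: wrap_zone_def)
  then show ?thesis unfolding sets_N by (simp add: sets_restrict_space_iff)
qed

lemma cell_eq_near:
  assumes "x \<in> {0..<1}" "y \<in> {0..<1}" "cell m x = cell m y"
  shows "\<bar>x - y\<bar> \<le> 1 / real b ^ m"
proof -
  have "\<bar>real b ^ m * x - real b ^ m * y\<bar> < 1"
    using assms(3) unfolding cell_def by linarith
  then have "real b ^ m * \<bar>x - y\<bar> < 1"
    using bpos(2)[of m] by (simp add: right_diff_distrib[symmetric] abs_mult)
  then show ?thesis using bpos(2)[of m] by (simp add: field_simps)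
qed

text \<open>\<open>y\<close> is any real lift of \<open>z\<close>, such as the value of
  \<open>Ft\<close>; its integer part disappears modulo b^l.\<close>

lemma cell_floor_mult:
  assumes "z \<in> {0..<1}" and "z = frac y"
  shows "cell l z = \<lfloor>real b ^ l * y\<rfloor> mod int b ^ l"
    and "(T ^^ l) z = frac (real b ^ l * y)"
proof -
  have *: "real b ^ l * z = real b ^ l * y - of_int (int b ^ l * \<lfloor>y\<rfloor>)"
    by (simp add: assms frac_def right_diff_distrib)
  have "\<lfloor>y\<rfloor> = \<lfloor>real b ^ l * y\<rfloor> div int b ^ l"
  proof -
    have "\<lfloor>(real b ^ l * y) / of_int (int b ^ l)\<rfloor> = \<lfloor>real b ^ l * y\<rfloor> div (int b ^ l)"
      by (rule floor_divide_real_eq_div) auto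
    then show ?thesis using bpos by simp
  qed
  then show "cell l z = \<lfloor>real b ^ l * y\<rfloor> mod int b ^ l"
    unfolding cell_def * floor_diff_of_int by (simp add: minus_mult_div_eq_mod)
  have "\<lfloor>real b ^ l * z\<rfloor> = \<lfloor>real b ^ l * y\<rfloor> - int b ^ l * \<lfloor>y\<rfloor>"
    unfolding * by (rule floor_diff_of_int)
  then show "(T ^^ l) z = frac (real b ^ l * y)"
    unfolding Tn_eq[OF assms(1)] frac_def using * by simp
qed

text \<open>On a cell of level \<open>l + d\<close> either \<open>F\<close> meets a fixed cell of level \<open>l\<close>, where linearising
  turns the frequency \<open>s b\<^sup>d\<close> seen through \<open>F\<close> into \<open>s \<tau>\<close>, or \<open>F\<close> is close to a cell boundary.\<close>

lemma compare_on_cell: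
  fixes Ft Ft' :: "real \<Rightarrow> real"
  assumes der: "\<And>x. (Ft has_real_derivative Ft' x) (at x)"
    and F: "\<And>x. x \<in> {0..<1} \<Longrightarrow> F x = frac (Ft x)" "F \<in> measurable N N"
    and L: "\<And>x. x \<in> {0..1} \<Longrightarrow> \<bar>Ft' x\<bar> < L"
    and \<tau>: "\<And>x. x \<in> {0..<1} \<Longrightarrow> cell q x = c0 \<Longrightarrow> \<bar>Ft' x - \<tau>\<bar> \<le> \<delta>"
    and s: "s > 0" and l: "q \<le> l + d" and c0: "c div int b ^ (l + d - q) = c0"
  defines "u \<equiv> char_fun (s * real b ^ d)" and "v \<equiv> char_fun (s * \<bar>\<tau>\<bar>)"
    and "I \<equiv> (\<lambda>x. indicator (cell (l + d) -` {c}) x :: real)"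
  shows "(\<integral>x. I x * Re (u ((T ^^ l) (F x)) * cnj (V u l (F x))) \<partial>N)
    \<le> (\<integral>x. I x * ((cmod (V u l (F x)))\<^sup>2 / 2 + (cmod (V v (l + d) x))\<^sup>2 / 2 + 2 * pi * s * \<delta>
         + indicator (wrap_zone (L / real b ^ d)) ((T ^^ l) (F x))) \<partial>N)"
proof -
  define C where "C = cell (l + d) -` {c} \<inter> space N"
  have C[measurable]: "C \<in> sets N"
    unfolding C_def by (rule partition_cell_sets[OF cell_partition])
  have I_C: "I x = indicator C x" if "x \<in> space N" for x
    using that by (auto simp: I_def C_def indicator_def)
  have Fs: "F x \<in> space N" if "x \<in> space N" for x
    using measurable_space[OF F(2) that] .
  have u: "test_fun u" and v: "test_fun v"
    unfolding u_def v_def by (rule test_fun_char)+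
  define f where "f x = Re (u ((T ^^ l) (F x)) * cnj (V u l (F x)))" for x
  define W where "W x = (indicator (wrap_zone (L / real b ^ d)) ((T ^^ l) (F x)) :: real)" for x
  define g where "g x = (cmod (V u l (F x)))\<^sup>2 / 2 + (cmod (V v (l + d) x))\<^sup>2 / 2 + 2 * pi * s * \<delta> + W x" for x
  have [measurable]: "(\<lambda>x. V u l (F x)) \<in> borel_measurable N" "(\<lambda>x. u ((T ^^ l) (F x))) \<in> borel_measurable N"
    by (rule measurable_compose[OF F(2)]; use V_measurable test_fun_shift(1)[OF u] in blast)+
  have [measurable]: "W \<in> borel_measurable N"
    unfolding W_def[abs_def]
    by (rule measurable_compose[OF F(2)], rule measurable_compose[OF Tn_measurable]) (use wrap_zone_sets in measurable)
  have ub: "cmod (u ((T ^^ l) (F x))) \<le> 1" for x by (simp add: u_def)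
  have fb: "\<bar>f x\<bar> \<le> 1" for x
  proof -
    have "\<bar>f x\<bar> \<le> cmod (u ((T ^^ l) (F x)) * cnj (V u l (F x)))"
      unfolding f_def by (rule abs_Re_le_cmod)
    also have "\<dots> \<le> 1"
      unfolding norm_mult complex_mod_cnj by (intro mult_le_one ub norm_ge_zero V_bound[OF u])
    finally show ?thesis .
  qed
  have fm[measurable]: "f \<in> borel_measurable N" unfolding f_def[abs_def] by measurable
  have gm[measurable]: "g \<in> borel_measurable N" unfolding g_def[abs_def] by measurable
  have if_: "integrable N (\<lambda>x. indicator C x * f x)"
    using fb by (intro integrable_bounded[where B = 1]) (auto simp: indicator_def)
  have gb: "\<bar>g x\<bar> \<le> 2 + \<bar>2 * pi * s * \<delta>\<bar>" for x
  proof -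
    have "(cmod (V u l (F x)))\<^sup>2 \<le> 1" "(cmod (V v (l + d) x))\<^sup>2 \<le> 1"
      using V_bound[OF u, of l "F x"] V_bound[OF v, of "l + d" x] by (auto intro: power_le_one)
    moreover have "0 \<le> W x" "W x \<le> 1" by (auto simp: W_def indicator_def)
    moreover have "(cmod (V u l (F x)))\<^sup>2 \<ge> 0" "(cmod (V v (l + d) x))\<^sup>2 \<ge> 0" by auto
    ultimately show ?thesis unfolding g_def by linarith
  qed
  have ig: "integrable N (\<lambda>x. indicator C x * g x)"
    using gb by (intro integrable_bounded[where B = "2 + \<bar>2 * pi * s * \<delta>\<bar>"]) (auto simp: indicator_def)
  have cellC: "cell q x = c0" if "x \<in> C" for x
    using cell_add_div[of q x "l + d - q"] l c0 that by (simp add: C_def)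
  have \<delta>0: "\<delta> \<ge> 0" if "x \<in> C" for x
    using \<tau>[of x] cellC[OF that] that by (auto simp: C_def space_N dest: order_trans[OF abs_ge_zero])
  have "(\<integral>x. indicator C x * f x \<partial>N) \<le> (\<integral>x. indicator C x * g x \<partial>N)"
  \<comment> \<open>If every image lies in the wrap zone, the indicator term equals 1 and alone
    dominates the integrand. Otherwise one good point y controls the whole cell.\<close>
  proof (cases "\<exists>y\<in>C. (T ^^ l) (F y) \<notin> wrap_zone (L / real b ^ d)")
    case False
    show ?thesis
    proof (rule integral_mono[OF if_ ig])
      fix x
      have "f x \<le> g x" if x: "x \<in> C"
      proof -
        have "W x = 1" using False x by (simp add: W_def)
        then show ?thesis using fb[of x] \<delta>0[OF x] s by (simp add: g_def abs_le_iff add_increasing)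
      qed
      then show "indicator C x * f x \<le> indicator C x * g x" by (auto simp: indicator_def)
    qed
  next
    case True
    then obtain y where y: "y \<in> C" "(T ^^ l) (F y) \<notin> wrap_zone (L / real b ^ d)" by blast
    have y01: "y \<in> {0..<1}" using y(1) by (simp add: C_def space_N)
    define r where "r = L / real b ^ d"
    define k where "k = \<lfloor>real b ^ l * Ft y\<rfloor>"
    have Fy01: "F y \<in> {0..<1}" using Fs y01 by (simp add: space_N)
    have "(T ^^ l) (F y) = frac (real b ^ l * Ft y)"
      by (rule cell_floor_mult(2)[OF Fy01 F(1)[OF y01]])
    then have fr: "r \<le> frac (real b ^ l * Ft y)" "frac (real b ^ l * Ft y) \<le> 1 - r"
      using y(2) frac_ge_0[of "real b ^ l * Ft y"] frac_lt_1[of "real b ^ l * Ft y"] by (auto simp: wrap_zone_def r_def)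
    have seg: "x \<in> C \<Longrightarrow> z \<in> closed_segment x y \<Longrightarrow> z \<in> C" for x z
    proof -
      assume x: "x \<in> C" and z: "z \<in> closed_segment x y"
      have z': "min x y \<le> z" "z \<le> max x y" using z by (auto simp: closed_segment_eq_real_ivl split: if_splits)
      have "z \<in> {0..<1}" using z' x y01 by (auto simp: C_def space_N min_def max_def split: if_splits)
      moreover have "cell (l + d) (min x y) = c" "cell (l + d) (max x y) = c"
        using x y(1) by (simp_all add: C_def min_def max_def)
      moreover have "cell (l + d) (min x y) \<le> cell (l + d) z" "cell (l + d) z \<le> cell (l + d) (max x y)"
        unfolding cell_def by (intro floor_mono mult_left_mono z'; simp)+
      ultimately show "z \<in> C" by (simp add: C_def space_N)
    qed
    have near: "\<bar>x - y\<bar> \<le> 1 / real b ^ (l + d)" if "x \<in> C" for x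
      using cell_eq_near[of x y "l + d"] that y(1) by (simp add: C_def space_N)
    \<comment> \<open>The strict bound on the derivative gives a strict inequality for x different
      from y, so the floor cannot jump even if the fractional part at y is exactly 1 - r.\<close>
    have lip: "\<bar>Ft x - Ft y\<bar> < r / real b ^ l \<or> x = y" if x: "x \<in> C" for x
    proof (cases "x = y")
      case False
      have "\<exists>z\<in>closed_segment x y. Ft x - Ft y = Ft' z * (x - y)"
      proof (cases "x < y")
        case True
        obtain z where "x < z" "z < y" "Ft y - Ft x = (y - x) * Ft' z"
          using MVT2[OF True, of Ft Ft'] der by auto
        then show ?thesis by (intro bexI[of _ z]) (auto simp: closed_segment_eq_real_ivl algebra_simps)
      next
        case False
        then have "y < x" using \<open>x \<noteq> y\<close> by simp
        obtain z where "y < z" "z < x" "Ft x - Ft y = (x - y) * Ft' z"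
          using MVT2[OF \<open>y < x\<close>, of Ft Ft'] der by auto
        then show ?thesis by (intro bexI[of _ z]) (auto simp: closed_segment_eq_real_ivl algebra_simps)
      qed
      then obtain z where z: "z \<in> C" "Ft x - Ft y = Ft' z * (x - y)" using seg[OF x] by blast
      have "\<bar>Ft' z\<bar> < L" using L z(1) by (auto simp: C_def space_N)
      have "\<bar>Ft x - Ft y\<bar> = \<bar>Ft' z\<bar> * \<bar>x - y\<bar>"
        unfolding z(2) by (rule abs_mult)
      also have "\<dots> < L * \<bar>x - y\<bar>"
        using \<open>\<bar>Ft' z\<bar> < L\<close> False by (intro mult_strict_right_mono) auto
      also have "\<dots> \<le> L * (1 / real b ^ (l + d))"
        using \<open>\<bar>Ft' z\<bar> < L\<close> by (intro mult_left_mono near[OF x]) linarith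
      finally have "\<bar>Ft x - Ft y\<bar> < L * (1 / real b ^ (l + d))" .
      then show ?thesis by (simp add: r_def power_add mult.commute)
    qed simp
    have floor_const: "\<lfloor>real b ^ l * Ft x\<rfloor> = k" if x: "x \<in> C" for x
    proof (cases "x = y")
      case False
      then have "real b ^ l * \<bar>Ft x - Ft y\<bar> < r"
        using lip[OF x] bpos(2)[of l] by (auto simp: field_simps)
      then have "\<bar>real b ^ l * Ft x - real b ^ l * Ft y\<bar> < r"
        using bpos(2)[of l] by (simp add: right_diff_distrib[symmetric] abs_mult)
      then show ?thesis using fr unfolding frac_def k_def by (intro floor_unique) linarith+
    qed (simp add: k_def)
    define G where "G = V u l (F y)"
    have cellF: "V u l (F x) = G" if x: "x \<in> C" for x
    proof -
      have x01: "x \<in> {0..<1}" using x by (simp add: C_def space_N)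
      have "F x \<in> {0..<1}" using Fs x01 by (simp add: space_N)
      then have "cell l (F x) = cell l (F y)"
        using cell_floor_mult(1)[OF _ F(1)[OF x01], of l] cell_floor_mult(1)[OF Fy01 F(1)[OF y01], of l]
          floor_const[OF x] by (simp add: k_def)
      then show ?thesis unfolding G_def by (rule V_const_on_cell)
    qed
    \<comment> \<open>The constant terms of the expansion Ft x = Ft y + \<tau> (x - y) + error.
      \<open>A\<close> has modulus 1 and leaves a pure character of frequency s \<tau>
      b^(l+d).\<close>
    define A where "A = ee (s * real b ^ d * (real b ^ l * Ft y - real b ^ l * \<tau> * y - of_int k))"
    have approx: "cmod (u ((T ^^ l) (F x)) - A * ee (s * \<tau> * real b ^ (l + d) * x)) \<le> 2 * pi * s * \<delta>"
      if x: "x \<in> C" for x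
    proof -
      have x01: "x \<in> {0..<1}" using x by (simp add: C_def space_N)
      have "F x \<in> {0..<1}" using Fs x01 by (simp add: space_N)
      then have "(T ^^ l) (F x) = real b ^ l * Ft x - of_int k"
        using cell_floor_mult(2)[OF _ F(1)[OF x01], of l] floor_const[OF x] by (simp add: frac_def)
      then have 1: "u ((T ^^ l) (F x)) = ee (s * real b ^ d * (real b ^ l * Ft x - of_int k))"
        by (simp add: u_def)
      have 2: "A * ee (s * \<tau> * real b ^ (l + d) * x)
          = ee (s * real b ^ d * (real b ^ l * Ft y - real b ^ l * \<tau> * y - of_int k) + s * \<tau> * real b ^ (l + d) * x)"
        unfolding A_def ee_add ..
      have "norm (Ft x - Ft y - \<tau> * (x - y)) \<le> \<delta> * norm (x - y)"
      proof -
        have "norm ((\<lambda>z. Ft z - \<tau> * z) x - (\<lambda>z. Ft z - \<tau> * z) y) \<le> \<delta> * norm (x - y)"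
        proof (rule field_differentiable_bound[where S = "closed_segment x y" and f' = "\<lambda>z. Ft' z - \<tau>"])
          fix z assume "z \<in> closed_segment x y"
          then have z: "z \<in> C" by (rule seg[OF x])
          show "((\<lambda>z. Ft z - \<tau> * z) has_real_derivative Ft' z - \<tau>) (at z within closed_segment x y)"
            by (auto intro!: derivative_eq_intros DERIV_subset[OF der])
          show "norm (Ft' z - \<tau>) \<le> \<delta>"
            using \<tau>[of z] cellC[OF z] z by (simp add: C_def space_N)
        qed auto
        then show ?thesis by (simp add: algebra_simps)
      qed
      also have "\<dots> \<le> \<delta> * (1 / real b ^ (l + d))"
        using near[OF x] \<delta>0[OF x] by (intro mult_left_mono) auto
      finally have 3: "\<bar>Ft x - Ft y - \<tau> * (x - y)\<bar> \<le> \<delta> * (1 / real b ^ (l + d))" by simp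
      have "cmod (u ((T ^^ l) (F x)) - A * ee (s * \<tau> * real b ^ (l + d) * x))
          \<le> 2 * pi * \<bar>s * real b ^ (l + d) * (Ft x - Ft y - \<tau> * (x - y))\<bar>"
        unfolding 1 2 by (rule order_trans[OF ee_lipschitz]) (simp add: algebra_simps power_add)
      also have "\<dots> = 2 * pi * (s * real b ^ (l + d) * \<bar>Ft x - Ft y - \<tau> * (x - y)\<bar>)"
        using s bpos(2)[of "l + d"] by (simp add: abs_mult)
      also have "\<dots> \<le> 2 * pi * (s * real b ^ (l + d) * (\<delta> * (1 / real b ^ (l + d))))"
        using 3 s bpos(2)[of "l + d"] by (intro mult_left_mono) auto
      also have "\<dots> = 2 * pi * s * \<delta>" using bpos(1) by simp
      finally show ?thesis .
    qed
    define V1 where "V1 = cmod (V v (l + d) y)"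
    have V1: "cmod (V v (l + d) x) = V1" if "x \<in> C" for x
      unfolding V1_def using that y(1) by (subst V_const_on_cell[of "l + d" x y]) (auto simp: C_def)
    \<comment> \<open>A negative slope \<tau> gives the complex conjugate of the integral for
      |\<tau>|, hence the same modulus.\<close>
    have phase_int: "cmod (\<integral>x. indicator C x *\<^sub>R ee (s * \<tau> * real b ^ (l + d) * x) \<partial>N) = measure N C * V1"
    proof -
      have "of_real (measure N C) * cell_exp N (cell (l + d)) (\<lambda>x. ee (s * \<bar>\<tau>\<bar> * real b ^ (l + d) * x)) y
        = (\<integral>x. indicator C x *\<^sub>R ee (s * \<bar>\<tau>\<bar> * real b ^ (l + d) * x) \<partial>N)"
      proof -
        have yc: "cell (l + d) y = c" using y(1) by (simp add: C_def)
        have "of_real (measure N C) * cell_exp N (cell (l + d)) (\<lambda>x. ee (s * \<bar>\<tau>\<bar> * real b ^ (l + d) * x)) y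
          = (\<integral>x. indicator (cell (l + d) -` {c}) x *\<^sub>R ee (s * \<bar>\<tau>\<bar> * real b ^ (l + d) * x) \<partial>N)"
          unfolding C_def
          by (rule cell_exp_mass[OF cell_partition[of "l + d"] char_measurable[of "s * \<bar>\<tau>\<bar> * real b ^ (l + d)"],
                where B = 1 and x = y, unfolded yc]) simp
        also have "\<dots> = (\<integral>x. indicator C x *\<^sub>R ee (s * \<bar>\<tau>\<bar> * real b ^ (l + d) * x) \<partial>N)"
          by (rule Bochner_Integration.integral_cong) (auto simp: C_def indicator_def)
        finally show ?thesis .
      qed
      then have "cmod (\<integral>x. indicator C x *\<^sub>R ee (s * \<bar>\<tau>\<bar> * real b ^ (l + d) * x) \<partial>N)
          = measure N C * cmod (cell_exp N (cell (l + d)) (\<lambda>x. ee (s * \<bar>\<tau>\<bar> * real b ^ (l + d) * x)) y)"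
        by (metis norm_mult norm_of_real abs_of_nonneg measure_nonneg)
      also have "\<dots> = measure N C * V1"
        using V_char_phase[of y "s * \<bar>\<tau>\<bar>" "l + d"] y01 by (simp add: V1_def v_def space_N)
      finally have *: "cmod (\<integral>x. indicator C x *\<^sub>R ee (s * \<bar>\<tau>\<bar> * real b ^ (l + d) * x) \<partial>N) = measure N C * V1" .
      show ?thesis
      proof (cases "\<tau> \<ge> 0")
        case False
        have "(\<integral>x. indicator C x *\<^sub>R ee (s * \<tau> * real b ^ (l + d) * x) \<partial>N)
            = (\<integral>x. cnj (indicator C x *\<^sub>R ee (s * \<bar>\<tau>\<bar> * real b ^ (l + d) * x)) \<partial>N)"
          using False by (intro Bochner_Integration.integral_cong) (auto simp: indicator_def simp flip: ee_minus)
        also have "\<dots> = cnj (\<integral>x. indicator C x *\<^sub>R ee (s * \<bar>\<tau>\<bar> * real b ^ (l + d) * x) \<partial>N)"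
          by (rule Bochner_Integration.integral_cnj)
        finally show ?thesis using * by simp
      qed (use * in simp)
    qed
    have mA: "cmod A = 1" by (simp add: A_def)
    have em: "(\<lambda>x. ee (s * \<tau> * real b ^ (l + d) * x)) \<in> borel_measurable N" by (rule char_measurable)
    have iu: "integrable N (\<lambda>x. indicator C x *\<^sub>R u ((T ^^ l) (F x)))"
      and ie: "integrable N (\<lambda>x. indicator C x *\<^sub>R (A * ee (s * \<tau> * real b ^ (l + d) * x)))"
    proof -
      have [measurable]: "(\<lambda>x. ee (s * \<tau> * real b ^ (l + d) * x)) \<in> borel_measurable N" by (rule em)
      have 1: "cmod (indicator C x *\<^sub>R u ((T ^^ l) (F x))) \<le> 1" for x
        using ub[of x] by (simp add: indicator_def)
      have 2: "cmod (indicator C x *\<^sub>R (A * ee (s * \<tau> * real b ^ (l + d) * x))) \<le> 1" for x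
        using mA by (simp add: indicator_def norm_mult)
      show "integrable N (\<lambda>x. indicator C x *\<^sub>R u ((T ^^ l) (F x)))"
        by (rule integrable_bounded[OF _ 1]) measurable
      show "integrable N (\<lambda>x. indicator C x *\<^sub>R (A * ee (s * \<tau> * real b ^ (l + d) * x)))"
        by (rule integrable_bounded[OF _ 2])
           (intro borel_measurable_scaleR borel_measurable_times borel_measurable_indicator C em borel_measurable_const)
    qed
    have main: "cmod (\<integral>x. indicator C x *\<^sub>R u ((T ^^ l) (F x)) \<partial>N) \<le> measure N C * (V1 + 2 * pi * s * \<delta>)"
    proof -
      have "cmod ((\<integral>x. indicator C x *\<^sub>R u ((T ^^ l) (F x)) \<partial>N)
          - (\<integral>x. indicator C x *\<^sub>R (A * ee (s * \<tau> * real b ^ (l + d) * x)) \<partial>N))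
        = cmod (\<integral>x. indicator C x *\<^sub>R (u ((T ^^ l) (F x)) - A * ee (s * \<tau> * real b ^ (l + d) * x)) \<partial>N)"
        using iu ie by (simp add: scaleR_diff_right)
      also have "\<dots> \<le> (\<integral>x. cmod (indicator C x *\<^sub>R (u ((T ^^ l) (F x)) - A * ee (s * \<tau> * real b ^ (l + d) * x))) \<partial>N)"
        by (rule integral_norm_bound)
      also have "\<dots> \<le> (\<integral>x. indicator C x *\<^sub>R (2 * pi * s * \<delta>) \<partial>N)"
      proof (rule integral_mono)
        show "integrable N (\<lambda>x. cmod (indicator C x *\<^sub>R (u ((T ^^ l) (F x)) - A * ee (s * \<tau> * real b ^ (l + d) * x))))"
          using iu ie by (intro integrable_norm) (simp add: scaleR_diff_right)
        show "integrable N (\<lambda>x. indicator C x *\<^sub>R (2 * pi * s * \<delta>))"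
          using C by (intro integrable_mult_indicator) auto
      qed (use approx in \<open>auto simp: indicator_def\<close>)
      also have "\<dots> = measure N C * (2 * pi * s * \<delta>)"
        using C by simp
      finally have 1: "cmod ((\<integral>x. indicator C x *\<^sub>R u ((T ^^ l) (F x)) \<partial>N)
          - (\<integral>x. indicator C x *\<^sub>R (A * ee (s * \<tau> * real b ^ (l + d) * x)) \<partial>N)) \<le> measure N C * (2 * pi * s * \<delta>)" .
      have "(\<integral>x. indicator C x *\<^sub>R (A * ee (s * \<tau> * real b ^ (l + d) * x)) \<partial>N)
          = (\<integral>x. A * (indicator C x *\<^sub>R ee (s * \<tau> * real b ^ (l + d) * x)) \<partial>N)"
        by (rule Bochner_Integration.integral_cong) (auto simp: indicator_def)
      also have "\<dots> = A * (\<integral>x. indicator C x *\<^sub>R ee (s * \<tau> * real b ^ (l + d) * x) \<partial>N)"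
        by (rule integral_mult_right_zero)
      finally have "cmod (\<integral>x. indicator C x *\<^sub>R (A * ee (s * \<tau> * real b ^ (l + d) * x)) \<partial>N) = measure N C * V1"
        by (simp only: norm_mult phase_int mA mult_1_left)
      then show ?thesis
        using 1 norm_triangle_sub[of "\<integral>x. indicator C x *\<^sub>R u ((T ^^ l) (F x)) \<partial>N"
          "\<integral>x. indicator C x *\<^sub>R (A * ee (s * \<tau> * real b ^ (l + d) * x)) \<partial>N"]
        by (simp only: distrib_left)
    qed
    have "(\<integral>x. indicator C x * f x \<partial>N) = (\<integral>x. Re (cnj G * (indicator C x *\<^sub>R u ((T ^^ l) (F x)))) \<partial>N)"
      by (rule Bochner_Integration.integral_cong) (auto simp: indicator_def f_def cellF mult.commute)
    also have "\<dots> = Re (\<integral>x. cnj G * (indicator C x *\<^sub>R u ((T ^^ l) (F x))) \<partial>N)"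
      by (rule integral_Re[OF integrable_mult_right[OF iu]])
    also have "\<dots> \<le> cmod (cnj G * (\<integral>x. indicator C x *\<^sub>R u ((T ^^ l) (F x)) \<partial>N))"
      unfolding integral_mult_right_zero by (rule complex_Re_le_cmod)
    also have "\<dots> \<le> cmod G * (measure N C * (V1 + 2 * pi * s * \<delta>))"
      unfolding norm_mult complex_mod_cnj by (rule mult_left_mono[OF main]) simp
    \<comment> \<open>The product of moduli is split with equal weights by xy \<le> (x^2 + y^2)/2;
      these weights later allow the absorption with constant 1.\<close>
    also have "\<dots> \<le> measure N C * ((cmod G)\<^sup>2 / 2 + V1\<^sup>2 / 2 + 2 * pi * s * \<delta>)"
    proof -
      have "cmod G * V1 \<le> (cmod G)\<^sup>2 / 2 + V1\<^sup>2 / 2"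
        using sum_squares_bound[of "cmod G" V1] by simp
      moreover have "cmod G * (2 * pi * s * \<delta>) \<le> 1 * (2 * pi * s * \<delta>)"
        using V_bound[OF u, of l "F y"] \<delta>0[OF y(1)] s by (intro mult_right_mono) (auto simp: G_def)
      ultimately have "cmod G * (V1 + 2 * pi * s * \<delta>) \<le> (cmod G)\<^sup>2 / 2 + V1\<^sup>2 / 2 + 2 * pi * s * \<delta>"
        by (simp only: distrib_left)
      then have "measure N C * (cmod G * (V1 + 2 * pi * s * \<delta>)) \<le> measure N C * ((cmod G)\<^sup>2 / 2 + V1\<^sup>2 / 2 + 2 * pi * s * \<delta>)"
        by (rule mult_left_mono) simp
      then show ?thesis by (simp only: mult.left_commute)
    qed
    also have "\<dots> = (\<integral>x. indicator C x *\<^sub>R ((cmod G)\<^sup>2 / 2 + V1\<^sup>2 / 2 + 2 * pi * s * \<delta>) \<partial>N)"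
      using C by simp
    also have "\<dots> \<le> (\<integral>x. indicator C x * g x \<partial>N)"
    proof (rule integral_mono[OF _ ig])
      show "integrable N (\<lambda>x. indicator C x *\<^sub>R ((cmod G)\<^sup>2 / 2 + V1\<^sup>2 / 2 + 2 * pi * s * \<delta>))"
        using C by (intro integrable_mult_indicator) auto
    qed (auto simp: indicator_def g_def cellF V1 W_def)
    finally show ?thesis .
  qed
  moreover have "(\<integral>x. I x * f x \<partial>N) = (\<integral>x. indicator C x * f x \<partial>N)" "(\<integral>x. I x * g x \<partial>N) = (\<integral>x. indicator C x * g x \<partial>N)"
    using I_C by (auto intro!: Bochner_Integration.integral_cong)
  ultimately show ?thesis unfolding f_def g_def W_def by simp
qed

end

context base_b
begin

text \<open>\<open>compare_on_cell\<close> is summed over the cells inside \<open>U\<close> and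
  averaged over the level. By \<open>asymp_invariant_average\<close> each term tends to its space
  mean times the measure of \<open>U\<close>, which cancels. Half of the energy at s b^d on the
  right is absorbed on the left, which doubles the error terms.\<close>

lemma Phi_compare_step:
  fixes Ft Ft' :: "real \<Rightarrow> real"
  assumes der: "\<And>x. (Ft has_real_derivative Ft' x) (at x)"
    and F: "\<And>x. x \<in> {0..<1} \<Longrightarrow> F x = frac (Ft x)" "F \<in> measurable N N" "distr N N F = N"
    and L: "\<And>x. x \<in> {0..1} \<Longrightarrow> \<bar>Ft' x\<bar> < L"
    and \<tau>: "\<And>x. x \<in> {0..<1} \<Longrightarrow> cell q x = c0 \<Longrightarrow> \<bar>Ft' x - \<tau>\<bar> \<le> \<delta>"
    and s: "s > 0" and pos: "measure N (cell q -` {c0} \<inter> space N) > 0"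
  shows "Phi (s * real b ^ d) \<le> Phi (s * \<bar>\<tau>\<bar>) + 4 * pi * s * \<delta> + 2 * measure N (wrap_zone (L / real b ^ d))"
proof -
  define u where "u = char_fun (s * real b ^ d)"
  define v where "v = char_fun (s * \<bar>\<tau>\<bar>)"
  define Z where "Z = wrap_zone (L / real b ^ d)"
  define U where "U = cell q -` {c0} \<inter> space N"
  have U: "U \<in> sets N" unfolding U_def by (rule partition_cell_sets[OF cell_partition])
  have Z: "Z \<in> sets N" unfolding Z_def by (rule wrap_zone_sets)
  have tu: "test_fun u" and tv: "test_fun v" unfolding u_def v_def by (rule test_fun_char)+
  have um: "u \<in> borel_measurable N" unfolding u_def by (rule char_measurable)
  define w1 where "w1 l x = Re (u ((T ^^ l) x) * cnj (V u l x))" for l x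
  define w2 where "w2 l x = (cmod (V u l x))\<^sup>2" for l x
  define w3 where "w3 l x = (cmod (V v l x))\<^sup>2" for l x
  define w4 where "w4 l x = (indicator Z ((T ^^ l) x) :: real)" for l x
  have a1: "asymp_invariant w1"
  proof -
    have "asymp_invariant (\<lambda>l x. cnj (V u l x))"
      by (rule asymp_invariant_lipschitz[OF asymp_invariant_V[OF tu]])
         (auto simp flip: complex_cnj_diff intro: continuous_on_cnj continuous_on_id)
    then have "asymp_invariant (\<lambda>l x. u ((T ^^ l) x) * cnj (V u l x))"
      by (intro asymp_invariant_mult asymp_invariant_funpow um) (auto simp: u_def)
    then show ?thesis unfolding w1_def[abs_def]
    proof (rule asymp_invariant_lipschitz)
      show "norm (Re y - Re z) \<le> norm (y - z)" for y z
        using abs_Re_le_cmod[of "y - z"] by simp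
      show "norm (Re y) \<le> norm y" for y
        using abs_Re_le_cmod[of y] by simp
      show "continuous_on UNIV Re" by (rule continuous_on_Re[OF continuous_on_id])
    qed
  qed
  have asq: "asymp_invariant (\<lambda>l x. (cmod (V t l x))\<^sup>2)" if "test_fun t" for t
  proof -
    have "asymp_invariant (\<lambda>l x. cmod (V t l x))"
      by (rule asymp_invariant_lipschitz[OF asymp_invariant_V[OF that]])
         (auto intro: norm_triangle_ineq3 continuous_intros)
    then show ?thesis unfolding power2_eq_square by (intro asymp_invariant_mult)
  qed
  have a2: "asymp_invariant w2" unfolding w2_def[abs_def] by (rule asq[OF tu])
  have a3: "asymp_invariant w3" unfolding w3_def[abs_def] by (rule asq[OF tv])
  have a4: "asymp_invariant w4" unfolding w4_def[abs_def]
    by (rule asymp_invariant_funpow) (use Z in \<open>auto simp: indicator_def\<close>)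
  \<comment> \<open>Levels are shifted by q so that every cell of level l + q + d is either
    contained in \<open>U\<close> or disjoint from it.\<close>
  have i1: "(\<lambda>l. \<integral>x. w1 (l + q) x \<partial>N) \<longlonglongrightarrow> Phi (s * real b ^ d)"
    unfolding w1_def integral_V_cross[OF tu] Phi_def unfolding u_def
    by (rule LIMSEQ_ignore_initial_segment[OF E2_tendsto[OF test_fun_char]])
  have i2: "(\<lambda>l. \<integral>x. w2 (l + q) x \<partial>N) \<longlonglongrightarrow> Phi (s * real b ^ d)"
    unfolding w2_def E2_def[symmetric] Phi_def u_def
    by (rule LIMSEQ_ignore_initial_segment[OF E2_tendsto[OF test_fun_char]])
  have i3: "(\<lambda>l. \<integral>x. w3 (l + (q + d)) x \<partial>N) \<longlonglongrightarrow> Phi (s * \<bar>\<tau>\<bar>)"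
    unfolding w3_def E2_def[symmetric] Phi_def v_def
    by (rule LIMSEQ_ignore_initial_segment[OF E2_tendsto[OF test_fun_char]])
  have i4: "(\<lambda>l. \<integral>x. w4 (l + q) x \<partial>N) \<longlonglongrightarrow> measure N Z"
  proof -
    have "(\<integral>x. w4 l x \<partial>N) = (\<integral>x. indicator Z x \<partial>N)" for l
      unfolding w4_def by (rule integral_funpow[OF T_measurable T_distr]) (use Z in simp)
    then show ?thesis using Z by simp
  qed
  let ?avg = "\<lambda>w G n. (\<Sum>l<n. \<integral>x. indicator U x * w l (G x) \<partial>N) / real n"
  have id: "(\<lambda>x. x) \<in> measurable N N" "distr N N (\<lambda>x. x) = N" by (auto simp: distr_id)
  note l1 = asymp_invariant_average[OF asymp_invariant_shift[OF a1] i1 F(2,3) U]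
  note l2 = asymp_invariant_average[OF asymp_invariant_shift[OF a2] i2 F(2,3) U]
  note l3 = asymp_invariant_average[OF asymp_invariant_shift[OF a3] i3 id U]
  note l4 = asymp_invariant_average[OF asymp_invariant_shift[OF a4] i4 F(2,3) U]
  have meas: "w l \<in> borel_measurable N" and bound: "\<And>x. x \<in> space N \<Longrightarrow> \<bar>w l x\<bar> \<le> 1"
    if "asymp_invariant w" for w :: "nat \<Rightarrow> real \<Rightarrow> real" and l
    using that by (auto simp: asymp_invariant_def)
  have Fs: "F x \<in> space N" if "x \<in> space N" for x
    using measurable_space[OF F(2) that] .
  have intF: "integrable N (\<lambda>x. indicator A x * w l (F x))" if "A \<in> sets N" "asymp_invariant w" for A and w :: "nat \<Rightarrow> real \<Rightarrow> real" and l
  proof (rule integrable_bounded[where B = 1])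
    have [measurable]: "(\<lambda>x. w l (F x)) \<in> borel_measurable N"
      by (rule measurable_compose[OF F(2) meas[OF that(2)]])
    show "(\<lambda>x. indicator A x * w l (F x)) \<in> borel_measurable N" using that(1) by measurable
    show "norm (indicator A x * w l (F x)) \<le> 1" if "x \<in> space N" for x
      using bound[OF \<open>asymp_invariant w\<close> Fs[OF that]] by (auto simp: indicator_def)
  qed
  have int0: "integrable N (\<lambda>x. indicator A x * w l x)" if "A \<in> sets N" "asymp_invariant w" for A and w :: "nat \<Rightarrow> real \<Rightarrow> real" and l
  proof (rule integrable_bounded[where B = 1])
    have [measurable]: "w l \<in> borel_measurable N" by (rule meas[OF that(2)])
    show "(\<lambda>x. indicator A x * w l x) \<in> borel_measurable N" using that(1) by measurable
    show "norm (indicator A x * w l x) \<le> 1" if "x \<in> space N" for x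
      using bound[OF \<open>asymp_invariant w\<close> that] by (auto simp: indicator_def)
  qed
  have ineq: "(\<integral>x. indicator U x * w1 (l + q) (F x) \<partial>N)
      \<le> (\<integral>x. indicator U x * w2 (l + q) (F x) \<partial>N) / 2 + (\<integral>x. indicator U x * w3 (l + (q + d)) x \<partial>N) / 2
        + 2 * pi * s * \<delta> * measure N U + (\<integral>x. indicator U x * w4 (l + q) (F x) \<partial>N)" for l
  proof -
    define m where "m = l + q"
    define g where "g x = w2 m (F x) / 2 + w3 (m + d) x / 2 + 2 * pi * s * \<delta> + w4 m (F x)" for x
    have split: "indicator U x * g x = indicator U x * w2 m (F x) / 2 + indicator U x * w3 (m + d) x / 2
        + 2 * pi * s * \<delta> * indicator U x + indicator U x * w4 m (F x)" for x
      by (simp add: g_def algebra_simps)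
    have iUg: "integrable N (\<lambda>x. indicator U x * g x)"
      unfolding split using U intF[OF U a2] intF[OF U a4] int0[OF U a3]
      by (intro Bochner_Integration.integrable_add integrable_mult_right integrable_divide) (auto simp: less_top[symmetric])
    have "(\<integral>x. indicator U x * w1 m (F x) \<partial>N)
      = (\<Sum>c\<in>cell (m + d) ` space N. \<integral>x. indicator (cell (m + d) -` {c}) x *\<^sub>R (indicator U x * w1 m (F x)) \<partial>N)"
      by (rule integral_partition[OF cell_partition intF[OF U a1]])
    also have "\<dots> \<le> (\<Sum>c\<in>cell (m + d) ` space N. \<integral>x. indicator (cell (m + d) -` {c}) x *\<^sub>R (indicator U x * g x) \<partial>N)"
    proof (rule sum_mono)
      fix c assume "c \<in> cell (m + d) ` space N"
      have qm: "q \<le> m + d" by (simp add: m_def)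
      have Ux: "x \<in> U \<longleftrightarrow> c div int b ^ (m + d - q) = c0" if "x \<in> space N" "cell (m + d) x = c" for x
        using cell_add_div[of q x "m + d - q"] qm that by (simp add: U_def)
      show "(\<integral>x. indicator (cell (m + d) -` {c}) x *\<^sub>R (indicator U x * w1 m (F x)) \<partial>N)
          \<le> (\<integral>x. indicator (cell (m + d) -` {c}) x *\<^sub>R (indicator U x * g x) \<partial>N)"
      proof (cases "c div int b ^ (m + d - q) = c0")
        case True
        have "(\<integral>x. indicator (cell (m + d) -` {c}) x *\<^sub>R (indicator U x * w1 m (F x)) \<partial>N)
            = (\<integral>x. indicator (cell (m + d) -` {c}) x * w1 m (F x) \<partial>N)"
          by (rule Bochner_Integration.integral_cong) (use Ux True in \<open>auto simp: indicator_def\<close>)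
        also have "\<dots> \<le> (\<integral>x. indicator (cell (m + d) -` {c}) x * g x \<partial>N)"
          unfolding w1_def g_def w2_def w3_def w4_def u_def v_def Z_def
          by (rule compare_on_cell[OF der F(1,2) L \<tau> s qm True])
        also have "\<dots> = (\<integral>x. indicator (cell (m + d) -` {c}) x *\<^sub>R (indicator U x * g x) \<partial>N)"
          by (rule Bochner_Integration.integral_cong) (use Ux True in \<open>auto simp: indicator_def\<close>)
        finally show ?thesis .
      next
        case False
        then have "(\<integral>x. indicator (cell (m + d) -` {c}) x *\<^sub>R (indicator U x * f x) \<partial>N) = (\<integral>x. 0 \<partial>N)" for f :: "real \<Rightarrow> real"
          by (intro Bochner_Integration.integral_cong) (use Ux in \<open>auto simp: indicator_def\<close>)
        then show ?thesis by simp
      qed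
    qed
    also have "\<dots> = (\<integral>x. indicator U x * g x \<partial>N)"
      by (rule integral_partition[OF cell_partition iUg, symmetric])
    also have "\<dots> = (\<integral>x. indicator U x * w2 m (F x) \<partial>N) / 2 + (\<integral>x. indicator U x * w3 (m + d) x \<partial>N) / 2
        + 2 * pi * s * \<delta> * measure N U + (\<integral>x. indicator U x * w4 m (F x) \<partial>N)"
    proof -
      have iU: "integrable N (\<lambda>x. 2 * pi * s * \<delta> * indicator U x)"
        using U by (intro integrable_mult_right) (auto simp: less_top[symmetric])
      have "(\<integral>x. 2 * pi * s * \<delta> * indicator U x \<partial>N) = 2 * pi * s * \<delta> * measure N U"
        using U by simp
      then show ?thesis
        unfolding split using iU intF[OF U a2, of m] intF[OF U a4, of m] int0[OF U a3, of "m + d"]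
        by (simp only: Bochner_Integration.integral_add Bochner_Integration.integrable_add integrable_divide integral_divide_zero)
    qed
    finally show ?thesis unfolding m_def by (simp add: add.assoc)
  qed
  have "Phi (s * real b ^ d) * measure N U \<le> Phi (s * real b ^ d) * measure N U / 2 + Phi (s * \<bar>\<tau>\<bar>) * measure N U / 2
      + 2 * pi * s * \<delta> * measure N U + measure N Z * measure N U"
  proof (rule LIMSEQ_le[OF l1])
    show "(\<lambda>n. ?avg (\<lambda>l. w2 (l + q)) F n / 2 + ?avg (\<lambda>l. w3 (l + (q + d))) (\<lambda>x. x) n / 2
        + 2 * pi * s * \<delta> * measure N U + ?avg (\<lambda>l. w4 (l + q)) F n)
      \<longlonglongrightarrow> Phi (s * real b ^ d) * measure N U / 2 + Phi (s * \<bar>\<tau>\<bar>) * measure N U / 2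
        + 2 * pi * s * \<delta> * measure N U + measure N Z * measure N U"
      by (intro tendsto_intros l2 l3 l4) simp_all
    show "\<exists>n0. \<forall>n\<ge>n0. ?avg (\<lambda>l. w1 (l + q)) F n \<le> ?avg (\<lambda>l. w2 (l + q)) F n / 2
        + ?avg (\<lambda>l. w3 (l + (q + d))) (\<lambda>x. x) n / 2 + 2 * pi * s * \<delta> * measure N U + ?avg (\<lambda>l. w4 (l + q)) F n"
    proof (intro exI[of _ 1] allI impI)
      fix n :: nat assume n: "n \<ge> 1"
      define S where "S w G = (\<Sum>l<n. \<integral>x. indicator U x * w l (G x) \<partial>N)" for w :: "nat \<Rightarrow> real \<Rightarrow> real" and G
      have "S (\<lambda>l. w1 (l + q)) F \<le> (\<Sum>l<n. (\<integral>x. indicator U x * w2 (l + q) (F x) \<partial>N) / 2 + (\<integral>x. indicator U x * w3 (l + (q + d)) x \<partial>N) / 2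
        + 2 * pi * s * \<delta> * measure N U + (\<integral>x. indicator U x * w4 (l + q) (F x) \<partial>N))"
        unfolding S_def by (rule sum_mono) (rule ineq)
      also have "\<dots> = S (\<lambda>l. w2 (l + q)) F / 2 + S (\<lambda>l. w3 (l + (q + d))) (\<lambda>x. x) / 2
        + real n * (2 * pi * s * \<delta> * measure N U) + S (\<lambda>l. w4 (l + q)) F"
        unfolding S_def sum.distrib sum_divide_distrib by simp
      finally have "S (\<lambda>l. w1 (l + q)) F / real n \<le> (S (\<lambda>l. w2 (l + q)) F / 2 + S (\<lambda>l. w3 (l + (q + d))) (\<lambda>x. x) / 2
        + real n * (2 * pi * s * \<delta> * measure N U) + S (\<lambda>l. w4 (l + q)) F) / real n"
        by (rule divide_right_mono) simp
      also have "\<dots> = S (\<lambda>l. w2 (l + q)) F / real n / 2 + S (\<lambda>l. w3 (l + (q + d))) (\<lambda>x. x) / real n / 2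
        + 2 * pi * s * \<delta> * measure N U + S (\<lambda>l. w4 (l + q)) F / real n"
        using n by (simp add: add_divide_distrib)
      finally show "?avg (\<lambda>l. w1 (l + q)) F n \<le> ?avg (\<lambda>l. w2 (l + q)) F n / 2
        + ?avg (\<lambda>l. w3 (l + (q + d))) (\<lambda>x. x) n / 2 + 2 * pi * s * \<delta> * measure N U + ?avg (\<lambda>l. w4 (l + q)) F n"
        unfolding S_def .
    qed
  qed
  also have "\<dots> = (Phi (s * real b ^ d) / 2 + Phi (s * \<bar>\<tau>\<bar>) / 2 + 2 * pi * s * \<delta> + measure N Z) * measure N U"
    by (simp add: algebra_simps)
  finally have "Phi (s * real b ^ d) \<le> Phi (s * real b ^ d) / 2 + Phi (s * \<bar>\<tau>\<bar>) / 2 + 2 * pi * s * \<delta> + measure N Z"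
    using pos unfolding U_def[symmetric] by (simp only: mult_le_cancel_right_pos)
  then show ?thesis unfolding Z_def by simp
qed

text \<open>The zones decrease to a subset of the massless point 0.\<close>

lemma wrap_zone_tendsto_0:
  assumes "measure N {0} = 0" "L > 0"
  shows "(\<lambda>d. measure N (wrap_zone (L / real b ^ d))) \<longlonglongrightarrow> 0"
proof -
  have lim: "(\<lambda>d. L / real b ^ d) \<longlonglongrightarrow> 0"
    using b by (intro LIMSEQ_divide_realpow_zero) auto
  have "(\<lambda>d. measure N (wrap_zone (L / real b ^ d))) \<longlonglongrightarrow> measure N (\<Inter>d. wrap_zone (L / real b ^ d))"
  proof (rule finite_Lim_measure_decseq)
    show "range (\<lambda>d. wrap_zone (L / real b ^ d)) \<subseteq> sets N" using wrap_zone_sets by auto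
    show "decseq (\<lambda>d. wrap_zone (L / real b ^ d))"
    proof (rule decseq_SucI)
      fix d
      have "L / real b ^ Suc d \<le> L / real b ^ d"
        using assms(2) b bpos(2)[of d] by (intro divide_left_mono) auto
      then show "wrap_zone (L / real b ^ Suc d) \<subseteq> wrap_zone (L / real b ^ d)"
        by (auto simp: wrap_zone_def)
    qed
  qed
  moreover have "(\<Inter>d. wrap_zone (L / real b ^ d)) \<subseteq> {0}"
  proof
    fix x assume x: "x \<in> (\<Inter>d. wrap_zone (L / real b ^ d))"
    then have x01: "x \<in> {0..<1}" by (auto simp: wrap_zone_def)
    show "x \<in> {0}"
    proof (rule ccontr)
      assume "x \<notin> {0}"
      then have "min x (1 - x) > 0" using x01 by auto
      then have "\<forall>\<^sub>F d in sequentially. L / real b ^ d < min x (1 - x)"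
        by (rule order_tendstoD[OF lim])
      then obtain d where "L / real b ^ d < min x (1 - x)" by (auto simp: eventually_sequentially)
      moreover have "x \<in> wrap_zone (L / real b ^ d)" using x by auto
      ultimately show False by (auto simp: wrap_zone_def)
    qed
  qed
  then have "measure N (\<Inter>d. wrap_zone (L / real b ^ d)) \<le> measure N {0}"
    by (rule finite_measure_mono) (auto simp: sets_N sets_restrict_space_iff)
  ultimately show ?thesis using assms(1) by (simp add: measure_le_0_iff)
qed

text \<open>Two limits in a fixed order: for given d the cell around \<open>y0\<close> shrinks,
  which sends the slope error \<delta> to 0; only then d grows, and the wrap zone
  disappears.\<close>

theorem Phi_compare:
  fixes Ft Ft' :: "real \<Rightarrow> real"
  assumes der: "\<And>x. (Ft has_real_derivative Ft' x) (at x)" and cont: "continuous_on UNIV Ft'"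
    and F: "\<And>x. x \<in> {0..<1} \<Longrightarrow> F x = frac (Ft x)" "F \<in> measurable N N" "distr N N F = N"
    and y0: "y0 \<in> {0..<1}" "\<And>q. measure N (cell q -` {cell q y0} \<inter> space N) > 0"
    and N0: "measure N {0} = 0" and s: "s > 0" and \<epsilon>: "\<And>d. \<epsilon> \<le> Phi (s * real b ^ d)"
  shows "\<epsilon> \<le> Phi (s * \<bar>Ft' y0\<bar>)"
proof -
  have "bounded (Ft' ` {0..1})"
    by (intro compact_imp_bounded compact_continuous_image continuous_on_subset[OF cont]) auto
  then obtain L0 where "\<forall>y\<in>Ft' ` {0..1}. norm y \<le> L0"
    unfolding bounded_iff by blast
  then have L0: "\<bar>Ft' x\<bar> \<le> L0" if "x \<in> {0..1}" for x using that by auto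
  define L where "L = \<bar>L0\<bar> + 1"
  have L: "\<bar>Ft' x\<bar> < L" if "x \<in> {0..1}" for x using L0[OF that] by (simp add: L_def)
  have step: "\<epsilon> \<le> Phi (s * \<bar>Ft' y0\<bar>) + 2 * measure N (wrap_zone (L / real b ^ d))" for d
  proof (rule field_le_epsilon)
    fix e :: real assume e: "e > 0"
    define \<delta> where "\<delta> = e / (4 * pi * s)"
    have \<delta>: "\<delta> > 0" using e s by (simp add: \<delta>_def)
    have "isCont Ft' y0" using cont by (simp add: continuous_on_eq_continuous_at)
    then obtain \<eta> where \<eta>: "\<eta> > 0" "\<And>x. \<bar>x - y0\<bar> < \<eta> \<Longrightarrow> \<bar>Ft' x - Ft' y0\<bar> < \<delta>"
      using \<delta> unfolding continuous_at_eps_delta dist_real_def by meson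
    have "(\<lambda>q. 1 / real b ^ q) \<longlonglongrightarrow> 0"
      using b by (intro LIMSEQ_divide_realpow_zero) auto
    then have "\<forall>\<^sub>F q in sequentially. 1 / real b ^ q < \<eta>" using \<eta>(1) by (rule order_tendstoD)
    then obtain q where q: "1 / real b ^ q < \<eta>" by (auto simp: eventually_sequentially)
    have \<tau>: "\<bar>Ft' x - Ft' y0\<bar> \<le> \<delta>" if "x \<in> {0..<1}" "cell q x = cell q y0" for x
      using \<eta>(2)[of x] cell_eq_near[OF that(1) y0(1) that(2)] q by linarith
    have "\<epsilon> \<le> Phi (s * real b ^ d)" by (rule \<epsilon>)
    also have "\<dots> \<le> Phi (s * \<bar>Ft' y0\<bar>) + 4 * pi * s * \<delta> + 2 * measure N (wrap_zone (L / real b ^ d))"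
      by (rule Phi_compare_step[OF der F L \<tau> s y0(2)])
    finally show "\<epsilon> \<le> Phi (s * \<bar>Ft' y0\<bar>) + 2 * measure N (wrap_zone (L / real b ^ d)) + e"
      using s by (simp add: \<delta>_def)
  qed
  have "(\<lambda>d. Phi (s * \<bar>Ft' y0\<bar>) + 2 * measure N (wrap_zone (L / real b ^ d))) \<longlonglongrightarrow> Phi (s * \<bar>Ft' y0\<bar>) + 2 * 0"
    by (intro tendsto_intros wrap_zone_tendsto_0 N0) (simp add: L_def)
  then show ?thesis using step by (intro LIMSEQ_le_const) auto
qed

end

subsection \<open>Entropy\<close>

text \<open>Orthogonality of the characters of Z/B, which is the vanishing geometric sum of a
  nontrivial B-th root of unity.\<close>

lemma parseval_finite:
  fixes P :: "nat \<Rightarrow> complex"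
  assumes B: "B > 0"
  shows "(\<Sum>i<B. (cmod (\<Sum>j<B. P j * ee (real i * real j / real B)))\<^sup>2) = real B * (\<Sum>j<B. (cmod (P j))\<^sup>2)"
proof -
  have orth: "(\<Sum>i<B. ee (real i * (real j - real k) / real B)) = (if j = k then of_nat B else 0)"
    if "j < B" "k < B" for j k
  proof (cases "j = k")
    case False
    define z where "z = ee ((real j - real k) / real B)"
    have zi: "ee (real i * (real j - real k) / real B) = z ^ i" for i
      unfolding z_def ee_def Complex.DeMoivre by (intro arg_cong[where f = cis]) (simp add: field_simps)
    have "z \<noteq> 1"
    proof
      assume "z = 1"
      then have "cis (2 * pi * ((real j - real k) / real B)) = 1" by (simp add: z_def ee_def)
      then obtain n :: int where "2 * pi * ((real j - real k) / real B) = of_int n * (2 * pi)"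
        unfolding cis_conv_exp exp_eq_1 by (auto simp: mult_ac)
      then have "(2 * pi) * ((real j - real k) / real B) = (2 * pi) * of_int n"
        by (simp only: mult.commute)
      then have "(real j - real k) / real B = of_int n"
        by (rule mult_left_cancel[THEN iffD1, rotated]) simp
      then have "real j - real k = of_int n * real B" using B by (simp add: field_simps)
      then have "real_of_int (int j - int k) = real_of_int (n * int B)" by simp
      then have eq: "int j - int k = n * int B" by (simp only: of_int_eq_iff)
      have "\<bar>int j - int k\<bar> < int B" using that by auto
      then have "\<bar>n\<bar> * int B < 1 * int B" unfolding eq abs_mult by simp
      then have "n = 0" using B by (simp only: mult_less_cancel_right) auto
      then show False using eq False by simp
    qed
    have "z ^ B = 1"
    proof -
      have "z ^ B = ee (real B * (real j - real k) / real B)" by (rule zi[symmetric])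
      also have "\<dots> = 1" using B by (auto intro!: ee_int)
      finally show ?thesis .
    qed
    then have "(\<Sum>i<B. z ^ i) = 0"
      using \<open>z \<noteq> 1\<close> by (simp add: geometric_sum)
    then show ?thesis using False by (simp add: zi)
  qed simp
  have "complex_of_real (\<Sum>i<B. (cmod (\<Sum>j<B. P j * ee (real i * real j / real B)))\<^sup>2)
      = (\<Sum>i<B. (\<Sum>j<B. P j * ee (real i * real j / real B)) * cnj (\<Sum>k<B. P k * ee (real i * real k / real B)))"
    by (simp only: of_real_sum complex_norm_square)
  also have "\<dots> = (\<Sum>i<B. \<Sum>j<B. \<Sum>k<B. P j * cnj (P k) * ee (real i * (real j - real k) / real B))"
    unfolding cnj_sum sum_product
    by (intro sum.cong refl)
       (simp add: mult_ac diff_divide_distrib right_diff_distrib flip: ee_minus ee_add)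
  also have "\<dots> = (\<Sum>j<B. \<Sum>k<B. P j * cnj (P k) * (\<Sum>i<B. ee (real i * (real j - real k) / real B)))"
    unfolding sum_distrib_left by (subst sum.swap) (intro sum.cong refl sum.swap)
  also have "\<dots> = (\<Sum>j<B. \<Sum>k<B. if k = j then P j * cnj (P k) * of_nat B else 0)"
    by (intro sum.cong refl) (simp add: orth)
  also have "\<dots> = (\<Sum>j<B. P j * cnj (P j) * of_nat B)"
    by (intro sum.cong refl) (simp add: sum.delta)
  also have "\<dots> = complex_of_real (real B * (\<Sum>j<B. (cmod (P j))\<^sup>2))"
    by (simp add: sum_distrib_left mult_ac flip: complex_norm_square)
  finally show ?thesis by (simp only: of_real_eq_iff)
qed

section \<open>Digit blocks and their conditional probabilities\<close>

context base_b
begin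

definition mass :: "nat \<Rightarrow> real \<Rightarrow> real" where
  "mass m x = measure N (cell m -` {cell m x} \<inter> space N)"

text \<open>Complex-valued so that \<open>V\<close> and \<open>E2\<close> apply to it.\<close>

definition digit_ind :: "nat \<Rightarrow> nat \<Rightarrow> real \<Rightarrow> complex" where
  "digit_ind p c x = indicator {x. cell p x = int c} x"

text \<open>The conditional probability of the next \<open>p\<close> digits given the first \<open>m\<close>.\<close>

definition next_prob :: "nat \<Rightarrow> nat \<Rightarrow> real \<Rightarrow> real" where
  "next_prob p m x = (\<Sum>c<b ^ p. Re (digit_ind p c ((T ^^ m) x) * cnj (V (digit_ind p c) m x)))"

text \<open>The expected sum of squared conditional probabilities of p-blocks given m digits, that
  is the probability that two independent continuations of a common past agree.\<close>

definition Qm :: "nat \<Rightarrow> nat \<Rightarrow> real" where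
  "Qm p m = (\<Sum>c<b ^ p. E2 (digit_ind p c) m)"

lemma test_fun_digit: "test_fun (digit_ind p c)"
proof -
  have "digit_ind p c = (\<lambda>x. (\<lambda>k. if k = int c then 1 else 0) (cell p x))"
    by (auto simp: digit_ind_def indicator_def)
  then have "digit_ind p c \<in> borel_measurable N"
    by (simp only:) (rule measurable_partition_comp[OF cell_measurable, where g = "\<lambda>k. if k = int c then 1 else 0"])
  then show ?thesis by (auto simp: test_fun_def digit_ind_def indicator_def)
qed

text \<open>An integer is determined by its quotient and remainder modulo b^p.\<close>

lemma cell_split_iff:
  assumes "x \<in> space N" "y \<in> space N"
  shows "cell m y = cell m x \<and> cell p ((T ^^ m) y) = cell p ((T ^^ m) x) \<longleftrightarrow> cell (m + p) y = cell (m + p) x"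
proof -
  have s: "cell p ((T ^^ m) z) = cell (m + p) z mod int b ^ p" "cell m z = cell (m + p) z div int b ^ p" if "z \<in> space N" for z
    using cell_shift[of z p m] cell_add_div[of m z p] that by (simp_all add: space_N add.commute)
  show ?thesis unfolding s[OF assms(1)] s[OF assms(2)] by (metis div_mult_mod_eq)
qed

lemma V_digit:
  "V (digit_ind p c) m x
    = of_real (measure N {y \<in> space N. cell m y = cell m x \<and> cell p ((T ^^ m) y) = int c} / mass m x)"
proof -
  have S: "{y \<in> space N. cell m y = cell m x \<and> cell p ((T ^^ m) y) = int c} \<in> sets N" (is "?S \<in> _")
  proof -
    have "?S = (cell m -` {cell m x} \<inter> space N) \<inter> ((\<lambda>y. cell p ((T ^^ m) y)) -` {int c} \<inter> space N)" by auto
    then show ?thesis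
      using partition_cell_sets[OF cell_partition] partition_cell_sets[OF cell_comp_partition] by auto
  qed
  have "(\<integral>y. indicator (cell m -` {cell m x}) y *\<^sub>R digit_ind p c ((T ^^ m) y) \<partial>N) = (\<integral>y. of_real (indicator ?S y) \<partial>N)"
    by (rule Bochner_Integration.integral_cong) (auto simp: digit_ind_def indicator_def)
  also have "\<dots> = of_real (measure N ?S)"
    using S by simp
  finally show ?thesis by (simp add: V_def cell_exp_def mass_def)
qed

lemma next_prob_eq:
  assumes x: "x \<in> space N"
  shows "next_prob p m x = mass (m + p) x / mass m x"
proof -
  have "(T ^^ m) x \<in> {0..<1}" using funpow_in_space[OF T_measurable x] by (simp add: space_N)
  then obtain c where c: "cell p ((T ^^ m) x) = int c" "c < b ^ p"
    using cell_range[of "(T ^^ m) x" p] by (metis atLeastLessThan_iff of_nat_less_iff of_nat_power zero_le_imp_eq_int)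
  have "next_prob p m x = (\<Sum>k\<in>{c}. Re (digit_ind p k ((T ^^ m) x) * cnj (V (digit_ind p k) m x)))"
    unfolding next_prob_def
    by (rule sum.mono_neutral_right) (use c in \<open>auto simp: digit_ind_def indicator_def\<close>)
  also have "\<dots> = measure N {y \<in> space N. cell m y = cell m x \<and> cell p ((T ^^ m) y) = int c} / mass m x"
    using c by (simp add: digit_ind_def V_digit)
  also have "{y \<in> space N. cell m y = cell m x \<and> cell p ((T ^^ m) y) = int c} = cell (m + p) -` {cell (m + p) x} \<inter> space N"
    using cell_split_iff[OF x, of _ m p] unfolding c(1) by blast
  finally show ?thesis by (simp add: mass_def)
qed

lemma mass_nonneg: "mass m x \<ge> 0" by (simp add: mass_def)

lemma mass_antimono: "mass (m + p) x \<le> mass m x"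
proof -
  have "cell (m + p) -` {cell (m + p) x} \<inter> space N \<subseteq> cell m -` {cell m x} \<inter> space N"
    using cell_add_div[of m _ p] by auto
  then show ?thesis
    unfolding mass_def by (intro finite_measure_mono partition_cell_sets[OF cell_partition])
qed

lemma next_prob_bounds:
  assumes "x \<in> space N"
  shows "0 \<le> next_prob p m x" "next_prob p m x \<le> 1"
  unfolding next_prob_eq[OF assms]
  using mass_antimono[of m p x] mass_nonneg[of m x] mass_nonneg[of "m + p" x]
  by (auto simp: divide_le_eq_1)

text \<open>Chain rule for conditional probabilities. If an intermediate cell is null, so are its
  subcells, and both sides are 0.\<close>

lemma next_prob_mult:
  assumes "x \<in> space N"
  shows "next_prob j m x * next_prob p (m + j) x = next_prob (j + p) m x"
  unfolding next_prob_eq[OF assms]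
  using mass_antimono[of "m + j" p x] mass_nonneg[of "m + j + p" x] by (auto simp: add.assoc)

lemma next_prob_antimono:
  assumes "x \<in> space N"
  shows "next_prob (j + p) m x \<le> next_prob j m x"
  using next_prob_bounds[OF assms] unfolding next_prob_mult[OF assms, symmetric]
  by (simp add: mult_left_le)

text \<open>A finite sum of real parts of products of a shifted indicator with a conjugated
  \<open>V\<close>, each asymptotically invariant by the closure properties; the tolerance is split
  among the b^p blocks.\<close>

lemma asymp_invariant_next_prob: "asymp_invariant (next_prob p)"
proof -
  define w where "w c m x = Re (digit_ind p c ((T ^^ m) x) * cnj (V (digit_ind p c) m x))" for c m x
  have aw: "asymp_invariant (w c)" for c
  proof -
    have "asymp_invariant (\<lambda>l x. cnj (V (digit_ind p c) l x))"
      by (rule asymp_invariant_lipschitz[OF asymp_invariant_V[OF test_fun_digit]])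
         (auto simp flip: complex_cnj_diff intro: continuous_on_cnj continuous_on_id)
    then have "asymp_invariant (\<lambda>l x. digit_ind p c ((T ^^ l) x) * cnj (V (digit_ind p c) l x))"
      using test_fun_digit[of p c] by (intro asymp_invariant_mult asymp_invariant_funpow) (auto simp: test_fun_def)
    then show ?thesis unfolding w_def[abs_def]
    proof (rule asymp_invariant_lipschitz)
      show "norm (Re y - Re z) \<le> norm (y - z)" for y z
        using abs_Re_le_cmod[of "y - z"] by simp
      show "norm (Re y) \<le> norm y" for y
        using abs_Re_le_cmod[of y] by simp
      show "continuous_on UNIV Re" by (rule continuous_on_Re[OF continuous_on_id])
    qed
  qed
  have np: "next_prob p m x = (\<Sum>c<b ^ p. w c m x)" for m x
    by (simp add: next_prob_def w_def)
  have wm[measurable]: "w c m \<in> borel_measurable N" for c m using aw by (auto simp: asymp_invariant_def)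
  have wb: "\<bar>w c m x\<bar> \<le> 1" if "x \<in> space N" for c m x using aw that by (auto simp: asymp_invariant_def)
  show ?thesis unfolding asymp_invariant_def
  proof (intro conjI allI impI ballI)
    show "next_prob p m \<in> borel_measurable N" for m unfolding np by measurable
    show "norm (next_prob p m x) \<le> 1" if "x \<in> space N" for m x using next_prob_bounds[OF that] by simp
    fix e :: real assume e: "e > 0"
    define n where "n = b ^ p"
    have n: "n > 0" using b by (simp add: n_def)
    have "\<forall>c. \<exists>m0. \<forall>m\<ge>m0. \<forall>j. (\<integral>x. \<bar>w c (m + j) x - w c m ((T ^^ j) x)\<bar> \<partial>N) \<le> e / real n"
      using aw e n unfolding asymp_invariant_def real_norm_def by (meson divide_pos_pos of_nat_0_less_iff)
    then obtain M where M: "\<And>c m j. m \<ge> M c \<Longrightarrow> (\<integral>x. \<bar>w c (m + j) x - w c m ((T ^^ j) x)\<bar> \<partial>N) \<le> e / real n"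
      by metis
    define m0 where "m0 = (\<Sum>c<n. M c)"
    have m0: "M c \<le> m0" if "c < n" for c
      unfolding m0_def using that by (intro member_le_sum) auto
    show "\<exists>m0. \<forall>m\<ge>m0. \<forall>j. (\<integral>x. norm (next_prob p (m + j) x - next_prob p m ((T ^^ j) x)) \<partial>N) \<le> e"
    proof (intro exI[of _ m0] allI impI)
      fix m j assume m: "m0 \<le> m"
      have [measurable]: "(\<lambda>x. w c m ((T ^^ j) x)) \<in> borel_measurable N" for c
        by (rule measurable_compose[OF Tn_measurable]) simp
      have int: "integrable N (\<lambda>x. \<bar>w c (m + j) x - w c m ((T ^^ j) x)\<bar>)" for c
      proof (rule integrable_bounded[where B = 2])
        show "norm \<bar>w c (m + j) x - w c m ((T ^^ j) x)\<bar> \<le> 2" if "x \<in> space N" for x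
          using wb[OF that, of c "m + j"] wb[OF funpow_in_space[OF T_measurable that], of c m j] by simp
      qed measurable
      have "(\<integral>x. norm (next_prob p (m + j) x - next_prob p m ((T ^^ j) x)) \<partial>N)
          \<le> (\<integral>x. (\<Sum>c<n. \<bar>w c (m + j) x - w c m ((T ^^ j) x)\<bar>) \<partial>N)"
        unfolding np n_def[symmetric] sum_subtractf[symmetric] real_norm_def
        using int by (intro integral_mono' Bochner_Integration.integrable_sum sum_abs) (auto intro: sum_nonneg)
      also have "\<dots> = (\<Sum>c<n. \<integral>x. \<bar>w c (m + j) x - w c m ((T ^^ j) x)\<bar> \<partial>N)"
        using int by (rule Bochner_Integration.integral_sum)
      also have "\<dots> \<le> (\<Sum>c<n. e / real n)"
        using m0 m by (intro sum_mono M) (auto intro: order_trans)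
      also have "\<dots> = e" using n by simp
      finally show "(\<integral>x. norm (next_prob p (m + j) x - next_prob p m ((T ^^ j) x)) \<partial>N) \<le> e" .
    qed
  qed
qed

lemma next_prob_measurable [measurable]: "next_prob p m \<in> borel_measurable N"
  using asymp_invariant_next_prob by (auto simp: asymp_invariant_def)

lemma next_prob_integrable: "integrable N (next_prob p m)"
  by (rule integrable_bounded[where B = 1]) (use next_prob_bounds in auto)

lemma integral_next_prob: "(\<integral>x. next_prob p m x \<partial>N) = Qm p m"
proof -
  have "integrable N (\<lambda>x. Re (digit_ind p c ((T ^^ m) x) * cnj (V (digit_ind p c) m x)))" for c
  proof (rule integrable_Re, rule integrable_bounded[where B = 1])
    have "(\<lambda>x. digit_ind p c ((T ^^ m) x)) \<in> borel_measurable N" by (rule test_fun_shift[OF test_fun_digit])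
    then show "(\<lambda>x. digit_ind p c ((T ^^ m) x) * cnj (V (digit_ind p c) m x)) \<in> borel_measurable N"
      by (intro borel_measurable_times borel_measurable_cnj V_measurable)
    show "cmod (digit_ind p c ((T ^^ m) x) * cnj (V (digit_ind p c) m x)) \<le> 1" if "x \<in> space N" for x
      unfolding norm_mult complex_mod_cnj
      by (intro mult_le_one test_fun_shift(2)[OF test_fun_digit that] V_bound[OF test_fun_digit] norm_ge_zero)
  qed
  then show ?thesis
    unfolding next_prob_def Qm_def by (simp only: Bochner_Integration.integral_sum integral_V_cross[OF test_fun_digit])
qed

lemma Qm_incseq: "incseq (Qm p)"
  unfolding Qm_def incseq_def
  by (auto intro!: sum_mono incseqD[OF E2_incseq[OF test_fun_digit]])

definition Qlim :: "nat \<Rightarrow> real" where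
  "Qlim p = (\<Sum>c<b ^ p. E2lim (digit_ind p c))"

lemma Qm_tendsto: "Qm p \<longlonglongrightarrow> Qlim p"
  unfolding Qm_def[abs_def] Qlim_def by (intro tendsto_sum E2_tendsto test_fun_digit)

lemma Qm_le_Qlim: "Qm p m \<le> Qlim p"
  using incseq_le[OF Qm_incseq Qm_tendsto] .

lemma Qm_bounds: "0 \<le> Qm p m" "Qm p m \<le> 1"
proof -
  show "0 \<le> Qm p m" unfolding Qm_def by (intro sum_nonneg E2_nonneg)
  have "norm (\<integral>x. next_prob p m x \<partial>N) \<le> 1"
    by (rule integral_norm_bounded) (use next_prob_bounds in auto)
  then show "Qm p m \<le> 1" by (simp add: integral_next_prob)
qed

lemma Qlim_le_1: "Qlim p \<le> 1"
  by (rule LIMSEQ_le_const2[OF Qm_tendsto]) (auto intro!: exI[of _ 0] Qm_bounds)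

lemma Qm_antimono: "Qm (j + p) m \<le> Qm j m"
  unfolding integral_next_prob[symmetric]
  by (intro integral_mono next_prob_integrable next_prob_antimono)

lemma Qlim_antimono: "Qlim (j + p) \<le> Qlim j"
  using Qm_antimono by (intro LIMSEQ_le[OF Qm_tendsto Qm_tendsto]) auto

lemma Qlim_nonneg: "0 \<le> Qlim p"
  using Qm_bounds(1)[of p 0] Qm_le_Qlim[of p 0] by linarith

text \<open>If the next digit is not determined by the past, then by ergodicity it is undetermined
  infinitely often along almost every orbit, so long blocks have small conditional probability.\<close>

lemma Qlim_dichotomy_bound:
  assumes \<beta>: "\<And>p. \<beta> \<le> Qlim p"
  shows "(1 - Qlim 1) * Qlim p \<le> Qlim p - \<beta>"
proof (rule field_le_epsilon)
  fix e :: real assume e: "e > 0"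
  define r where "r m x = 1 - next_prob 1 m x" for m x
  have [measurable]: "r m \<in> borel_measurable N" for m unfolding r_def[abs_def] by measurable
  have rb: "0 \<le> r m x" "r m x \<le> 1" if "x \<in> space N" for m x
    using next_prob_bounds[OF that, of 1 m] by (auto simp: r_def)
  have e5: "e / 5 > 0" using e by simp
  obtain m1 where m1: "\<And>m j. m \<ge> m1 \<Longrightarrow> (\<integral>x. \<bar>next_prob p (m + j) x - next_prob p m ((T ^^ j) x)\<bar> \<partial>N) \<le> e / 5"
    using asymp_invariant_next_prob e5 unfolding asymp_invariant_def real_norm_def by meson
  have "\<forall>\<^sub>F m in sequentially. Qlim p - e / 5 < Qm p m"
    using e5 by (intro order_tendstoD[OF Qm_tendsto]) auto
  then obtain m2 where m2: "\<And>m. m \<ge> m2 \<Longrightarrow> Qlim p - e / 5 < Qm p m"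
    by (auto simp: eventually_sequentially)
  define m0 where "m0 = max m1 m2"
  define g where "g = next_prob p m0"
  have gm[measurable]: "g \<in> borel_measurable N" unfolding g_def by measurable
  have gb: "\<bar>g x\<bar> \<le> 1" if "x \<in> space N" for x using next_prob_bounds[OF that] by (simp add: g_def)
  have "\<forall>\<^sub>F n in sequentially. (\<integral>x. \<bar>birkhoff T g n x - (\<integral>x. g x \<partial>N)\<bar> \<partial>N) < e / 5"
    by (rule order_tendstoD(2)[OF mean_ergodic[OF ergT gm gb] e5])
  then obtain J where J: "(\<integral>x. \<bar>birkhoff T g J x - (\<integral>x. g x \<partial>N)\<bar> \<partial>N) < e / 5" "J \<ge> 1"
    unfolding eventually_sequentially by (meson le_add1 le_add2)
  have key: "(1 - Qm 1 m) * Qm p m0 \<le> (\<Sum>j<J. Qlim p - Qm (Suc j + p) m) / real J + 2 * (e / 5)" if m: "m \<ge> m0" for m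
  proof -
    \<comment> \<open>\<open>r m\<close> is the conditional probability of missing one digit, which
      is at most that of missing j + 1 digits. The chain rule then turns (1 - P(j + 1 digits))
      P(next p digits) into a difference whose mean is a difference of collision
      probabilities.\<close>
    have step: "(\<integral>x. r m x * g ((T ^^ (m - m0 + Suc j)) x) \<partial>N) \<le> Qlim p - Qm (Suc j + p) m + e / 5" for j
    proof -
      let ?k = "m - m0 + Suc j"
      have mk: "m0 + ?k = m + Suc j" using m by simp
      have [measurable]: "(\<lambda>x. g ((T ^^ ?k) x)) \<in> borel_measurable N"
        by (rule measurable_compose[OF Tn_measurable gm])
      have gT: "\<bar>g ((T ^^ ?k) x)\<bar> \<le> 1" if "x \<in> space N" for x
        by (rule gb[OF funpow_in_space[OF T_measurable that]])
      let ?h = "next_prob p (m + Suc j)"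
      have hb: "0 \<le> ?h x" "?h x \<le> 1" if "x \<in> space N" for x using next_prob_bounds[OF that] by auto
      have i1: "integrable N (\<lambda>x. \<bar>?h x - g ((T ^^ ?k) x)\<bar>)"
      proof (rule integrable_bounded[where B = 2])
        show "norm \<bar>?h x - g ((T ^^ ?k) x)\<bar> \<le> 2" if "x \<in> space N" for x
          using hb[OF that] gT[OF that] by simp
      qed measurable
      have i2: "integrable N (\<lambda>x. ?h x - next_prob (Suc j + p) m x)"
        by (intro Bochner_Integration.integrable_diff next_prob_integrable)
      have "(\<integral>x. r m x * g ((T ^^ ?k) x) \<partial>N) \<le> (\<integral>x. (?h x - next_prob (Suc j + p) m x) + \<bar>?h x - g ((T ^^ ?k) x)\<bar> \<partial>N)"
      proof (rule integral_mono)
        show "integrable N (\<lambda>x. r m x * g ((T ^^ ?k) x))"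
        proof (rule integrable_bounded[where B = 1])
          show "norm (r m x * g ((T ^^ ?k) x)) \<le> 1" if "x \<in> space N" for x
            unfolding real_norm_def abs_mult using rb[OF that, of m] gT[OF that] by (intro mult_le_one) auto
        qed measurable
        show "integrable N (\<lambda>x. (?h x - next_prob (Suc j + p) m x) + \<bar>?h x - g ((T ^^ ?k) x)\<bar>)"
          using i1 i2 by (rule Bochner_Integration.integrable_add[rotated])
        fix x assume x: "x \<in> space N"
        have "r m x * g ((T ^^ ?k) x) \<le> r m x * (?h x + \<bar>?h x - g ((T ^^ ?k) x)\<bar>)"
          using rb[OF x, of m] by (intro mult_left_mono) auto
        also have "\<dots> \<le> r m x * ?h x + \<bar>?h x - g ((T ^^ ?k) x)\<bar>"
          using rb[OF x, of m] by (simp add: distrib_left mult_left_le_one_le)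
        also have "r m x * ?h x \<le> (1 - next_prob (Suc j) m x) * ?h x"
          using next_prob_antimono[OF x, of 1 j m] hb[OF x] by (intro mult_right_mono) (auto simp: r_def)
        also have "\<dots> = ?h x - next_prob (Suc j + p) m x"
          using next_prob_mult[OF x, of "Suc j" m p] by (simp add: algebra_simps)
        finally show "r m x * g ((T ^^ ?k) x) \<le> (?h x - next_prob (Suc j + p) m x) + \<bar>?h x - g ((T ^^ ?k) x)\<bar>" by simp
      qed
      also have "\<dots> = Qm p (m + Suc j) - Qm (Suc j + p) m + (\<integral>x. \<bar>?h x - g ((T ^^ ?k) x)\<bar> \<partial>N)"
        using i1 i2 next_prob_integrable by (simp add: integral_next_prob)
      also have "\<dots> \<le> Qlim p - Qm (Suc j + p) m + e / 5"
        using m1[of m0 ?k] Qm_le_Qlim[of p "m + Suc j"] unfolding mk g_def m0_def[symmetric] by (simp add: m0_def)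
      finally show ?thesis .
    qed
    \<comment> \<open>Averaging over j < J replaces \<open>g\<close> by a Birkhoff average, close in
      L1 to the constant \<open>c\<close>. This decouples \<open>r m\<close> from \<open>g\<close>
      without any mixing assumption.\<close>
    define k where "k = m - m0 + 1"
    define c where "c = (\<integral>x. g x \<partial>N)"
    have bT: "(\<lambda>x. birkhoff T g J ((T ^^ k) x)) \<in> borel_measurable N"
      by (rule measurable_compose[OF Tn_measurable birkhoff_measurable[OF T_measurable gm]])
    have bb: "\<bar>birkhoff T g J ((T ^^ k) x)\<bar> \<le> 1" if "x \<in> space N" for x
      by (rule birkhoff_bound[OF T_measurable gb _ funpow_in_space[OF T_measurable that]]) auto
    have cb: "c = Qm p m0" unfolding c_def g_def by (rule integral_next_prob)
    have c01: "0 \<le> c" "c \<le> 1" unfolding cb using Qm_bounds by auto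
    have "(\<integral>x. r m x * c - \<bar>birkhoff T g J ((T ^^ k) x) - c\<bar> \<partial>N) \<le> (\<integral>x. r m x * birkhoff T g J ((T ^^ k) x) \<partial>N)"
    proof (rule integral_mono)
      have [measurable]: "(\<lambda>x. birkhoff T g J ((T ^^ k) x)) \<in> borel_measurable N" by (rule bT)
      show "integrable N (\<lambda>x. r m x * c - \<bar>birkhoff T g J ((T ^^ k) x) - c\<bar>)"
      proof (rule integrable_bounded[where B = 3])
        show "norm (r m x * c - \<bar>birkhoff T g J ((T ^^ k) x) - c\<bar>) \<le> 3" if "x \<in> space N" for x
        proof -
          have "0 \<le> r m x * c" "r m x * c \<le> 1"
            using rb[OF that, of m] c01 by (auto intro: mult_le_one)
          moreover have "\<bar>birkhoff T g J ((T ^^ k) x) - c\<bar> \<le> 2" using bb[OF that] c01 by linarith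
          ultimately show ?thesis unfolding real_norm_def by linarith
        qed
      qed measurable
      show "integrable N (\<lambda>x. r m x * birkhoff T g J ((T ^^ k) x))"
      proof (rule integrable_bounded[where B = 1])
        show "norm (r m x * birkhoff T g J ((T ^^ k) x)) \<le> 1" if "x \<in> space N" for x
          unfolding real_norm_def abs_mult using rb[OF that, of m] bb[OF that] by (intro mult_le_one) auto
      qed measurable
      fix x assume x: "x \<in> space N"
      have "r m x * (c - birkhoff T g J ((T ^^ k) x)) \<le> r m x * \<bar>birkhoff T g J ((T ^^ k) x) - c\<bar>"
        using rb[OF x, of m] by (intro mult_left_mono) auto
      also have "\<dots> \<le> 1 * \<bar>birkhoff T g J ((T ^^ k) x) - c\<bar>"
        using rb[OF x, of m] by (intro mult_right_mono) auto
      finally have "r m x * (c - birkhoff T g J ((T ^^ k) x)) \<le> 1 * \<bar>birkhoff T g J ((T ^^ k) x) - c\<bar>" .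
      then show "r m x * c - \<bar>birkhoff T g J ((T ^^ k) x) - c\<bar> \<le> r m x * birkhoff T g J ((T ^^ k) x)"
        by (simp add: right_diff_distrib)
    qed
    also have "(\<integral>x. r m x * c - \<bar>birkhoff T g J ((T ^^ k) x) - c\<bar> \<partial>N)
        = (1 - Qm 1 m) * c - (\<integral>x. \<bar>birkhoff T g J ((T ^^ k) x) - c\<bar> \<partial>N)"
    proof -
      have [measurable]: "(\<lambda>x. birkhoff T g J ((T ^^ k) x)) \<in> borel_measurable N" by (rule bT)
      have "integrable N (\<lambda>x. \<bar>birkhoff T g J ((T ^^ k) x) - c\<bar>)"
      proof (rule integrable_bounded[where B = 2])
        show "norm \<bar>birkhoff T g J ((T ^^ k) x) - c\<bar> \<le> 2" if "x \<in> space N" for x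
          using bb[OF that] c01 by simp
      qed measurable
      moreover have "integrable N (r m)"
        by (rule integrable_bounded[where B = 1]) (use rb in auto)
      moreover have "(\<integral>x. r m x \<partial>N) = 1 - Qm 1 m"
        using next_prob_integrable by (simp add: r_def[abs_def] integral_next_prob prob_space)
      ultimately show ?thesis by simp
    qed
    also have "(\<integral>x. \<bar>birkhoff T g J ((T ^^ k) x) - c\<bar> \<partial>N) = (\<integral>x. \<bar>birkhoff T g J x - c\<bar> \<partial>N)"
      by (rule integral_funpow[OF T_measurable T_distr, of "\<lambda>x. \<bar>birkhoff T g J x - c\<bar>"])
         (intro borel_measurable_abs borel_measurable_diff birkhoff_measurable[OF T_measurable gm] borel_measurable_const)
    also have "(\<integral>x. r m x * birkhoff T g J ((T ^^ k) x) \<partial>N) = (\<Sum>j<J. \<integral>x. r m x * g ((T ^^ (m - m0 + Suc j)) x) \<partial>N) / real J"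
    proof -
      have "integrable N (\<lambda>x. r m x * g ((T ^^ (m - m0 + Suc j)) x))" for j
      proof (rule integrable_bounded[where B = 1])
        have [measurable]: "(\<lambda>x. g ((T ^^ (m - m0 + Suc j)) x)) \<in> borel_measurable N"
          by (rule measurable_compose[OF Tn_measurable gm])
        show "(\<lambda>x. r m x * g ((T ^^ (m - m0 + Suc j)) x)) \<in> borel_measurable N" by measurable
        show "norm (r m x * g ((T ^^ (m - m0 + Suc j)) x)) \<le> 1" if "x \<in> space N" for x
          unfolding real_norm_def abs_mult using rb[OF that, of m]
          by (intro mult_le_one gb[OF funpow_in_space[OF T_measurable that]]) simp_all
      qed
      note ii = this
      have "r m x * birkhoff T g J ((T ^^ k) x) = (\<Sum>j<J. r m x * g ((T ^^ (m - m0 + Suc j)) x)) / real J" for x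
        unfolding birkhoff_def k_def
        by (simp add: sum_distrib_left add.commute flip: funpow_add[THEN fun_cong, unfolded comp_def] funpow.simps)
      then show ?thesis using ii by simp
    qed
    also have "(\<Sum>j<J. \<integral>x. r m x * g ((T ^^ (m - m0 + Suc j)) x) \<partial>N) / real J
        \<le> (\<Sum>j<J. Qlim p - Qm (Suc j + p) m + e / 5) / real J"
      by (intro divide_right_mono sum_mono step) simp
    also have "\<dots> = (\<Sum>j<J. Qlim p - Qm (Suc j + p) m) / real J + e / 5"
      using J(2) by (simp add: sum.distrib add_divide_distrib)
    finally show ?thesis using J(1) unfolding cb[symmetric] c_def[symmetric] by simp
  qed
  have "(1 - Qlim 1) * Qm p m0 \<le> (\<Sum>j<J. Qlim p - Qlim (Suc j + p)) / real J + 2 * (e / 5)"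
  proof (rule LIMSEQ_le)
    show "(\<lambda>m. (1 - Qm 1 m) * Qm p m0) \<longlonglongrightarrow> (1 - Qlim 1) * Qm p m0"
      by (intro tendsto_intros Qm_tendsto)
    show "(\<lambda>m. (\<Sum>j<J. Qlim p - Qm (Suc j + p) m) / real J + 2 * (e / 5)) \<longlonglongrightarrow> (\<Sum>j<J. Qlim p - Qlim (Suc j + p)) / real J + 2 * (e / 5)"
      using J(2) by (intro tendsto_intros Qm_tendsto) auto
    show "\<exists>n. \<forall>m\<ge>n. (1 - Qm 1 m) * Qm p m0 \<le> (\<Sum>j<J. Qlim p - Qm (Suc j + p) m) / real J + 2 * (e / 5)"
      using key by blast
  qed
  also have "(\<Sum>j<J. Qlim p - Qlim (Suc j + p)) / real J \<le> (\<Sum>j<J. Qlim p - \<beta>) / real J"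
    using \<beta> by (intro divide_right_mono sum_mono) auto
  also have "\<dots> = Qlim p - \<beta>" using J(2) by simp
  finally have 1: "(1 - Qlim 1) * Qm p m0 \<le> Qlim p - \<beta> + 2 * (e / 5)" by simp
  have Q1: "0 \<le> Qlim 1" "Qlim 1 \<le> 1"
    by (rule Qlim_nonneg, rule Qlim_le_1)
  have "(1 - Qlim 1) * (Qlim p - Qm p m0) \<le> 1 * (e / 5)"
    using Q1 m2[of m0] Qm_le_Qlim[of p m0] e by (intro mult_mono) (auto simp: m0_def)
  then have "(1 - Qlim 1) * Qlim p \<le> (1 - Qlim 1) * Qm p m0 + e / 5" by (simp add: right_diff_distrib)
  then show "(1 - Qlim 1) * Qlim p \<le> Qlim p - \<beta> + e" using 1 e by linarith
qed

text \<open>With \<beta> the limit of the decreasing sequence \<open>Qlim\<close>, the bound becomes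
  (1 - Qlim 1) \<beta> \<le> 0 as p grows: either the next digit is determined by the past, or long
  blocks become unpredictable.\<close>

lemma Qlim_dichotomy: "Qlim 1 = 1 \<or> Qlim \<longlonglongrightarrow> 0"
proof -
  define \<beta> where "\<beta> = (INF p. Qlim p)"
  have bdd: "bdd_below (range Qlim)" by (rule bdd_belowI[of _ 0]) (auto simp: Qlim_nonneg)
  have dec: "decseq Qlim"
    by (rule decseq_SucI) (use Qlim_antimono[of _ 1] in simp)
  have \<beta>: "\<beta> \<le> Qlim p" for p unfolding \<beta>_def by (rule cINF_lower[OF bdd]) simp
  have lim: "Qlim \<longlonglongrightarrow> \<beta>" unfolding \<beta>_def by (rule LIMSEQ_decseq_INF[OF bdd dec])
  have "(1 - Qlim 1) * \<beta> \<le> \<beta> - \<beta>"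
    by (rule LIMSEQ_le[OF tendsto_mult[OF tendsto_const lim] tendsto_diff[OF lim tendsto_const]])
       (use Qlim_dichotomy_bound[OF \<beta>] in auto)
  moreover have "Qlim 1 \<le> 1" by (rule Qlim_le_1)
  moreover have "\<beta> \<ge> 0" unfolding \<beta>_def by (rule cINF_greatest) (auto simp: Qlim_nonneg)
  ultimately have "Qlim 1 = 1 \<or> \<beta> = 0"
    using mult_pos_pos[of "1 - Qlim 1" \<beta>] by linarith
  then show ?thesis using lim by auto
qed

end

lemma (in prob_space) cell_exp_sum:
  assumes "partition_map \<kappa>" and u: "\<And>j. j \<in> A \<Longrightarrow> u j \<in> borel_measurable M"
    "\<And>j x. j \<in> A \<Longrightarrow> x \<in> space M \<Longrightarrow> cmod (u j x) \<le> B"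
  shows "cell_exp M \<kappa> (\<lambda>y. \<Sum>j\<in>A. a j * u j y) x = (\<Sum>j\<in>A. a j * cell_exp M \<kappa> (u j) x)"
proof -
  have int: "integrable M (\<lambda>y. indicator (\<kappa> -` {\<kappa> x}) y *\<^sub>R (a j * u j y))" if j: "j \<in> A" for j
  proof -
    have "integrable M (\<lambda>y. indicator (\<kappa> -` {\<kappa> x} \<inter> space M) y *\<^sub>R (a j * u j y))"
    proof (intro integrable_mult_indicator integrable_mult_right)
      show "integrable M (u j)" by (rule integrable_bounded[OF u(1)[OF j] u(2)[OF j]])
    qed (rule partition_cell_sets[OF assms(1)])
    moreover have "integrable M (\<lambda>y. indicator (\<kappa> -` {\<kappa> x} \<inter> space M) y *\<^sub>R (a j * u j y))
        \<longleftrightarrow> integrable M (\<lambda>y. indicator (\<kappa> -` {\<kappa> x}) y *\<^sub>R (a j * u j y))"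
      by (rule Bochner_Integration.integrable_cong) (auto simp: indicator_def)
    ultimately show ?thesis by simp
  qed
  have "(\<integral>y. indicator (\<kappa> -` {\<kappa> x}) y *\<^sub>R (\<Sum>j\<in>A. a j * u j y) \<partial>M)
      = (\<Sum>j\<in>A. \<integral>y. indicator (\<kappa> -` {\<kappa> x}) y *\<^sub>R (a j * u j y) \<partial>M)"
    unfolding scaleR_sum_right by (rule Bochner_Integration.integral_sum) (rule int)
  also have "\<dots> = (\<Sum>j\<in>A. a j * (\<integral>y. indicator (\<kappa> -` {\<kappa> x}) y *\<^sub>R u j y \<partial>M))"
    by (simp only: mult_scaleR_right[symmetric] integral_mult_right_zero)
  finally show ?thesis by (simp add: cell_exp_def sum_divide_distrib)
qed

section \<open>From block probabilities to small energies\<close>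

context base_b
begin

text \<open>Truncating \<open>(T ^^ m) y\<close> to p digits changes a character of frequency i <
  b^(p-l) by at most 2 pi / b^l. The truncated characters yield the finite Fourier transform on
  Z/b^p of the block probabilities, so Parseval bounds the sum of their energies by b^p
  \<open>Qm p m\<close>; division by the b^(p-l) frequencies leaves b^l.\<close>

lemma E2_char_sum_le:
  assumes "l \<le> p"
  defines "n \<equiv> b ^ (p - l)"
  shows "(\<Sum>i<n. E2 (char_fun (real i)) m) / real n \<le> 2 * real b ^ l * Qm p m + 2 * (2 * pi / real b ^ l)\<^sup>2"
proof -
  define B where "B = b ^ p"
  have B: "B > 0" "n > 0" "n \<le> B" using b by (auto simp: B_def n_def intro: power_increasing)
  have Bn: "real B = real b ^ l * real n" using assms by (simp add: B_def flip: power_add)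
  define P where "P j x = V (digit_ind p j) m x" for j x
  define S where "S i x = (\<Sum>j<B. P j x * ee (real i * real j / real B))" for i x
  have pw: "(cmod (V (char_fun (real i)) m x))\<^sup>2 \<le> 2 * (cmod (S i x))\<^sup>2 + 2 * (2 * pi / real b ^ l)\<^sup>2"
    if i: "i < n" for i x
  proof -
    let ?s = "\<lambda>y. ee (real i * real_of_int (cell p ((T ^^ m) y)) / real B)"
    have sm: "?s \<in> borel_measurable N"
      by (rule measurable_partition_comp) (use cell_comp_partition in blast)
    have "V (char_fun (real i)) m x - cell_exp N (cell m) ?s x = cell_exp N (cell m) (\<lambda>y. ee (real i * (T ^^ m) y) - ?s y) x"
      unfolding V_def by (rule cell_exp_diff[OF cell_partition char_shift_measurable _ sm, symmetric, where B = 1]) simp_all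
    also have "cmod \<dots> \<le> 2 * pi / real b ^ l"
    proof (rule cell_exp_bound[OF cell_partition])
      show "(\<lambda>y. ee (real i * (T ^^ m) y) - ?s y) \<in> borel_measurable N"
        by (intro borel_measurable_diff char_shift_measurable sm)
      fix y assume y: "y \<in> space N"
      define z where "z = (T ^^ m) y"
      have "real B * z - 1 < real_of_int (cell p z)" "real_of_int (cell p z) \<le> real B * z"
        unfolding cell_def B_def by (auto simp: of_nat_power)
      then have "\<bar>real B * z - real_of_int (cell p z)\<bar> \<le> 1" by linarith
      then have "\<bar>real B * z - real_of_int (cell p z)\<bar> / real B \<le> 1 / real B"
        by (rule divide_right_mono) simp
      then have zz: "\<bar>z - real_of_int (cell p z) / real B\<bar> \<le> 1 / real B"
      proof -
        have "z - real_of_int (cell p z) / real B = (real B * z - real_of_int (cell p z)) / real B"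
          using B by (simp add: field_simps)
        then show ?thesis
          using \<open>\<bar>real B * z - real_of_int (cell p z)\<bar> / real B \<le> 1 / real B\<close> by (simp only: abs_divide)
      qed
      have "cmod (ee (real i * z) - ee (real i * real_of_int (cell p z) / real B)) \<le> 2 * pi * \<bar>real i * z - real i * real_of_int (cell p z) / real B\<bar>"
        by (rule ee_lipschitz)
      also have "\<bar>real i * z - real i * real_of_int (cell p z) / real B\<bar> = real i * \<bar>z - real_of_int (cell p z) / real B\<bar>"
        by (simp add: abs_mult flip: right_diff_distrib times_divide_eq_right)
      also have "2 * pi * (real i * \<bar>z - real_of_int (cell p z) / real B\<bar>) \<le> 2 * pi * (real n * (1 / real B))"
        using i zz by (intro mult_left_mono mult_mono) auto
      also have "\<dots> = 2 * pi / real b ^ l" using B by (simp add: Bn)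
      finally show "cmod (ee (real i * (T ^^ m) y) - ?s y) \<le> 2 * pi / real b ^ l" unfolding z_def .
    qed simp
    finally have 1: "cmod (V (char_fun (real i)) m x - cell_exp N (cell m) ?s x) \<le> 2 * pi / real b ^ l" .
    have "cell_exp N (cell m) ?s x = cell_exp N (cell m) (\<lambda>y. \<Sum>j<B. ee (real i * real j / real B) * digit_ind p j ((T ^^ m) y)) x"
    proof (rule cell_exp_cong)
      fix y assume "y \<in> space N"
      then have "(T ^^ m) y \<in> {0..<1}" using funpow_in_space[OF T_measurable] by (simp add: space_N)
      then obtain c where c: "cell p ((T ^^ m) y) = int c" "c < B"
        using cell_range[of "(T ^^ m) y" p] unfolding B_def
        by (metis atLeastLessThan_iff of_nat_less_iff of_nat_power zero_le_imp_eq_int)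
      have "(\<Sum>j<B. ee (real i * real j / real B) * digit_ind p j ((T ^^ m) y))
          = (\<Sum>j\<in>{c}. ee (real i * real j / real B) * digit_ind p j ((T ^^ m) y))"
        by (rule sum.mono_neutral_right) (use c in \<open>auto simp: digit_ind_def indicator_def\<close>)
      then show "?s y = (\<Sum>j<B. ee (real i * real j / real B) * digit_ind p j ((T ^^ m) y))"
        using c by (simp add: digit_ind_def)
    qed
    also have "\<dots> = (\<Sum>j<B. ee (real i * real j / real B) * cell_exp N (cell m) (\<lambda>y. digit_ind p j ((T ^^ m) y)) x)"
      by (rule cell_exp_sum[OF cell_partition, where B = 1]) (auto intro: test_fun_shift[OF test_fun_digit])
    also have "\<dots> = S i x"
      by (simp add: S_def P_def V_def mult.commute)
    finally have 2: "cell_exp N (cell m) ?s x = S i x" .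
    have "cmod (V (char_fun (real i)) m x) \<le> cmod (S i x) + 2 * pi / real b ^ l"
      using 1 norm_triangle_sub[of "V (char_fun (real i)) m x" "S i x"] unfolding 2 by linarith
    then have "(cmod (V (char_fun (real i)) m x))\<^sup>2 \<le> (cmod (S i x) + 2 * pi / real b ^ l)\<^sup>2"
      by (rule power_mono) simp
    also have "\<dots> \<le> 2 * (cmod (S i x))\<^sup>2 + 2 * (2 * pi / real b ^ l)\<^sup>2"
      using sum_squares_bound[of "cmod (S i x)" "2 * pi / real b ^ l"] by (simp add: power2_sum)
    finally show ?thesis .
  qed
  have "(\<Sum>i<n. E2 (char_fun (real i)) m) = (\<integral>x. (\<Sum>i<n. (cmod (V (char_fun (real i)) m x))\<^sup>2) \<partial>N)"
    unfolding E2_def by (rule Bochner_Integration.integral_sum[symmetric]) (rule V_sq_integrable[OF test_fun_char])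
  also have "\<dots> \<le> (\<integral>x. 2 * (real B * (\<Sum>j<B. (cmod (P j x))\<^sup>2)) + real n * (2 * (2 * pi / real b ^ l)\<^sup>2) \<partial>N)"
  proof (rule integral_mono)
    show "integrable N (\<lambda>x. \<Sum>i<n. (cmod (V (char_fun (real i)) m x))\<^sup>2)"
      by (rule Bochner_Integration.integrable_sum) (rule V_sq_integrable[OF test_fun_char])
    show "integrable N (\<lambda>x. 2 * (real B * (\<Sum>j<B. (cmod (P j x))\<^sup>2)) + real n * (2 * (2 * pi / real b ^ l)\<^sup>2))"
      unfolding P_def
      by (intro Bochner_Integration.integrable_add integrable_mult_right Bochner_Integration.integrable_sum V_sq_integrable[OF test_fun_digit] integrable_const)
    fix x
    have "(\<Sum>i<n. (cmod (V (char_fun (real i)) m x))\<^sup>2) \<le> (\<Sum>i<n. 2 * (cmod (S i x))\<^sup>2 + 2 * (2 * pi / real b ^ l)\<^sup>2)"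
      by (rule sum_mono) (use pw in auto)
    also have "\<dots> = 2 * (\<Sum>i<n. (cmod (S i x))\<^sup>2) + real n * (2 * (2 * pi / real b ^ l)\<^sup>2)"
      by (simp add: sum.distrib flip: sum_distrib_left)
    \<comment> \<open>Parseval runs over all residues i < B; the added terms are
      nonnegative.\<close>
    also have "(\<Sum>i<n. (cmod (S i x))\<^sup>2) \<le> (\<Sum>i<B. (cmod (S i x))\<^sup>2)"
      by (rule sum_mono2) (use B(3) in auto)
    also have "\<dots> = real B * (\<Sum>j<B. (cmod (P j x))\<^sup>2)"
      unfolding S_def by (rule parseval_finite[OF B(1)])
    finally show "(\<Sum>i<n. (cmod (V (char_fun (real i)) m x))\<^sup>2) \<le> 2 * (real B * (\<Sum>j<B. (cmod (P j x))\<^sup>2)) + real n * (2 * (2 * pi / real b ^ l)\<^sup>2)"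
      by simp
  qed
  also have "\<dots> = 2 * (real B * Qm p m) + real n * (2 * (2 * pi / real b ^ l)\<^sup>2)"
  proof -
    have i: "integrable N (\<lambda>x. (cmod (P j x))\<^sup>2)" for j
      unfolding P_def by (rule V_sq_integrable[OF test_fun_digit])
    have "(\<integral>x. (\<Sum>j<B. (cmod (P j x))\<^sup>2) \<partial>N) = Qm p m"
      unfolding Qm_def E2_def P_def B_def
      by (rule Bochner_Integration.integral_sum) (rule V_sq_integrable[OF test_fun_digit])
    moreover have "integrable N (\<lambda>x. \<Sum>j<B. (cmod (P j x))\<^sup>2)"
      by (rule Bochner_Integration.integrable_sum) (rule i)
    ultimately show ?thesis by (simp add: prob_space)
  qed
  finally have "(\<Sum>i<n. E2 (char_fun (real i)) m) / real n \<le> (2 * (real B * Qm p m) + real n * (2 * (2 * pi / real b ^ l)\<^sup>2)) / real n"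
    by (rule divide_right_mono) simp
  also have "\<dots> = 2 * real b ^ l * Qm p m + 2 * (2 * pi / real b ^ l)\<^sup>2"
    using B(2) by (simp add: Bn add_divide_distrib)
  finally show ?thesis .
qed

text \<open>First l is fixed to make the truncation error small, then p to make b^l
  \<open>Qlim p\<close> small. The average of \<open>Phi\<close> over the integers below b^(p-l)
  then drops under \<epsilon>/2.\<close>

lemma Phi_small:
  assumes Q: "Qlim \<longlonglongrightarrow> 0" and \<epsilon>: "\<epsilon> > 0"
  shows "\<exists>s>0. Phi s < \<epsilon>"
proof (rule ccontr)
  assume neg: "\<not> (\<exists>s>0. Phi s < \<epsilon>)"
  have "(\<lambda>l. 2 * pi / real b ^ l) \<longlonglongrightarrow> 0"
    using b by (intro LIMSEQ_divide_realpow_zero) auto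
  then have lim1: "(\<lambda>l. 2 * (2 * pi / real b ^ l)\<^sup>2) \<longlonglongrightarrow> 2 * 0\<^sup>2"
    by (intro tendsto_intros)
  have "\<forall>\<^sub>F l in sequentially. 2 * (2 * pi / real b ^ l)\<^sup>2 < \<epsilon> / 4"
    by (rule order_tendstoD(2)[OF lim1]) (use \<epsilon> in simp)
  then obtain l where l: "2 * (2 * pi / real b ^ l)\<^sup>2 < \<epsilon> / 4" by (auto simp: eventually_sequentially)
  have lim2: "(\<lambda>p. 2 * real b ^ l * Qlim p) \<longlonglongrightarrow> 2 * real b ^ l * 0" by (intro tendsto_intros Q)
  have "\<forall>\<^sub>F p in sequentially. 2 * real b ^ l * Qlim p < \<epsilon> / 4"
    by (rule order_tendstoD(2)[OF lim2]) (use \<epsilon> in simp)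
  then obtain p0 where p0: "\<And>p. p \<ge> p0 \<Longrightarrow> 2 * real b ^ l * Qlim p < \<epsilon> / 4" by (auto simp: eventually_sequentially)
  define p where "p = max p0 (l + 1)"
  define n where "n = b ^ (p - l)"
  have lp: "l \<le> p" by (simp add: p_def)
  have "b ^ 1 \<le> b ^ (p - l)" using b by (intro power_increasing) (auto simp: p_def)
  \<comment> \<open>Frequency 0, whose energy is not controlled from above, is thus at most half of
    the frequencies, and the others alone would contribute \<epsilon>/2.\<close>
  then have n: "n \<ge> 2" using b by (simp add: n_def)
  have "(\<Sum>i<n. Phi (real i)) / real n \<le> 2 * real b ^ l * Qlim p + 2 * (2 * pi / real b ^ l)\<^sup>2"
  proof (rule LIMSEQ_le)
    show "(\<lambda>m. (\<Sum>i<n. E2 (char_fun (real i)) m) / real n) \<longlonglongrightarrow> (\<Sum>i<n. Phi (real i)) / real n"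
      unfolding Phi_def using n by (intro tendsto_divide tendsto_sum E2_tendsto test_fun_char tendsto_const) auto
    show "(\<lambda>m. 2 * real b ^ l * Qm p m + 2 * (2 * pi / real b ^ l)\<^sup>2) \<longlonglongrightarrow> 2 * real b ^ l * Qlim p + 2 * (2 * pi / real b ^ l)\<^sup>2"
      by (intro tendsto_add tendsto_mult tendsto_const Qm_tendsto)
    show "\<exists>M. \<forall>m\<ge>M. (\<Sum>i<n. E2 (char_fun (real i)) m) / real n \<le> 2 * real b ^ l * Qm p m + 2 * (2 * pi / real b ^ l)\<^sup>2"
      using E2_char_sum_le[OF lp] unfolding n_def by blast
  qed
  also have "\<dots> < \<epsilon> / 2" using p0[of p] l by (simp add: p_def)
  finally have 1: "(\<Sum>i<n. Phi (real i)) / real n < \<epsilon> / 2" .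
  have neg': "\<epsilon> \<le> Phi s" if "s > 0" for s using neg that by (meson not_less)
  have "(\<Sum>i\<in>{1..<n}. \<epsilon>) \<le> (\<Sum>i\<in>{1..<n}. Phi (real i))"
    by (intro sum_mono neg') auto
  also have "\<dots> \<le> (\<Sum>i<n. Phi (real i))"
    by (rule sum_mono2) (auto intro: Phi_nonneg)
  finally have "real (n - 1) * \<epsilon> \<le> (\<Sum>i<n. Phi (real i))" by simp
  moreover have "real n / 2 * \<epsilon> \<le> real (n - 1) * \<epsilon>"
    using n \<epsilon> by (intro mult_right_mono) (auto simp: of_nat_diff)
  ultimately have "real n / 2 * \<epsilon> \<le> (\<Sum>i<n. Phi (real i))" by linarith
  then have "\<epsilon> / 2 \<le> (\<Sum>i<n. Phi (real i)) / real n"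
    using n by (simp add: field_simps)
  then show False using 1 by linarith
qed

section \<open>Zero entropy and covers by few cells\<close>

text \<open>A level has finitely many cells, so the union of its null cells is null.\<close>

lemma AE_mass_pos: "AE x in N. mass m x > 0"
proof -
  let ?Z = "{c \<in> cell m ` space N. measure N (cell m -` {c} \<inter> space N) = 0}"
  have "AE x in N. \<forall>c\<in>?Z. x \<notin> cell m -` {c} \<inter> space N"
  proof (rule AE_finite_allI)
    show "finite ?Z" using cell_partition[of m] by auto
    fix c assume "c \<in> ?Z"
    then show "AE x in N. x \<notin> cell m -` {c} \<inter> space N"
      using partition_cell_sets[OF cell_partition, of m "{c}"] by (intro AE_not_in) (simp add: null_sets_def emeasure_eq_measure)
  qed
  then show ?thesis using AE_space
    by eventually_elim (auto simp: mass_def zero_less_measure_iff)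
qed

lemma integrable_cell: "integrable N (\<lambda>x. g (cell m x) :: real)"
proof -
  have "finite ((\<lambda>c. \<bar>g c\<bar>) ` cell m ` space N)" using cell_partition[of m] by simp
  then have "\<bar>g (cell m x)\<bar> \<le> Max ((\<lambda>c. \<bar>g c\<bar>) ` cell m ` space N)" if "x \<in> space N" for x
    using that by (intro Max_ge) auto
  then show ?thesis
    by (intro integrable_bounded[where B = "Max ((\<lambda>c. \<bar>g c\<bar>) ` cell m ` space N)"] measurable_partition_comp cell_measurable) auto
qed

lemma mass_fun_cell: "\<exists>g. \<forall>x. mass m x = g (cell m x)"
  unfolding mass_def by (rule exI[of _ "\<lambda>c. measure N (cell m -` {c} \<inter> space N)"]) simp

text \<open>Both masses depend only on the cell of level m + 1, so the function takes finitely many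
  values; this covers logarithms and quotients of masses.\<close>

lemma integrable_mass_fun: "integrable N (\<lambda>x. h (mass m x) (mass (m + 1) x) :: real)"
proof -
  obtain g0 g1 where g: "\<And>x. mass m x = g0 (cell m x)" "\<And>x. mass (m + 1) x = g1 (cell (m + 1) x)"
    using mass_fun_cell by metis
  have "(\<lambda>x. h (mass m x) (mass (m + 1) x)) = (\<lambda>x. (\<lambda>c. h (g0 (c div int b ^ 1)) (g1 c)) (cell (m + 1) x))"
    unfolding g using cell_add_div[of m _ 1] by simp
  then show ?thesis using integrable_cell by simp
qed

text \<open>Given the past, the mean of 1/P(next digit) counts the digits of positive conditional
  probability, of which there are at most b. \<open>G\<close> is that reciprocal, set to 0 where the
  probability vanishes, and \<open>cell_exp_projection\<close> replaces the digit indicator by its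
  conditional probability.\<close>

lemma integral_inverse_next_prob: "(\<integral>x. mass m x / mass (m + 1) x \<partial>N) \<le> real b"
proof -
  define G where "G c x = (if V (digit_ind 1 c) m x = 0 then 0 else 1 / V (digit_ind 1 c) m x)" for c x
  have "(\<integral>x. digit_ind 1 c ((T ^^ m) x) * G c x \<partial>N) = (\<integral>x. V (digit_ind 1 c) m x * G c x \<partial>N)" for c
  proof -
    define v where "v k = (\<integral>y. indicator (cell m -` {k}) y *\<^sub>R digit_ind 1 c ((T ^^ m) y) \<partial>N) / of_real (measure N (cell m -` {k} \<inter> space N))" for k
    define g where "g k = (if v k = 0 then 0 else 1 / v k)" for k
    have g: "G c x = g (cell m x)" for x by (simp add: G_def g_def v_def V_def cell_exp_def)
    have "(\<integral>x. g (cell m x) * V (digit_ind 1 c) m x \<partial>N) = (\<integral>x. g (cell m x) * digit_ind 1 c ((T ^^ m) x) \<partial>N)"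
      unfolding V_def
      by (rule cell_exp_projection[OF cell_partition test_fun_shift(1)[OF test_fun_digit] test_fun_shift(2)[OF test_fun_digit]])
    then show ?thesis by (simp add: g mult.commute)
  qed
  then have eq: "(\<integral>x. digit_ind 1 c ((T ^^ m) x) * G c x \<partial>N) = (\<integral>x. (if V (digit_ind 1 c) m x = 0 then 0 else 1) \<partial>N)" for c
    by (simp add: G_def if_distrib cong: if_cong)
  have le1: "Re (\<integral>x. digit_ind 1 c ((T ^^ m) x) * G c x \<partial>N) \<le> 1" for c
  proof -
    have "Re (\<integral>x. digit_ind 1 c ((T ^^ m) x) * G c x \<partial>N) \<le> norm (\<integral>x. (if V (digit_ind 1 c) m x = 0 then 0 else 1 :: complex) \<partial>N)"
      unfolding eq by (rule complex_Re_le_cmod)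
    also have "\<dots> \<le> 1" by (rule integral_norm_bounded) auto
    finally show ?thesis .
  qed
  have int: "integrable N (\<lambda>x. Re (digit_ind 1 c ((T ^^ m) x) * G c x))"
    and int': "integrable N (\<lambda>x. digit_ind 1 c ((T ^^ m) x) * G c x)" for c
  proof -
    define v where "v k = (\<integral>y. indicator (cell m -` {k}) y *\<^sub>R digit_ind 1 c ((T ^^ m) y) \<partial>N) / of_real (measure N (cell m -` {k} \<inter> space N))" for k
    define g where "g k = (if v k = 0 then 0 else 1 / v k)" for k
    have g: "G c x = g (cell m x)" for x by (simp add: G_def g_def v_def V_def cell_exp_def)
    have fin: "finite ((\<lambda>k. cmod (g k)) ` cell m ` space N)" using cell_partition[of m] by simp
    have "cmod (digit_ind 1 c ((T ^^ m) x) * G c x) \<le> Max ((\<lambda>k. cmod (g k)) ` cell m ` space N)" if "x \<in> space N" for x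
    proof -
      have "cmod (g (cell m x)) \<le> Max ((\<lambda>k. cmod (g k)) ` cell m ` space N)" using that by (intro Max_ge[OF fin]) auto
      moreover have "cmod (digit_ind 1 c ((T ^^ m) x) * G c x) \<le> 1 * cmod (g (cell m x))"
        unfolding norm_mult g by (intro mult_right_mono test_fun_shift(2)[OF test_fun_digit that]) simp
      ultimately show ?thesis by simp
    qed
    moreover have "(\<lambda>x. digit_ind 1 c ((T ^^ m) x) * G c x) \<in> borel_measurable N"
      unfolding g by (intro borel_measurable_times test_fun_shift(1)[OF test_fun_digit] measurable_partition_comp cell_measurable)
    ultimately show i': "integrable N (\<lambda>x. digit_ind 1 c ((T ^^ m) x) * G c x)" by (rule integrable_bounded[rotated])
    show "integrable N (\<lambda>x. Re (digit_ind 1 c ((T ^^ m) x) * G c x))" by (rule integrable_Re[OF i'])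
  qed
  have "(\<integral>x. mass m x / mass (m + 1) x \<partial>N) = (\<integral>x. (\<Sum>c<b. Re (digit_ind 1 c ((T ^^ m) x) * G c x)) \<partial>N)"
  proof (rule Bochner_Integration.integral_cong[OF refl])
    fix x assume x: "x \<in> space N"
    have "(T ^^ m) x \<in> {0..<1}" using funpow_in_space[OF T_measurable x] by (simp add: space_N)
    then obtain c where c: "cell 1 ((T ^^ m) x) = int c" "c < b"
      using cell_range[of "(T ^^ m) x" 1] by (metis atLeastLessThan_iff of_nat_less_iff power_one_right zero_le_imp_eq_int)
    have "(\<Sum>k<b. Re (digit_ind 1 k ((T ^^ m) x) * G k x)) = (\<Sum>k\<in>{c}. Re (digit_ind 1 k ((T ^^ m) x) * G k x))"
      by (rule sum.mono_neutral_right) (use c in \<open>auto simp: digit_ind_def indicator_def\<close>)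
    also have "\<dots> = Re (G c x)" using c by (simp add: digit_ind_def)
    also have "V (digit_ind 1 c) m x = of_real (mass (m + 1) x / mass m x)"
    proof -
      have "{y \<in> space N. cell m y = cell m x \<and> cell 1 ((T ^^ m) y) = int c} = cell (m + 1) -` {cell (m + 1) x} \<inter> space N"
        using cell_split_iff[OF x, of _ m 1] unfolding c(1) by blast
      then show ?thesis unfolding V_digit by (simp add: mass_def)
    qed
    then have "Re (G c x) = mass m x / mass (m + 1) x"
      by (simp add: G_def Re_divide_of_real flip: of_real_divide)
    finally show "mass m x / mass (m + 1) x = (\<Sum>c<b. Re (digit_ind 1 c ((T ^^ m) x) * G c x))" by simp
  qed
  also have "\<dots> = (\<Sum>c<b. \<integral>x. Re (digit_ind 1 c ((T ^^ m) x) * G c x) \<partial>N)"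
    by (rule Bochner_Integration.integral_sum) (rule int)
  also have "\<dots> \<le> (\<Sum>c<b. 1)"
    by (rule sum_mono) (use le1 integral_Re[OF int'] in simp)
  finally show ?thesis by simp
qed

text \<open>With q the square root of r, - ln r = 2 ln (1/q) \<le> 2 (1 - r)/q, and 2/q \<le>
  1/\<kappa> + \<kappa>/r by the inequality of means. The weight \<kappa> separates a term that is
  small when r is near 1 in mean from one controlled by the mean of 1/r.\<close>

lemma neg_ln_le:
  fixes r \<kappa> :: real
  assumes "0 < r" "r \<le> 1" "\<kappa> > 0"
  shows "- ln r \<le> (1 - r) / \<kappa> + \<kappa> / r"
proof -
  define q where "q = sqrt r"
  have q: "0 < q" "q \<le> 1" "r = q\<^sup>2" using assms by (auto simp: q_def)
  have "ln (1 / q) \<le> 1 / q - 1" using q by (intro ln_le_minus_one) auto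
  then have "- ln r \<le> 2 * ((1 - q) / q)" using q by (simp add: ln_div ln_realpow diff_divide_distrib)
  also have "(1 - q) / q \<le> (1 - r) / q"
    using q by (intro divide_right_mono) (auto simp: power2_eq_square mult_left_le)
  also have "2 * ((1 - r) / q) \<le> (1 - r) / \<kappa> + \<kappa> / r"
  proof -
    have "2 * (1 - r) * (1 / q) \<le> (1 - r) * (1 / \<kappa> + \<kappa> / r)"
    proof -
      have "2 * (1 / q) \<le> 1 / \<kappa> + \<kappa> / r"
      proof -
        have "0 \<le> (1 / sqrt \<kappa> - sqrt \<kappa> / q)\<^sup>2" by simp
        also have "\<dots> = 1 / \<kappa> + \<kappa> / r - 2 * (1 / q)"
          using assms(3) q by (simp add: power2_diff power_divide)
        finally show ?thesis by simp
      qed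
      then show ?thesis using mult_left_mono[of "2 * (1/q)" "1 / \<kappa> + \<kappa> / r" "1 - r"] assms by (simp add: mult_ac)
    qed
    also have "\<dots> \<le> (1 - r) / \<kappa> + \<kappa> / r"
    proof -
      have "(1 - r) * (\<kappa> / r) \<le> 1 * (\<kappa> / r)" using assms by (intro mult_right_mono) auto
      then show ?thesis by (simp add: distrib_left)
    qed
    finally show ?thesis by simp
  qed
  finally show ?thesis by simp
qed

lemma entropy_increment_tendsto_0:
  assumes "Qlim 1 = 1"
  shows "(\<lambda>m. \<integral>x. ln (mass m x) - ln (mass (m + 1) x) \<partial>N) \<longlonglongrightarrow> 0"
proof (rule LIMSEQ_I)
  fix e :: real assume e: "e > 0"
  \<comment> \<open>The mean of the reciprocal probability is at most b, so its term costs e/2; the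
    other term is then made small by the choice of m.\<close>
  define \<kappa> where "\<kappa> = e / (2 * real b)"
  have \<kappa>: "\<kappa> > 0" using e b by (simp add: \<kappa>_def)
  have "(\<lambda>m. (1 - Qm 1 m) / \<kappa>) \<longlonglongrightarrow> (1 - Qlim 1) / \<kappa>"
    using \<kappa> by (intro tendsto_intros Qm_tendsto) auto
  then have "\<forall>\<^sub>F m in sequentially. (1 - Qm 1 m) / \<kappa> < e / 2"
    using e assms by (intro order_tendstoD(2)) auto
  then have "\<forall>\<^sub>F m in sequentially. norm ((\<integral>x. ln (mass m x) - ln (mass (m + 1) x) \<partial>N) - 0) < e"
  proof eventually_elim
    case (elim m)
    have i: "integrable N (\<lambda>x. ln (mass m x) - ln (mass (m + 1) x))" "integrable N (\<lambda>x. mass m x / mass (m + 1) x)"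
      by (rule integrable_mass_fun[of "\<lambda>p q. ln p - ln q"] integrable_mass_fun[of "\<lambda>p q. p / q"])+
    have pos: "AE x in N. mass m x > 0 \<and> mass (m + 1) x > 0 \<and> x \<in> space N"
      using AE_mass_pos[of m] AE_mass_pos[of "m + 1"] AE_space by eventually_elim simp
    have "AE x in N. 0 \<le> ln (mass m x) - ln (mass (m + 1) x)"
      using pos by eventually_elim (use mass_antimono[of m 1] in \<open>simp add: ln_mono\<close>)
    then have nn: "0 \<le> (\<integral>x. ln (mass m x) - ln (mass (m + 1) x) \<partial>N)" by (rule integral_nonneg_AE)
    have "(\<integral>x. ln (mass m x) - ln (mass (m + 1) x) \<partial>N)
        \<le> (\<integral>x. (1 - next_prob 1 m x) / \<kappa> + \<kappa> * (mass m x / mass (m + 1) x) \<partial>N)"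
    proof (rule integral_mono_AE)
      show "integrable N (\<lambda>x. (1 - next_prob 1 m x) / \<kappa> + \<kappa> * (mass m x / mass (m + 1) x))"
        by (intro Bochner_Integration.integrable_add integrable_divide integrable_mult_right Bochner_Integration.integrable_diff next_prob_integrable i integrable_const)
      show "AE x in N. ln (mass m x) - ln (mass (m + 1) x) \<le> (1 - next_prob 1 m x) / \<kappa> + \<kappa> * (mass m x / mass (m + 1) x)"
        using pos
      proof eventually_elim
        case (elim x)
        have "next_prob 1 m x = mass (m + 1) x / mass m x" using elim by (intro next_prob_eq) simp
        then show ?case
          using neg_ln_le[of "next_prob 1 m x" \<kappa>] next_prob_bounds[of x 1 m] elim \<kappa> by (simp add: ln_div)
      qed
    qed (rule i)
    also have "\<dots> = (1 - Qm 1 m) / \<kappa> + \<kappa> * (\<integral>x. mass m x / mass (m + 1) x \<partial>N)"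
    proof -
      define q where "q = (\<lambda>x. mass m x / mass (m + 1) x)"
      have iq: "integrable N q" using i(2) by (simp add: q_def)
      have "(\<integral>x. (1 - next_prob 1 m x) / \<kappa> + \<kappa> * q x \<partial>N) = (1 - Qm 1 m) / \<kappa> + \<kappa> * (\<integral>x. q x \<partial>N)"
        using iq next_prob_integrable[of 1 m] by (simp add: integral_next_prob[of 1 m] prob_space del: One_nat_def)
      then show ?thesis unfolding q_def .
    qed
    also have "\<dots> \<le> (1 - Qm 1 m) / \<kappa> + \<kappa> * real b"
      using \<kappa> integral_inverse_next_prob[of m] by (intro add_left_mono mult_left_mono) auto
    also have "\<dots> < e" using elim b by (simp add: \<kappa>_def)
    finally show ?case using nn by simp
  qed
  then show "\<exists>no. \<forall>n\<ge>no. norm ((\<integral>x. ln (mass n x) - ln (mass (n + 1) x) \<partial>N) - 0) < e"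
    by (simp add: eventually_sequentially)
qed

text \<open>Telescoping from mass 1 at level 0 writes the entropy of level m as a sum of increments
  tending to 0; Cesaro averages do the rest.\<close>

lemma entropy_average_tendsto_0:
  assumes "Qlim 1 = 1"
  shows "(\<lambda>m. (\<integral>x. - ln (mass m x) \<partial>N) / real m) \<longlonglongrightarrow> 0"
proof -
  define h where "h m = (\<integral>x. ln (mass m x) - ln (mass (m + 1) x) \<partial>N)" for m
  have h0: "h \<longlonglongrightarrow> 0" unfolding h_def[abs_def] by (rule entropy_increment_tendsto_0[OF assms])
  have int: "integrable N (\<lambda>x. ln (mass m x))" for m
    using integrable_mass_fun[of "\<lambda>p q. ln p"] by simp
  have mass0: "mass 0 x = 1" if "x \<in> space N" for x
  proof -
    have c0: "cell 0 y = 0" if "y \<in> space N" for y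
      using that by (simp add: cell_def space_N floor_eq_iff)
    have "cell 0 -` {cell 0 x} \<inter> space N = space N"
      using c0 that by auto
    then show ?thesis by (simp add: mass_def prob_space)
  qed
  have sum: "(\<integral>x. - ln (mass m x) \<partial>N) = (\<Sum>i<m. h i)" for m
  proof (induction m)
    case 0
    have "(\<integral>x. - ln (mass 0 x) \<partial>N) = (\<integral>x. 0 \<partial>N)"
      by (rule Bochner_Integration.integral_cong) (auto simp: mass0)
    then show ?case by simp
  next
    case (Suc m)
    then show ?case using int by (simp add: h_def)
  qed
  show ?thesis
  proof (rule LIMSEQ_I)
    fix e :: real assume e: "e > 0"
    have "\<forall>\<^sub>F i in sequentially. \<bar>h i\<bar> < e / 4"
      using tendstoD[OF h0, of "e / 4"] e by (simp add: dist_real_def)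
    then obtain i0 where i0: "\<And>i. i \<ge> i0 \<Longrightarrow> \<bar>h i\<bar> < e / 4" by (auto simp: eventually_sequentially)
    define C where "C = (\<Sum>i<i0. \<bar>h i\<bar>)"
    have bound: "\<bar>\<Sum>i<m. h i\<bar> \<le> C + real m * (e / 4)" for m
    proof -
      have "\<bar>\<Sum>i<m. h i\<bar> \<le> (\<Sum>i<m. \<bar>h i\<bar>)" by (rule sum_abs)
      also have "\<dots> \<le> (\<Sum>i<m. (if i < i0 then \<bar>h i\<bar> else 0) + e / 4)"
        using i0 e by (intro sum_mono) (auto simp: not_less intro: less_imp_le)
      also have "\<dots> = (\<Sum>i<m. (if i < i0 then \<bar>h i\<bar> else 0)) + real m * (e / 4)"
        by (simp add: sum.distrib)
      also have "(\<Sum>i<m. (if i < i0 then \<bar>h i\<bar> else 0)) \<le> C"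
      proof -
        have "(\<Sum>i<m. (if i < i0 then \<bar>h i\<bar> else 0)) = (\<Sum>i\<in>{..<m} \<inter> {..<i0}. \<bar>h i\<bar>)"
          by (simp add: sum.If_cases lessThan_def Int_def)
        also have "\<dots> \<le> C" unfolding C_def by (rule sum_mono2) auto
        finally show ?thesis .
      qed
      finally show ?thesis by simp
    qed
    have "\<forall>\<^sub>F m in sequentially. C / real m < e / 4"
      using e by (intro order_tendstoD[OF lim_const_over_n]) auto
    then have "\<forall>\<^sub>F m in sequentially. norm ((\<integral>x. - ln (mass m x) \<partial>N) / real m - 0) < e"
      using eventually_ge_at_top[of 1]
    proof eventually_elim
      case (elim m)
      have "\<bar>\<Sum>i<m. h i\<bar> / real m \<le> (C + real m * (e / 4)) / real m"
        by (rule divide_right_mono[OF bound]) simp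
      also have "\<dots> = C / real m + e / 4" using elim(2) by (simp add: add_divide_distrib)
      finally have "\<bar>\<Sum>i<m. h i\<bar> / real m < e" using elim(1) e by linarith
      then show ?case unfolding sum by (simp add: abs_divide)
    qed
    then show "\<exists>no. \<forall>n\<ge>no. norm ((\<integral>x. - ln (mass n x) \<partial>N) / real n - 0) < e"
      by (simp add: eventually_sequentially)
  qed
qed

text \<open>\<open>G m\<close> consists of the cells of mass at least b^(-\<delta> m), of which
  there are at most b^(\<delta> m). By Markov's inequality and the vanishing entropy rate they fill
  mass tending to 1, so almost every point meets them at infinitely many levels, which is enough for
  Hausdorff covers.\<close>

lemma zero_entropy_cover:
  assumes "Qlim 1 = 1" and \<delta>: "\<delta> > 0"
  obtains G :: "nat \<Rightarrow> int set" and A where "A \<in> sets N" "measure N A = 1"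
    "\<And>m. finite (G m)" "\<And>m. real (card (G m)) \<le> real b powr (\<delta> * real m)"
    "\<And>x M. x \<in> A \<Longrightarrow> \<exists>m\<ge>M. cell m x \<in> G m"
proof -
  define G where "G m = {c \<in> cell m ` space N. measure N (cell m -` {c} \<inter> space N) \<ge> real b powr (- \<delta> * real m)}" for m
  have fin: "finite (G m)" for m unfolding G_def using cell_partition[of m] by auto
  have card: "real (card (G m)) \<le> real b powr (\<delta> * real m)" for m
  proof -
    have "real (card (G m)) * real b powr (- \<delta> * real m) \<le> (\<Sum>c\<in>G m. measure N (cell m -` {c} \<inter> space N))"
      using sum_bounded_below[of "G m" "real b powr (- \<delta> * real m)" "\<lambda>c. measure N (cell m -` {c} \<inter> space N)"] by (auto simp: G_def)
    also have "\<dots> = measure N (\<Union>c\<in>G m. cell m -` {c} \<inter> space N)"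
      by (rule finite_measure_finite_Union[symmetric])
         (use fin partition_cell_sets[OF cell_partition] in \<open>auto simp: disjoint_family_on_def\<close>)
    also have "\<dots> \<le> 1" by simp
    finally have "real (card (G m)) * real b powr (- \<delta> * real m) \<le> 1" .
    then have "real (card (G m)) * real b powr (- \<delta> * real m) * real b powr (\<delta> * real m) \<le> 1 * real b powr (\<delta> * real m)"
      by (rule mult_right_mono) simp
    then show ?thesis using b by (simp add: mult.assoc flip: powr_add)
  qed
  define S where "S m = {x \<in> space N. cell m x \<in> G m}" for m
  have S: "S m \<in> sets N" for m
  proof -
    have "S m = cell m -` G m \<inter> space N" by (auto simp: S_def)
    then show ?thesis using partition_cell_sets[OF cell_partition] by simp
  qed
  have markov: "measure N (space N - S m) \<le> (\<integral>x. - ln (mass m x) \<partial>N) / real m / (\<delta> * ln (real b))" if m: "m \<ge> 1" for m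
  proof -
    have lb: "ln (real b) > 0" using b by simp
    define t where "t = \<delta> * ln (real b) * real m"
    have t: "t > 0" using \<delta> lb m by (simp add: t_def)
    have int: "integrable N (\<lambda>x. - ln (mass m x))"
      using integrable_mass_fun[of "\<lambda>p q. - ln p"] by simp
    have nn: "AE x in N. 0 \<le> - ln (mass m x)"
      using AE_mass_pos[of m] by eventually_elim (simp add: mass_def)
    have "measure N (space N - S m) \<le> measure N {x \<in> space N. - ln (mass m x) \<ge> t}"
    proof (rule finite_measure_mono_AE)
      show "AE x in N. x \<in> space N - S m \<longrightarrow> x \<in> {x \<in> space N. - ln (mass m x) \<ge> t}"
        using AE_mass_pos[of m]
      proof eventually_elim
        case (elim x)
        show ?case
        proof
          assume "x \<in> space N - S m"
          then have x: "x \<in> space N" "mass m x < real b powr (- \<delta> * real m)"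
            by (auto simp: S_def G_def mass_def)
          then have "ln (mass m x) < ln (real b powr (- \<delta> * real m))" using elim b by (intro ln_less_cancel_iff[THEN iffD2]) auto
          then show "x \<in> {x \<in> space N. - ln (mass m x) \<ge> t}" using x b by (simp add: t_def ln_powr mult_ac)
        qed
      qed
      have "(\<lambda>x. - ln (mass m x)) \<in> borel_measurable N" by (rule borel_measurable_integrable[OF int])
      then show "{x \<in> space N. - ln (mass m x) \<ge> t} \<in> sets N" by measurable
    qed
    also have "\<dots> \<le> (\<integral>x. - ln (mass m x) \<partial>N) / t"
      by (rule integral_Markov_inequality_measure[OF int sets.empty_sets nn t])
    finally show ?thesis by (simp add: t_def mult_ac)
  qed
  define A where "A = (\<Inter>M. \<Union>m\<in>{M..}. S m)"
  have A: "A \<in> sets N" unfolding A_def using S by (intro sets.countable_INT sets.countable_UN') auto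
  have U: "measure N (\<Union>m\<in>{M..}. S m) = 1" for M
  proof -
    have Us: "(\<Union>m\<in>{M..}. S m) \<in> sets N" using S by (intro sets.countable_UN') auto
    have "1 - measure N (\<Union>m\<in>{M..}. S m) \<le> 0"
    proof (rule LIMSEQ_le_const)
      have "(\<lambda>m. (\<integral>x. - ln (mass m x) \<partial>N) / real m / (\<delta> * ln (real b))) \<longlonglongrightarrow> 0 / (\<delta> * ln (real b))"
        using \<delta> b by (intro tendsto_divide entropy_average_tendsto_0 assms(1) tendsto_const) auto
      then show "(\<lambda>m. (\<integral>x. - ln (mass m x) \<partial>N) / real m / (\<delta> * ln (real b))) \<longlonglongrightarrow> 0" by simp
      show "\<exists>n0. \<forall>m\<ge>n0. 1 - measure N (\<Union>m\<in>{M..}. S m) \<le> (\<integral>x. - ln (mass m x) \<partial>N) / real m / (\<delta> * ln (real b))"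
      proof (intro exI[of _ "max 1 M"] allI impI)
        fix m assume m: "max 1 M \<le> m"
        have "measure N (S m) \<le> measure N (\<Union>m\<in>{M..}. S m)"
          using m by (intro finite_measure_mono Us) auto
        then show "1 - measure N (\<Union>m\<in>{M..}. S m) \<le> (\<integral>x. - ln (mass m x) \<partial>N) / real m / (\<delta> * ln (real b))"
          using markov[of m] m prob_compl[OF S[of m]] by simp
      qed
    qed
    then show ?thesis using prob_le_1[of "\<Union>m\<in>{M..}. S m"] by linarith
  qed
  have "measure N A = 1"
  proof -
    have "AE x in N. \<forall>M. x \<in> (\<Union>m\<in>{M..}. S m)"
      unfolding AE_all_countable
      using U S by (intro allI AE_prob_1) blast
    then have "AE x in N. x \<in> A" by eventually_elim (auto simp: A_def)
    then show ?thesis by (subst prob_eq_1[OF A])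
  qed
  moreover have "\<exists>m\<ge>M. cell m x \<in> G m" if "x \<in> A" for x M
    using that by (auto simp: A_def S_def)
  ultimately show ?thesis using that[OF A _ fin card] by blast
qed

end

subsection \<open>Derivatives of an invariant map\<close>

text \<open>The translations mapping \<open>A\<close> into itself form a semigroup containing all
  multiples of \<beta>, and a nonzero one shorter than the radius \<delta> of a hole in
  \<open>A\<close> would step into the hole. For n > \<beta>/\<delta> Dirichlet approximation makes
  from any \<tau> a translation k\<tau> - h\<beta> of length below \<delta> with k \<le> n, which
  must be 0; n! is a multiple of every such k.\<close>

lemma translations_discrete:
  fixes A :: "real set"
  assumes "closed A" "A \<noteq> {}" "A \<noteq> UNIV" and \<beta>: "\<beta> > 0"
    and plus: "\<And>r. r \<in> A \<Longrightarrow> r + \<beta> \<in> A" and minus: "\<And>r. r \<in> A \<Longrightarrow> r - \<beta> \<in> A"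
  shows "\<exists>J::nat. J \<ge> 1 \<and> (\<forall>\<tau>. (\<forall>r\<in>A. r + \<tau> \<in> A) \<longrightarrow> (\<exists>i::int. real J * \<tau> = of_int i * \<beta>))"
proof -
  obtain z where z: "z \<in> - A" using assms(3) by auto
  have "open (- A)" using assms(1) by (simp add: open_Compl)
  then obtain \<delta> where \<delta>: "\<delta> > 0" "\<And>w. \<bar>w - z\<bar> < \<delta> \<Longrightarrow> w \<notin> A"
    using z unfolding open_dist dist_real_def by blast
  have mult: "r + real n * \<tau> \<in> A" if "\<forall>r\<in>A. r + \<tau> \<in> A" "r \<in> A" for n \<tau> r
  proof (induction n)
    case (Suc n)
    then show ?case using that(1)[rule_format, OF Suc] by (simp add: algebra_simps)
  qed (use that in simp)
  have multj: "r + of_int j * \<beta> \<in> A" if r: "r \<in> A" for j r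
  proof (cases "j \<ge> 0")
    case True
    then show ?thesis using mult[of \<beta> r "nat j"] plus r by simp
  next
    case False
    then show ?thesis using mult[of "- \<beta>" r "nat (- j)"] minus r by simp
  qed
  \<comment> \<open>Only positive multiples of \<rho> are available, so the starting point has to
    lie left or right of the hole according to the sign of \<rho>; multiples of \<beta>, available
    with both signs, bring it there.\<close>
  have no_small: False if \<rho>: "\<forall>r\<in>A. r + \<rho> \<in> A" "\<rho> \<noteq> 0" "\<bar>\<rho>\<bar> < \<delta>" for \<rho>
  proof -
    obtain x where x: "x \<in> A" using assms(2) by auto
    show False
    proof (cases "\<rho> > 0")
      case True
      define x' where "x' = x + of_int (\<lfloor>(z - x) / \<beta>\<rfloor>) * \<beta>"
      have x': "x' \<in> A" unfolding x'_def by (rule multj[OF x])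
      have "of_int \<lfloor>(z - x) / \<beta>\<rfloor> * \<beta> \<le> (z - x) / \<beta> * \<beta>"
        using \<beta> by (intro mult_right_mono) auto
      then have le: "x' \<le> z" using \<beta> by (simp add: x'_def)
      define n where "n = nat \<lceil>(z - x') / \<rho>\<rceil>"
      have "(z - x') / \<rho> \<ge> 0" using le True by simp
      then have n: "(z - x') / \<rho> \<le> real n" "real n < (z - x') / \<rho> + 1"
        unfolding n_def by linarith+
      have "z - x' \<le> real n * \<rho>" "real n * \<rho> < z - x' + \<rho>"
        using n True by (simp_all add: field_simps)
      then have "\<bar>x' + real n * \<rho> - z\<bar> < \<delta>" using \<rho>(3) True by linarith
      then show False using \<delta>(2) mult[OF \<rho>(1) x', of n] by blast
    next
      case False
      then have neg: "\<rho> < 0" using \<rho>(2) by simp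
      define x' where "x' = x + of_int (\<lceil>(z - x) / \<beta>\<rceil>) * \<beta>"
      have x': "x' \<in> A" unfolding x'_def by (rule multj[OF x])
      have "(z - x) / \<beta> * \<beta> \<le> of_int \<lceil>(z - x) / \<beta>\<rceil> * \<beta>"
        using \<beta> by (intro mult_right_mono) auto
      then have le: "z \<le> x'" using \<beta> by (simp add: x'_def)
      define n where "n = nat \<lceil>(x' - z) / (- \<rho>)\<rceil>"
      have "(x' - z) / (- \<rho>) \<ge> 0" using le neg by (intro divide_nonneg_pos) auto
      then have n: "(x' - z) / (- \<rho>) \<le> real n" "real n < (x' - z) / (- \<rho>) + 1"
        unfolding n_def by linarith+
      have "x' - z \<le> real n * (- \<rho>)" "real n * (- \<rho>) < x' - z + (- \<rho>)"
        using n neg pos_divide_le_eq[of "- \<rho>" "x' - z" "real n"] pos_less_divide_eq[of "- \<rho>" "real n - 1" "x' - z"]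
        by (simp_all add: algebra_simps)
      then have "\<bar>x' + real n * \<rho> - z\<bar> < \<delta>" using \<rho>(3) neg by (simp add: abs_if)
      then show False using \<delta>(2) mult[OF \<rho>(1) x', of n] by blast
    qed
  qed
  define n where "n = nat \<lceil>\<beta> / \<delta>\<rceil> + 1"
  have n: "\<beta> / \<delta> < real n" unfolding n_def by linarith
  have n0: "n > 0" by (simp add: n_def)
  show ?thesis
  proof (intro exI[of _ "fact n :: nat"] conjI allI impI)
    show "1 \<le> (fact n :: nat)" by simp
    fix \<tau> assume \<tau>: "\<forall>r\<in>A. r + \<tau> \<in> A"
    obtain h k where hk: "0 < k" "k \<le> int n" "\<bar>of_int k * (\<tau> / \<beta>) - of_int h\<bar> < 1 / n"
      using Dirichlet_approx[OF n0, of "\<tau> / \<beta>"] by blast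
    define \<rho> where "\<rho> = of_int k * \<tau> - of_int h * \<beta>"
    have \<rho>S: "\<forall>r\<in>A. r + \<rho> \<in> A"
    proof
      fix r assume "r \<in> A"
      then have "r + real (nat k) * \<tau> \<in> A" by (rule mult[OF \<tau>])
      then have "r + real (nat k) * \<tau> + of_int (- h) * \<beta> \<in> A" by (rule multj)
      then show "r + \<rho> \<in> A" using hk(1) by (simp add: \<rho>_def algebra_simps)
    qed
    have "\<bar>\<rho>\<bar> = \<beta> * \<bar>of_int k * (\<tau> / \<beta>) - of_int h\<bar>"
    proof -
      have "\<rho> = \<beta> * (of_int k * (\<tau> / \<beta>) - of_int h)" using \<beta> by (simp add: \<rho>_def right_diff_distrib)
      then show ?thesis using \<beta> by (simp add: abs_mult)
    qed
    also have "\<dots> < \<beta> * (1 / real n)" using hk(3) \<beta> by (intro mult_strict_left_mono) auto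
    also have "\<dots> < \<delta>" using n n0 \<delta>(1) by (simp add: field_simps)
    finally have "\<rho> = 0" using no_small[OF \<rho>S] by blast
    then have k\<tau>: "of_int k * \<tau> = of_int h * \<beta>" by (simp add: \<rho>_def)
    have "nat k dvd fact n" using hk by (intro dvd_fact) auto
    then obtain q where q: "fact n = nat k * q" by blast
    have "real (fact n) * \<tau> = real q * (of_int k * \<tau>)" using hk(1) q by (simp only: q) simp
    also have "\<dots> = of_int (int q * h) * \<beta>" unfolding k\<tau> by simp
    finally show "\<exists>i::int. real (fact n) * \<tau> = of_int i * \<beta>" by blast
  qed
qed

context base_b
begin

text \<open>\<open>A\<close> is stable under adding ln b because its condition runs over all p,
  under subtracting ln b by \<open>Phi_base_mult_le\<close>, and under adding ln |Ft' y| by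
  \<open>Phi_compare\<close>, at every y all of whose cells have positive mass, that is at almost
  every y.\<close>

theorem derivative_rational_powers:
  fixes Ft Ft' :: "real \<Rightarrow> real"
  assumes Q: "Qlim \<longlonglongrightarrow> 0" and N0: "measure N {0} = 0"
    and der: "\<And>x. (Ft has_real_derivative Ft' x) (at x)" and cont: "continuous_on UNIV Ft'"
    and nz: "\<And>x. Ft' x \<noteq> 0"
    and F: "\<And>x. x \<in> {0..<1} \<Longrightarrow> F x = frac (Ft x)" "F \<in> measurable N N" "distr N N F = N"
    and k: "k \<in> \<int>" "k > 0" "(\<integral>x. ee (k * x) \<partial>N) \<noteq> 0"
  shows "\<exists>J::nat. J \<ge> 1 \<and> (AE y in N. \<exists>i::int. real J * ln \<bar>Ft' y\<bar> = of_int i * ln (real b))"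
proof -
  define \<epsilon> where "\<epsilon> = (cmod (\<integral>x. ee (k * x) \<partial>N))\<^sup>2"
  have \<epsilon>: "\<epsilon> > 0" using k(3) by (simp add: \<epsilon>_def)
  define A where "A = {r. \<forall>p. \<epsilon> \<le> Phi (exp r * real b ^ p)}"
  have contPhi: "continuous_on UNIV Phi"
  proof (rule continuous_at_imp_continuous_on, rule ballI)
    fix x
    have "(4 * pi)-lipschitz_on UNIV Phi"
      by (rule lipschitz_onI) (use Phi_lipschitz in \<open>auto simp: dist_real_def\<close>)
    then show "isCont Phi x"
      using lipschitz_on_continuous_on continuous_on_eq_continuous_at by blast
  qed
  have "A = (\<Inter>p. {r. \<epsilon> \<le> Phi (exp r * real b ^ p)})" by (auto simp: A_def)
  also have "closed \<dots>"
  proof (rule closed_INT, rule ballI)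
    fix p
    show "closed {r. \<epsilon> \<le> Phi (exp r * real b ^ p)}"
      by (intro closed_Collect_le continuous_intros continuous_on_compose2[OF contPhi]) auto
  qed
  finally have cl: "closed A" .
  have ne: "ln k \<in> A"
    using fourier_le_Phi[OF k(1)] k(2) by (auto simp: A_def \<epsilon>_def)
  have proper: "A \<noteq> UNIV"
  proof -
    obtain s where s: "s > 0" "Phi s < \<epsilon>" using Phi_small[OF Q \<epsilon>] by blast
    then have "ln s \<notin> A" by (auto simp: A_def intro!: exI[of _ 0])
    then show ?thesis by auto
  qed
  have eb: "exp (ln (real b)) = real b" using b by simp
  have plus: "r + ln (real b) \<in> A" if "r \<in> A" for r
  proof -
    have "\<epsilon> \<le> Phi (exp r * real b ^ Suc p)" for p using that unfolding A_def by blast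
    then show ?thesis by (simp add: A_def exp_add eb mult.assoc)
  qed
  have minus: "r - ln (real b) \<in> A" if r: "r \<in> A" for r
  proof -
    have "\<epsilon> \<le> Phi (exp (r - ln (real b)) * real b ^ p)" for p
    proof -
      have "\<epsilon> \<le> Phi (exp r * real b ^ p)" using r unfolding A_def by blast
      also have "exp r * real b ^ p = real b * (exp (r - ln (real b)) * real b ^ p)"
        using b by (simp add: exp_diff eb)
      also have "Phi \<dots> \<le> Phi (exp (r - ln (real b)) * real b ^ p)" by (rule Phi_base_mult_le)
      finally show ?thesis .
    qed
    then show ?thesis by (simp add: A_def)
  qed
  have "ln (real b) > 0" using b by simp
  then obtain J :: nat where J: "J \<ge> 1" "\<And>\<tau>. (\<forall>r\<in>A. r + \<tau> \<in> A) \<Longrightarrow> \<exists>i::int. real J * \<tau> = of_int i * ln (real b)"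
    using translations_discrete[OF cl _ proper _ plus minus] ne by blast
  have "AE y in N. \<forall>q. mass q y > 0"
    unfolding AE_all_countable using AE_mass_pos by blast
  then have "AE y in N. \<exists>i::int. real J * ln \<bar>Ft' y\<bar> = of_int i * ln (real b)"
    using AE_space
  proof eventually_elim
    case (elim y)
    have y: "y \<in> {0..<1}" using elim(2) by (simp add: space_N)
    show ?case
    proof (rule J(2), rule ballI)
      fix r assume r: "r \<in> A"
      have "\<epsilon> \<le> Phi (exp (r + ln \<bar>Ft' y\<bar>) * real b ^ p)" for p
      proof -
        have "\<epsilon> \<le> Phi ((exp r * real b ^ p) * \<bar>Ft' y\<bar>)"
        proof (rule Phi_compare[OF der cont F y _ N0])
          show "0 < measure N (cell q -` {cell q y} \<inter> space N)" for q
            using elim(1) by (simp add: mass_def)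
          show "0 < exp r * real b ^ p" using bpos by simp
          show "\<epsilon> \<le> Phi (exp r * real b ^ p * real b ^ d)" for d
            using r unfolding A_def by (auto simp: mult.assoc simp flip: power_add)
        qed
        then show ?thesis using nz[of y] by (simp add: exp_add mult_ac)
      qed
      then show "r + ln \<bar>Ft' y\<bar> \<in> A" by (simp add: A_def)
    qed
  qed
  then show ?thesis using J(1) by blast
qed

end

subsection \<open>Fourier coefficients on the circle\<close>

lift_definition circ_frac :: "circle \<Rightarrow> real" is frac
proof -
  fix x y :: real assume "x - y \<in> \<int>"
  then obtain k where k: "x = y + of_int k" by (metis Ints_cases add.commute diff_add_cancel)
  show "frac x = frac y" unfolding k frac_def by simp
qed

lemma circ_frac_to_circle [simp]: "circ_frac (to_circle t) = frac t"
  by (rule circ_frac.abs_eq)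

lemma to_circle_eq_iff: "to_circle s = to_circle t \<longleftrightarrow> s - t \<in> \<int>"
  using circle.abs_eq_iff by simp

lemma to_circle_circ_frac [simp]: "to_circle (circ_frac x) = x"
proof (induction x rule: circle.abs_induct)
  case (1 t)
  have "frac t - t \<in> \<int>" by (simp add: frac_def)
  then show ?case by (simp add: to_circle_eq_iff)
qed

lemma circ_frac_range: "circ_frac x \<in> {0..<1}"
  by (induction x rule: circle.abs_induct) (simp add: frac_ge_0 frac_lt_1)

lemma circ_frac_bounds: "0 \<le> circ_frac x" "circ_frac x < 1"
  using circ_frac_range[of x] by auto

lemma to_circle_surj: "\<exists>t\<in>{0..<1}. x = to_circle t"
  using circ_frac_range[of x] to_circle_circ_frac[of x] by metis

lemma compact_circle: "compact (UNIV :: circle set)"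
proof -
  have "compact (to_circle ` {0..1})"
    by (intro compact_continuous_image continuous_on_to_circle) simp
  moreover have "to_circle ` {0..1} = (UNIV :: circle set)"
    using to_circle_surj by force
  ultimately show ?thesis by simp
qed

text \<open>\<open>circ_frac\<close> jumps at 0, so measurability is read off from its sublevel
  sets, which are images of compact intervals.\<close>

lemma circ_frac_measurable [measurable]: "circ_frac \<in> borel_measurable borel"
  unfolding borel_measurable_iff_le
proof
  fix c :: real
  consider "c < 0" | "0 \<le> c" "c < 1" | "1 \<le> c" by linarith
  then show "{x \<in> space borel. circ_frac x \<le> c} \<in> sets borel"
  proof cases
    case 1
    then have "{x \<in> space borel. circ_frac x \<le> c} = {}"
      using circ_frac_bounds(1) by (auto simp: not_le intro: less_le_trans)
    then show ?thesis by simp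
  next
    case 2
    have "{x. circ_frac x \<le> c} = to_circle ` {0..c}"
    proof safe
      fix x assume "circ_frac x \<le> c"
      then show "x \<in> to_circle ` {0..c}"
        using circ_frac_range[of x] by (intro image_eqI[of _ _ "circ_frac x"]) auto
    next
      fix t assume "t \<in> {0..c}"
      then show "circ_frac (to_circle t) \<le> c" using 2 by (simp add: frac_eq[THEN iffD2])
    qed
    moreover have "compact (to_circle ` {0..c})"
      by (intro compact_continuous_image continuous_on_to_circle) simp
    ultimately show ?thesis by (simp add: compact_imp_closed)
  next
    case 3
    then have "{x \<in> space borel. circ_frac x \<le> c} = UNIV"
      by (auto intro: less_imp_le less_le_trans[OF circ_frac_bounds(2)])
    then show ?thesis by simp
  qed
qed

lemma circ_frac_times_map: "circ_frac (times_map m x) = frac (real m * circ_frac x)"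
proof -
  have "times_map m x = to_circle (real m * circ_frac x)"
    by (subst to_circle_circ_frac[of x, symmetric], subst times_map.abs_eq) simp
  then show ?thesis by simp
qed

lemma times_map_to_circle: "times_map m (to_circle t) = to_circle (real m * t)"
  by (rule times_map.abs_eq)

text \<open>Defined through the representative in [0,1); as \<open>k\<close> is an integer, every
  lift gives the same value.\<close>

definition circ_char :: "int \<Rightarrow> circle \<Rightarrow> complex" where
  "circ_char k x = ee (of_int k * circ_frac x)"

lemma ee_add_int: "k \<in> \<int> \<Longrightarrow> ee (t + k) = ee t"
  by (simp add: ee_add ee_int)

lemma circ_char_to_circle: "circ_char k (to_circle t) = ee (of_int k * t)"
proof -
  have "of_int k * t = of_int k * frac t + of_int k * of_int \<lfloor>t\<rfloor>"
    by (simp add: frac_def algebra_simps)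
  then show ?thesis by (simp add: circ_char_def ee_add_int)
qed

lemma circ_char_add: "circ_char (k + l) x = circ_char k x * circ_char l x"
  by (simp add: circ_char_def distrib_right ee_add)

lemma circ_char_0 [simp]: "circ_char 0 x = 1" by (simp add: circ_char_def)

lemma circ_char_cnj: "cnj (circ_char k x) = circ_char (- k) x"
  by (simp add: circ_char_def ee_minus)

lemma norm_circ_char [simp]: "cmod (circ_char k x) = 1" by (simp add: circ_char_def)

lemma circ_char_measurable [measurable]: "circ_char k \<in> borel_measurable borel"
  unfolding circ_char_def[abs_def] by measurable

lemma circ_char_times_map: "circ_char k (times_map m x) = circ_char (k * int m) x"
proof -
  obtain t where "x = to_circle t" using to_circle_surj by blast
  then show ?thesis by (simp add: times_map_to_circle circ_char_to_circle mult.assoc)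
qed

lemma circ_char_1_continuous: "continuous_on UNIV (circ_char 1)"
proof -
  have "cmod (circ_char 1 x - circ_char 1 y) \<le> 2 * pi * dist x y" for x y
  proof -
    obtain s t where st: "x = to_circle s" "y = to_circle t" using to_circle_surj by metis
    define k where "k = round (s - t)"
    have "circ_char 1 x = ee (s - of_int k)" using ee_add_int[of "- of_int k" s] by (simp add: st circ_char_to_circle)
    then have "cmod (circ_char 1 x - circ_char 1 y) \<le> 2 * pi * \<bar>s - of_int k - t\<bar>"
      using ee_lipschitz[of "s - of_int k" t] by (simp add: st circ_char_to_circle)
    also have "\<bar>s - of_int k - t\<bar> = dist x y"
      by (simp add: st dist_circle.abs_eq int_dist_def k_def algebra_simps)
    finally show ?thesis .
  qed
  then have "(2 * pi)-lipschitz_on UNIV (circ_char 1)"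
    by (intro lipschitz_onI) (auto simp: dist_norm)
  then show ?thesis by (rule lipschitz_on_continuous_on)
qed

lemma ee_eq_iff: "ee s = ee t \<longleftrightarrow> s - t \<in> \<int>"
proof
  assume "ee s = ee t"
  then have "ee (s - t) = 1" using ee_add[of t "s - t"] norm_ee[of t] by (metis add_diff_cancel_left' diff_add_cancel add.commute mult_cancel_left2 norm_zero zero_neq_one)
  then have "exp (\<i> * of_real (2 * pi * (s - t))) = 1" by (simp add: ee_def cis_conv_exp)
  then obtain n :: int where "2 * pi * (s - t) = of_int (2 * n) * pi" unfolding exp_eq_1 by auto
  then have "(2 * pi) * (s - t) = (2 * pi) * of_int n" by simp
  then have "s - t = of_int n" by (rule mult_left_cancel[THEN iffD1, rotated]) simp
  then show "s - t \<in> \<int>" by simp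
next
  assume "s - t \<in> \<int>"
  then show "ee s = ee t" using ee_add_int[of "s - t" t] by simp
qed

lemma circ_char_1_inj: "inj (circ_char 1)"
proof (rule injI)
  fix x y assume eq: "circ_char 1 x = circ_char 1 y"
  obtain s t where st: "x = to_circle s" "y = to_circle t" using to_circle_surj by metis
  show "x = y" using eq by (simp add: st circ_char_to_circle ee_eq_iff to_circle_eq_iff)
qed

text \<open>A list of coefficients and frequencies, repetitions allowed, makes sums and products
  accessible to list induction.\<close>

definition trig_poly :: "(circle \<Rightarrow> complex) \<Rightarrow> bool" where
  "trig_poly p \<longleftrightarrow> (\<exists>xs. \<forall>x. p x = (\<Sum>(c, k)\<leftarrow>xs. c * circ_char k x))"

lemma trig_poly_char: "trig_poly (\<lambda>x. c * circ_char k x)"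
  unfolding trig_poly_def by (rule exI[of _ "[(c, k)]"]) simp

lemma trig_poly_add: "trig_poly p \<Longrightarrow> trig_poly q \<Longrightarrow> trig_poly (\<lambda>x. p x + q x)"
  unfolding trig_poly_def by (elim exE, rule_tac x = "xs @ xsa" in exI) simp

lemma trig_poly_mult:
  assumes "trig_poly p" "trig_poly q"
  shows "trig_poly (\<lambda>x. p x * q x)"
proof -
  obtain ys where ys: "\<And>x. q x = (\<Sum>(c, k)\<leftarrow>ys. c * circ_char k x)"
    using assms(2) by (auto simp: trig_poly_def)
  have mono: "trig_poly (\<lambda>x. (c * circ_char k x) * q x)" for c k
    unfolding trig_poly_def
  proof (intro exI allI)
    fix x
    have "(c * circ_char k x) * (\<Sum>(d, l)\<leftarrow>ys. d * circ_char l x) = (\<Sum>(d, l)\<leftarrow>map (\<lambda>(d, l). (c * d, k + l)) ys. d * circ_char l x)" for ys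
      by (induction ys) (auto simp: circ_char_add algebra_simps)
    then show "(c * circ_char k x) * q x = (\<Sum>(d, l)\<leftarrow>map (\<lambda>(d, l). (c * d, k + l)) ys. d * circ_char l x)"
      by (simp add: ys)
  qed
  have "trig_poly (\<lambda>x. (\<Sum>(c, k)\<leftarrow>xs. c * circ_char k x) * q x)" for xs
  proof (induction xs)
    case Nil
    then show ?case using trig_poly_char[of 0 0] by simp
  next
    case (Cons a xs)
    obtain c k where a: "a = (c, k)" by (cases a)
    show ?case using trig_poly_add[OF mono[of c k] Cons] by (simp add: a distrib_right)
  qed
  moreover obtain xs where "\<And>x. p x = (\<Sum>(c, k)\<leftarrow>xs. c * circ_char k x)"
    using assms(1) by (auto simp: trig_poly_def)
  ultimately show ?thesis by simp
qed

text \<open>Real and imaginary part of \<open>circ_char 1\<close> are combinations of the characters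
  1 and -1, so a real linear function of it is one too; products of characters are
  characters.\<close>

lemma trig_poly_real_polynomial:
  assumes "real_polynomial_function g"
  shows "trig_poly (\<lambda>x. complex_of_real (g (circ_char 1 x)))"
  using assms
proof induction
  case (linear f)
  have f: "f z = Re z * f 1 + Im z * f \<i>" for z
  proof -
    interpret bounded_linear f by (rule linear)
    have "f z = f (Re z *\<^sub>R 1 + Im z *\<^sub>R \<i>)" by (rule arg_cong[where f = f]) (simp add: complex_eq_iff)
    then show ?thesis by (simp only: add scaleR real_scaleR_def)
  qed
  have eq: "complex_of_real (f (circ_char 1 x))
      = ((of_real (f 1) - \<i> * of_real (f \<i>)) / 2) * circ_char 1 x + ((of_real (f 1) + \<i> * of_real (f \<i>)) / 2) * circ_char (-1) x" for x
    unfolding circ_char_cnj[of 1 x, simplified, symmetric]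
    by (subst f) (simp add: complex_eq_iff field_simps)
  show ?case unfolding eq by (rule trig_poly_add[OF trig_poly_char trig_poly_char])
next
  case (const c)
  then show ?case using trig_poly_char[of "of_real c" 0] by simp
next
  case (add f g)
  then show ?case using trig_poly_add by simp
next
  case (mult f g)
  then show ?case using trig_poly_mult by simp
qed

text \<open>\<open>circ_char 1\<close> embeds the compact circle into the plane, where
  Stone-Weierstrass applies.\<close>

lemma circle_continuous_approx:
  fixes \<phi> :: "circle \<Rightarrow> real"
  assumes "continuous_on UNIV \<phi>" "e > 0"
  obtains p where "trig_poly p" "\<And>x. cmod (of_real (\<phi> x) - p x) < e"
proof -
  let ?E = "circ_char 1"
  have "continuous_on (?E ` UNIV) (inv ?E)"
    by (rule continuous_on_inv[OF circ_char_1_continuous compact_circle]) (simp add: circ_char_1_inj)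
  then have "continuous_on (range ?E) (\<lambda>z. \<phi> (inv ?E z))"
    using continuous_on_compose2[OF assms(1)] by auto
  moreover have "compact (range ?E)"
    by (rule compact_continuous_image[OF circ_char_1_continuous compact_circle])
  ultimately obtain g where g: "real_polynomial_function g" "\<And>z. z \<in> range ?E \<Longrightarrow> \<bar>\<phi> (inv ?E z) - g z\<bar> < e"
    using Stone_Weierstrass_real_polynomial_function[of "range ?E" "\<lambda>z. \<phi> (inv ?E z)" e] assms(2) by blast
  have "cmod (of_real (\<phi> x) - of_real (g (?E x))) < e" for x
    using g(2)[of "?E x"] by (simp add: circ_char_1_inj flip: of_real_diff)
  then show ?thesis using that trig_poly_real_polynomial[OF g(1)] by blast
qed

text \<open>Characters fix the integrals of trigonometric polynomials, then of continuous functions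
  by uniform approximation, then the measures of closed sets as limits of the bumps max 0 (1 - n
  dist); closed sets are an intersection-stable generator.\<close>

lemma circle_measure_eqI:
  fixes M1 M2 :: "circle measure"
  assumes sets: "sets M1 = sets borel" "sets M2 = sets borel" and prob: "prob_space M1" "prob_space M2"
    and eq: "\<And>k. k \<noteq> 0 \<Longrightarrow> (\<integral>x. circ_char k x \<partial>M1) = (\<integral>x. circ_char k x \<partial>M2)"
  shows "M1 = M2"
proof -
  interpret M1: prob_space M1 by (rule prob)
  interpret M2: prob_space M2 by (rule prob)
  have space: "space M1 = UNIV" "space M2 = UNIV"
    using sets_eq_imp_space_eq[OF sets(1)] sets_eq_imp_space_eq[OF sets(2)] by auto
  have meas: "f \<in> borel_measurable M1" "f \<in> borel_measurable M2" if "f \<in> borel_measurable borel"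
    for f :: "circle \<Rightarrow> 'b::topological_space"
    using that sets by (auto cong: measurable_cong_sets)
  have eq': "(\<integral>x. circ_char k x \<partial>M1) = (\<integral>x. circ_char k x \<partial>M2)" for k
    using eq[of k] by (cases "k = 0") (auto simp: M1.prob_space M2.prob_space)
  have intc: "integrable M1 (circ_char k)" "integrable M2 (circ_char k)" for k
    by (rule M1.integrable_bounded[where B = 1] M2.integrable_bounded[where B = 1]; use meas[OF circ_char_measurable] in simp)+
  have trig: "integrable M1 p \<and> integrable M2 p \<and> (\<integral>x. p x \<partial>M1) = (\<integral>x. p x \<partial>M2)" if "trig_poly p" for p
  proof -
    obtain xs where xs: "\<And>x. p x = (\<Sum>(c, k)\<leftarrow>xs. c * circ_char k x)" using \<open>trig_poly p\<close> by (auto simp: trig_poly_def)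
    have "integrable M1 (\<lambda>x. \<Sum>(c, k)\<leftarrow>xs. c * circ_char k x) \<and> integrable M2 (\<lambda>x. \<Sum>(c, k)\<leftarrow>xs. c * circ_char k x)
      \<and> (\<integral>x. (\<Sum>(c, k)\<leftarrow>xs. c * circ_char k x) \<partial>M1) = (\<integral>x. (\<Sum>(c, k)\<leftarrow>xs. c * circ_char k x) \<partial>M2)"
      by (induction xs) (auto simp: intc eq')
    moreover have "p = (\<lambda>x. \<Sum>(c, k)\<leftarrow>xs. c * circ_char k x)" using xs by blast
    ultimately show ?thesis by simp
  qed
  have cont: "(\<integral>x. \<phi> x \<partial>M1) = (\<integral>x. \<phi> x \<partial>M2)" if c: "continuous_on UNIV \<phi>" for \<phi> :: "circle \<Rightarrow> real"
  proof (rule ccontr)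
    assume ne: "(\<integral>x. \<phi> x \<partial>M1) \<noteq> (\<integral>x. \<phi> x \<partial>M2)"
    define e where "e = \<bar>(\<integral>x. \<phi> x \<partial>M1) - (\<integral>x. \<phi> x \<partial>M2)\<bar> / 2"
    have e: "e > 0" using ne by (simp add: e_def)
    have "compact (range \<phi>)" by (rule compact_continuous_image[OF c compact_circle])
    then have "bounded (range \<phi>)" by (rule compact_imp_bounded)
    then obtain B where "\<forall>y\<in>range \<phi>. norm y \<le> B" unfolding bounded_iff by blast
    then have B: "\<bar>\<phi> x\<bar> \<le> B" for x by simp
    have m: "\<phi> \<in> borel_measurable borel" by (rule borel_measurable_continuous_onI[OF c])
    have i: "integrable M1 \<phi>" "integrable M2 \<phi>"
      using M1.integrable_bounded[of \<phi> B] M2.integrable_bounded[of \<phi> B] meas[OF m] B by auto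
    obtain p' where p': "trig_poly p'" "\<And>x. cmod (of_real (\<phi> x) - p' x) < e / 2"
      using circle_continuous_approx[OF c, of "e/2"] e by auto
    note tp' = trig[OF p'(1)]
    have 1: "cmod (of_real (\<integral>x. \<phi> x \<partial>M1) - (\<integral>x. p' x \<partial>M1)) \<le> e / 2"
    proof -
      have "of_real (\<integral>x. \<phi> x \<partial>M1) - (\<integral>x. p' x \<partial>M1) = (\<integral>x. of_real (\<phi> x) - p' x \<partial>M1)"
        using i tp' by simp
      also have "cmod \<dots> \<le> e / 2"
        by (rule M1.integral_norm_bounded) (use p'(2) i tp' in \<open>auto intro: less_imp_le\<close>)
      finally show ?thesis .
    qed
    have 2: "cmod (of_real (\<integral>x. \<phi> x \<partial>M2) - (\<integral>x. p' x \<partial>M2)) \<le> e / 2"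
    proof -
      have "of_real (\<integral>x. \<phi> x \<partial>M2) - (\<integral>x. p' x \<partial>M2) = (\<integral>x. of_real (\<phi> x) - p' x \<partial>M2)"
        using i tp' by simp
      also have "cmod \<dots> \<le> e / 2"
        by (rule M2.integral_norm_bounded) (use p'(2) i tp' in \<open>auto intro: less_imp_le\<close>)
      finally show ?thesis .
    qed
    have "cmod (of_real (\<integral>x. \<phi> x \<partial>M1) - of_real (\<integral>x. \<phi> x \<partial>M2)) \<le> e / 2 + e / 2"
      using norm_diff_triangle_le[OF 1, of "of_real (\<integral>x. \<phi> x \<partial>M2)" "e/2"] 2 tp' by (simp add: norm_minus_commute)
    then show False using e by (simp add: e_def flip: of_real_diff)
  qed
  have closed: "emeasure M1 C = emeasure M2 C" if C: "closed C" for C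
  proof (cases "C = {}")
    case False
    define \<phi> where "\<phi> n x = max 0 (1 - real n * infdist x C)" for n x
    have cphi: "continuous_on UNIV (\<phi> n)" for n
      unfolding \<phi>_def by (intro continuous_intros continuous_on_max)
    have lim: "(\<lambda>n. \<phi> n x) \<longlonglongrightarrow> indicator C x" for x
    proof (cases "x \<in> C")
      case True
      then show ?thesis by (simp add: \<phi>_def)
    next
      case False
      then have "infdist x C > 0"
        using C \<open>C \<noteq> {}\<close> by (metis in_closed_iff_infdist_zero infdist_nonneg order_le_less)
      then obtain n0 where n0: "1 < real n0 * infdist x C" by (metis reals_Archimedean3)
      have "\<forall>\<^sub>F n in sequentially. \<phi> n x = 0"
        using eventually_ge_at_top[of n0]
      proof eventually_elim
        case (elim n)
        have "real n0 * infdist x C \<le> real n * infdist x C" using elim \<open>infdist x C > 0\<close> by (intro mult_right_mono) auto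
        then show ?case using n0 by (simp add: \<phi>_def)
      qed
      then show ?thesis using False by (simp add: tendsto_eventually)
    qed
    have b: "\<bar>\<phi> n x\<bar> \<le> 1" for n x
      using infdist_nonneg[of x C] by (simp add: \<phi>_def)
    have mphi: "\<phi> n \<in> borel_measurable borel" for n
      by (rule borel_measurable_continuous_onI[OF cphi])
    have Cs: "C \<in> sets borel" using C by simp
    have "(\<lambda>n. \<integral>x. \<phi> n x \<partial>M1) \<longlonglongrightarrow> (\<integral>x. indicator C x \<partial>M1)"
      by (rule integral_dominated_convergence[where w = "\<lambda>_. 1"]) (use lim b meas[OF mphi] sets Cs in auto)
    moreover have "(\<lambda>n. \<integral>x. \<phi> n x \<partial>M2) \<longlonglongrightarrow> (\<integral>x. indicator C x \<partial>M2)"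
      by (rule integral_dominated_convergence[where w = "\<lambda>_. 1"]) (use lim b meas[OF mphi] sets Cs in auto)
    ultimately have "(\<integral>x. indicator C x \<partial>M1) = (\<integral>x. indicator C x \<partial>M2 :: real)"
      using cont[OF cphi] LIMSEQ_unique by simp
    then show ?thesis
      using sets Cs space by (simp add: M1.emeasure_eq_measure M2.emeasure_eq_measure)
  qed simp
  show ?thesis
  proof (rule measure_eqI_generator_eq[where E = "Collect closed" and \<Omega> = UNIV and A = "\<lambda>_. UNIV"])
    show "Int_stable (Collect closed)" by (auto simp: Int_stable_def)
    show "sets M1 = sigma_sets UNIV (Collect closed)" "sets M2 = sigma_sets UNIV (Collect closed)"
      using sets by (simp_all add: borel_eq_closed)
    show "emeasure M1 X = emeasure M2 X" if "X \<in> Collect closed" for X using closed that by simp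
  qed auto
qed

subsection \<open>Lebesgue measure on the circle\<close>

lemma sets_lebesgue_circle [simp]: "sets lebesgue_circle = sets borel"
  and space_lebesgue_circle [simp]: "space lebesgue_circle = UNIV"
  by (simp_all add: lebesgue_circle_def)

lemma to_circle_measurable_restrict: "to_circle \<in> measurable (restrict_space lborel {0..<1}) borel"
  by (rule measurable_restrict_space1) simp

lemma emeasure_lebesgue_circle:
  assumes "A \<in> sets borel"
  shows "emeasure lebesgue_circle A = emeasure lborel (to_circle -` A \<inter> {0..<1})"
proof -
  have "emeasure lebesgue_circle A = emeasure (restrict_space lborel {0..<1}) (to_circle -` A \<inter> {0..<1})"
    unfolding lebesgue_circle_def
    by (subst emeasure_distr[OF to_circle_measurable_restrict assms]) (simp add: space_restrict_space)
  then show ?thesis by (simp add: emeasure_restrict_space)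
qed

lemma prob_space_lebesgue_circle: "prob_space lebesgue_circle"
  by (rule prob_spaceI) (simp add: emeasure_lebesgue_circle)

lemma integral_lebesgue_circle:
  fixes f :: "circle \<Rightarrow> 'b::{banach, second_countable_topology}"
  assumes "f \<in> borel_measurable borel"
  shows "(\<integral>x. f x \<partial>lebesgue_circle) = (\<integral>t. indicator {0..<1} t *\<^sub>R f (to_circle t) \<partial>lborel)"
proof -
  have "(\<integral>x. f x \<partial>lebesgue_circle) = (\<integral>t. f (to_circle t) \<partial>restrict_space lborel {0..<1})"
    unfolding lebesgue_circle_def by (rule integral_distr[OF to_circle_measurable_restrict assms])
  also have "\<dots> = (\<integral>t. indicator {0..<1} t *\<^sub>R f (to_circle t) \<partial>lborel)"
    by (subst integral_restrict_space) (auto simp: set_lebesgue_integral_def)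
  finally show ?thesis .
qed

lemma fourier_lebesgue_circle:
  assumes "k \<noteq> 0"
  shows "(\<integral>x. circ_char k x \<partial>lebesgue_circle) = 0"
proof -
  define c where "c = 2 * pi * real_of_int k"
  have c: "c \<noteq> 0" using assms by (simp add: c_def)
  define G where "G t = - \<i> / of_real c * cis (c * t)" for t
  have der: "(G has_vector_derivative ee (of_int k * t)) (at t within {0..1})" for t
  proof -
    have "((\<lambda>t. - \<i> / of_real c * exp (\<i> * of_real (c * t))) has_vector_derivative
        - \<i> / of_real c * (exp (\<i> * of_real (c * t)) * (\<i> * of_real c))) (at t within {0..1})"
      by (auto intro!: derivative_eq_intros has_vector_derivative_real_field) (simp add: mult.commute mult.left_commute)
    then show ?thesis using c by (simp add: G_def[abs_def] cis_conv_exp ee_def c_def mult_ac)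
  qed
  have cont: "continuous_on {0..1} (\<lambda>t. ee (of_int k * t))"
    unfolding ee_def cis_conv_exp by (intro continuous_intros)
  have "(\<integral>t. indicator {0..1} t *\<^sub>R ee (of_int k * t) \<partial>lborel) = G 1 - G 0"
    by (rule integral_FTC_Icc[OF _ der cont]) simp
  also have "\<dots> = 0"
    using ee_int[of "of_int k"] by (simp add: G_def c_def ee_def mult.assoc)
  finally have 1: "(\<integral>t. indicator {0..1} t *\<^sub>R ee (of_int k * t) \<partial>lborel) = 0" .
  have "(\<integral>x. circ_char k x \<partial>lebesgue_circle) = (\<integral>t. indicator {0..<1} t *\<^sub>R ee (of_int k * t) \<partial>lborel)"
    by (subst integral_lebesgue_circle) (simp_all add: circ_char_to_circle)
  also have "\<dots> = (\<integral>t. indicator {0..1} t *\<^sub>R ee (of_int k * t) \<partial>lborel)"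
  proof (rule integral_cong_AE)
    have "AE t in lborel. t \<noteq> (1::real)" by (rule AE_lborel_singleton)
    then show "AE t in lborel. indicator {0..<1} t *\<^sub>R ee (of_int k * t) = indicator {0..1} t *\<^sub>R ee (of_int k * t)"
      by eventually_elim (auto simp: indicator_def)
  qed measurable
  finally show ?thesis using 1 by simp
qed

lemma times_map_measurable [measurable]: "times_map m \<in> measurable borel borel"
proof -
  have "times_map m = (\<lambda>x. to_circle (real m * circ_frac x))"
  proof
    fix x
    obtain t where "x = to_circle t" using to_circle_surj by blast
    then show "times_map m x = to_circle (real m * circ_frac x)"
      using circ_frac_times_map[of m x] to_circle_circ_frac[of "times_map m x"]
      by (metis circ_frac_to_circle to_circle_circ_frac)
  qed
  moreover have "(\<lambda>x. to_circle (real m * circ_frac x)) \<in> measurable borel borel" by measurable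
  ultimately show ?thesis by simp
qed

lemma measurable_circle_measure:
  assumes "sets M = sets borel" "f \<in> measurable borel borel"
  shows "f \<in> measurable M M"
  using assms by (simp cong: measurable_cong_sets)

lemma lebesgue_circle_times_invariant:
  assumes "m \<ge> 1"
  shows "distr lebesgue_circle lebesgue_circle (times_map m) = lebesgue_circle"
proof -
  interpret L: prob_space lebesgue_circle by (rule prob_space_lebesgue_circle)
  have tm: "times_map m \<in> measurable lebesgue_circle lebesgue_circle"
    by (rule measurable_circle_measure) simp_all
  show ?thesis
  proof (rule circle_measure_eqI)
    show "prob_space (distr lebesgue_circle lebesgue_circle (times_map m))" by (rule L.prob_space_distr[OF tm])
    fix k :: int assume k: "k \<noteq> 0"
    have cm: "circ_char k \<in> borel_measurable lebesgue_circle"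
      using circ_char_measurable[of k] by (simp cong: measurable_cong_sets)
    have "(\<integral>x. circ_char k x \<partial>distr lebesgue_circle lebesgue_circle (times_map m)) = (\<integral>x. circ_char (k * int m) x \<partial>lebesgue_circle)"
      by (subst integral_distr[OF tm cm]) (simp add: circ_char_times_map)
    also have "\<dots> = 0" using k assms by (intro fourier_lebesgue_circle) simp
    finally show "(\<integral>x. circ_char k x \<partial>distr lebesgue_circle lebesgue_circle (times_map m)) = (\<integral>x. circ_char k x \<partial>lebesgue_circle)"
      using fourier_lebesgue_circle[OF k] by simp
  qed (simp_all add: prob_space_lebesgue_circle)
qed

text \<open>Bessel's inequality for one constant: testing against the sum S of n orthonormal
  characters gives n |c| \<le> \<integral>|S| \<le> sqrt n for every n.\<close>

lemma bessel_lacunary: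
  assumes A: "A \<in> sets borel" and a: "a \<ge> 2" and k: "k \<noteq> 0"
    and c: "\<And>n. (\<integral>x. indicator A x *\<^sub>R circ_char (k * int a ^ n) x \<partial>lebesgue_circle) = c"
  shows "c = 0"
proof -
  interpret L: prob_space lebesgue_circle by (rule prob_space_lebesgue_circle)
  have meas: "f \<in> borel_measurable lebesgue_circle" if "f \<in> borel_measurable borel" for f :: "circle \<Rightarrow> complex"
    using that by (simp cong: measurable_cong_sets)
  have cm[measurable]: "circ_char l \<in> borel_measurable lebesgue_circle" for l by (rule meas) simp
  have Am[measurable]: "A \<in> sets lebesgue_circle" using A by simp
  have "real n * (cmod c)\<^sup>2 \<le> 1" for n
  proof (cases "n = 0")
    case False
    define S where "S x = (\<Sum>i<n. circ_char (k * int a ^ i) x)" for x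
    have Sm[measurable]: "S \<in> borel_measurable lebesgue_circle" unfolding S_def[abs_def] by measurable
    have Sb: "cmod (S x) \<le> real n" for x
      unfolding S_def by (rule order_trans[OF norm_sum]) simp
    have int: "integrable lebesgue_circle (\<lambda>x. indicator A x *\<^sub>R circ_char l x)" for l
      by (rule L.integrable_bounded[where B = 1]) (auto simp: indicator_def)
    have intc: "integrable lebesgue_circle (circ_char l)" for l
      by (rule L.integrable_bounded[where B = 1]) auto
    have "of_nat n * c = (\<Sum>i<n. \<integral>x. indicator A x *\<^sub>R circ_char (k * int a ^ i) x \<partial>lebesgue_circle)"
      using c by simp
    also have "\<dots> = (\<integral>x. indicator A x *\<^sub>R S x \<partial>lebesgue_circle)"
      unfolding S_def scaleR_sum_right by (rule Bochner_Integration.integral_sum[symmetric]) (rule int)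
    finally have 1: "of_nat n * c = (\<integral>x. indicator A x *\<^sub>R S x \<partial>lebesgue_circle)" .
    have "cmod (of_nat n * c) \<le> (\<integral>x. cmod (indicator A x *\<^sub>R S x) \<partial>lebesgue_circle)"
      unfolding 1 by (rule integral_norm_bound)
    also have "\<dots> \<le> (\<integral>x. \<bar>cmod (S x)\<bar> \<partial>lebesgue_circle)"
    proof (rule integral_mono)
      show "integrable lebesgue_circle (\<lambda>x. cmod (indicator A x *\<^sub>R S x))" "integrable lebesgue_circle (\<lambda>x. \<bar>cmod (S x)\<bar>)"
        by (rule L.integrable_bounded[where B = "real n"]; use Sb in \<open>simp add: indicator_def\<close>)+
    qed (simp add: indicator_def)
    finally have "(real n * cmod c)\<^sup>2 \<le> (\<integral>x. \<bar>cmod (S x)\<bar> \<partial>lebesgue_circle)\<^sup>2"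
      by (intro power_mono) (simp_all add: norm_mult)
    also have "\<dots> \<le> (\<integral>x. (cmod (S x))\<^sup>2 \<partial>lebesgue_circle)"
      by (rule L.L1_le_L2[where B = "real n"]) (use Sb in auto)
    also have "\<dots> = real n"
    proof -
      have "complex_of_real (\<integral>x. (cmod (S x))\<^sup>2 \<partial>lebesgue_circle) = (\<integral>x. S x * cnj (S x) \<partial>lebesgue_circle)"
      proof -
        have "norm ((cmod (S x))\<^sup>2) \<le> (real n)\<^sup>2" for x
          using power_mono[OF Sb[of x], of 2] by simp
        then have "integrable lebesgue_circle (\<lambda>x. (cmod (S x))\<^sup>2)"
          by (intro L.integrable_bounded[where B = "(real n)\<^sup>2"]) auto
        then show ?thesis by (simp only: integral_of_real[symmetric] complex_norm_square)
      qed
      also have "\<dots> = (\<integral>x. (\<Sum>i<n. \<Sum>j<n. circ_char (k * int a ^ i - k * int a ^ j) x) \<partial>lebesgue_circle)"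
        unfolding S_def cnj_sum sum_product circ_char_cnj
        by (simp only: circ_char_add[symmetric] add_uminus_conv_diff)
      also have "\<dots> = (\<Sum>i<n. \<Sum>j<n. \<integral>x. circ_char (k * int a ^ i - k * int a ^ j) x \<partial>lebesgue_circle)"
        using intc by simp
      also have "\<dots> = (\<Sum>i<n. \<Sum>j<n. if j = i then 1 else 0)"
      proof (intro sum.cong refl)
        fix i j
        show "(\<integral>x. circ_char (k * int a ^ i - k * int a ^ j) x \<partial>lebesgue_circle) = (if j = i then 1 else 0)"
        proof (cases "j = i")
          case True
          then show ?thesis by (simp add: L.prob_space[simplified])
        next
          case False
          then have "k * int a ^ i - k * int a ^ j \<noteq> 0" using k a by (simp add: power_inject_exp)
          then show ?thesis using False by (simp add: fourier_lebesgue_circle)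
        qed
      qed
      also have "\<dots> = complex_of_real (real n)" by simp
      finally show ?thesis by (simp only: of_real_eq_iff)
    qed
    finally have "real n * (real n * (cmod c)\<^sup>2) \<le> real n * 1" by (simp add: power2_eq_square mult_ac)
    then show ?thesis using False by (simp only: mult_le_cancel_left_pos of_nat_0_less_iff)
  qed simp
  note bd = this
  show "c = 0"
  proof (rule ccontr)
    assume "c \<noteq> 0"
    then have "(cmod c)\<^sup>2 > 0" by simp
    then obtain n where "1 < real n * (cmod c)\<^sup>2" using reals_Archimedean3 by blast
    then show False using bd[of n] by linarith
  qed
qed

text \<open>An invariant set has equal Fourier coefficients at k and k a^n, so
  \<open>bessel_lacunary\<close> makes those with k \<noteq> 0 vanish. If the set has positive
  measure, normalised Lebesgue measure on it has the coefficients of Lebesgue measure, hence equals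
  it, and it does not charge the complement.\<close>

lemma ergodic_lebesgue_circle:
  assumes a: "a \<ge> 2"
  shows "ergodic lebesgue_circle (times_map a)"
  unfolding ergodic_def
proof (intro conjI ballI impI)
  interpret L: prob_space lebesgue_circle by (rule prob_space_lebesgue_circle)
  show tm: "times_map a \<in> measurable lebesgue_circle lebesgue_circle"
    by (rule measurable_circle_measure) simp_all
  show inv: "distr lebesgue_circle lebesgue_circle (times_map a) = lebesgue_circle"
    by (rule lebesgue_circle_times_invariant) (use a in simp)
  fix A assume A: "A \<in> sets lebesgue_circle" and "times_map a -` A \<inter> space lebesgue_circle = A"
  then have iA: "times_map a x \<in> A \<longleftrightarrow> x \<in> A" for x by auto
  have meas: "(\<lambda>x. indicator A x *\<^sub>R circ_char k x) \<in> borel_measurable lebesgue_circle" for k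
  proof -
    have "circ_char k \<in> borel_measurable lebesgue_circle" using circ_char_measurable[of k] by (simp cong: measurable_cong_sets)
    then show ?thesis using A by measurable
  qed
  define c where "c k = (\<integral>x. indicator A x *\<^sub>R circ_char k x \<partial>lebesgue_circle)" for k
  have step: "c (k * int a) = c k" for k
  proof -
    have "c k = (\<integral>x. indicator A (times_map a x) *\<^sub>R circ_char k (times_map a x) \<partial>lebesgue_circle)"
      unfolding c_def by (rule L.integral_measure_preserving[OF tm inv meas, symmetric])
    also have "\<dots> = c (k * int a)"
      unfolding c_def by (rule Bochner_Integration.integral_cong) (auto simp: indicator_def iA circ_char_times_map)
    finally show ?thesis by simp
  qed
  have "c (k * int a ^ n) = c k" for k n
  proof (induction n)
    case (Suc n)
    then show ?case using step[of "k * int a ^ n"] by (simp add: mult_ac)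
  qed simp
  then have c0: "c k = 0" if "k \<noteq> 0" for k
    using bessel_lacunary[OF _ a that, of A "c k"] A by (simp add: c_def)
  show "emeasure lebesgue_circle A = 0 \<or> emeasure lebesgue_circle (space lebesgue_circle - A) = 0"
  proof (cases "emeasure lebesgue_circle A = 0")
    case False
    define p where "p = measure lebesgue_circle A"
    have p: "p > 0" using False by (simp add: p_def L.emeasure_eq_measure zero_less_measure_iff)
    define g where "g x = indicator A x / p" for x
    have gm[measurable]: "g \<in> borel_measurable lebesgue_circle" unfolding g_def[abs_def] using A by measurable
    have g0: "g x \<ge> 0" for x using p by (simp add: g_def)
    define U where "U = density lebesgue_circle (\<lambda>x. ennreal (g x))"
    have sU: "sets U = sets borel" by (simp add: U_def)
    have gi: "integrable lebesgue_circle g"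
      by (rule L.integrable_bounded[where B = "1 / p"]) (use p in \<open>auto simp: g_def indicator_def\<close>)
    have U: "prob_space U"
    proof (rule prob_spaceI)
      have "emeasure U (space U) = (\<integral>\<^sup>+x. ennreal (g x) \<partial>lebesgue_circle)"
        unfolding U_def by (subst emeasure_density) auto
      also have "\<dots> = ennreal (\<integral>x. g x \<partial>lebesgue_circle)"
        by (rule nn_integral_eq_integral[OF gi]) (simp add: g0)
      also have "(\<integral>x. g x \<partial>lebesgue_circle) = 1"
        using A p by (simp add: g_def p_def)
      finally show "emeasure U (space U) = 1" by simp
    qed
    have "U = lebesgue_circle"
    proof (rule circle_measure_eqI)
      fix k :: int assume k: "k \<noteq> 0"
      have cm: "circ_char k \<in> borel_measurable lebesgue_circle" using circ_char_measurable[of k] by (simp cong: measurable_cong_sets)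
      have "(\<integral>x. circ_char k x \<partial>U) = (\<integral>x. g x *\<^sub>R circ_char k x \<partial>lebesgue_circle)"
        unfolding U_def by (rule integral_density) (use cm g0 in auto)
      also have "\<dots> = (\<integral>x. (1 / p) *\<^sub>R (indicator A x *\<^sub>R circ_char k x) \<partial>lebesgue_circle)"
        by (rule Bochner_Integration.integral_cong) (auto simp: g_def indicator_def)
      also have "\<dots> = (1 / p) *\<^sub>R c k" unfolding c_def by (rule integral_scaleR_right)
      finally show "(\<integral>x. circ_char k x \<partial>U) = (\<integral>x. circ_char k x \<partial>lebesgue_circle)"
        using c0[OF k] fourier_lebesgue_circle[OF k] by simp
    qed (simp_all add: sU U prob_space_lebesgue_circle)
    then have "emeasure lebesgue_circle (space lebesgue_circle - A) = emeasure U (space lebesgue_circle - A)" by simp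
    also have "\<dots> = (\<integral>\<^sup>+x. ennreal (g x) * indicator (space lebesgue_circle - A) x \<partial>lebesgue_circle)"
      unfolding U_def by (rule emeasure_density) (use A in auto)
    also have "\<dots> = (\<integral>\<^sup>+x. 0 \<partial>lebesgue_circle)"
      by (rule nn_integral_cong) (auto simp: g_def indicator_def)
    finally show ?thesis by simp
  qed simp
qed

subsection \<open>Lifts of diffeomorphisms\<close>

lemma integer_valued_continuous_const:
  fixes f :: "real \<Rightarrow> real"
  assumes "continuous_on UNIV f" "\<And>x. f x \<in> \<int>"
  shows "f x = f 0"
proof -
  have "f constant_on UNIV"
  proof (rule continuous_discrete_range_constant[OF connected_UNIV assms(1)])
    fix x
    show "\<exists>e>0. \<forall>y. y \<in> UNIV \<and> f y \<noteq> f x \<longrightarrow> e \<le> norm (f y - f x)"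
    proof (intro exI[of _ 1] conjI allI impI)
      fix y assume "y \<in> UNIV \<and> f y \<noteq> f x"
      moreover have "f y - f x \<in> \<int>" using assms(2) by (intro Ints_diff)
      ultimately show "1 \<le> norm (f y - f x)" using Ints_nonzero_abs_ge1[of "f y - f x"] by simp
    qed simp
  qed
  then show ?thesis unfolding constant_on_def by (metis UNIV_I)
qed

text \<open>Lifts are known to agree only modulo integers, but the difference is continuous and thus
  constant. In this way identities between circle maps become identities between
  derivatives.\<close>

lemma int_diff_deriv_eq:
  fixes f g :: "real \<Rightarrow> real"
  assumes f: "\<And>x. (f has_real_derivative f' x) (at x)" and g: "\<And>x. (g has_real_derivative g' x) (at x)"
    and int: "\<And>x. f x - g x \<in> \<int>"
  shows "f' x = g' x"
proof -
  have d: "((\<lambda>x. f x - g x) has_real_derivative f' x - g' x) (at x)" for x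
    by (intro derivative_intros f g)
  have "continuous_on UNIV (\<lambda>x. f x - g x)"
    using DERIV_isCont[OF d] by (simp add: continuous_on_eq_continuous_at)
  then have "f x - g x = f 0 - g 0" for x
    by (rule integer_valued_continuous_const) (rule int)
  then have "(\<lambda>x. f x - g x) = (\<lambda>x. f 0 - g 0)" by blast
  then have "((\<lambda>x. f 0 - g 0) has_real_derivative f' x - g' x) (at x)" using d[of x] by simp
  then show ?thesis using DERIV_unique[OF _ DERIV_const] by fastforce
qed

text \<open>Each composite of the lifts \<open>X\<close> and \<open>Y\<close> is the identity up to
  integers, so the derivatives multiply to 1 and \<open>X1\<close> cannot vanish. Moving by 1
  changes \<open>X\<close> by an integer, whence the period of \<open>X1\<close>.\<close>

lemma C2_diffeo_lift:
  assumes "C2_diffeo \<xi>"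
  obtains X X1 X2 Y Y1 Y2 where
    "\<And>x. (X has_real_derivative X1 x) (at x)" "\<And>x. (X1 has_real_derivative X2 x) (at x)" "continuous_on UNIV X2"
    "\<And>x. (Y has_real_derivative Y1 x) (at x)" "\<And>x. (Y1 has_real_derivative Y2 x) (at x)"
    "\<And>x. \<xi> (to_circle x) = to_circle (X x)" "\<And>x. inv \<xi> (to_circle x) = to_circle (Y x)"
    "\<And>y. X1 (Y y) * Y1 y = 1" "\<And>x. X1 x \<noteq> 0" "\<And>x. X1 (x + 1) = X1 x"
proof -
  have bij: "bij \<xi>" using assms by (simp add: C2_diffeo_def)
  obtain X where X: "C2_real X" "\<And>x. \<xi> (to_circle x) = to_circle (X x)"
    using assms by (auto simp: C2_diffeo_def C2_circle_def)
  obtain Y where Y: "C2_real Y" "\<And>x. inv \<xi> (to_circle x) = to_circle (Y x)"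
    using assms by (auto simp: C2_diffeo_def C2_circle_def)
  obtain X1 X2 where X12: "\<And>x. (X has_real_derivative X1 x) (at x)" "\<And>x. (X1 has_real_derivative X2 x) (at x)" "continuous_on UNIV X2"
    using X(1) by (auto simp: C2_real_def)
  obtain Y1 Y2 where Y12: "\<And>x. (Y has_real_derivative Y1 x) (at x)" "\<And>x. (Y1 has_real_derivative Y2 x) (at x)" "continuous_on UNIV Y2"
    using Y(1) by (auto simp: C2_real_def)
  have XY: "X1 (Y y) * Y1 y = 1" for y
  proof (rule int_diff_deriv_eq[where f = "\<lambda>y. X (Y y)" and g = "\<lambda>y. y" and f' = "\<lambda>y. X1 (Y y) * Y1 y" and g' = "\<lambda>_. 1"])
    show "((\<lambda>y. X (Y y)) has_real_derivative X1 (Y x) * Y1 x) (at x)" for x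
      by (rule DERIV_chain2[OF X12(1) Y12(1)])
    have "to_circle (X (Y x)) = to_circle x" for x
      using X(2)[of "Y x"] Y(2)[of x] bij by (metis bij_is_surj surj_f_inv_f)
    then show "X (Y x) - x \<in> \<int>" for x by (simp add: to_circle_eq_iff)
  qed simp
  have YX: "Y1 (X y) * X1 y = 1" for y
  proof (rule int_diff_deriv_eq[where f = "\<lambda>y. Y (X y)" and g = "\<lambda>y. y" and f' = "\<lambda>y. Y1 (X y) * X1 y" and g' = "\<lambda>_. 1"])
    show "((\<lambda>y. Y (X y)) has_real_derivative Y1 (X x) * X1 x) (at x)" for x
      by (rule DERIV_chain2[OF Y12(1) X12(1)])
    have "to_circle (Y (X x)) = to_circle x" for x
      using X(2)[of x] Y(2)[of "X x"] bij by (metis bij_is_inj inv_f_f)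
    then show "Y (X x) - x \<in> \<int>" for x by (simp add: to_circle_eq_iff)
  qed simp
  have per: "X1 (x + 1) = X1 x" for x
  proof (rule int_diff_deriv_eq[where f = "\<lambda>x. X (x + 1)" and g = X and f' = "\<lambda>x. X1 (x + 1)"])
    show "((\<lambda>x. X (x + 1)) has_real_derivative X1 (x + 1)) (at x)" for x
      using DERIV_shift[of X "X1 (x + 1)" x 1] X12(1)[of "x + 1"] by simp
    have "to_circle (x + 1) = to_circle x" for x by (simp add: to_circle_eq_iff)
    then have "to_circle (X (x + 1)) = to_circle (X x)" for x using X(2) by metis
    then show "X (x + 1) - X x \<in> \<int>" for x by (simp add: to_circle_eq_iff)
  qed (rule X12)
  have "X1 x \<noteq> 0" for x using YX[of x] by auto
  then show ?thesis using that[OF X12 Y12(1,2) X(2) Y(2) XY _ per] by blast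
qed

lemma C2_real_compose:
  assumes "C2_real F" "C2_real G"
  shows "C2_real (\<lambda>x. F (G x))"
proof -
  obtain F1 F2 where F: "\<And>x. (F has_real_derivative F1 x) (at x)" "\<And>x. (F1 has_real_derivative F2 x) (at x)" "continuous_on UNIV F2"
    using assms(1) by (auto simp: C2_real_def)
  obtain G1 G2 where G: "\<And>x. (G has_real_derivative G1 x) (at x)" "\<And>x. (G1 has_real_derivative G2 x) (at x)" "continuous_on UNIV G2"
    using assms(2) by (auto simp: C2_real_def)
  have cont: "continuous_on UNIV f" if "\<And>x. (f has_real_derivative f' x) (at x)" for f f' :: "real \<Rightarrow> real"
    using DERIV_isCont[OF that] by (simp add: continuous_on_eq_continuous_at)
  show ?thesis unfolding C2_real_def
  proof (intro exI conjI allI)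
    show "((\<lambda>x. F (G x)) has_real_derivative F1 (G x) * G1 x) (at x)" for x
      by (rule DERIV_chain2[OF F(1) G(1)])
    show "((\<lambda>x. F1 (G x) * G1 x) has_real_derivative (F2 (G x) * G1 x) * G1 x + G2 x * F1 (G x)) (at x)" for x
      by (rule DERIV_mult'[OF DERIV_chain2[OF F(2) G(1)] G(2), THEN DERIV_cong]) simp
    show "continuous_on UNIV (\<lambda>x. (F2 (G x) * G1 x) * G1 x + G2 x * F1 (G x))"
      by (intro continuous_intros G(3) cont[OF G(2)] continuous_on_compose2[OF F(3) cont[OF G(1)]]
          continuous_on_compose2[OF cont[OF F(2)] cont[OF G(1)]]) auto
  qed
qed

lemma C2_circle_compose: "C2_circle f \<Longrightarrow> C2_circle g \<Longrightarrow> C2_circle (f \<circ> g)"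
  unfolding C2_circle_def using C2_real_compose by (metis comp_apply)

lemma C2_diffeo_inv: "C2_diffeo f \<Longrightarrow> C2_diffeo (inv f)"
  by (simp add: C2_diffeo_def bij_imp_bij_inv inv_inv_eq)

lemma C2_diffeo_compose: "C2_diffeo f \<Longrightarrow> C2_diffeo g \<Longrightarrow> C2_diffeo (f \<circ> g)"
  by (simp add: C2_diffeo_def bij_comp o_inv_distrib C2_circle_compose)

lemma C2_diffeo_continuous:
  assumes "C2_diffeo f"
  shows "continuous_on UNIV f"
proof -
  obtain F where F: "C2_real F" "\<And>x. f (to_circle x) = to_circle (F x)"
    using assms by (auto simp: C2_diffeo_def C2_circle_def)
  have cF: "isCont F t" for t using F(1) DERIV_isCont by (auto simp: C2_real_def)
  show ?thesis unfolding continuous_on_iff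
  proof (intro ballI allI impI)
    fix x and e :: real assume e: "e > 0"
    obtain t where t: "x = to_circle t" using to_circle_surj by blast
    obtain d where d: "d > 0" "\<And>s. \<bar>s - t\<bar> < d \<Longrightarrow> \<bar>F s - F t\<bar> < e"
      using cF[of t] e unfolding continuous_at_eps_delta dist_real_def by meson
    show "\<exists>d>0. \<forall>x'\<in>UNIV. dist x' x < d \<longrightarrow> dist (f x') (f x) < e"
    proof (intro exI[of _ d] conjI ballI impI d(1))
      fix x' assume dist: "dist x' x < d"
      obtain s where s: "x' = to_circle s" using to_circle_surj by blast
      obtain k where k: "k \<in> \<int>" "int_dist (s - t) = \<bar>s - t - k\<bar>" using int_dist_attained by blast
      have "to_circle (s - k) = to_circle s" using k(1) by (simp add: to_circle_eq_iff)
      then have x': "x' = to_circle (s - k)" using s by simp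
      have "\<bar>(s - k) - t\<bar> < d" using dist k(2) by (simp add: s t dist_circle.abs_eq algebra_simps)
      then have "\<bar>F (s - k) - F t\<bar> < e" by (rule d(2))
      then show "dist (f x') (f x) < e"
        unfolding x' t F(2) by (rule order_le_less_trans[OF dist_to_circle_le])
    qed
  qed
qed

lemma C2_diffeo_measurable: "C2_diffeo f \<Longrightarrow> f \<in> measurable borel borel"
  by (rule borel_measurable_continuous_onI[OF C2_diffeo_continuous])

subsection \<open>Transport of measures\<close>

lemma ergodic_push:
  fixes \<mu> :: "circle measure"
  assumes erg: "ergodic \<mu> g" and sets: "sets \<mu> = sets borel" and \<psi>: "C2_diffeo \<psi>"
  shows "ergodic (distr \<mu> borel \<psi>) (\<psi> \<circ> g \<circ> inv \<psi>)"
proof -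
  have bij: "bij \<psi>" using \<psi> by (simp add: C2_diffeo_def)
  have inv: "inv \<psi> (\<psi> x) = x" "\<psi> (inv \<psi> y) = y" for x y
    using bij by (auto simp: bij_is_inj surj_f_inv_f[OF bij_is_surj])
  have m\<psi>: "\<psi> \<in> measurable borel borel" "inv \<psi> \<in> measurable borel borel"
    using C2_diffeo_measurable[OF \<psi>] C2_diffeo_measurable[OF C2_diffeo_inv[OF \<psi>]] by auto
  have m\<psi>\<mu>: "\<psi> \<in> measurable \<mu> borel" using m\<psi>(1) sets by (simp cong: measurable_cong_sets)
  have g: "g \<in> measurable \<mu> \<mu>" "distr \<mu> \<mu> g = \<mu>" using erg by (auto simp: ergodic_def)
  have gb: "g \<in> measurable borel borel" using g(1) sets by (simp cong: measurable_cong_sets)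
  let ?G = "\<psi> \<circ> g \<circ> inv \<psi>" and ?\<nu> = "distr \<mu> borel \<psi>"
  have sp: "space \<mu> = UNIV" using sets_eq_imp_space_eq[OF sets] by simp
  have Gb: "?G \<in> measurable borel borel"
    by (intro measurable_comp[OF m\<psi>(2)] measurable_comp[OF gb] m\<psi>)
  show ?thesis unfolding ergodic_def
  proof (intro conjI ballI impI)
    show G: "?G \<in> measurable ?\<nu> ?\<nu>" using Gb by (simp cong: measurable_cong_sets)
    have "distr ?\<nu> ?\<nu> ?G = distr ?\<nu> borel ?G" by (rule distr_cong) auto
    also have "\<dots> = distr \<mu> borel (?G \<circ> \<psi>)" by (rule distr_distr[OF Gb m\<psi>\<mu>])
    also have "?G \<circ> \<psi> = \<psi> \<circ> g" by (simp add: fun_eq_iff inv)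
    also have "distr \<mu> borel (\<psi> \<circ> g) = distr (distr \<mu> \<mu> g) borel \<psi>"
      by (rule distr_distr[symmetric, OF m\<psi>\<mu> g(1)])
    finally show "distr ?\<nu> ?\<nu> ?G = ?\<nu>" by (simp only: g(2))
    fix A assume A: "A \<in> sets ?\<nu>" and iA: "?G -` A \<inter> space ?\<nu> = A"
    define A' where "A' = \<psi> -` A"
    have A': "A' \<in> sets \<mu>" using measurable_sets[OF m\<psi>(1), of A] A sets by (simp add: A'_def)
    have "g x \<in> A' \<longleftrightarrow> x \<in> A'" for x
    proof -
      have "?G -` A = A" using iA by simp
      then have "?G (\<psi> x) \<in> A \<longleftrightarrow> \<psi> x \<in> A" by (metis vimage_eq)
      then show ?thesis by (simp add: A'_def inv)
    qed
    then have "g -` A' \<inter> space \<mu> = A'" by (auto simp: sp)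
    then have "emeasure \<mu> A' = 0 \<or> emeasure \<mu> (space \<mu> - A') = 0"
      using erg A' by (auto simp: ergodic_def)
    moreover have "emeasure ?\<nu> A = emeasure \<mu> A'"
      using A by (subst emeasure_distr[OF m\<psi>\<mu>]) (auto simp: A'_def sp)
    moreover have "emeasure ?\<nu> (space ?\<nu> - A) = emeasure \<mu> (space \<mu> - A')"
    proof -
      have "emeasure ?\<nu> (space ?\<nu> - A) = emeasure \<mu> (\<psi> -` (space ?\<nu> - A) \<inter> space \<mu>)"
        using A by (intro emeasure_distr[OF m\<psi>\<mu>]) auto
      also have "\<psi> -` (space ?\<nu> - A) \<inter> space \<mu> = space \<mu> - A'" by (auto simp: A'_def sp)
      finally show ?thesis .
    qed
    ultimately show "emeasure ?\<nu> A = 0 \<or> emeasure ?\<nu> (space ?\<nu> - A) = 0" by simp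
  qed
qed

definition real_model :: "circle measure \<Rightarrow> real measure" where
  "real_model \<nu> = distr \<nu> (restrict_space borel {0..<1}) circ_frac"

lemma circ_frac_measurable_restrict:
  "sets \<nu> = sets borel \<Longrightarrow> circ_frac \<in> measurable \<nu> (restrict_space borel {0..<1})"
  using circ_frac_measurable circ_frac_range
  by (intro measurable_restrict_space2) (auto cong: measurable_cong_sets)

lemma frac_measurable [measurable]: "frac \<in> borel_measurable (borel :: real measure)"
  unfolding frac_def[abs_def] by measurable

text \<open>\<open>circ_frac\<close> is a bijection onto [0,1) intertwining the two multiplications,
  so invariant sets correspond exactly.\<close>

lemma real_model_base_b:
  assumes sets: "sets \<nu> = sets borel" and "prob_space \<nu>" and "b \<ge> 2" and erg: "ergodic \<nu> (times_map b)"
  shows "base_b (real_model \<nu>) b"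
proof -
  interpret \<nu>: prob_space \<nu> by fact
  have sp: "space \<nu> = UNIV" using sets_eq_imp_space_eq[OF sets] by simp
  note cf = circ_frac_measurable_restrict[OF sets]
  let ?R = "restrict_space borel {0..<1} :: real measure" and ?T = "\<lambda>x. frac (real b * x)"
  interpret N: prob_space "real_model \<nu>" unfolding real_model_def by (rule \<nu>.prob_space_distr[OF cf])
  have sN: "sets (real_model \<nu>) = sets ?R" by (simp add: real_model_def)
  have spN: "space (real_model \<nu>) = {0..<1}" by (simp add: real_model_def space_restrict_space)
  have TR: "?T \<in> measurable ?R ?R"
    by (intro measurable_restrict_space2 measurable_restrict_space1) (auto simp: frac_ge_0 frac_lt_1)
  have tm: "times_map b \<in> measurable \<nu> \<nu>" "distr \<nu> \<nu> (times_map b) = \<nu>" using erg by (auto simp: ergodic_def)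
  have comm: "?T \<circ> circ_frac = circ_frac \<circ> times_map b" by (simp add: fun_eq_iff circ_frac_times_map)
  show ?thesis
  proof unfold_locales
    show "ergodic (real_model \<nu>) ?T" unfolding ergodic_def
    proof (intro conjI ballI impI)
      show TN: "?T \<in> measurable (real_model \<nu>) (real_model \<nu>)"
        using TR by (simp cong: measurable_cong_sets add: sN)
      have "distr (real_model \<nu>) (real_model \<nu>) ?T = distr (real_model \<nu>) ?R ?T" by (rule distr_cong) (auto simp: sN)
      also have "\<dots> = distr \<nu> ?R (?T \<circ> circ_frac)" unfolding real_model_def by (rule distr_distr[OF TR cf])
      also have "\<dots> = distr (distr \<nu> \<nu> (times_map b)) ?R circ_frac"
        unfolding comm by (rule distr_distr[symmetric, OF cf tm(1)])
      finally show "distr (real_model \<nu>) (real_model \<nu>) ?T = real_model \<nu>" using tm(2) by (simp add: real_model_def)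
      fix A assume A: "A \<in> sets (real_model \<nu>)" and iA: "?T -` A \<inter> space (real_model \<nu>) = A"
      define A' where "A' = circ_frac -` A"
      have A': "A' \<in> sets \<nu>" using measurable_sets[OF cf, of A] A sp by (simp add: A'_def sN)
      have "times_map b x \<in> A' \<longleftrightarrow> x \<in> A'" for x
      proof -
        have "times_map b x \<in> A' \<longleftrightarrow> circ_frac x \<in> ?T -` A \<inter> space (real_model \<nu>)"
          using circ_frac_range[of x] by (simp add: A'_def circ_frac_times_map spN)
        then show ?thesis unfolding iA by (simp add: A'_def)
      qed
      then have "times_map b -` A' \<inter> space \<nu> = A'" by (auto simp: sp)
      then have "emeasure \<nu> A' = 0 \<or> emeasure \<nu> (space \<nu> - A') = 0" using erg A' by (auto simp: ergodic_def)
      moreover have "emeasure (real_model \<nu>) A = emeasure \<nu> A'"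
        using A unfolding real_model_def by (subst emeasure_distr[OF cf]) (auto simp: A'_def sp)
      moreover have "emeasure (real_model \<nu>) (space (real_model \<nu>) - A) = emeasure \<nu> (space \<nu> - A')"
      proof -
        have "emeasure (real_model \<nu>) (space (real_model \<nu>) - A) = emeasure \<nu> (circ_frac -` (space (real_model \<nu>) - A) \<inter> space \<nu>)"
          using sets.compl_sets[OF A] unfolding real_model_def by (intro emeasure_distr[OF cf]) simp
        also have "circ_frac -` (space (real_model \<nu>) - A) \<inter> space \<nu> = space \<nu> - A'"
          using circ_frac_range by (auto simp: A'_def sp spN)
        finally show ?thesis .
      qed
      ultimately show "emeasure (real_model \<nu>) A = 0 \<or> emeasure (real_model \<nu>) (space (real_model \<nu>) - A) = 0" by simp
    qed
  qed (use assms in \<open>auto simp: sN\<close>)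
qed

subsection \<open>Hausdorff dimension\<close>

lemma hausdorff_measure_le_covers:
  fixes A :: "'a::metric_space set"
  assumes "\<And>\<delta> e. \<delta> > 0 \<Longrightarrow> e > 0 \<Longrightarrow> \<exists>U::nat \<Rightarrow> 'a set. A \<subseteq> (\<Union>i. U i) \<and> (\<forall>i. bounded (U i) \<and> diameter (U i) \<le> \<delta>)
      \<and> (\<Sum>i. ennreal (diameter (U i) powr s)) \<le> ennreal e"
  shows "hausdorff_measure s A = 0"
proof -
  have "hausdorff_premeasure \<delta> s A \<le> 0" if \<delta>: "\<delta> > 0" for \<delta>
  proof (rule ennreal_le_epsilon)
    fix e :: real assume "e > 0"
    then obtain U :: "nat \<Rightarrow> 'a set" where U: "A \<subseteq> (\<Union>i. U i)" "\<forall>i. bounded (U i) \<and> diameter (U i) \<le> \<delta>"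
      "(\<Sum>i. ennreal (diameter (U i) powr s)) \<le> ennreal e"
      using assms[OF \<delta>] by blast
    have "hausdorff_premeasure \<delta> s A \<le> (\<Sum>i. ennreal (diameter (U i) powr s))"
      unfolding hausdorff_premeasure_def by (rule INF_lower) (use U in auto)
    then show "hausdorff_premeasure \<delta> s A \<le> 0 + ennreal e" using U(3) by simp
  qed
  then have "hausdorff_measure s A \<le> 0"
    unfolding hausdorff_measure_def by (intro SUP_least) auto
  then show ?thesis by simp
qed

text \<open>Level m contributes at most \<beta>^(-ms/2) sets of size L \<beta>^m, hence an s-sum of
  order \<beta>^(ms/2) = q^m q^m. For m \<ge> M one factor gives the smallness q^M, the other makes
  the series converge.\<close>

lemma hausdorff_measure_limsup_cells:
  fixes A :: "'a::metric_space set" and U :: "nat \<Rightarrow> nat \<Rightarrow> 'a set"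
  assumes \<beta>: "0 < \<beta>" "\<beta> < 1" and s: "s > 0" and L: "L > 0"
    and diam: "\<And>m i. bounded (U m i) \<and> diameter (U m i) \<le> L * \<beta> ^ m"
    and n: "\<And>m. real (n m) \<le> (\<beta> ^ m) powr (- s / 2)"
    and A: "\<And>x M. x \<in> A \<Longrightarrow> \<exists>m\<ge>M. \<exists>i<n m. x \<in> U m i"
  shows "hausdorff_measure s A = 0"
proof (rule hausdorff_measure_le_covers)
  fix \<delta> e :: real assume \<delta>: "\<delta> > 0" and e: "e > 0"
  define q where "q = \<beta> powr (s / 4)"
  have q: "0 < q" "q < 1"
    using \<beta> s powr_less_mono2[of "s/4" \<beta> 1] by (auto simp: q_def)
  define K where "K = L powr s / (1 - q)"
  have K: "K > 0" using L q by (simp add: K_def)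
  have "(\<lambda>M. K * q ^ M) \<longlonglongrightarrow> K * 0" using q by (intro tendsto_intros LIMSEQ_realpow_zero) auto
  then have "\<forall>\<^sub>F M in sequentially. K * q ^ M < e" using e by (auto dest: order_tendstoD(2))
  moreover have "(\<lambda>M. L * \<beta> ^ M) \<longlonglongrightarrow> L * 0" using \<beta> by (intro tendsto_intros LIMSEQ_realpow_zero) auto
  then have "\<forall>\<^sub>F M in sequentially. L * \<beta> ^ M < \<delta>" using \<delta> by (auto dest: order_tendstoD(2))
  ultimately have "\<forall>\<^sub>F M in sequentially. K * q ^ M < e \<and> L * \<beta> ^ M < \<delta>" by eventually_elim simp
  then obtain M where M: "K * q ^ M < e" "L * \<beta> ^ M < \<delta>" by (auto simp: eventually_sequentially)
  \<comment> \<open>Index pairs outside the range receive the empty set, which contributes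
    \<open>0 powr s = 0\<close>; the pairs are later enumerated by
    \<open>prod_decode\<close>.\<close>
  define W where "W = (\<lambda>(m, i). if m \<ge> M \<and> i < n m then U m i else {})"
  have W: "bounded (W k) \<and> diameter (W k) \<le> \<delta>" for k
  proof (cases k)
    case (Pair m i)
    show ?thesis
    proof (cases "m \<ge> M \<and> i < n m")
      case True
      have "\<beta> ^ m \<le> \<beta> ^ M" using True \<beta> by (intro power_decreasing) auto
      then have "L * \<beta> ^ m \<le> L * \<beta> ^ M" using L by simp
      then show ?thesis using diam[of m i] M(2) True by (auto simp: W_def Pair)
    next
      case False
      then have "W k = {}" by (auto simp: W_def Pair)
      then show ?thesis using \<delta> by simp
    qed
  qed
  define f where "f k = ennreal (diameter (W k) powr s)" for k
  define g where "g m = (\<Sum>i. f (m, i))" for m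
  have g: "g m \<le> ennreal (L powr s * q ^ M * q ^ m)" for m
  proof (cases "m \<ge> M")
    case True
    have "g m = (\<Sum>i\<in>{..<n m}. f (m, i))"
      unfolding g_def by (rule suminf_finite) (auto simp: f_def W_def)
    also have "\<dots> \<le> (\<Sum>i\<in>{..<n m}. ennreal ((L * \<beta> ^ m) powr s))"
      unfolding f_def using diam s True
      by (intro sum_mono ennreal_leI powr_mono2) (auto simp: W_def diameter_ge_0)
    also have "\<dots> = ennreal (real (n m) * (L * \<beta> ^ m) powr s)"
      by (simp add: ennreal_mult ennreal_of_nat_eq_real_of_nat)
    also have "\<dots> \<le> ennreal (L powr s * q ^ M * q ^ m)"
    proof (rule ennreal_leI)
      have "real (n m) * (L * \<beta> ^ m) powr s \<le> (\<beta> ^ m) powr (- s / 2) * (L * \<beta> ^ m) powr s"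
        by (intro mult_right_mono n) simp
      also have "\<dots> = L powr s * ((\<beta> ^ m) powr (- s / 2) * (\<beta> ^ m) powr s)"
        using L \<beta> by (simp add: powr_mult)
      also have "(\<beta> ^ m) powr (- s / 2) * (\<beta> ^ m) powr s = (\<beta> ^ m) powr (s / 2)"
        using \<beta> by (simp flip: powr_add)
      also have "\<dots> = q ^ m * q ^ m"
      proof -
        have "(\<beta> ^ m) powr (s / 2) = (\<beta> ^ m) powr (s / 4) * (\<beta> ^ m) powr (s / 4)"
          using \<beta> by (simp flip: powr_add)
        also have "(\<beta> ^ m) powr (s / 4) = q ^ m"
          using \<beta> by (simp add: q_def powr_powr mult.commute flip: powr_realpow)
        finally show ?thesis .
      qed
      also have "L powr s * (q ^ m * q ^ m) \<le> L powr s * (q ^ M * q ^ m)"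
        using q True by (intro mult_left_mono mult_right_mono power_decreasing) auto
      finally show "real (n m) * (L * \<beta> ^ m) powr s \<le> L powr s * q ^ M * q ^ m" by (simp add: mult.assoc)
    qed
    finally show ?thesis .
  next
    case False
    then have "g m = 0" unfolding g_def by (simp add: f_def W_def)
    then show ?thesis by simp
  qed
  show "\<exists>U. A \<subseteq> (\<Union>i. U i) \<and> (\<forall>i. bounded (U i) \<and> diameter (U i) \<le> \<delta>) \<and> (\<Sum>i. ennreal (diameter (U i) powr s)) \<le> ennreal e"
  proof (intro exI[of _ "\<lambda>i. W (prod_decode i)"] conjI allI)
    show "A \<subseteq> (\<Union>i. W (prod_decode i))"
    proof
      fix x assume "x \<in> A"
      then obtain m i where "m \<ge> M" "i < n m" "x \<in> U m i" using A by blast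
      then have "x \<in> W (prod_decode (prod_encode (m, i)))" by (simp add: W_def)
      then show "x \<in> (\<Union>i. W (prod_decode i))" by blast
    qed
    have "(\<Sum>i. ennreal (diameter (W (prod_decode i)) powr s)) = suminf g"
      unfolding f_def[symmetric] by (rule suminf_ennreal_2dimen[OF g_def])
    also have "\<dots> \<le> (\<Sum>m. ennreal (L powr s * q ^ M * q ^ m))"
      by (intro suminf_le g) auto
    also have "\<dots> = ennreal (\<Sum>m. L powr s * q ^ M * q ^ m)"
      using q by (intro suminf_ennreal2 summable_mult summable_geometric) auto
    also have "(\<Sum>m. L powr s * q ^ M * q ^ m) = K * q ^ M"
      using q by (simp add: suminf_mult suminf_geometric K_def)
    also have "ennreal (K * q ^ M) \<le> ennreal e" using M(1) by (intro ennreal_leI) simp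
    finally show "(\<Sum>i. ennreal (diameter (W (prod_decode i)) powr s)) \<le> ennreal e" .
  qed (use W in auto)
qed

lemma measure_dim_le:
  assumes "A \<in> sets M" "emeasure M A > 0" "s > 0" "hausdorff_measure s A = 0"
  shows "measure_dim M \<le> ennreal s"
proof -
  have "measure_dim M \<le> hausdorff_dim A"
    unfolding measure_dim_def by (rule INF_lower) (use assms in auto)
  also have "\<dots> \<le> ennreal s"
    unfolding hausdorff_dim_def by (rule INF_lower) (use assms in auto)
  finally show ?thesis .
qed

text \<open>An atom would be a set of positive mass covered by itself, with diameter 0, and so of
  dimension 0.\<close>

lemma measure_dim_pos_nonatomic:
  fixes M :: "'a::metric_space measure"
  assumes "measure_dim M > 0" "{x} \<in> sets M"
  shows "emeasure M {x} = 0"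
proof (rule ccontr)
  assume "emeasure M {x} \<noteq> 0"
  then have pos: "emeasure M {x} > 0" by (simp add: zero_less_iff_neq_zero)
  have "hausdorff_measure s {x} = 0" for s :: real
  proof (rule hausdorff_measure_le_covers)
    fix \<delta> e :: real assume "\<delta> > 0" "e > 0"
    then show "\<exists>U. {x} \<subseteq> (\<Union>i. U i) \<and> (\<forall>i. bounded (U i) \<and> diameter (U i) \<le> \<delta>) \<and> (\<Sum>i. ennreal (diameter (U i) powr s)) \<le> ennreal e"
      by (intro exI[of _ "\<lambda>_::nat. {x}"]) auto
  qed
  then have "measure_dim M \<le> ennreal s" if "s > 0" for s :: real
    using measure_dim_le[OF assms(2) pos that] by blast
  then have "measure_dim M \<le> 0 + ennreal s" if "s > 0" for s :: real using that by simp
  then have "measure_dim M \<le> 0" by (rule ennreal_le_epsilon)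
  then show False using assms(1) by simp
qed

text \<open>If the past determined the next digit, \<open>zero_entropy_cover\<close> would cover a
  set of full measure infinitely often by at most b^(sm/2) cells of level m. The Lipschitz inverse
  \<open>G\<close> of the coordinate \<open>h\<close> carries these cells to the original space and
  makes the dimension at most s, for every s > 0.\<close>

lemma (in base_b) positive_dimension_not_deterministic:
  fixes \<mu> :: "'c::metric_space measure" and h :: "'c \<Rightarrow> real" and G :: "real \<Rightarrow> 'c"
  assumes h: "h \<in> measurable \<mu> N" "distr \<mu> N h = N" and prob: "prob_space \<mu>"
    and G: "\<And>x. x \<in> space \<mu> \<Longrightarrow> G (h x) = x" and lip: "\<And>s t. s \<in> {0..<1} \<Longrightarrow> t \<in> {0..<1} \<Longrightarrow> dist (G s) (G t) \<le> L * \<bar>s - t\<bar>"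
    and dim: "measure_dim \<mu> > 0"
  shows "Qlim 1 \<noteq> 1"
proof
  assume Q: "Qlim 1 = 1"
  have "measure_dim \<mu> \<le> ennreal s" if s: "s > 0" for s :: real
  proof -
    have s2: "s / 2 > 0" using s by simp
    obtain Gs A where GA: "A \<in> sets N" "measure N A = 1" "\<And>m. finite (Gs m)"
      "\<And>m. real (card (Gs m)) \<le> real b powr (s / 2 * real m)" "\<And>x M. x \<in> A \<Longrightarrow> \<exists>m\<ge>M. cell m x \<in> Gs m"
      using zero_entropy_cover[OF Q s2] by metis
    have "\<forall>m. \<exists>e. bij_betw e {0..<card (Gs m)} (Gs m)"
      using ex_bij_betw_nat_finite[OF GA(3)] by blast
    then obtain e where e: "\<And>m. bij_betw (e m) {0..<card (Gs m)} (Gs m)" by metis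
    define L' where "L' = \<bar>L\<bar> + 1"
    define U where "U m i = G ` {t \<in> {0..<1}. cell m t = e m i}" for m i
    have "hausdorff_measure s (h -` A \<inter> space \<mu>) = 0"
    proof (rule hausdorff_measure_limsup_cells[where \<beta> = "1 / real b" and L = L' and U = U and n = "\<lambda>m. card (Gs m)"])
      show "0 < 1 / real b" "1 / real b < 1" using b by auto
      show "0 < L'" by (simp add: L'_def)
      show "real (card (Gs m)) \<le> ((1 / real b) ^ m) powr (- s / 2)" for m
      proof -
        have "((1 / real b) ^ m) powr (- s / 2) = (real b powr (- real m)) powr (- s / 2)"
          using bpos(1) by (simp add: powr_minus powr_realpow power_divide inverse_eq_divide)
        also have "\<dots> = real b powr (s / 2 * real m)" by (simp add: powr_powr mult.commute)
        finally show ?thesis using GA(4)[of m] by simp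
      qed
      show "bounded (U m i) \<and> diameter (U m i) \<le> L' * (1 / real b) ^ m" for m i
      proof -
        have d: "dist x y \<le> L' * (1 / real b) ^ m" if xy: "x \<in> U m i" "y \<in> U m i" for x y
        proof -
          obtain s t where st: "x = G s" "y = G t" "s \<in> {0..<1}" "t \<in> {0..<1}" "cell m s = cell m t"
            using xy by (auto simp: U_def)
          have "dist x y \<le> L * \<bar>s - t\<bar>" using lip st by simp
          also have "\<dots> \<le> L' * \<bar>s - t\<bar>" by (intro mult_right_mono) (auto simp: L'_def)
          also have "\<dots> \<le> L' * (1 / real b ^ m)"
            using cell_eq_near[OF st(3,4,5)] by (intro mult_left_mono) (auto simp: L'_def)
          finally show ?thesis by (simp add: power_one_over)
        qed
        have nn: "0 \<le> L' * (1 / real b) ^ m" by (simp add: L'_def)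
        show ?thesis
        proof
          show "bounded (U m i)" unfolding bounded_two_points using d by blast
          show "diameter (U m i) \<le> L' * (1 / real b) ^ m"
            unfolding diameter_def using d nn by (auto intro!: cSUP_least)
        qed
      qed
      fix x M assume x: "x \<in> h -` A \<inter> space \<mu>"
      then obtain m where m: "m \<ge> M" "cell m (h x) \<in> Gs m" using GA(5) by blast
      then obtain i where i: "i < card (Gs m)" "e m i = cell m (h x)"
        using e[of m] unfolding bij_betw_def by (metis atLeastLessThan_iff imageE)
      have "h x \<in> {0..<1}" using measurable_space[OF h(1)] x by (simp add: space_N)
      then have "x \<in> U m i"
        unfolding U_def using i G[of x] x by (intro image_eqI[of _ _ "h x"]) auto
      then show "\<exists>m\<ge>M. \<exists>i<card (Gs m). x \<in> U m i" using m(1) i(1) by blast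
    qed (rule s)
    moreover have "h -` A \<inter> space \<mu> \<in> sets \<mu>" by (rule measurable_sets[OF h(1) GA(1)])
    moreover have "emeasure \<mu> (h -` A \<inter> space \<mu>) = emeasure N A"
      using emeasure_distr[OF h(1) GA(1)] h(2) by simp
    then have "emeasure \<mu> (h -` A \<inter> space \<mu>) > 0" by (simp add: emeasure_eq_measure GA(2))
    ultimately show ?thesis using s by (intro measure_dim_le)
  qed
  then have "measure_dim \<mu> \<le> 0 + ennreal s" if "s > 0" for s :: real using that by simp
  then have "measure_dim \<mu> \<le> 0" by (rule ennreal_le_epsilon)
  then show False using dim by simp
qed

section \<open>Arithmetic and real-variable lemmas for the rigidity argument\<close>

text \<open>Euclidean descent. If a < b then q < p, so a^q divides b^q and a divides b; the equation
  a^(p-q) = (b/a)^q has a smaller sum of bases, and a common base of a and b/a is one of b.\<close>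

lemma power_eq_mult_dep:
  fixes a b p q :: nat
  assumes "a \<ge> 2" "b \<ge> 2" "p \<ge> 1" "q \<ge> 1" "a ^ p = b ^ q"
  shows "mult_dep a b"
  using assms
proof (induction "a + b" arbitrary: a b p q rule: less_induct)
  case less
  have step: "mult_dep x y \<and> mult_dep y x"
    if xy: "x < y" "x + y = a + b" "x \<ge> 2" "y \<ge> 2" "p \<ge> 1" "q \<ge> 1" "x ^ p = y ^ q" for x y p q :: nat
  proof -
    have "q < p"
    proof (rule ccontr)
      assume "\<not> q < p"
      then have "x ^ p \<le> x ^ q" using xy by (intro power_increasing) auto
      moreover have "x ^ q < y ^ q" using xy by (intro power_strict_mono) auto
      ultimately show False using xy by simp
    qed
    have "x ^ q dvd y ^ q" unfolding xy(7)[symmetric] using \<open>q < p\<close> by (intro le_imp_power_dvd) simp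
    then have "x dvd y" using xy(6) by (simp add: pow_divides_pow_iff)
    then obtain y' where y': "y = x * y'" by blast
    have "y' \<noteq> 0" "y' \<noteq> 1" using xy y' by auto
    then have y'2: "y' \<ge> 2" by linarith
    have "x ^ q * x ^ (p - q) = x ^ q * y' ^ q"
      using xy(7) \<open>q < p\<close> by (simp add: y' power_mult_distrib flip: power_add)
    then have "x ^ (p - q) = y' ^ q" using xy by simp
    moreover have "x + y' < a + b" using xy y' y'2 unfolding xy(2)[symmetric]
      by (metis add_less_cancel_left mult.commute n_less_n_mult_m not_less_eq numeral_2_eq_2 Suc_le_eq less_le_trans zero_less_numeral)
    ultimately have "mult_dep x y'" using less.hyps[of x y' "p - q" q] xy y'2 \<open>q < p\<close> by simp
    then obtain c k m where c: "c \<ge> 1" "k \<ge> 1" "m \<ge> 1" "x = c ^ k" "y' = c ^ m" by (auto simp: mult_dep_def)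
    then have "y = c ^ (k + m)" by (simp add: y' power_add)
    then show ?thesis using c unfolding mult_dep_def by (metis le_add1 order_trans)
  qed
  consider "a = b" | "a < b" | "b < a" by linarith
  then show ?case
  proof cases
    case 1
    then show ?thesis using less.prems unfolding mult_dep_def
      by (intro exI[of _ a] exI[of _ 1]) auto
  next
    case 2
    then show ?thesis using step[of a b p q] less.prems by simp
  next
    case 3
    then show ?thesis using step[of b a q p] less.prems by (simp add: add.commute)
  qed
qed

text \<open>Points with isolation radius at least 1/(n+1) are separated by the floor of (n+1)t,
  which injects them into the integers.\<close>

lemma countable_isolated:
  fixes B :: "real set"
  assumes iso: "\<And>t. t \<in> B \<Longrightarrow> \<exists>e>0. \<forall>y\<in>B. y \<noteq> t \<longrightarrow> e \<le> \<bar>y - t\<bar>"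
  shows "countable B"
proof -
  define S where "S n = {t \<in> B. \<forall>y\<in>B. y \<noteq> t \<longrightarrow> 1 / real (Suc n) \<le> \<bar>y - t\<bar>}" for n
  have "countable (S n)" for n
  proof -
    have "inj_on (\<lambda>t. \<lfloor>real (Suc n) * t\<rfloor>) (S n)"
    proof (rule inj_onI, rule ccontr)
      fix x y assume xy: "x \<in> S n" "y \<in> S n" "\<lfloor>real (Suc n) * x\<rfloor> = \<lfloor>real (Suc n) * y\<rfloor>" "x \<noteq> y"
      have "\<bar>real (Suc n) * y - real (Suc n) * x\<bar> < 1" using xy(3) by linarith
      then have "real (Suc n) * \<bar>y - x\<bar> < 1" by (simp add: abs_mult flip: right_diff_distrib)
      moreover have "1 / real (Suc n) \<le> \<bar>y - x\<bar>" using xy by (auto simp: S_def)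
      then have "1 \<le> real (Suc n) * \<bar>y - x\<bar>" by (simp add: field_simps)
      ultimately show False by linarith
    qed
    then show ?thesis using countable_image_inj_on[of "\<lambda>t. \<lfloor>real (Suc n) * t\<rfloor>" "S n"] by simp
  qed
  moreover have "B = (\<Union>n. S n)"
  proof
    show "B \<subseteq> (\<Union>n. S n)"
    proof
      fix t assume t: "t \<in> B"
      then obtain e where e: "e > 0" "\<forall>y\<in>B. y \<noteq> t \<longrightarrow> e \<le> \<bar>y - t\<bar>" using iso by blast
      obtain n where "1 / real (Suc n) < e" using nat_approx_posE[OF e(1)] by blast
      then have "t \<in> S n" using t e(2) by (auto simp: S_def intro: order_trans[OF less_imp_le])
      then show "t \<in> (\<Union>n. S n)" by blast
    qed
  qed (auto simp: S_def)
  ultimately show ?thesis by (metis countable_UN countableI_type)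
qed

text \<open>Near such a point D stays within 1 of its value and does not return to it, so D takes no
  integer value there and the point is isolated.\<close>

lemma countable_integer_noncritical:
  fixes D :: "real \<Rightarrow> real"
  assumes der: "\<And>t. (D has_real_derivative D' t) (at t)"
  shows "countable {t. D t \<in> \<int> \<and> D' t \<noteq> 0}"
proof (rule countable_isolated)
  fix t assume "t \<in> {t. D t \<in> \<int> \<and> D' t \<noteq> 0}"
  then have t: "D t \<in> \<int>" "D' t \<noteq> 0" by auto
  have "isCont D t" by (rule DERIV_isCont[OF der])
  then obtain d1 where d1: "d1 > 0" "\<And>y. \<bar>y - t\<bar> < d1 \<Longrightarrow> \<bar>D y - D t\<bar> < 1"
    unfolding continuous_at_eps_delta dist_real_def by (meson zero_less_one)
  have "((\<lambda>y. (D y - D t) / (y - t)) \<longlongrightarrow> D' t) (at t)" using der[of t] by (simp add: has_field_derivative_iff)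
  then have "\<forall>\<^sub>F y in at t. (D y - D t) / (y - t) \<noteq> 0" using t(2) by (rule tendsto_imp_eventually_ne)
  then obtain d2 where d2: "d2 > 0" "\<And>y. y \<noteq> t \<Longrightarrow> \<bar>y - t\<bar> < d2 \<Longrightarrow> D y \<noteq> D t"
    unfolding eventually_at dist_real_def by auto
  show "\<exists>e>0. \<forall>y\<in>{t. D t \<in> \<int> \<and> D' t \<noteq> 0}. y \<noteq> t \<longrightarrow> e \<le> \<bar>y - t\<bar>"
  proof (intro exI[of _ "min d1 d2"] conjI ballI impI)
    fix y assume y: "y \<in> {t. D t \<in> \<int> \<and> D' t \<noteq> 0}" "y \<noteq> t"
    show "min d1 d2 \<le> \<bar>y - t\<bar>"
    proof (rule ccontr)
      assume "\<not> min d1 d2 \<le> \<bar>y - t\<bar>"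
      then have "\<bar>D y - D t\<bar> < 1" "D y \<noteq> D t" using d1(2) d2(2) y(2) by auto
      moreover have "D y - D t \<in> \<int>" using y(1) t(1) by auto
      ultimately show False using Ints_nonzero_abs_ge1[of "D y - D t"] by auto
    qed
  qed (use d1 d2 in auto)
qed

text \<open>The easy one-dimensional Sard lemma. By uniform continuity |h'| is at most \<epsilon> on
  every piece of length 1/n that contains a critical point, so its image lies in an interval of
  length 2\<epsilon>/n. With \<epsilon> = e/4 the total is at most e/2.\<close>

lemma negligible_critical_values:
  fixes h :: "real \<Rightarrow> real"
  assumes der: "\<And>t. (h has_real_derivative h' t) (at t)" and cont: "continuous_on UNIV h'"
  shows "negligible (h ` {t \<in> {0..1}. h' t = 0})"
proof -
  let ?Z = "{t \<in> {0..1}. h' t = 0}"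
  show ?thesis unfolding negligible_outer
  proof (intro allI impI)
    fix e :: real assume e: "e > 0"
    define \<epsilon> where "\<epsilon> = e / 4"
    have \<epsilon>: "\<epsilon> > 0" using e by (simp add: \<epsilon>_def)
    have "uniformly_continuous_on {0..1} h'"
      by (rule compact_uniformly_continuous[OF continuous_on_subset[OF cont]]) auto
    then obtain d where d: "d > 0" "\<And>x y. x \<in> {0..1} \<Longrightarrow> y \<in> {0..1} \<Longrightarrow> \<bar>x - y\<bar> < d \<Longrightarrow> \<bar>h' x - h' y\<bar> < \<epsilon>"
      using \<epsilon> unfolding uniformly_continuous_on_def dist_real_def by meson
    obtain m where m: "1 / real (Suc m) < d" using nat_approx_posE[OF d(1)] by blast
    define n where "n = Suc m"
    have n: "n > 0" "1 / real n < d" using m by (auto simp: n_def)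
    define I where "I i = {real i / real n .. real (Suc i) / real n}" for i
    define z where "z i = (SOME z. z \<in> ?Z \<inter> I i)" for i
    define J where "J i = (if ?Z \<inter> I i = {} then {} else {h (z i) - \<epsilon> / real n .. h (z i) + \<epsilon> / real n})" for i
    have cover: "h ` ?Z \<subseteq> (\<Union>i<n. J i)"
    proof
      fix w assume "w \<in> h ` ?Z"
      then obtain t where t: "t \<in> {0..1}" "h' t = 0" "w = h t" by auto
      define i where "i = (if t = 1 then n - 1 else nat \<lfloor>real n * t\<rfloor>)"
      have i: "i < n" "t \<in> I i"
      proof -
        have "i < n \<and> real i \<le> real n * t \<and> real n * t \<le> real (Suc i)"
        proof (cases "t = 1")
          case True
          then show ?thesis using n by (simp add: i_def of_nat_diff)
        next
          case False
          then have "real n * t < real n" "0 \<le> real n * t" using t(1) n by auto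
          then show ?thesis using False unfolding i_def by simp linarith
        qed
        then show "i < n" "t \<in> I i" using n by (auto simp: I_def field_simps)
      qed
      then have ne: "?Z \<inter> I i \<noteq> {}" using t by auto
      then have zi: "z i \<in> ?Z \<inter> I i" unfolding z_def by (rule some_in_eq[THEN iffD2])
      have "norm (h t - h (z i)) \<le> \<epsilon> * norm (t - z i)"
      proof (rule field_differentiable_bound[where S = "I i \<inter> {0..1}" and f' = h'])
        show "convex (I i \<inter> {0..1})" unfolding I_def by (intro convex_Int) auto
        show "(h has_field_derivative h' x) (at x within I i \<inter> {0..1})" for x by (rule DERIV_subset[OF der]) simp
        show "norm (h' x) \<le> \<epsilon>" if x: "x \<in> I i \<inter> {0..1}" for x
        proof -
          have "\<bar>x - z i\<bar> \<le> 1 / real n" using x zi n by (auto simp: I_def abs_le_iff field_simps)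
          then have "\<bar>h' x - h' (z i)\<bar> < \<epsilon>" using x zi n(2) by (intro d(2)) auto
          then show ?thesis using zi by simp
        qed
      qed (use t i zi in auto)
      also have "\<dots> \<le> \<epsilon> * (1 / real n)"
        using \<epsilon> i(2) zi n by (intro mult_left_mono) (auto simp: I_def abs_le_iff field_simps)
      finally have "\<bar>h t - h (z i)\<bar> \<le> \<epsilon> / real n" by simp
      then have "w \<in> J i" using ne by (simp add: J_def t(3) abs_le_iff)
      then show "w \<in> (\<Union>i<n. J i)" using i(1) by blast
    qed
    have Jm: "J i \<in> lmeasurable" for i by (simp add: J_def)
    have "measure lebesgue (\<Union>i<n. J i) \<le> (\<Sum>i<n. measure lebesgue (J i))"
      by (rule measure_UNION_le) (use Jm in \<open>auto intro: fmeasurableD\<close>)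
    also have "\<dots> \<le> (\<Sum>i<n. 2 * \<epsilon> / real n)"
      by (rule sum_mono) (use \<epsilon> n in \<open>auto simp: J_def\<close>)
    also have "\<dots> < e" using n e by (simp add: \<epsilon>_def)
    finally have "measure lebesgue (\<Union>i<n. J i) < e" .
    then show "\<exists>T. h ` ?Z \<subseteq> T \<and> T \<in> lmeasurable \<and> measure lebesgue T < e"
      using cover Jm by (intro exI[of _ "\<Union>i<n. J i"]) (auto intro!: fmeasurable.finite_UN)
  qed
qed

text \<open>The lifts in \<open>S\<close> may lie anywhere on the line; countably many integer
  translates bring them back to [0,1).\<close>

lemma lebesgue_circle_null:
  assumes S: "negligible S" and A: "A \<in> sets borel" "A \<subseteq> to_circle ` S"
  shows "emeasure lebesgue_circle A = 0"
proof -
  define B where "B = to_circle -` A \<inter> {0..<1}"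
  have B: "B \<in> sets borel"
  proof -
    have "to_circle -` A \<inter> space borel \<in> sets borel"
      by (rule measurable_sets[OF borel_measurable_to_circle A(1)])
    then show ?thesis by (simp add: B_def)
  qed
  have "B \<subseteq> (\<Union>n::int. (\<lambda>x. of_int n + x) ` S)"
  proof
    fix t assume "t \<in> B"
    then obtain s where s: "s \<in> S" "to_circle t = to_circle s" using A(2) by (auto simp: B_def)
    then obtain n where "t - s = of_int n" by (auto simp: to_circle_eq_iff elim: Ints_cases)
    then have "t = of_int n + s" by simp
    then show "t \<in> (\<Union>n::int. (\<lambda>x. of_int n + x) ` S)" using s(1) by blast
  qed
  moreover have "negligible (\<Union>n::int. (\<lambda>x. of_int n + x) ` S)"
    by (rule negligible_countable_Union) (auto intro: negligible_translation[OF S])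
  ultimately have "negligible B" by (rule negligible_subset[rotated])
  then have "B \<in> null_sets lebesgue" by (simp add: negligible_iff_null_sets)
  then have "emeasure lborel B = 0" using B by (auto simp: null_sets_def)
  then show ?thesis using A(1) by (simp add: emeasure_lebesgue_circle B_def)
qed

lemma periodic_int:
  fixes f :: "real \<Rightarrow> 'a"
  assumes "\<And>x. f (x + 1) = f x" "x - y \<in> \<int>"
  shows "f x = f y"
proof -
  have nat: "f (x + real n) = f x" for x n
  proof (induction n)
    case (Suc n)
    then show ?case using assms(1)[of "x + real n"] by (simp add: add.assoc add.commute[of 1])
  qed simp
  obtain k where k: "x = y + of_int k" using assms(2) by (metis Ints_cases add.commute diff_add_cancel)
  show ?thesis
  proof (cases "k \<ge> 0")
    case True
    then show ?thesis using nat[of y "nat k"] k by simp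
  next
    case False
    then show ?thesis using nat[of x "nat (- k)"] k by simp
  qed
qed

subsection \<open>Measure rigidity\<close>

theorem joint_measure_lebesgue:
  fixes \<mu> :: "circle measure"
  assumes a: "a \<ge> 2" and b: "b \<ge> 2" and nd: "\<not> mult_dep a b"
    and sets: "sets \<mu> = sets borel" and prob: "prob_space \<mu>" and dim: "measure_dim \<mu> > 0"
    and f: "f \<in> measurable \<mu> \<mu>" "distr \<mu> \<mu> f = \<mu>" and erg: "ergodic \<mu> g"
    and \<phi>: "C2_diffeo \<phi>" "\<phi> \<circ> f \<circ> inv \<phi> = times_map a" and \<psi>: "C2_diffeo \<psi>" "\<psi> \<circ> g \<circ> inv \<psi> = times_map b"
  shows "distr \<mu> borel \<psi> = lebesgue_circle"
proof (rule ccontr)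
  assume contra: "distr \<mu> borel \<psi> \<noteq> lebesgue_circle"
  interpret \<mu>: prob_space \<mu> by (rule prob)
  have sp: "space \<mu> = UNIV" using sets_eq_imp_space_eq[OF sets] by simp
  have bij: "bij \<phi>" "bij \<psi>" using \<phi>(1) \<psi>(1) by (auto simp: C2_diffeo_def)
  have inv: "inv \<phi> (\<phi> x) = x" "\<phi> (inv \<phi> x) = x" "inv \<psi> (\<psi> x) = x" "\<psi> (inv \<psi> x) = x" for x
    using bij by (auto simp: bij_is_inj surj_f_inv_f[OF bij_is_surj])
  have \<phi>f: "\<phi> (f x) = times_map a (\<phi> x)" for x
    using fun_cong[OF \<phi>(2), of "\<phi> x"] by (simp add: inv)
  have borel_\<mu>: "u \<in> measurable \<mu> M'" if "u \<in> measurable borel M'" for u :: "circle \<Rightarrow> 'x" and M'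
    using that sets by (simp cong: measurable_cong_sets)
  have m\<phi>: "\<phi> \<in> measurable borel borel" and m\<psi>: "\<psi> \<in> measurable borel borel" and mi\<psi>: "inv \<psi> \<in> measurable borel borel"
    using C2_diffeo_measurable \<phi>(1) \<psi>(1) C2_diffeo_inv by blast+
  have fb: "f \<in> measurable borel borel" using f(1) sets by (simp cong: measurable_cong_sets)
  have nonatomic: "AE x in \<mu>. x \<noteq> p" for p
  proof -
    have "emeasure \<mu> {p} = 0" by (rule measure_dim_pos_nonatomic[OF dim]) (simp add: sets)
    then have "AE x in \<mu>. x \<notin> {p}" by (intro AE_not_in) (simp add: null_sets_def sets)
    then show ?thesis by simp
  qed
  define \<nu> where "\<nu> = distr \<mu> borel \<psi>"
  have s\<nu>: "sets \<nu> = sets borel" by (simp add: \<nu>_def)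
  have p\<nu>: "prob_space \<nu>" unfolding \<nu>_def by (rule \<mu>.prob_space_distr[OF borel_\<mu>[OF m\<psi>]])
  have e\<nu>: "ergodic \<nu> (times_map b)" unfolding \<nu>_def \<psi>(2)[symmetric] by (rule ergodic_push[OF erg sets \<psi>(1)])
  define N where "N = real_model \<nu>"
  interpret N: base_b N b unfolding N_def by (rule real_model_base_b[OF s\<nu> p\<nu> b e\<nu>])
  define h where "h x = circ_frac (\<psi> x)" for x
  have hR: "h \<in> measurable borel (restrict_space borel {0..<1})"
    unfolding h_def[abs_def] by (rule measurable_compose[OF m\<psi> circ_frac_measurable_restrict]) simp
  have h: "h \<in> measurable \<mu> N"
    using borel_\<mu>[OF hR] N.sets_N by (simp cong: measurable_cong_sets)
  have hd: "distr \<mu> N h = N"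
  proof -
    have "distr \<mu> N h = distr \<mu> (restrict_space borel {0..<1}) (circ_frac \<circ> \<psi>)"
      using N.sets_N by (intro distr_cong) (auto simp: h_def)
    also have "\<dots> = N" unfolding N_def real_model_def \<nu>_def
      by (rule distr_distr[symmetric]) (use circ_frac_measurable_restrict borel_\<mu>[OF m\<psi>] in auto)
    finally show ?thesis .
  qed
  have to_h: "to_circle (h x) = \<psi> x" for x by (simp add: h_def)
  \<comment> \<open>The inverse coordinate is Lipschitz by the bound on \<open>Y1\<close>, so
    positive dimension of \<open>\<mu>\<close> excludes the deterministic alternative of
    \<open>Qlim_dichotomy\<close>.\<close>
  have Q0: "N.Qlim \<longlonglongrightarrow> 0"
  proof -
    obtain Y Y1 Y2 where Y: "\<And>x. (Y has_real_derivative Y1 x) (at x)" "\<And>x. (Y1 has_real_derivative Y2 x) (at x)"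
      "\<And>x. inv \<psi> (to_circle x) = to_circle (Y x)"
      using C2_diffeo_lift[OF \<psi>(1)] by metis
    have "continuous_on {0..1} Y1" by (rule continuous_at_imp_continuous_on) (use DERIV_isCont[OF Y(2)] in auto)
    then have "bounded (Y1 ` {0..1})" by (intro compact_imp_bounded compact_continuous_image) auto
    then obtain L where L: "\<forall>y\<in>Y1 ` {0..1}. norm y \<le> L" unfolding bounded_iff by blast
    have "N.Qlim 1 \<noteq> 1"
    proof (rule N.positive_dimension_not_deterministic[OF h hd prob _ _ dim, where G = "\<lambda>t. inv \<psi> (to_circle t)" and L = L])
      show "inv \<psi> (to_circle (h x)) = x" for x by (simp add: to_h inv)
      fix s t :: real assume st: "s \<in> {0..<1}" "t \<in> {0..<1}"
      have "norm (Y s - Y t) \<le> L * norm (s - t)"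
        by (rule field_differentiable_bound[where S = "{0..1}" and f' = Y1]) (use Y(1) L st in \<open>auto intro: DERIV_subset\<close>)
      then show "dist (inv \<psi> (to_circle s)) (inv \<psi> (to_circle t)) \<le> L * \<bar>s - t\<bar>"
        unfolding Y(3) using dist_to_circle_le[of "Y s" "Y t"] by simp
    qed
    then show ?thesis using N.Qlim_dichotomy by blast
  qed
  have N0: "measure N {0} = 0"
  proof -
    have "AE x in \<mu>. h x \<noteq> 0"
      using nonatomic[of "inv \<psi> (to_circle 0)"]
    proof eventually_elim
      case (elim x)
      then show ?case using to_h[of x] inv(3)[of x] by metis
    qed
    then have "AE t in distr \<mu> N h. t \<noteq> 0"
      by (subst AE_distr_iff[OF h]) (auto simp: N.space_N N.sets_N sets_restrict_space_iff)
    then show ?thesis unfolding hd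
      by (subst N.prob_eq_0) (auto simp: N.sets_N sets_restrict_space_iff)
  qed
  define \<xi> where "\<xi> = \<psi> \<circ> inv \<phi>"
  have \<xi>: "C2_diffeo \<xi>" unfolding \<xi>_def by (intro C2_diffeo_compose C2_diffeo_inv \<phi> \<psi>)
  have inv\<xi>: "inv \<xi> = \<phi> \<circ> inv \<psi>"
    unfolding \<xi>_def using bij by (simp add: o_inv_distrib bij_imp_bij_inv inv_inv_eq)
  obtain X X1 X2 Y Y1 Y2 where X: "\<And>x. (X has_real_derivative X1 x) (at x)" "\<And>x. (X1 has_real_derivative X2 x) (at x)" "continuous_on UNIV X2"
    and Y: "\<And>x. (Y has_real_derivative Y1 x) (at x)" "\<And>x. (Y1 has_real_derivative Y2 x) (at x)"
    and lift: "\<And>x. \<xi> (to_circle x) = to_circle (X x)" "\<And>x. inv \<xi> (to_circle x) = to_circle (Y x)"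
    and XY: "\<And>y. X1 (Y y) * Y1 y = 1" and X1nz: "\<And>x. X1 x \<noteq> 0" and X1per: "\<And>x. X1 (x + 1) = X1 x"
    by (rule C2_diffeo_lift[OF \<xi>]) (rule that)
  have cont: "continuous_on UNIV u" if "\<And>x. (u has_real_derivative u' x) (at x)" for u u' :: "real \<Rightarrow> real"
    using DERIV_isCont[OF that] by (simp add: continuous_on_eq_continuous_at)
  \<comment> \<open>A lift of f in the coordinate given by \<open>\<psi>\<close>: the lift
    \<open>Y\<close> of the inverse of \<open>\<xi>\<close>, multiplication by a, then the lift
    \<open>X\<close> of \<open>\<xi>\<close>.\<close>
  define Ft where "Ft y = X (real a * Y y)" for y
  define Ft' where "Ft' y = X1 (real a * Y y) * (real a * Y1 y)" for y
  define F where "F y = circ_frac (\<psi> (f (inv \<psi> (to_circle y))))" for y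
  have Fder: "(Ft has_real_derivative Ft' y) (at y)" for y
    unfolding Ft_def[abs_def] Ft'_def by (intro DERIV_chain2[OF X(1)] DERIV_cmult Y(1))
  have Fcont: "continuous_on UNIV Ft'"
    unfolding Ft'_def[abs_def]
    by (intro continuous_intros cont[OF Y(2)] continuous_on_compose2[OF cont[OF X(2)]] cont[OF Y(1)]) auto
  have Fnz: "Ft' y \<noteq> 0" for y using X1nz[of "real a * Y y"] XY[of y] a by (auto simp: Ft'_def)
  have Feq: "F y = frac (Ft y)" for y
  proof -
    have "\<psi> (f (inv \<psi> (to_circle y))) = \<xi> (\<phi> (f (inv \<psi> (to_circle y))))" by (simp add: \<xi>_def inv)
    also have "\<dots> = \<xi> (times_map a (inv \<xi> (to_circle y)))" by (simp add: \<phi>f inv\<xi>)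
    also have "\<dots> = to_circle (Ft y)" by (simp add: lift times_map_to_circle Ft_def)
    finally show ?thesis by (simp add: F_def)
  qed
  have FN: "F \<in> measurable N N"
  proof -
    have "(\<lambda>y. circ_frac (\<psi> (f (inv \<psi> (to_circle y))))) \<in> borel_measurable borel"
      by (intro measurable_compose[OF borel_measurable_to_circle] measurable_compose[OF mi\<psi>] measurable_compose[OF fb]
          measurable_compose[OF m\<psi>] circ_frac_measurable)
    then have "F \<in> measurable (restrict_space borel {0..<1}) (restrict_space borel {0..<1})"
      unfolding F_def[abs_def] by (intro measurable_restrict_space2 measurable_restrict_space1) (use circ_frac_range in auto)
    then show ?thesis using N.sets_N by (simp cong: measurable_cong_sets)
  qed
  have Fd: "distr N N F = N"
  proof -
    have Fh: "F \<circ> h = h \<circ> f" by (simp add: fun_eq_iff F_def to_h inv h_def)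
    have "distr N N F = distr (distr \<mu> N h) N F" by (simp only: hd)
    also have "\<dots> = distr \<mu> N (F \<circ> h)" by (rule distr_distr[OF FN h])
    also have "\<dots> = distr (distr \<mu> \<mu> f) N h" unfolding Fh by (rule distr_distr[symmetric, OF h f(1)])
    also have "\<dots> = N" by (simp only: f(2) hd)
    finally show ?thesis .
  qed
  have coef: "(\<integral>x. circ_char k x \<partial>\<nu>) = (\<integral>t. ee (of_int k * t) \<partial>N)" for k
  proof -
    have "(\<integral>x. circ_char k x \<partial>\<nu>) = (\<integral>x. circ_char k (\<psi> x) \<partial>\<mu>)"
      unfolding \<nu>_def by (rule integral_distr[OF borel_\<mu>[OF m\<psi>]]) simp
    also have "\<dots> = (\<integral>x. ee (of_int k * h x) \<partial>\<mu>)" by (simp add: circ_char_def h_def)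
    also have "\<dots> = (\<integral>t. ee (of_int k * t) \<partial>distr \<mu> N h)"
      by (rule integral_distr[symmetric, OF h N.char_measurable])
    finally show ?thesis by (simp only: hd)
  qed
  \<comment> \<open>A nonzero coefficient exists because the coefficients determine the measure;
    conjugation makes its index positive, as the logarithmic scale requires.\<close>
  obtain k :: int where k: "k > 0" "(\<integral>t. ee (of_int k * t) \<partial>N) \<noteq> 0"
  proof -
    have "\<exists>k. k \<noteq> 0 \<and> (\<integral>x. circ_char k x \<partial>\<nu>) \<noteq> 0"
    proof (rule ccontr)
      assume "\<not> (\<exists>k. k \<noteq> 0 \<and> (\<integral>x. circ_char k x \<partial>\<nu>) \<noteq> 0)"
      then have "\<nu> = lebesgue_circle"
        using fourier_lebesgue_circle by (intro circle_measure_eqI s\<nu> p\<nu> prob_space_lebesgue_circle) auto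
      then show False using contra by (simp add: \<nu>_def)
    qed
    then obtain k where k: "k \<noteq> 0" "(\<integral>x. circ_char k x \<partial>\<nu>) \<noteq> 0" by blast
    have "(\<integral>x. circ_char (- k) x \<partial>\<nu>) = cnj (\<integral>x. circ_char k x \<partial>\<nu>)"
      unfolding circ_char_cnj[symmetric] by (rule Bochner_Integration.integral_cnj)
    then have k': "(\<integral>x. circ_char (- k) x \<partial>\<nu>) \<noteq> 0" using k(2) by simp
    show thesis
    proof (cases "k > 0")
      case True
      then show thesis using that[of k] k(2) coef by simp
    next
      case False
      then show thesis using that[of "- k"] k(1) k' coef[of "- k"] by simp
    qed
  qed
  have lb: "ln (real b) > 0" and la: "ln (real a) > 0" using a b by auto
  obtain J :: nat where J: "J \<ge> 1" "AE y in N. \<exists>i::int. real J * ln \<bar>Ft' y\<bar> = of_int i * ln (real b)"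
    using N.derivative_rational_powers[OF Q0 N0 Fder Fcont Fnz _ FN Fd, of "of_int k"] Feq k by auto
  \<comment> \<open>From here on points are described in the coordinate given by
    \<open>\<phi>\<close>, in which f is multiplication by a.\<close>
  define t where "t x = circ_frac (\<phi> x)" for x
  have t_meas: "t \<in> borel_measurable \<mu>"
    unfolding t_def[abs_def] by (rule measurable_compose[OF borel_\<mu>[OF m\<phi>] circ_frac_measurable])
  have tf: "t (f x) = frac (real a * t x)" for x by (simp add: t_def \<phi>f circ_frac_times_map)
  have t01: "t x \<in> {0..<1}" for x unfolding t_def by (rule circ_frac_range)
  \<comment> \<open>Equal to ln |X1 s|, but in a form whose derivative needs no case distinction on
    signs.\<close>
  define H where "H s = ln (X1 s * X1 s) / 2" for s
  define H1 where "H1 s = X2 s / X1 s" for s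
  have Hder: "(H has_real_derivative H1 s) (at s)" for s
  proof -
    have pos: "0 < X1 s * X1 s" using X1nz[of s] not_real_square_gt_zero by blast
    have "((\<lambda>s. ln (X1 s * X1 s) / 2) has_real_derivative
        (inverse (X1 s * X1 s) * (X1 s * X2 s + X2 s * X1 s)) / 2) (at s)"
      by (intro DERIV_cdivide DERIV_chain2[where f = ln and g = "\<lambda>s. X1 s * X1 s", OF DERIV_ln[OF pos]] DERIV_mult'[OF X(2) X(2)])
    moreover have "(inverse (X1 s * X1 s) * (X1 s * X2 s + X2 s * X1 s)) / 2 = H1 s"
      using X1nz[of s] by (simp add: H1_def field_simps)
    ultimately show ?thesis unfolding H_def[abs_def] by (simp only:)
  qed
  have Hln: "H s = ln \<bar>X1 s\<bar>" for s
    using X1nz[of s] ln_mult[of "\<bar>X1 s\<bar>" "\<bar>X1 s\<bar>"] by (simp add: H_def)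
  have Hper: "H (s + 1) = H s" for s by (simp add: H_def X1per)
  have X2per: "X2 (s + 1) = X2 s" for s
  proof (rule int_diff_deriv_eq[where f = "\<lambda>s. X1 (s + 1)" and g = X1 and f' = "\<lambda>s. X2 (s + 1)"])
    show "((\<lambda>s. X1 (s + 1)) has_real_derivative X2 (s + 1)) (at s)" for s
      using DERIV_shift[of X1 "X2 (s + 1)" s 1] X(2)[of "s + 1"] by simp
  qed (use X(2) X1per in auto)
  have H1per: "H1 (s + 1) = H1 s" for s by (simp add: H1_def X1per X2per)
  have H1cont: "continuous_on UNIV H1"
    unfolding H1_def[abs_def] by (intro continuous_on_divide X(3) cont[OF X(2)]) (use X1nz in auto)
  \<comment> \<open>By the chain rule and \<open>XY\<close> this is J ln |Ft'| / ln b, expressed in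
    the coordinate \<open>t\<close>.\<close>
  define D where "D s = real J * (ln (real a) + H (real a * s) - H s) / ln (real b)" for s
  define D' where "D' s = real J * (real a * H1 (real a * s) - H1 s) / ln (real b)" for s
  have Dder: "(D has_real_derivative D' s) (at s)" for s
  proof -
    have "((\<lambda>s. H (real a * s)) has_real_derivative H1 (real a * s) * real a) (at s)"
      by (rule DERIV_chain2[OF Hder]) (auto intro!: derivative_eq_intros)
    then have "((\<lambda>s. real J * (ln (real a) + H (real a * s) - H s) / ln (real b)) has_real_derivative
        real J * (0 + H1 (real a * s) * real a - H1 s) / ln (real b)) (at s)"
      by (intro DERIV_cdivide DERIV_cmult DERIV_diff DERIV_add DERIV_const Hder)
    then show ?thesis by (simp add: D_def[abs_def] D'_def mult.commute)
  qed
  have D_int: "AE x in \<mu>. D (t x) \<in> \<int>"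
  proof -
    have "AE y in distr \<mu> N h. \<exists>i::int. real J * ln \<bar>Ft' y\<bar> = of_int i * ln (real b)" unfolding hd by (rule J(2))
    then have "AE x in \<mu>. \<exists>i::int. real J * ln \<bar>Ft' (h x)\<bar> = of_int i * ln (real b)" by (rule AE_distrD[OF h])
    then show ?thesis
    proof eventually_elim
      case (elim x)
      then obtain i :: int where i: "real J * ln \<bar>Ft' (h x)\<bar> = of_int i * ln (real b)" by blast
      define z where "z = Y (h x)"
      have "to_circle z = \<phi> x" using lift(2)[of "h x"] by (simp add: z_def inv\<xi> to_h inv)
      then have "t x = frac z" unfolding t_def by (metis circ_frac_to_circle)
      then have zt: "z - t x \<in> \<int>" by (simp add: frac_def)
      have azt: "real a * z - real a * t x \<in> \<int>"
        unfolding right_diff_distrib[symmetric] using zt by (intro Ints_mult) auto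
      have "ln \<bar>Ft' (h x)\<bar> = ln (real a) + H (real a * z) - H z"
      proof -
        have "\<bar>Y1 (h x)\<bar> = 1 / \<bar>X1 z\<bar>" using XY[of "h x"] X1nz[of z] unfolding z_def
          by (metis abs_mult abs_one nonzero_eq_divide_eq abs_eq_0 mult.commute)
        then have "\<bar>Ft' (h x)\<bar> = \<bar>X1 (real a * z)\<bar> * real a / \<bar>X1 z\<bar>" by (simp add: Ft'_def z_def[symmetric] abs_mult)
        then show ?thesis using X1nz a by (simp add: Hln ln_mult ln_div)
      qed
      also have "\<dots> = ln (real a) + H (real a * t x) - H (t x)"
        using periodic_int[where f = H, OF Hper zt] periodic_int[where f = H, OF Hper azt] by simp
      finally have "D (t x) = of_int i" using i lb by (simp add: D_def)
      then show ?case by simp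
    qed
  qed
  \<comment> \<open>The parameters where D is an integer but D' does not vanish are countably many,
    and \<open>\<mu>\<close> has no atoms.\<close>
  have D'0: "AE x in \<mu>. D' (t x) = 0"
  proof -
    have "AE x in \<mu>. \<forall>\<beta>\<in>{s. D s \<in> \<int> \<and> D' s \<noteq> 0}. t x \<noteq> \<beta>"
      unfolding AE_ball_countable[OF countable_integer_noncritical[OF Dder]]
    proof
      fix \<beta>
      show "AE x in \<mu>. t x \<noteq> \<beta>"
        using nonatomic[of "inv \<phi> (to_circle \<beta>)"]
        by eventually_elim (metis t_def to_circle_circ_frac inv(1))
    qed
    with D_int show ?thesis by eventually_elim blast
  qed
  have H1step: "AE x in \<mu>. \<bar>H1 (t (f x))\<bar> = \<bar>H1 (t x)\<bar> / real a"
    using D'0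
  proof eventually_elim
    case (elim x)
    then have "real a * H1 (real a * t x) = H1 (t x)" using J(1) lb by (simp add: D'_def)
    moreover have "H1 (t (f x)) = H1 (real a * t x)"
      unfolding tf by (rule periodic_int[where f = H1, OF H1per]) (simp add: frac_def)
    ultimately show ?case using a by (simp add: field_simps flip: abs_mult) (metis abs_mult abs_of_nat mult.commute)
  qed
  have Hm: "(\<lambda>x. \<bar>H1 (t x)\<bar>) \<in> borel_measurable \<mu>"
    by (intro borel_measurable_abs measurable_compose[OF t_meas borel_measurable_continuous_onI[OF H1cont]])
  \<comment> \<open>By invariance |H1(t)| and |H1(t)|/a have the same integral, and a > 1.\<close>
  have H10: "AE x in \<mu>. H1 (t x) = 0"
  proof -
    have "bounded (H1 ` {0..1})"
      by (intro compact_imp_bounded compact_continuous_image continuous_on_subset[OF H1cont]) auto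
    then obtain B where B: "\<forall>y\<in>H1 ` {0..1}. norm y \<le> B" unfolding bounded_iff by blast
    have int: "integrable \<mu> (\<lambda>x. \<bar>H1 (t x)\<bar>)"
      by (rule \<mu>.integrable_bounded[OF Hm, of B]) (use B t01 in \<open>auto simp: less_imp_le\<close>)
    have "(\<integral>x. \<bar>H1 (t x)\<bar> \<partial>\<mu>) = (\<integral>x. \<bar>H1 (t (f x))\<bar> \<partial>\<mu>)"
      by (rule \<mu>.integral_measure_preserving[OF f Hm, symmetric])
    also have "\<dots> = (\<integral>x. \<bar>H1 (t x)\<bar> / real a \<partial>\<mu>)"
      by (rule integral_cong_AE) (use H1step measurable_compose[OF f(1) Hm] Hm in auto)
    also have "\<dots> = (\<integral>x. \<bar>H1 (t x)\<bar> \<partial>\<mu>) / real a" by simp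
    finally have "(\<integral>x. \<bar>H1 (t x)\<bar> \<partial>\<mu>) * (real a - 1) = 0" using a by (simp add: field_simps)
    then have "(\<integral>x. \<bar>H1 (t x)\<bar> \<partial>\<mu>) = 0" using a by simp
    then show ?thesis using integral_nonneg_eq_0_iff_AE[OF int] by simp
  qed
  \<comment> \<open>Along f, \<open>K\<close> changes by D - \<theta> with D integral and \<theta> =
    J ln a / ln b, so its law modulo 1 is invariant under rotation by \<theta>.\<close>
  define K where "K s = real J * H s / ln (real b)" for s
  have Kder: "(K has_real_derivative real J * H1 s / ln (real b)) (at s)" for s
    unfolding K_def[abs_def] by (intro DERIV_cdivide DERIV_cmult Hder)
  have Kcont: "continuous_on UNIV K" by (rule cont[OF Kder])
  define \<kappa> where "\<kappa> x = to_circle (K (t x))" for x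
  have \<kappa>m: "\<kappa> \<in> measurable \<mu> borel"
    unfolding \<kappa>_def[abs_def]
    by (intro measurable_compose[OF _ borel_measurable_to_circle] measurable_compose[OF t_meas borel_measurable_continuous_onI[OF Kcont]])
  have law: "distr \<mu> borel \<kappa> = lebesgue_circle"
  proof (rule circle_measure_eqI)
    show "prob_space (distr \<mu> borel \<kappa>)" by (rule \<mu>.prob_space_distr[OF \<kappa>m])
    fix n :: int assume n: "n \<noteq> 0"
    define \<theta> where "\<theta> = real J * ln (real a) / ln (real b)"
    define u where "u x = ee (of_int n * K (t x))" for x
    have um: "u \<in> borel_measurable \<mu>"
      unfolding u_def[abs_def]
      by (intro measurable_compose[OF _ ee_measurable] borel_measurable_times borel_measurable_const
          measurable_compose[OF t_meas borel_measurable_continuous_onI[OF Kcont]])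
    have "(\<integral>x. u x \<partial>\<mu>) = (\<integral>x. u (f x) \<partial>\<mu>)"
      by (rule \<mu>.integral_measure_preserving[OF f um, symmetric])
    also have "\<dots> = (\<integral>x. ee (- (of_int n * \<theta>)) * u x \<partial>\<mu>)"
    proof (rule integral_cong_AE)
      show "AE x in \<mu>. u (f x) = ee (- (of_int n * \<theta>)) * u x"
        using D_int
      proof eventually_elim
        case (elim x)
        have "H (t (f x)) = H (real a * t x)"
          unfolding tf by (rule periodic_int[where f = H, OF Hper]) (simp add: frac_def)
        then have Keq: "K (t (f x)) = D (t x) - \<theta> + K (t x)"
          using lb by (simp add: K_def D_def \<theta>_def field_simps)
        have "u (f x) = ee (of_int n * D (t x) + (- (of_int n * \<theta>) + of_int n * K (t x)))"
          unfolding u_def Keq by (simp add: algebra_simps)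
        also have "\<dots> = ee (of_int n * D (t x)) * (ee (- (of_int n * \<theta>)) * u x)"
          by (simp only: ee_add u_def)
        also have "ee (of_int n * D (t x)) = 1" using elim by (intro ee_int Ints_mult) auto
        finally show ?case by simp
      qed
    qed (use um measurable_compose[OF f(1) um] in auto)
    also have "\<dots> = ee (- (of_int n * \<theta>)) * (\<integral>x. u x \<partial>\<mu>)" by simp
    finally have eq: "(\<integral>x. u x \<partial>\<mu>) = ee (- (of_int n * \<theta>)) * (\<integral>x. u x \<partial>\<mu>)" .
    \<comment> \<open>An integral value of n\<theta> would give a^p = b^q with p, q \<ge> 1, against
      the multiplicative independence of a and b.\<close>
    have ne1: "ee (- (of_int n * \<theta>)) \<noteq> 1"
    proof
      assume "ee (- (of_int n * \<theta>)) = 1"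
      then have "- (of_int n * \<theta>) \<in> \<int>" using ee_eq_iff[of "- (of_int n * \<theta>)" 0] by simp
      then obtain i where "- (of_int n * \<theta>) = of_int i" by (elim Ints_cases)
      then have "of_int (- n) * (real J * ln (real a)) = of_int i * ln (real b)"
        using lb by (simp add: \<theta>_def field_simps)
      then have "\<bar>of_int (- n) * (real J * ln (real a))\<bar> = \<bar>of_int i * ln (real b)\<bar>" by simp
      then have eq: "of_int \<bar>n\<bar> * (real J * ln (real a)) = of_int \<bar>i\<bar> * ln (real b)"
        using la lb by (simp add: abs_mult)
      define p where "p = nat \<bar>n\<bar> * J"
      define q where "q = nat \<bar>i\<bar>"
      have pq: "real p * ln (real a) = real q * ln (real b)"
        using eq by (simp add: p_def q_def)
      have p: "p \<ge> 1" using n J(1) by (simp add: p_def Suc_le_eq)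
      then have "real q * ln (real b) > 0" unfolding pq[symmetric] using la by simp
      then have q: "q \<ge> 1" using lb by (cases q) auto
      have "ln (real a ^ p) = ln (real b ^ q)" using pq a b by (simp add: ln_realpow)
      then have "real a ^ p = real b ^ q" using a b by (subst (asm) ln_inj_iff) auto
      then have "a ^ p = b ^ q" by (simp only: of_nat_power[symmetric] of_nat_eq_iff)
      then show False using power_eq_mult_dep[OF a b p q] nd by blast
    qed
    have "(\<integral>x. circ_char n x \<partial>distr \<mu> borel \<kappa>) = (\<integral>x. u x \<partial>\<mu>)"
      by (subst integral_distr[OF \<kappa>m]) (simp_all add: \<kappa>_def u_def[abs_def] circ_char_to_circle)
    also have "\<dots> = 0" using eq ne1 by (metis mult_cancel_right1)
    finally show "(\<integral>x. circ_char n x \<partial>distr \<mu> borel \<kappa>) = (\<integral>x. circ_char n x \<partial>lebesgue_circle)"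
      using fourier_lebesgue_circle[OF n] by simp
  qed (simp_all add: prob_space_lebesgue_circle)
  \<comment> \<open>The critical set of \<open>K\<close>. By \<open>H10\<close> the law of K modulo
    1 is carried by the compact null set \<open>P\<close>, whereas \<open>law\<close> identifies it
    with Lebesgue measure.\<close>
  define Z where "Z = {s \<in> {0..1}. real J * H1 s / ln (real b) = 0}"
  have KZ: "negligible (K ` Z)"
    unfolding Z_def by (rule negligible_critical_values[OF Kder]) (intro continuous_intros H1cont, use lb in simp)
  define P where "P = to_circle ` K ` Z"
  have "compact Z"
  proof -
    have "closed {s. real J * H1 s / ln (real b) = 0}"
      using lb by (intro closed_Collect_eq continuous_intros H1cont) auto
    then have "compact ({0..1} \<inter> {s. real J * H1 s / ln (real b) = 0})" by (intro compact_Int_closed) auto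
    moreover have "Z = {0..1} \<inter> {s. real J * H1 s / ln (real b) = 0}" by (auto simp: Z_def)
    ultimately show ?thesis by simp
  qed
  then have "compact P"
    unfolding P_def by (intro compact_continuous_image continuous_on_to_circle continuous_on_subset[OF Kcont]) auto
  then have Ps: "P \<in> sets borel" by (simp add: compact_imp_closed)
  have "emeasure lebesgue_circle P = 0"
    by (rule lebesgue_circle_null[OF KZ Ps]) (simp add: P_def)
  moreover have "emeasure (distr \<mu> borel \<kappa>) P = 1"
  proof -
    have "AE x in \<mu>. \<kappa> x \<in> P"
      using H10 by eventually_elim (use t01 in \<open>auto simp: \<kappa>_def P_def Z_def less_imp_le\<close>)
    moreover have "\<kappa> -` P \<inter> space \<mu> \<in> sets \<mu>" by (rule measurable_sets[OF \<kappa>m Ps])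
    ultimately have "emeasure \<mu> (\<kappa> -` P \<inter> space \<mu>) = 1"
      by (intro \<mu>.emeasure_eq_1_AE) (auto simp: sp)
    then show ?thesis using Ps by (subst emeasure_distr[OF \<kappa>m]) auto
  qed
  ultimately show False unfolding law by simp
qed

subsection \<open>Arcs and diffeomorphisms preserving Lebesgue measure\<close>

lemma translation_measurable: "(\<lambda>x::circle. x + \<theta>) \<in> measurable borel borel"
proof (rule borel_measurable_continuous_onI)
  have "dist (x + \<theta>) (y + \<theta>) = dist x y" for x y :: circle by transfer simp
  then show "continuous_on UNIV (\<lambda>x::circle. x + \<theta>)" unfolding continuous_on_iff by auto
qed

lemma circ_char_plus: "circ_char k (x + y) = circ_char k x * circ_char k y"
proof -
  obtain s t where "x = to_circle s" "y = to_circle t" using to_circle_surj by meson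
  then show ?thesis by (simp add: plus_circle.abs_eq circ_char_to_circle distrib_left ee_add)
qed

lemma lebesgue_circle_translation: "distr lebesgue_circle borel (\<lambda>x. x + \<theta>) = lebesgue_circle"
proof (rule circle_measure_eqI)
  have m: "(\<lambda>x. x + \<theta>) \<in> measurable lebesgue_circle borel"
    using translation_measurable by (simp cong: measurable_cong_sets)
  show "prob_space (distr lebesgue_circle borel (\<lambda>x. x + \<theta>))"
    by (rule prob_space.prob_space_distr[OF prob_space_lebesgue_circle m])
  fix k :: int assume k: "k \<noteq> 0"
  have "(\<integral>x. circ_char k x \<partial>distr lebesgue_circle borel (\<lambda>x. x + \<theta>)) = (\<integral>x. circ_char k (x + \<theta>) \<partial>lebesgue_circle)"
    by (rule integral_distr[OF m]) simp
  also have "\<dots> = (\<integral>x. circ_char k x \<partial>lebesgue_circle)"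
    by (simp add: circ_char_plus fourier_lebesgue_circle[OF k])
  finally show "(\<integral>x. circ_char k x \<partial>distr lebesgue_circle borel (\<lambda>x. x + \<theta>)) = (\<integral>x. circ_char k x \<partial>lebesgue_circle)" .
qed (simp_all add: prob_space_lebesgue_circle)

lemma arc_borel: "to_circle ` {p..q} \<in> sets borel"
  by (intro borel_closed compact_imp_closed compact_continuous_image continuous_on_to_circle) auto

text \<open>For p = 0 the measure is computed in [0,1), where r < 1 prevents the arc from wrapping
  around; translation invariance covers the rest.\<close>

lemma emeasure_arc:
  assumes "0 \<le> r" "r < 1"
  shows "emeasure lebesgue_circle (to_circle ` {p..p + r}) = ennreal r"
proof -
  have "to_circle -` to_circle ` {0..r} \<inter> {0..<1} = {0..r}"
  proof
    show "to_circle -` to_circle ` {0..r} \<inter> {0..<1} \<subseteq> {0..r}"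
    proof
      fix t assume "t \<in> to_circle -` to_circle ` {0..r} \<inter> {0..<1}"
      then obtain s where s: "s \<in> {0..r}" "to_circle t = to_circle s" and t: "t \<in> {0..<1}" by auto
      then have "t - s \<in> \<int>" by (simp add: to_circle_eq_iff)
      moreover have "\<bar>t - s\<bar> < 1" using s(1) t assms by auto
      ultimately have "t = s" using Ints_nonzero_abs_ge1[of "t - s"] by auto
      then show "t \<in> {0..r}" using s(1) by simp
    qed
  qed (use assms in auto)
  then have 0: "emeasure lebesgue_circle (to_circle ` {0..r}) = ennreal r"
    using assms by (simp add: emeasure_lebesgue_circle[OF arc_borel])
  have eq: "(\<lambda>x. x + to_circle (- p)) -` (to_circle ` {0..r}) = to_circle ` {p..p + r}"
  proof (rule set_eqI)
    fix x
    obtain s where s: "x = to_circle s" using to_circle_surj by blast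
    have "x + to_circle (- p) \<in> to_circle ` {0..r} \<longleftrightarrow> (\<exists>u\<in>{0..r}. s - p - u \<in> \<int>)"
      by (simp add: s plus_circle.abs_eq to_circle_eq_iff image_iff)
    also have "\<dots> \<longleftrightarrow> (\<exists>v\<in>{p..p + r}. s - v \<in> \<int>)"
    proof
      assume "\<exists>u\<in>{0..r}. s - p - u \<in> \<int>"
      then obtain u where "u \<in> {0..r}" "s - p - u \<in> \<int>" by blast
      then show "\<exists>v\<in>{p..p + r}. s - v \<in> \<int>" by (intro bexI[of _ "p + u"]) (auto simp: algebra_simps)
    next
      assume "\<exists>v\<in>{p..p + r}. s - v \<in> \<int>"
      then obtain v where "v \<in> {p..p + r}" "s - v \<in> \<int>" by blast
      then show "\<exists>u\<in>{0..r}. s - p - u \<in> \<int>" by (intro bexI[of _ "v - p"]) auto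
    qed
    also have "\<dots> \<longleftrightarrow> x \<in> to_circle ` {p..p + r}"
      by (simp add: s to_circle_eq_iff image_iff)
    finally show "x \<in> (\<lambda>x. x + to_circle (- p)) -` (to_circle ` {0..r}) \<longleftrightarrow> x \<in> to_circle ` {p..p + r}" by simp
  qed
  have m: "(\<lambda>x. x + to_circle (- p)) \<in> measurable lebesgue_circle borel"
    using translation_measurable by (simp cong: measurable_cong_sets)
  have "emeasure lebesgue_circle (to_circle ` {0..r})
      = emeasure (distr lebesgue_circle borel (\<lambda>x. x + to_circle (- p))) (to_circle ` {0..r})"
    by (simp only: lebesgue_circle_translation)
  also have "\<dots> = emeasure lebesgue_circle (to_circle ` {p..p + r})"
    by (subst emeasure_distr[OF m arc_borel]) (simp only: eq space_lebesgue_circle Int_UNIV_right)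
  finally show ?thesis using 0 by simp
qed

lemma emeasure_arc_le:
  assumes "0 \<le> r"
  shows "emeasure lebesgue_circle (to_circle ` {p..p + r}) \<le> ennreal r"
proof (cases "r < 1")
  case True
  then show ?thesis using emeasure_arc[OF assms] by simp
next
  case False
  have "emeasure lebesgue_circle (to_circle ` {p..p + r}) \<le> 1"
    by (rule prob_space.emeasure_le_1[OF prob_space_lebesgue_circle])
  also have "\<dots> \<le> ennreal r" using False by (simp flip: ennreal_1 add: ennreal_leI del: ennreal_1)
  finally show ?thesis .
qed

lemma emeasure_cball_le:
  assumes "0 \<le> r"
  shows "emeasure lebesgue_circle (cball z r) \<le> ennreal (2 * r)"
proof -
  obtain p where p: "z = to_circle p" using to_circle_surj by blast
  have "cball z r \<subseteq> to_circle ` {p - r..(p - r) + 2 * r}"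
  proof
    fix x assume x: "x \<in> cball z r"
    obtain s where s: "x = to_circle s" using to_circle_surj by blast
    obtain k where k: "k \<in> \<int>" "int_dist (p - s) = \<bar>p - s - k\<bar>" using int_dist_attained by blast
    have "x = to_circle (s + k)" using k(1) by (simp add: s to_circle_eq_iff)
    moreover have "\<bar>p - s - k\<bar> \<le> r" using x k(2) by (simp add: p s dist_circle.abs_eq)
    then have "s + k \<in> {p - r..(p - r) + 2 * r}" by auto
    ultimately show "x \<in> to_circle ` {p - r..(p - r) + 2 * r}" by blast
  qed
  then have "emeasure lebesgue_circle (cball z r) \<le> emeasure lebesgue_circle (to_circle ` {p - r..(p - r) + 2 * r})"
    by (rule emeasure_mono) (simp only: sets_lebesgue_circle arc_borel)
  also have "\<dots> \<le> ennreal (2 * r)" by (rule emeasure_arc_le) (use assms in simp)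
  finally show ?thesis .
qed

lemma distr_inv:
  assumes sets: "sets \<mu> = sets borel" and \<psi>: "C2_diffeo \<psi>"
  shows "distr (distr \<mu> borel \<psi>) borel (inv \<psi>) = \<mu>"
proof -
  have m: "\<psi> \<in> measurable \<mu> borel" using C2_diffeo_measurable[OF \<psi>] sets by (simp cong: measurable_cong_sets)
  have "distr (distr \<mu> borel \<psi>) borel (inv \<psi>) = distr \<mu> borel (inv \<psi> \<circ> \<psi>)"
    by (rule distr_distr[OF C2_diffeo_measurable[OF C2_diffeo_inv[OF \<psi>]] m])
  also have "inv \<psi> \<circ> \<psi> = (\<lambda>x. x)" using \<psi> by (simp add: C2_diffeo_def bij_is_inj fun_eq_iff)
  also have "distr \<mu> borel (\<lambda>x. x) = \<mu>" by (rule distr_id2) (simp add: sets)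
  finally show ?thesis .
qed

lemma emeasure_distr_image:
  assumes sets: "sets \<mu> = sets borel" and \<psi>: "C2_diffeo \<psi>" and A: "A \<in> sets borel"
  shows "\<psi> ` A \<in> sets borel" "emeasure (distr \<mu> borel \<psi>) (\<psi> ` A) = emeasure \<mu> A"
proof -
  have bij: "bij \<psi>" using \<psi> by (simp add: C2_diffeo_def)
  have m: "\<psi> \<in> measurable \<mu> borel" using C2_diffeo_measurable[OF \<psi>] sets by (simp cong: measurable_cong_sets)
  have sp: "space \<mu> = UNIV" using sets_eq_imp_space_eq[OF sets] by simp
  have "inv \<psi> -` A \<inter> space borel \<in> sets borel"
    by (rule measurable_sets[OF C2_diffeo_measurable[OF C2_diffeo_inv[OF \<psi>]] A])
  moreover have "inv \<psi> -` A = \<psi> ` A"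
    using bij_vimage_eq_inv_image[OF bij_imp_bij_inv[OF bij], of A] by (simp only: inv_inv_eq[OF bij])
  ultimately show b: "\<psi> ` A \<in> sets borel" by simp
  have "\<psi> -` (\<psi> ` A) = A" by (rule inj_vimage_image_eq[OF bij_is_inj[OF bij]])
  then show "emeasure (distr \<mu> borel \<psi>) (\<psi> ` A) = emeasure \<mu> A"
    by (simp add: emeasure_distr[OF m b] sp)
qed

text \<open>By the intermediate value theorem the image of the arc from s to t contains the arc
  between X s and X t, of length |X t - X s| once this is below 1. Preservation of length bounds it
  by t - s; then t decreases to s.\<close>

lemma measure_preserving_deriv_le:
  assumes \<eta>: "C2_diffeo \<eta>" and inv: "distr lebesgue_circle borel \<eta> = lebesgue_circle"
    and lift: "\<And>x. \<eta> (to_circle x) = to_circle (X x)"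
    and der: "\<And>x. (X has_real_derivative X1 x) (at x)"
  shows "\<bar>X1 s\<bar> \<le> 1"
proof -
  have cont: "isCont X x" for x by (rule DERIV_isCont[OF der])
  have le: "\<bar>X t - X s\<bar> \<le> t - s" if t: "s < t" "\<bar>X t - X s\<bar> < 1" for t
  proof -
    define lo hi where "lo = min (X s) (X t)" and "hi = max (X s) (X t)"
    have hi: "hi = lo + \<bar>X t - X s\<bar>" by (auto simp: lo_def hi_def)
    have sub: "to_circle ` {lo..hi} \<subseteq> \<eta> ` to_circle ` {s..s + (t - s)}"
    proof
      fix x assume "x \<in> to_circle ` {lo..hi}"
      then obtain y where y: "x = to_circle y" "lo \<le> y" "y \<le> hi" by auto
      have "\<exists>u\<ge>s. u \<le> t \<and> X u = y"
      proof (cases "X s \<le> X t")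
        case True
        then show ?thesis using y t(1) cont by (intro IVT) (auto simp: lo_def hi_def)
      next
        case False
        then show ?thesis using y t(1) cont by (intro IVT2) (auto simp: lo_def hi_def)
      qed
      then obtain u where "s \<le> u" "u \<le> t" "X u = y" by blast
      then show "x \<in> \<eta> ` to_circle ` {s..s + (t - s)}" using y(1) lift[of u] by (intro image_eqI[of _ _ "to_circle u"]) auto
    qed
    have "ennreal \<bar>X t - X s\<bar> = emeasure lebesgue_circle (to_circle ` {lo..hi})"
      unfolding hi using t(2) by (intro emeasure_arc[symmetric]) auto
    also have "\<dots> \<le> emeasure lebesgue_circle (\<eta> ` to_circle ` {s..s + (t - s)})"
      by (rule emeasure_mono[OF sub]) (simp only: sets_lebesgue_circle emeasure_distr_image(1)[OF sets_lebesgue_circle \<eta> arc_borel])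
    also have "\<dots> = emeasure lebesgue_circle (to_circle ` {s..s + (t - s)})"
      using emeasure_distr_image(2)[OF sets_lebesgue_circle \<eta> arc_borel] by (simp only: inv)
    also have "\<dots> \<le> ennreal (t - s)" by (rule emeasure_arc_le) (use t in simp)
    finally show ?thesis using t(1) by (simp add: ennreal_le_iff)
  qed
  have lim: "((\<lambda>t. (X t - X s) / (t - s)) \<longlongrightarrow> X1 s) (at_right s)"
    using der[of s] has_field_derivative_iff tendsto_within_subset[of _ _ s UNIV] by blast
  have "(X \<longlongrightarrow> X s) (at_right s)" using cont[of s] unfolding isCont_def by (rule tendsto_within_subset) simp
  then have "\<forall>\<^sub>F t in at_right s. dist (X t) (X s) < 1" by (rule tendstoD) simp
  moreover have "\<forall>\<^sub>F t in at_right s. s < t" by (rule eventually_at_right_less)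
  ultimately have "\<forall>\<^sub>F t in at_right s. \<bar>(X t - X s) / (t - s)\<bar> \<le> 1"
    by eventually_elim (use le in \<open>auto simp: dist_real_def\<close>)
  then show ?thesis by (intro tendsto_upperbound[OF tendsto_rabs[OF lim]]) auto
qed

text \<open>The derivative bound holds for \<open>\<eta>\<close> and for its inverse, and these
  derivatives multiply to 1, so |X1| = 1. Being continuous with integer values, \<open>X1\<close> is
  constant, and the lift is affine with slope 1 or -1.\<close>

lemma measure_preserving_diffeo_cases:
  assumes \<eta>: "C2_diffeo \<eta>" and inv: "distr lebesgue_circle borel \<eta> = lebesgue_circle"
  obtains \<theta> where "\<eta> = (\<lambda>x. x + \<theta>)" | \<theta> where "\<eta> = (\<lambda>x. - x + \<theta>)"
proof -
  obtain X X1 X2 Y Y1 Y2 where X: "\<And>x. (X has_real_derivative X1 x) (at x)" "\<And>x. (X1 has_real_derivative X2 x) (at x)"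
    and Y: "\<And>x. (Y has_real_derivative Y1 x) (at x)"
    and lift: "\<And>x. \<eta> (to_circle x) = to_circle (X x)" "\<And>x. inv \<eta> (to_circle x) = to_circle (Y x)"
    and XY: "\<And>y. X1 (Y y) * Y1 y = 1" and per: "\<And>x. X1 (x + 1) = X1 x"
    by (rule C2_diffeo_lift[OF \<eta>]) (rule that)
  have "distr lebesgue_circle borel (inv \<eta>) = lebesgue_circle"
    using distr_inv[OF sets_lebesgue_circle \<eta>] by (simp only: inv)
  then have Y1: "\<bar>Y1 y\<bar> \<le> 1" for y
    by (rule measure_preserving_deriv_le[OF C2_diffeo_inv[OF \<eta>] _ lift(2) Y])
  have X1: "\<bar>X1 x\<bar> \<le> 1" for x by (rule measure_preserving_deriv_le[OF \<eta> inv lift(1) X(1)])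
  have abs1: "\<bar>X1 x\<bar> = 1" for x
  proof -
    have "inv \<eta> (\<eta> (to_circle x)) = to_circle x" using \<eta> by (simp add: C2_diffeo_def bij_is_inj)
    then have "Y (X x) - x \<in> \<int>" by (simp add: lift to_circle_eq_iff)
    \<comment> \<open>\<open>Y (X x)\<close> and x differ by an integer, which the period 1 of
      \<open>X1\<close> absorbs.\<close>
    then have eq: "X1 x = X1 (Y (X x))" using periodic_int[where f = X1, OF per] by metis
    have "1 = \<bar>X1 x\<bar> * \<bar>Y1 (X x)\<bar>" using XY[of "X x"] by (simp add: eq flip: abs_mult)
    also have "\<dots> \<le> \<bar>X1 x\<bar> * 1" by (rule mult_left_mono[OF Y1]) simp
    finally show ?thesis using X1[of x] by simp
  qed
  have const: "X1 x = X1 0" for x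
  proof (rule integer_valued_continuous_const)
    show "continuous_on UNIV X1" using DERIV_isCont[OF X(2)] by (simp add: continuous_on_eq_continuous_at)
    show "X1 x \<in> \<int>" for x using abs1[of x] by (auto simp: abs_if split: if_splits)
  qed
  have "((\<lambda>x. X x - X1 0 * x) has_real_derivative 0) (at x)" for x
    using X(1)[of x] const[of x] by (auto intro!: derivative_eq_intros)
  then have Xc: "X x - X1 0 * x = X 0 - X1 0 * 0" for x by (intro DERIV_isconst_all) auto
  have Xeq: "X x = X1 0 * x + X 0" for x using Xc[of x] by simp
  consider "X1 0 = 1" | "X1 0 = -1" using abs1[of 0] by linarith
  then show ?thesis
  proof cases
    case 1
    have "\<eta> x = x + to_circle (X 0)" for x
    proof -
      obtain t where "x = to_circle t" using to_circle_surj by blast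
      then show ?thesis using Xeq[of t] 1 by (simp add: lift plus_circle.abs_eq)
    qed
    then show ?thesis using that(1) by blast
  next
    case 2
    have "\<eta> x = - x + to_circle (X 0)" for x
    proof -
      obtain t where "x = to_circle t" using to_circle_surj by blast
      then show ?thesis using Xeq[of t] 2 by (simp add: lift plus_circle.abs_eq uminus_circle.abs_eq)
    qed
    then show ?thesis using that(2) by blast
  qed
qed

subsection \<open>The smooth invariant measure\<close>

text \<open>A differentiable lift maps null sets of the line to null sets.\<close>

lemma C2_diffeo_null:
  assumes \<eta>: "C2_diffeo \<eta>" and A: "A \<in> sets borel" "emeasure lebesgue_circle A = 0"
  shows "emeasure lebesgue_circle (\<eta> ` A) = 0"
proof -
  obtain X X1 where X: "\<And>x. (X has_real_derivative X1 x) (at x)" "\<And>x. \<eta> (to_circle x) = to_circle (X x)"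
    by (rule C2_diffeo_lift[OF \<eta>]) (rule that)
  define B where "B = to_circle -` A \<inter> {0..<1}"
  have "to_circle -` A \<inter> space borel \<in> sets borel" by (rule measurable_sets[OF borel_measurable_to_circle A(1)])
  then have "B \<in> sets borel" by (simp add: B_def)
  then have "B \<in> null_sets lborel" using A by (auto simp: null_sets_def emeasure_lebesgue_circle B_def)
  then have "negligible B" by (simp add: negligible_iff_null_sets null_sets_completionI)
  then have "negligible (X ` B)"
  proof (rule negligible_differentiable_image_negligible[OF order_refl])
    show "X differentiable_on B"
      unfolding differentiable_on_def real_differentiable_def using X(1) has_field_derivative_at_within by blast
  qed
  then show ?thesis
  proof (rule lebesgue_circle_null)
    show "\<eta> ` A \<in> sets borel" by (rule emeasure_distr_image(1)[OF sets_lebesgue_circle \<eta> A(1)])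
    show "\<eta> ` A \<subseteq> to_circle ` X ` B"
    proof
      fix y assume "y \<in> \<eta> ` A"
      then obtain x where x: "x \<in> A" "y = \<eta> x" by blast
      obtain t where t: "t \<in> {0..<1}" "x = to_circle t" using to_circle_surj by blast
      then have "t \<in> B" using x by (simp add: B_def)
      then show "y \<in> to_circle ` X ` B" using x t X(2) by blast
    qed
  qed
qed

text \<open>The \<open>\<mu>\<close>-measure of A is the Lebesgue measure of its image under
  \<open>\<psi>\<close>, and both \<open>\<psi>\<close> and its inverse preserve null sets.\<close>

lemma equivalent_lebesgue_circle:
  assumes sets: "sets \<mu> = sets borel" and \<psi>: "C2_diffeo \<psi>" and d: "distr \<mu> borel \<psi> = lebesgue_circle"
  shows "equivalent_measures \<mu> lebesgue_circle"
proof -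
  have bij: "bij \<psi>" using \<psi> by (simp add: C2_diffeo_def)
  have im: "emeasure lebesgue_circle (\<psi> ` A) = emeasure \<mu> A" if "A \<in> sets borel" for A
    using emeasure_distr_image(2)[OF sets \<psi> that] by (simp only: d)
  have "emeasure lebesgue_circle A = 0 \<longleftrightarrow> emeasure \<mu> A = 0" if A: "A \<in> sets borel" for A
  proof
    assume "emeasure lebesgue_circle A = 0"
    then show "emeasure \<mu> A = 0" using C2_diffeo_null[OF \<psi> A] im[OF A] by simp
  next
    assume "emeasure \<mu> A = 0"
    then have "emeasure lebesgue_circle (inv \<psi> ` \<psi> ` A) = 0"
      using im[OF A] by (intro C2_diffeo_null[OF C2_diffeo_inv[OF \<psi>]] emeasure_distr_image(1)[OF sets \<psi> A]) simp
    then show "emeasure lebesgue_circle A = 0" using bij by (simp add: bij_is_inj)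
  qed
  then show ?thesis
    unfolding equivalent_measures_def absolutely_continuous_def by (auto simp: null_sets_def sets)
qed

lemma C2_diffeo_lipschitz:
  assumes "C2_diffeo \<eta>"
  obtains L where "L > 0" "\<And>x y. dist (\<eta> x) (\<eta> y) \<le> L * dist x y"
proof -
  obtain X X1 X2 where X: "\<And>x. (X has_real_derivative X1 x) (at x)" "\<And>x. (X1 has_real_derivative X2 x) (at x)"
    "\<And>x. \<eta> (to_circle x) = to_circle (X x)" and per: "\<And>x. X1 (x + 1) = X1 x"
    by (rule C2_diffeo_lift[OF assms]) (rule that)
  have "continuous_on {0..1} X1"
    using DERIV_isCont[OF X(2)] by (intro continuous_at_imp_continuous_on) auto
  then have "bounded (X1 ` {0..1})" by (intro compact_imp_bounded compact_continuous_image) auto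
  then obtain B where B: "B > 0" "\<And>t. t \<in> {0..1} \<Longrightarrow> norm (X1 t) \<le> B" unfolding bounded_pos by auto
  have bd: "norm (X1 t) \<le> B" for t
  proof -
    have "X1 t = X1 (frac t)" by (rule periodic_int[where f = X1, OF per]) (simp add: frac_def)
    then show ?thesis using B(2)[of "frac t"] frac_ge_0[of t] frac_lt_1[of t] by simp
  qed
  have "dist (\<eta> x) (\<eta> y) \<le> B * dist x y" for x y
  proof -
    obtain s t where st: "x = to_circle s" "y = to_circle t" using to_circle_surj by meson
    obtain k where k: "k \<in> \<int>" "int_dist (s - t) = \<bar>s - t - k\<bar>" using int_dist_attained by blast
    have y: "y = to_circle (t + k)" using k(1) by (simp add: st to_circle_eq_iff)
    have "dist (\<eta> x) (\<eta> y) \<le> \<bar>X s - X (t + k)\<bar>"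
      unfolding y st(1) X(3) by (rule dist_to_circle_le)
    also have "\<dots> = norm (X s - X (t + k))" by simp
    also have "\<dots> \<le> B * norm (s - (t + k))"
      by (rule field_differentiable_bound[where S = UNIV and f' = X1]) (use X(1) bd in auto)
    also have "\<dots> = B * dist x y" using k(2) by (simp add: st dist_circle.abs_eq algebra_simps)
    finally show ?thesis .
  qed
  then show ?thesis using that B(1) by blast
qed

text \<open>Mass distribution principle: a ball of radius r has mass at most 2 L r, with
  \<open>L\<close> a Lipschitz constant of \<open>\<phi>\<close>. A cover of a set of positive mass
  with too small an s-sum, s < 1, would contradict this, so the dimension is at least 1.\<close>

lemma measure_dim_push_lebesgue_circle:
  assumes \<phi>: "C2_diffeo \<phi>"
  shows "measure_dim (distr lebesgue_circle borel (inv \<phi>)) > 0"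
proof -
  define \<mu> where "\<mu> = distr lebesgue_circle borel (inv \<phi>)"
  have sets: "sets \<mu> = sets borel" by (simp add: \<mu>_def)
  have "distr \<mu> borel (inv (inv \<phi>)) = lebesgue_circle"
    unfolding \<mu>_def by (rule distr_inv[OF sets_lebesgue_circle C2_diffeo_inv[OF \<phi>]])
  moreover have "inv (inv \<phi>) = \<phi>" using \<phi> by (simp add: C2_diffeo_def inv_inv_eq)
  ultimately have d: "distr \<mu> borel \<phi> = lebesgue_circle" by simp
  interpret \<mu>: prob_space \<mu>
    unfolding \<mu>_def using C2_diffeo_measurable[OF C2_diffeo_inv[OF \<phi>]]
    by (intro prob_space.prob_space_distr prob_space_lebesgue_circle) (simp cong: measurable_cong_sets)
  obtain L where L: "L > 0" "\<And>x y. dist (\<phi> x) (\<phi> y) \<le> L * dist x y" using C2_diffeo_lipschitz[OF \<phi>] by blast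
  have ball: "emeasure \<mu> (cball y r) \<le> ennreal (2 * L * r)" if r: "r \<ge> 0" for y r
  proof -
    have "emeasure \<mu> (cball y r) = emeasure lebesgue_circle (\<phi> ` cball y r)"
      using emeasure_distr_image(2)[OF sets \<phi>, of "cball y r"] by (simp add: d)
    also have "\<dots> \<le> emeasure lebesgue_circle (cball (\<phi> y) (L * r))"
    proof (rule emeasure_mono)
      show "\<phi> ` cball y r \<subseteq> cball (\<phi> y) (L * r)"
      proof
        fix z assume "z \<in> \<phi> ` cball y r"
        then obtain x where x: "z = \<phi> x" "dist y x \<le> r" by auto
        have "L * dist y x \<le> L * r" using x(2) L(1) by simp
        then show "z \<in> cball (\<phi> y) (L * r)" using L(2)[of y x] x(1) by simp
      qed
    qed simp
    also have "\<dots> \<le> ennreal (2 * (L * r))" by (rule emeasure_cball_le) (use L r in simp)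
    finally show ?thesis by (simp add: mult.assoc)
  qed
  have pos: "hausdorff_measure s A \<noteq> 0" if A: "A \<in> sets borel" "emeasure \<mu> A > 0" and s: "0 < s" "s < 1" for s A
  proof
    assume H: "hausdorff_measure s A = 0"
    define m where "m = measure \<mu> A"
    have m: "emeasure \<mu> A = ennreal m" "m > 0" using A(2) by (auto simp: m_def \<mu>.emeasure_eq_measure)
    \<comment> \<open>Chosen so that the final estimate 2 L e equals m/2.\<close>
    define e where "e = m / (4 * L)"
    have e: "e > 0" using m L by (simp add: e_def)
    have "hausdorff_premeasure 1 s A \<le> hausdorff_measure s A"
      unfolding hausdorff_measure_def by (rule SUP_upper) simp
    then have "hausdorff_premeasure 1 s A < ennreal e" using H e by simp
    then obtain U where U: "A \<subseteq> (\<Union>i. U i)" "\<And>i. bounded (U i) \<and> diameter (U i) \<le> 1"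
      "(\<Sum>i. ennreal (diameter (U i) powr s)) < ennreal e"
      unfolding hausdorff_premeasure_def INF_less_iff by auto
    \<comment> \<open>Covering sets need not be measurable; each is enlarged to a closed ball about
      one of its points, with its diameter as radius.\<close>
    define C where "C i = (if U i = {} then {} else cball (SOME y. y \<in> U i) (diameter (U i)))" for i :: nat
    have UC: "U i \<subseteq> C i" for i
    proof
      fix x assume x: "x \<in> U i"
      then have "(SOME y. y \<in> U i) \<in> U i" by (rule someI)
      then show "x \<in> C i" using x U(2)[of i] by (auto simp: C_def intro: diameter_bounded_bound)
    qed
    have Cm: "emeasure \<mu> (C i) \<le> ennreal (2 * L) * ennreal (diameter (U i) powr s)" for i
    proof (cases "U i = {}")
      case False
      define r where "r = diameter (U i)"
      have r: "0 \<le> r" "r \<le> 1" using U(2)[of i] diameter_ge_0[of "U i"] by (auto simp: r_def)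
      have "emeasure \<mu> (C i) \<le> ennreal (2 * L * r)" using ball[OF r(1)] False by (simp add: C_def r_def)
      also have "\<dots> \<le> ennreal (2 * L * r powr s)"
      proof (intro ennreal_leI mult_left_mono)
        \<comment> \<open>Here r is at most 1, because the premeasure was taken at scale 1.\<close>
        have "r powr 1 \<le> r powr s" using r s by (intro powr_mono') auto
        then show "r \<le> r powr s" using r by simp
      qed (use L in simp)
      also have "\<dots> = ennreal (2 * L) * ennreal (r powr s)" using L by (intro ennreal_mult) auto
      finally show ?thesis by (simp add: r_def)
    qed (simp add: C_def)
    have Cs: "C i \<in> sets \<mu>" for i by (simp add: C_def sets)
    have "A \<subseteq> (\<Union>i. C i)" using U(1) UC by blast
    then have "emeasure \<mu> A \<le> emeasure \<mu> (\<Union>i. C i)" by (rule emeasure_mono) (use Cs in auto)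
    also have "\<dots> \<le> (\<Sum>i. emeasure \<mu> (C i))" by (rule emeasure_subadditive_countably) (use Cs in auto)
    also have "\<dots> \<le> (\<Sum>i. ennreal (2 * L) * ennreal (diameter (U i) powr s))"
      by (rule suminf_le) (auto intro: Cm)
    also have "\<dots> = ennreal (2 * L) * (\<Sum>i. ennreal (diameter (U i) powr s))" by (rule ennreal_suminf_cmult)
    also have "\<dots> \<le> ennreal (2 * L) * ennreal e" by (rule mult_left_mono) (use U(3) in auto)
    also have "\<dots> = ennreal (m / 2)" using L e by (simp add: e_def flip: ennreal_mult)
    finally have "m \<le> m / 2" using m by (simp add: ennreal_le_iff)
    then show False using m(2) by simp
  qed
  have "1 \<le> measure_dim \<mu>"
    unfolding measure_dim_def hausdorff_dim_def
  proof (intro INF_greatest)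
    fix A s assume A: "A \<in> {A \<in> sets \<mu>. 0 < emeasure \<mu> A}" and s: "s \<in> {s. 0 < s \<and> hausdorff_measure s A = 0}"
    then have "\<not> s < 1" using pos[of A s] by (auto simp: sets)
    then show "1 \<le> ennreal s" by (simp flip: ennreal_1 add: ennreal_leI del: ennreal_1)
  qed
  moreover have "(0::ennreal) < 1" by simp
  ultimately show ?thesis unfolding \<mu>_def by (rule less_le_trans[rotated])
qed

lemma C2_diffeo_uminus: "C2_diffeo (uminus :: circle \<Rightarrow> circle)"
proof -
  have inv: "inv (uminus :: circle \<Rightarrow> circle) = uminus" by (rule inv_equality) simp_all
  have "C2_real uminus"
    unfolding C2_real_def
    by (rule exI[of _ "\<lambda>_. -1"], rule exI[of _ "\<lambda>_. 0"]) (auto intro!: derivative_eq_intros)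
  then have "C2_circle uminus" unfolding C2_circle_def by (intro exI[of _ uminus]) (simp add: uminus_circle.abs_eq)
  moreover have "bij (uminus :: circle \<Rightarrow> circle)" by (rule o_bij[of uminus]) (simp_all add: fun_eq_iff)
  ultimately show ?thesis by (simp add: C2_diffeo_def inv)
qed

lemma times_map_uminus: "times_map m (- x) = - times_map m x"
  by transfer simp

text \<open>Translation invariance makes the pull-backs of Lebesgue measure by \<open>\<phi>\<close>
  and by \<open>\<psi>\<close> one and the same measure, ergodic for f through the first description
  and for g through the second.\<close>

lemma push_joint_ergodic:
  assumes a: "a \<ge> 2" and b: "b \<ge> 2"
    and \<phi>: "C2_diffeo \<phi>" "\<phi> \<circ> f \<circ> inv \<phi> = times_map a" and \<psi>: "C2_diffeo \<psi>" "\<psi> \<circ> g \<circ> inv \<psi> = times_map b"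
    and rot: "\<psi> \<circ> inv \<phi> = (\<lambda>x. x + \<theta>)"
  shows "distr lebesgue_circle borel (inv \<phi>) \<in> joint_ergodic_measures f g"
proof -
  have push: "ergodic (distr lebesgue_circle borel (inv \<xi>)) u"
    if \<xi>: "C2_diffeo \<xi>" "\<xi> \<circ> u \<circ> inv \<xi> = times_map m" "m \<ge> 2" for \<xi> u m
  proof -
    have bij: "bij \<xi>" using \<xi>(1) by (simp add: C2_diffeo_def)
    have "ergodic (distr lebesgue_circle borel (inv \<xi>)) (inv \<xi> \<circ> times_map m \<circ> inv (inv \<xi>))"
      by (rule ergodic_push[OF ergodic_lebesgue_circle[OF \<xi>(3)] sets_lebesgue_circle C2_diffeo_inv[OF \<xi>(1)]])
    also have "inv \<xi> \<circ> times_map m \<circ> inv (inv \<xi>) = u"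
      unfolding \<xi>(2)[symmetric] using bij by (simp add: inv_inv_eq fun_eq_iff bij_is_inj)
    finally show ?thesis .
  qed
  have bij: "bij \<psi>" using \<psi>(1) by (simp add: C2_diffeo_def)
  have "inv \<phi> = inv \<psi> \<circ> (\<lambda>x. x + \<theta>)"
    unfolding rot[symmetric] using bij by (simp add: fun_eq_iff bij_is_inj)
  then have "distr lebesgue_circle borel (inv \<phi>) = distr (distr lebesgue_circle borel (\<lambda>x. x + \<theta>)) borel (inv \<psi>)"
    using translation_measurable C2_diffeo_measurable[OF C2_diffeo_inv[OF \<psi>(1)]]
    by (simp add: distr_distr cong: measurable_cong_sets)
  then have eq: "distr lebesgue_circle borel (inv \<phi>) = distr lebesgue_circle borel (inv \<psi>)"
    by (simp only: lebesgue_circle_translation)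
  have "prob_space (distr lebesgue_circle borel (inv \<phi>))"
    using C2_diffeo_measurable[OF C2_diffeo_inv[OF \<phi>(1)]]
    by (intro prob_space.prob_space_distr prob_space_lebesgue_circle) (simp cong: measurable_cong_sets)
  then show ?thesis
    using measure_dim_push_lebesgue_circle[OF \<phi>(1)] push[OF \<phi> a] push[OF \<psi> b]
    by (simp add: joint_ergodic_measures_def eq)
qed

section \<open>Uniqueness and the rotation criterion\<close>

text \<open>Equivalence to Lebesgue measure by itself would leave room for several measures, so
  uniqueness is a conjunct of its own. It holds because a joint measure is recovered from its image
  under \<open>\<psi>\<close>, which is always Lebesgue measure.\<close>

theorem corollary1p5:
  fixes a b :: nat and f g :: "circle \<Rightarrow> circle"
  assumes "a \<ge> 2" and "b \<ge> 2" and "\<not> mult_dep a b"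
    and "C2_conjugate f (times_map a)" and "C2_conjugate g (times_map b)"
  shows "(\<forall>\<mu>\<in>joint_ergodic_measures f g. equivalent_measures \<mu> lebesgue_circle) \<and>
    (\<forall>\<mu>\<in>joint_ergodic_measures f g. \<forall>\<nu>\<in>joint_ergodic_measures f g. \<mu> = \<nu>) \<and>
    ((\<exists>\<mu>\<in>joint_ergodic_measures f g. equivalent_measures \<mu> lebesgue_circle) \<longleftrightarrow>
      (\<exists>\<phi> \<psi>. C2_diffeo \<phi> \<and> C2_diffeo \<psi> \<and>
        \<phi> \<circ> f \<circ> inv \<phi> = times_map a \<and> \<psi> \<circ> g \<circ> inv \<psi> = times_map b \<and>
        (\<exists>\<theta>. \<psi> \<circ> inv \<phi> = (\<lambda>x. x + \<theta>))))"
proof -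
  have nd: "\<not> mult_dep a b" "\<not> mult_dep b a" using assms(3) by (auto simp: mult_dep_def)
  obtain \<phi> \<psi> where \<phi>: "C2_diffeo \<phi>" "\<phi> \<circ> f \<circ> inv \<phi> = times_map a"
    and \<psi>: "C2_diffeo \<psi>" "\<psi> \<circ> g \<circ> inv \<psi> = times_map b"
    using assms(4,5) by (auto simp: C2_conjugate_def)
  \<comment> \<open>\<open>joint_measure_lebesgue\<close> is applied twice, with the roles of (a, f,
    \<phi>) and (b, g, \<psi>) exchanged.\<close>
  have leb: "sets \<mu> = sets borel" "distr \<mu> borel \<phi> = lebesgue_circle" "distr \<mu> borel \<psi> = lebesgue_circle"
    if \<mu>: "\<mu> \<in> joint_ergodic_measures f g" for \<mu>
  proof -
    have m: "sets \<mu> = sets borel" "prob_space \<mu>" "measure_dim \<mu> > 0" "ergodic \<mu> f" "ergodic \<mu> g"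
      using \<mu> by (auto simp: joint_ergodic_measures_def)
    have pres: "f \<in> measurable \<mu> \<mu>" "distr \<mu> \<mu> f = \<mu>" "g \<in> measurable \<mu> \<mu>" "distr \<mu> \<mu> g = \<mu>"
      using m by (auto simp: ergodic_def)
    show "sets \<mu> = sets borel" by (rule m(1))
    show "distr \<mu> borel \<psi> = lebesgue_circle"
      by (rule joint_measure_lebesgue[OF assms(1,2) nd(1) m(1-3) pres(1,2) m(5) \<phi> \<psi>])
    show "distr \<mu> borel \<phi> = lebesgue_circle"
      by (rule joint_measure_lebesgue[OF assms(2,1) nd(2) m(1-3) pres(3,4) m(4) \<psi> \<phi>])
  qed
  have equiv: "equivalent_measures \<mu> lebesgue_circle" if "\<mu> \<in> joint_ergodic_measures f g" for \<mu>
    using leb[OF that] by (intro equivalent_lebesgue_circle[OF _ \<psi>(1)])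
  have "\<mu> = distr lebesgue_circle borel (inv \<psi>)" if "\<mu> \<in> joint_ergodic_measures f g" for \<mu>
    using distr_inv[OF leb(1)[OF that] \<psi>(1)] leb(3)[OF that] by simp
  then have unique: "\<mu> = \<nu>" if "\<mu> \<in> joint_ergodic_measures f g" "\<nu> \<in> joint_ergodic_measures f g" for \<mu> \<nu>
    using that by metis
  have rotation: "\<exists>\<phi> \<psi>. C2_diffeo \<phi> \<and> C2_diffeo \<psi> \<and> \<phi> \<circ> f \<circ> inv \<phi> = times_map a \<and> \<psi> \<circ> g \<circ> inv \<psi> = times_map b \<and>
      (\<exists>\<theta>. \<psi> \<circ> inv \<phi> = (\<lambda>x. x + \<theta>))" if \<mu>: "\<mu> \<in> joint_ergodic_measures f g" for \<mu>
  proof -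
    note l = leb[OF \<mu>]
    have bij: "bij \<phi>" using \<phi>(1) by (simp add: C2_diffeo_def)
    have \<eta>: "C2_diffeo (\<psi> \<circ> inv \<phi>)" by (intro C2_diffeo_compose \<psi>(1) C2_diffeo_inv \<phi>(1))
    have "distr (distr \<mu> borel \<phi>) borel (\<psi> \<circ> inv \<phi>) = distr \<mu> borel (\<psi> \<circ> inv \<phi> \<circ> \<phi>)"
      using C2_diffeo_measurable[OF \<phi>(1)] l(1)
      by (intro distr_distr C2_diffeo_measurable[OF \<eta>]) (simp cong: measurable_cong_sets)
    also have "\<psi> \<circ> inv \<phi> \<circ> \<phi> = \<psi>" using bij by (simp add: fun_eq_iff bij_is_inj)
    finally have pres: "distr lebesgue_circle borel (\<psi> \<circ> inv \<phi>) = lebesgue_circle" by (simp only: l(2,3))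
    show ?thesis
    proof (cases rule: measure_preserving_diffeo_cases[OF \<eta> pres])
      case (1 \<theta>)
      then show ?thesis using \<phi> \<psi> by blast
    next
      \<comment> \<open>The reflection commutes with \<open>times_map b\<close>, so its composite
        with \<open>\<psi>\<close> still conjugates g to \<open>times_map b\<close>, and it turns
        the transition map into a rotation.\<close>
      case (2 \<theta>)
      have inv': "inv (uminus \<circ> \<psi>) = inv \<psi> \<circ> uminus"
      proof -
        have "inv (uminus :: circle \<Rightarrow> circle) = uminus" by (rule inv_equality) simp_all
        then show ?thesis using \<psi>(1) C2_diffeo_uminus by (simp add: o_inv_distrib C2_diffeo_def)
      qed
      have "(uminus \<circ> \<psi>) \<circ> g \<circ> inv (uminus \<circ> \<psi>) = uminus \<circ> (\<psi> \<circ> g \<circ> inv \<psi>) \<circ> uminus"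
        by (simp add: inv' fun_eq_iff)
      also have "\<dots> = times_map b" by (simp only: \<psi>(2)) (simp add: fun_eq_iff times_map_uminus)
      finally have conj: "(uminus \<circ> \<psi>) \<circ> g \<circ> inv (uminus \<circ> \<psi>) = times_map b" .
      have "(uminus \<circ> \<psi>) \<circ> inv \<phi> = (\<lambda>x. x + - \<theta>)"
        unfolding comp_assoc 2 by (simp add: fun_eq_iff)
      then show ?thesis using \<phi> conj C2_diffeo_compose[OF C2_diffeo_uminus \<psi>(1)] by blast
    qed
  qed
  show ?thesis
  proof (intro conjI ballI iffI)
    assume "\<exists>\<phi> \<psi>. C2_diffeo \<phi> \<and> C2_diffeo \<psi> \<and> \<phi> \<circ> f \<circ> inv \<phi> = times_map a \<and> \<psi> \<circ> g \<circ> inv \<psi> = times_map b \<and>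
      (\<exists>\<theta>. \<psi> \<circ> inv \<phi> = (\<lambda>x. x + \<theta>))"
    then show "\<exists>\<mu>\<in>joint_ergodic_measures f g. equivalent_measures \<mu> lebesgue_circle"
      using push_joint_ergodic[OF assms(1,2)] equiv by metis
  qed (use equiv unique rotation in auto)
qed

end
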